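(* Let $q$ be an odd prime power. The stabilisers in $\mathrm{PGL}(3,q)$ (up to isomorphism) and the orbit sizes of the nets of conics of rank one in $\mathrm{PG}(2,q)$ are as follows (for each type: stabiliser of a net of that type; number of nets of that type). $\Sigma_1$: $E_q^2:\mathrm{GL}(2,q)$; $q^2+q+1$. $\Sigma_2$: $C_{q-1}^2:S_3$; $\frac{1}{6}q^3(q^2+q+1)(q+1)$. $\Sigma_3$: $E_q:C_{q-1}^2$; $q^2(q^2+q+1)(q+1)$. $\Sigma_4$: $(E_q:C_{q-1}):C_2$; $\frac12 q^2(q^3-1)(q+1)$. $\Sigma_5$: $C_{q-1}:C_2$; $\frac12 q^3(q^3-1)(q+1)$. $\Sigma_6$: $\mathrm{GO}^-(2,q)$; $\frac12 q^3(q^3-1)$. $\Sigma_7$: $E_q^2:\mathrm{GL}(2,q)$; $q^2+q+1$. $\Sigma_8$: $E_q:C_{q-1}^2$; $q^2(q^2+q+1)(q+1)$. $\Sigma_9$: $(E_q:C_{q-1}):C_2$; $\frac12 q^2(q^3-1)(q+1)$. $\Sigma_{10}$: $(E_q:C_{q-1}):C_2$; $\frac12 q^2(q^3-1)(q+1)$. $\Sigma_{11}$: if $q\not\equiv 0\pmod 3$: $C_{q-1}$; $q^3(q^3-1)(q+1)$. If $q\equiv 0\pmod 3$: $E_q$; $q^2(q^3-1)(q^2-1)$. $\Sigma_{12}$: if $q\equiv 1\pmod 3$: $S_3$; $\frac16 q^3(q^3-1)(q^2-1)$. If $q\not\equiv 1\pmod 3$: $C_2$; $\frac12 q^3(q^3-1)(q^2-1)$.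 $\Sigma_{13}$: if $q\equiv -1\pmod 3$: $S_3$; $\frac16 q^3(q^3-1)(q^2-1)$. If $q\not\equiv -1\pmod 3$: $C_2$; $\frac12 q^3(q^3-1)(q^2-1)$. $\Sigma_{14}$ ($q\not\equiv 0\pmod 3$): $C_3$; $\frac13 q^3(q^3-1)(q^2-1)$. $\Sigma_{14}'$ ($q\equiv 0\pmod 3$): $E_q:C_{q-1}$; $q^2(q^3-1)(q+1)$. $\Sigma_{15}$: $E_q^{1+2}:C_{q-1}$; $(q^3-1)(q+1)$.
   Context: Throughout, $q$ is an odd prime power and $\mathbb{F}_q$ is the field with $q$ elements. Nets and planes. A net of conics in $\mathrm{PG}(2,q)$ is a two-dimensional linear system of conics, i.e. the projective plane of a $3$-dimensional subspace of the space of ternary quadratic forms over $\mathbb{F}_q$. The net has rank one if it contains a repeated line (a nonzero form that is a scalar multiple of the square of a linear form). $\mathrm{PGL}(3,q)$ acts on nets by linear changes of coordinates. Points of $\mathrm{PG}(5,q)$ are represented by nonzero symmetric $3\times 3$ matrices over $\mathbb{F}_q$ up to scalars, so planes of $\mathrm{PG}(5,q)$ are $3$-dimensional subspaces of the space of symmetric $3\times 3$ matrices. Associating to a conic the Gram matrix of its quadratic form, nets correspond to planes of $\mathrm{PG}(5,q)$, and nets of rank one correspond to planes containing a point of rank $1$ (i.e. meeting the quadric Veronesean, the set of points represented by matrices of rank $1$). $K\cong\mathrm{PGL}(3,q)$ acts on $\mathrm{PG}(5,q)$ by $M\mapsto AMA^T$, $A\in\mathrm{GL}(3,q)$; orbits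 and stabilisers (up to isomorphism) of nets under $\mathrm{PGL}(3,q)$ correspond to orbits and stabilisers of planes under $K$. Plane orbits. It is known (Lavrauw–Popiel–Sheekey) that the planes of $\mathrm{PG}(5,q)$ containing a point of rank $1$ form exactly $15$ $K$-orbits: $\Sigma_1,\dots,\Sigma_{13},\Sigma_{15}$ together with $\Sigma_{14}$ if $q\not\equiv 0\pmod 3$, or $\Sigma_{14}'$ if $q\equiv 0\pmod 3$. Representatives, with $(\alpha,\beta,\gamma)$ ranging over $\mathbb{F}_q^3\setminus\{(0,0,0)\}$, rows separated by semicolons, and $\varepsilon$ a (fixed, arbitrary) non-square in $\mathbb{F}_q$: $\Sigma_1$: $[\alpha,\gamma,0;\ \gamma,\beta,0;\ 0,0,0]$. $\Sigma_2$: $\mathrm{diag}(\alpha,\beta,\gamma)$. $\Sigma_3$: $[\alpha,0,\gamma;\ 0,\beta,0;\ \gamma,0,0]$. $\Sigma_4$: $[\alpha,0,\gamma;\ 0,\beta,\gamma;\ \gamma,\gamma,0]$. $\Sigma_5$: $[\alpha,0,\gamma;\ 0,\beta,\gamma;\ \gamma,\gamma,\gamma]$. $\Sigma_6$: $[\alpha,\beta,0;\ \beta,\varepsilon\alpha,0;\ 0,0,\gamma]$. $\Sigma_7$: $[\alpha,\beta,\gamma;\ \beta,0,0;\ \gamma,0,0]$. $\Sigma_8$: $[\alpha,\beta,0;\ \beta,0,\gamma;\ 0,\gamma,0]$. $\Sigma_9$: $[\alpha,\beta,0;\ \beta,\gamma,0;\ 0,0,-\gamma]$. $\Sigma_{10}$: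 $[\alpha,\beta,0;\ \beta,\gamma,0;\ 0,0,-\varepsilon\gamma]$. $\Sigma_{11}$: $[0,\beta,\gamma;\ \beta,\alpha,\alpha;\ \gamma,\alpha,\alpha+\gamma]$. $\Sigma_{12}$: $[\alpha,\beta,0;\ \beta,\gamma,\beta;\ 0,\beta,\gamma]$. $\Sigma_{13}$: $[\alpha,\beta,0;\ \beta,\gamma,\beta;\ 0,\beta,\varepsilon\gamma]$. $\Sigma_{14}$ ($q\not\equiv 0 \pmod 3$): $[\alpha,\beta,0;\ \beta,c\gamma,\beta-\gamma;\ 0,\beta-\gamma,\gamma]$, where $c\in\mathbb{F}_q\setminus\{0,1\}$ is such that $-3c$ is a square in $\mathbb{F}_q$ and $\frac{\sqrt{c}+1}{\sqrt{c}-1}$ is a non-cube in $\mathbb{F}_q(\sqrt{-3})$. $\Sigma_{14}'$ ($q\equiv 0 \pmod 3$): $[\alpha+\gamma,\gamma,\gamma;\ \gamma,\beta+\gamma,\gamma;\ \gamma,\gamma,-\beta]$. $\Sigma_{15}$: $[\alpha,\beta,\gamma;\ \beta,\gamma,0;\ \gamma,0,0]$. A net is of type $\Sigma_i$ if the corresponding plane lies in the orbit $\Sigma_i$. Group notation. $E_q$ is an elementary abelian group of order $q$; $C_k$ is a cyclic group of order $k$; $S_n$ is the symmetric group on $n$ letters; $X^2=X\times X$ for $X=E_q$ or $X=C_{q-1}$; $A:B$ denotes a semidirect product with normal subgroup $A$ and subgroup $B$; $\mathrm{GO}^-(2,q)$ is the similarity group of a non-degenerate quadratic form of $-$ type (i.e.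 anisotropic) on a $2$-dimensional vector space over $\mathbb{F}_q$, of order $2(q^2-1)$; $E_q^{1+2}$ denotes a group with centre $Z\cong E_q$ and $E_q^{1+2}/Z\cong E_q^2$. *)

theory Defs
  imports
    "HOL-Analysis.Analysis"
    "HOL-Algebra.Algebra"
    "HOL-Algebra.Algebraic_Closure_Type"
    "HOL-Library.Function_Algebras"
begin

section \<open>Quadratic forms and nets of conics\<close>

text \<open>
  A quadratic form is represented by the function it induces on the vector space. For the
  fields of odd order considered here (at least three elements), the coefficients of a quadratic
  form are determined by that function.
\<close>

definition quadratic_form :: "('a::field ^ 'n \<Rightarrow> 'a) \<Rightarrow> bool" where
  "quadratic_form f \<longleftrightarrow>
     (\<exists>a :: 'n \<Rightarrow> 'n \<Rightarrow> 'a. \<forall>x. f x = (\<Sum>i\<in>UNIV. \<Sum>j\<in>UNIV. a i j * x $ i * x $ j))"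

definition linear_form :: "('a::field ^ 'n \<Rightarrow> 'a) \<Rightarrow> bool" where
  "linear_form l \<longleftrightarrow> (\<exists>a :: 'n \<Rightarrow> 'a. \<forall>x. l x = (\<Sum>i\<in>UNIV. a i * x $ i))"

definition form_scale :: "'a::field \<Rightarrow> ('a ^ 'n \<Rightarrow> 'a) \<Rightarrow> 'a ^ 'n \<Rightarrow> 'a" where
  "form_scale c f = (\<lambda>x. c * f x)"

global_interpretation form: vector_space "form_scale :: 'a::field \<Rightarrow> ('a ^ 'n \<Rightarrow> 'a) \<Rightarrow> _"
  defines form_subspace = form.subspace
      and form_dim = form.dim
  by standard (auto simp: form_scale_def fun_eq_iff algebra_simps)

text \<open>Projective subspaces are represented by the underlying linear subspaces.\<close>

definition net_of_conics :: "('a::field ^ 3 \<Rightarrow> 'a) set \<Rightarrow> bool" where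
  "net_of_conics N \<longleftrightarrow> (\<forall>f\<in>N. quadratic_form f) \<and> form_subspace N \<and> form_dim N = 3"

definition repeated_line :: "('a::field ^ 3 \<Rightarrow> 'a) \<Rightarrow> bool" where
  "repeated_line f \<longleftrightarrow> f \<noteq> 0 \<and> (\<exists>c l. linear_form l \<and> (\<forall>x. f x = c * (l x)\<^sup>2))"

definition net_of_rank_one :: "('a::field ^ 3 \<Rightarrow> 'a) set \<Rightarrow> bool" where
  "net_of_rank_one N \<longleftrightarrow> net_of_conics N \<and> (\<exists>f\<in>N. repeated_line f)"

section \<open>Linear groups and their actions\<close>

definition GL :: "('a::field ^ 'n ^ 'n) monoid" where
  "GL = \<lparr>carrier = {A. invertible A}, mult = (**), one = mat 1\<rparr>"

definition scalar_matrices :: "('a::field ^ 'n ^ 'n) set" where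
  "scalar_matrices = {mat c | c. c \<noteq> 0}"

definition PGL :: "('a::field ^ 'n ^ 'n) set monoid" where
  "PGL = GL Mod scalar_matrices"

definition GL_on_nets ::
  "'a::field ^ 3 ^ 3 \<Rightarrow> ('a ^ 3 \<Rightarrow> 'a) set \<Rightarrow> ('a ^ 3 \<Rightarrow> 'a) set" where
  "GL_on_nets A N = (\<lambda>f x. f (matrix_inv A *v x)) ` N"

text \<open>
  A scalar matrix multiplies a quadratic form by a nonzero constant, so all matrices in a coset
  of the scalars have the same effect on a net.
\<close>

definition PGL_on_nets ::
  "('a::field ^ 3 ^ 3) set \<Rightarrow> ('a ^ 3 \<Rightarrow> 'a) set \<Rightarrow> ('a ^ 3 \<Rightarrow> 'a) set" where
  "PGL_on_nets C N = the_elem ((\<lambda>A. GL_on_nets A N) ` C)"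

definition net_stabiliser :: "('a::field ^ 3 \<Rightarrow> 'a) set \<Rightarrow> ('a ^ 3 ^ 3) set monoid" where
  "net_stabiliser N = PGL\<lparr>carrier := stabilizer PGL PGL_on_nets N\<rparr>"

section \<open>Planes of symmetric matrices\<close>

definition gram :: "('a::field ^ 3 \<Rightarrow> 'a) \<Rightarrow> 'a ^ 3 ^ 3" where
  "gram f = (THE M. transpose M = M \<and>
                    (\<forall>x. f x = (\<Sum>i\<in>UNIV. \<Sum>j\<in>UNIV. x $ i * M $ i $ j * x $ j)))"

definition plane_of_net :: "('a::field ^ 3 \<Rightarrow> 'a) set \<Rightarrow> ('a ^ 3 ^ 3) set" where
  "plane_of_net N = gram ` N"

definition K_on_planes ::
  "'a::field ^ 3 ^ 3 \<Rightarrow> ('a ^ 3 ^ 3) set \<Rightarrow> ('a ^ 3 ^ 3) set" where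
  "K_on_planes A P = (\<lambda>M. A ** M ** transpose A) ` P"

definition K_orbit :: "('a::field ^ 3 ^ 3) set \<Rightarrow> ('a ^ 3 ^ 3) set set" where
  "K_orbit P = orbit GL K_on_planes P"

definition nets_of_type :: "('a::field ^ 3 ^ 3) set \<Rightarrow> ('a ^ 3 \<Rightarrow> 'a) set set" where
  "nets_of_type P = {N. net_of_rank_one N \<and> plane_of_net N \<in> K_orbit P}"

definition mat3 :: "'a::field list \<Rightarrow> 'a list \<Rightarrow> 'a list \<Rightarrow> 'a ^ 3 ^ 3" where
  "mat3 r s t = vector [vector r, vector s, vector t]"

text \<open>Representatives of the plane orbits; as linear subspaces they include the zero matrix.\<close>

definition Sigma1 :: "('a::field ^ 3 ^ 3) set" where
  "Sigma1 = {mat3 [\<alpha>, \<gamma>, 0] [\<gamma>, \<beta>, 0] [0, 0, 0] | \<alpha> \<beta> \<gamma>. True}"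

definition Sigma2 :: "('a::field ^ 3 ^ 3) set" where
  "Sigma2 = {mat3 [\<alpha>, 0, 0] [0, \<beta>, 0] [0, 0, \<gamma>] | \<alpha> \<beta> \<gamma>. True}"

definition Sigma3 :: "('a::field ^ 3 ^ 3) set" where
  "Sigma3 = {mat3 [\<alpha>, 0, \<gamma>] [0, \<beta>, 0] [\<gamma>, 0, 0] | \<alpha> \<beta> \<gamma>. True}"

definition Sigma4 :: "('a::field ^ 3 ^ 3) set" where
  "Sigma4 = {mat3 [\<alpha>, 0, \<gamma>] [0, \<beta>, \<gamma>] [\<gamma>, \<gamma>, 0] | \<alpha> \<beta> \<gamma>. True}"

definition Sigma5 :: "('a::field ^ 3 ^ 3) set" where
  "Sigma5 = {mat3 [\<alpha>, 0, \<gamma>] [0, \<beta>, \<gamma>] [\<gamma>, \<gamma>, \<gamma>] | \<alpha> \<beta> \<gamma>. True}"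

definition Sigma6 :: "'a::field \<Rightarrow> ('a ^ 3 ^ 3) set" where
  "Sigma6 \<epsilon> = {mat3 [\<alpha>, \<beta>, 0] [\<beta>, \<epsilon> * \<alpha>, 0] [0, 0, \<gamma>] | \<alpha> \<beta> \<gamma>. True}"

definition Sigma7 :: "('a::field ^ 3 ^ 3) set" where
  "Sigma7 = {mat3 [\<alpha>, \<beta>, \<gamma>] [\<beta>, 0, 0] [\<gamma>, 0, 0] | \<alpha> \<beta> \<gamma>. True}"

definition Sigma8 :: "('a::field ^ 3 ^ 3) set" where
  "Sigma8 = {mat3 [\<alpha>, \<beta>, 0] [\<beta>, 0, \<gamma>] [0, \<gamma>, 0] | \<alpha> \<beta> \<gamma>. True}"

definition Sigma9 :: "('a::field ^ 3 ^ 3) set" where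
  "Sigma9 = {mat3 [\<alpha>, \<beta>, 0] [\<beta>, \<gamma>, 0] [0, 0, - \<gamma>] | \<alpha> \<beta> \<gamma>. True}"

definition Sigma10 :: "'a::field \<Rightarrow> ('a ^ 3 ^ 3) set" where
  "Sigma10 \<epsilon> = {mat3 [\<alpha>, \<beta>, 0] [\<beta>, \<gamma>, 0] [0, 0, - (\<epsilon> * \<gamma>)] | \<alpha> \<beta> \<gamma>. True}"

definition Sigma11 :: "('a::field ^ 3 ^ 3) set" where
  "Sigma11 = {mat3 [0, \<beta>, \<gamma>] [\<beta>, \<alpha>, \<alpha>] [\<gamma>, \<alpha>, \<alpha> + \<gamma>] | \<alpha> \<beta> \<gamma>. True}"

definition Sigma12 :: "('a::field ^ 3 ^ 3) set" where
  "Sigma12 = {mat3 [\<alpha>, \<beta>, 0] [\<beta>, \<gamma>, \<beta>] [0, \<beta>, \<gamma>] | \<alpha> \<beta> \<gamma>. True}"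

definition Sigma13 :: "'a::field \<Rightarrow> ('a ^ 3 ^ 3) set" where
  "Sigma13 \<epsilon> = {mat3 [\<alpha>, \<beta>, 0] [\<beta>, \<gamma>, \<beta>] [0, \<beta>, \<epsilon> * \<gamma>] | \<alpha> \<beta> \<gamma>. True}"

definition Sigma14 :: "'a::field \<Rightarrow> ('a ^ 3 ^ 3) set" where
  "Sigma14 c = {mat3 [\<alpha>, \<beta>, 0] [\<beta>, c * \<gamma>, \<beta> - \<gamma>] [0, \<beta> - \<gamma>, \<gamma>] | \<alpha> \<beta> \<gamma>. True}"

definition Sigma14' :: "('a::field ^ 3 ^ 3) set" where
  "Sigma14' = {mat3 [\<alpha> + \<gamma>, \<gamma>, \<gamma>] [\<gamma>, \<beta> + \<gamma>, \<gamma>] [\<gamma>, \<gamma>, - \<beta>] | \<alpha> \<beta> \<gamma>. True}"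

definition Sigma15 :: "('a::field ^ 3 ^ 3) set" where
  "Sigma15 = {mat3 [\<alpha>, \<beta>, \<gamma>] [\<beta>, \<gamma>, 0] [\<gamma>, 0, 0] | \<alpha> \<beta> \<gamma>. True}"

subsection \<open>The parameter of \<open>\<Sigma>\<^sub>1\<^sub>4\<close>\<close>

definition is_subfield :: "'b::field set \<Rightarrow> bool" where
  "is_subfield L \<longleftrightarrow> 0 \<in> L \<and> 1 \<in> L \<and> (\<forall>x\<in>L. \<forall>y\<in>L. x - y \<in> L \<and> x * y \<in> L) \<and>
                    (\<forall>x\<in>L. inverse x \<in> L)"

text \<open>The field obtained by adjoining \<open>\<surd>-3\<close>, inside the algebraic closure.\<close>

definition adjoin_sqrt_minus3 :: "'a::field alg_closure set" where
  "adjoin_sqrt_minus3 =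
     \<Inter> {L. is_subfield L \<and> range to_ac \<subseteq> L \<and> {w. w\<^sup>2 = - 3} \<subseteq> L}"

text \<open>
  Replacing the square root \<open>s\<close> of \<open>c\<close> by its negative inverts \<open>(s + 1) / (s - 1)\<close>, so the
  choice of the root does not matter.
\<close>

definition Sigma14_parameter :: "'a::field \<Rightarrow> bool" where
  "Sigma14_parameter c \<longleftrightarrow> c \<noteq> 0 \<and> c \<noteq> 1 \<and> (\<exists>r. - 3 * c = r\<^sup>2) \<and>
     (\<exists>s\<in>adjoin_sqrt_minus3. s\<^sup>2 = to_ac c \<and>
        \<not> (\<exists>t\<in>adjoin_sqrt_minus3. (s + 1) / (s - 1) = t ^ 3))"

section \<open>Isomorphism types of groups\<close>

definition elementary_abelian :: "nat \<Rightarrow> 'g monoid \<Rightarrow> bool" where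
  "elementary_abelian n G \<longleftrightarrow> comm_group G \<and> order G = n \<and>
     (\<exists>p::nat. Factorial_Ring.prime p \<and> (\<forall>x\<in>carrier G. x [^]\<^bsub>G\<^esub> p = \<one>\<^bsub>G\<^esub>))"

definition cyclic_of_order :: "nat \<Rightarrow> 'g monoid \<Rightarrow> bool" where
  "cyclic_of_order n G \<longleftrightarrow> group G \<and> cyclic_group G \<and> order G = n"

definition symmetric_group :: "nat \<Rightarrow> 'g monoid \<Rightarrow> bool" where
  "symmetric_group n G \<longleftrightarrow> group G \<and> G \<cong> sym_group n"

definition squared :: "('g monoid \<Rightarrow> bool) \<Rightarrow> 'g monoid \<Rightarrow> bool" where
  "squared T G \<longleftrightarrow> group G \<and> (\<exists>H. T H \<and> G \<cong> H \<times>\<times> H)"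

text \<open>\<open>semidirect S T G\<close>: the group \<open>G\<close> is an (internal) semidirect product \<open>A : B\<close> of a normal
  subgroup \<open>A\<close> of type \<open>S\<close> and a subgroup \<open>B\<close> of type \<open>T\<close>.\<close>

definition semidirect ::
  "('g monoid \<Rightarrow> bool) \<Rightarrow> ('g monoid \<Rightarrow> bool) \<Rightarrow> 'g monoid \<Rightarrow> bool" where
  "semidirect S T G \<longleftrightarrow>
     (\<exists>A B. A \<lhd> G \<and> subgroup B G \<and> A \<inter> B = {\<one>\<^bsub>G\<^esub>} \<and> A <#>\<^bsub>G\<^esub> B = carrier G \<and>
            S (G\<lparr>carrier := A\<rparr>) \<and> T (G\<lparr>carrier := B\<rparr>))"

definition group_centre :: "'g monoid \<Rightarrow> 'g set" where
  "group_centre G = {z \<in> carrier G. \<forall>x\<in>carrier G. z \<otimes>\<^bsub>G\<^esub> x = x \<otimes>\<^bsub>G\<^esub> z}"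

text \<open>The groups denoted \<open>E\<^bsub>q\<^esub>\<^bsup>1+2\<^esup>\<close>.\<close>

definition E_1_plus_2 :: "nat \<Rightarrow> 'g monoid \<Rightarrow> bool" where
  "E_1_plus_2 q G \<longleftrightarrow> group G \<and>
     elementary_abelian q (G\<lparr>carrier := group_centre G\<rparr>) \<and>
     squared (elementary_abelian q) (G Mod group_centre G)"

definition general_linear_2 :: "'a::field itself \<Rightarrow> 'g monoid \<Rightarrow> bool" where
  "general_linear_2 _ G \<longleftrightarrow> group G \<and> G \<cong> (GL :: ('a ^ 2 ^ 2) monoid)"

definition similarity_group :: "('a::field ^ 'n \<Rightarrow> 'a) \<Rightarrow> ('a ^ 'n ^ 'n) monoid" where
  "similarity_group Q = GL\<lparr>carrier := {A \<in> carrier GL. \<exists>c. c \<noteq> 0 \<and> (\<forall>x. Q (A *v x) = c * Q x)}\<rparr>"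

definition anisotropic :: "('a::field ^ 'n \<Rightarrow> 'a) \<Rightarrow> bool" where
  "anisotropic Q \<longleftrightarrow> (\<forall>x. Q x = 0 \<longrightarrow> x = 0)"

definition GO_minus_2 :: "'a::field itself \<Rightarrow> 'g monoid \<Rightarrow> bool" where
  "GO_minus_2 _ G \<longleftrightarrow> group G \<and>
     (\<exists>Q :: 'a ^ 2 \<Rightarrow> 'a. quadratic_form Q \<and> anisotropic Q \<and> G \<cong> similarity_group Q)"

definition stabiliser_and_number ::
  "('a::field ^ 3 ^ 3) set \<Rightarrow> (('a ^ 3 ^ 3) set monoid \<Rightarrow> bool) \<Rightarrow> real \<Rightarrow> bool" where
  "stabiliser_and_number P T m \<longleftrightarrow>
     (\<forall>N\<in>nets_of_type P. T (net_stabiliser N)) \<and> real (card (nets_of_type P)) = m"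

end

theory Submission
  imports Defs
begin

text \<open>
  A net of rank one is the set of forms whose Gram matrices fill a plane, a linear space of
  dimension three that contains a matrix of rank one. Substituting the inverse of a matrix \<open>A\<close>
  in a form changes its Gram matrix by congruence with the transpose of \<open>A\<^sup>-\<^sup>1\<close>, and passing
  to the inverse transpose is an automorphism of the linear group. So the stabiliser of a net
  in \<open>PGL(3,q)\<close> is isomorphic to the stabiliser of the corresponding plane, the nets of a
  given type correspond bijectively to the planes in one orbit, and by the orbit-stabiliser
  theorem their number is the order \<open>q\<^sup>3(q\<^sup>3 - 1)(q\<^sup>2 - 1)\<close> of \<open>PGL(3,q)\<close> divided by the order
  of the stabiliser. Hence each line of the classification follows from the structure of the
  stabiliser of a single representative plane: this is \<open>stabiliser_and_number_PGL\<close>.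

  The stabilisers are computed with explicit matrices. The condition on \<open>A\<close> is that the images
  of three spanning matrices of the plane lie in the plane again, which is a system of
  polynomial equations in the entries; the points of rank one give the simplest of them and
  make \<open>A\<close> sparse. For all types except \<open>\<Sigma>\<^sub>2\<close>, and for a suitable basis, the result has a
  diagonal entry that never vanishes and that is multiplicative, so the matrices with this
  entry equal to one form a group that meets every class modulo scalars exactly once, and one
  can work in \<open>GL(3,q)\<close> (\<open>stabiliser_and_number_complement\<close>). The stabiliser of \<open>\<Sigma>\<^sub>2\<close> permutes
  the three coordinate points, no entry can be normalised, and the argument is carried out
  with classes of monomial matrices.

  The group structures are read off with a split homomorphism (\<open>semidirect_of_split_hom\<close>): its
  kernel and its section are given by explicit families of matrices, and the types of their
  parameter groups (the additive group, the multiplicative group, \<open>GL(2,q)\<close>) are transported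
  along isomorphisms.

  The arithmetic of the field enters in two places. For \<open>\<Sigma>\<^sub>1\<^sub>1\<close> and \<open>\<Sigma>\<^sub>1\<^sub>4'\<close> the unipotent
  parameter \<open>t\<close> and the diagonal parameter \<open>d\<close> of the stabiliser are tied by \<open>3t = k(d - 1)\<close>,
  and the characteristic and \<open>k\<close> decide whether \<open>d\<close>, \<open>t\<close> or both are free. For \<open>\<Sigma>\<^sub>1\<^sub>2\<close>, \<open>\<Sigma>\<^sub>1\<^sub>3\<close>,
  \<open>\<Sigma>\<^sub>1\<^sub>4\<close> the determinant of the matrices in the plane is a nodal cubic, and the stabiliser
  consists of rotations and reflections. A rotation of order three exists if and only if \<open>-3k\<close>
  is a nonzero square, where \<open>\<beta>\<^sup>2 = k\<gamma>\<^sup>2\<close> gives the tangents at the node; the reflections are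
  always present for \<open>\<Sigma>\<^sub>1\<^sub>2\<close> and \<open>\<Sigma>\<^sub>1\<^sub>3\<close>, whereas for \<open>\<Sigma>\<^sub>1\<^sub>4\<close> a reflection would exhibit
  \<open>(\<surd>c + 1)/(\<surd>c - 1)\<close> as a cube.
\<close>

no_notation fps_nth (infixl \<open>$\<close> 75)

section \<open>Isomorphism types of groups\<close>

lemma restrict_group_simps [simp]:
  "carrier (G\<lparr>carrier := H\<rparr>) = H"
  "mult (G\<lparr>carrier := H\<rparr>) = mult G"
  "one (G\<lparr>carrier := H\<rparr>) = one G"
  by simp_all

lemma iso_induced_subgroup:
  assumes "f \<in> iso G K" and "A \<subseteq> carrier G"
  shows "G\<lparr>carrier := A\<rparr> \<cong> K\<lparr>carrier := f ` A\<rparr>"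
proof -
  have "f \<in> iso (G\<lparr>carrier := A\<rparr>) (K\<lparr>carrier := f ` A\<rparr>)"
    using assms by (auto simp: iso_def hom_def bij_betw_def inj_on_def Pi_iff subset_iff)
  then show ?thesis by (rule is_isoI)
qed

lemma elementary_abelian_iso:
  assumes "group H" "G \<cong> H" "elementary_abelian n G"
  shows "elementary_abelian n H"
proof -
  obtain f where f: "f \<in> iso G H" using assms(2) by (auto simp: is_iso_def)
  have G: "comm_group G" using assms(3) by (simp add: elementary_abelian_def)
  interpret G: comm_group G by fact
  interpret H: group H by fact
  have fh: "f \<in> hom G H" and surj: "f ` carrier G = carrier H"
    using f by (auto simp: iso_iff)
  interpret f: group_hom G H f by standard (rule fh)
  have "comm_group H"
  proof (rule H.group_comm_groupI)
    fix x y assume "x \<in> carrier H" "y \<in> carrier H"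
    then obtain a b where "a \<in> carrier G" "b \<in> carrier G" "x = f a" "y = f b"
      using surj by blast
    then show "x \<otimes>\<^bsub>H\<^esub> y = y \<otimes>\<^bsub>H\<^esub> x"
      by (metis G.m_comm f.hom_mult)
  qed
  moreover have "order H = n"
    using iso_same_card[OF assms(2)] assms(3) by (simp add: elementary_abelian_def order_def)
  moreover
  have "\<exists>p::nat. Factorial_Ring.prime p \<and> (\<forall>x\<in>carrier G. x [^]\<^bsub>G\<^esub> p = \<one>\<^bsub>G\<^esub>)"
    using assms(3) unfolding elementary_abelian_def by (elim conjE)
  then obtain p :: nat where p: "Factorial_Ring.prime p"
    "\<forall>x\<in>carrier G. x [^]\<^bsub>G\<^esub> p = \<one>\<^bsub>G\<^esub>" by blast
  have "\<forall>y\<in>carrier H. y [^]\<^bsub>H\<^esub> p = \<one>\<^bsub>H\<^esub>"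
  proof
    fix y assume "y \<in> carrier H"
    then obtain a where a: "a \<in> carrier G" "y = f a" using surj by blast
    have "f a [^]\<^bsub>H\<^esub> p = f (a [^]\<^bsub>G\<^esub> p)" using f.hom_nat_pow[OF a(1), of p] by (rule sym)
    then show "y [^]\<^bsub>H\<^esub> p = \<one>\<^bsub>H\<^esub>" using p(2) a by simp
  qed
  ultimately show ?thesis using p(1) unfolding elementary_abelian_def by (intro conjI exI[of _ p])
qed

lemma cyclic_of_order_iso:
  assumes "group H" "G \<cong> H" "cyclic_of_order n G"
  shows "cyclic_of_order n H"
  using assms isomorphic_group_cyclicity[OF assms(2)] iso_same_card[OF assms(2)]
  by (auto simp: cyclic_of_order_def order_def)

lemma symmetric_group_iso:
  assumes "group H" "G \<cong> H" "symmetric_group n G"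
  shows "symmetric_group n H"
  using assms iso_trans[of H G] group.iso_sym[of G H] by (auto simp: symmetric_group_def)

lemma general_linear_2_iso:
  assumes "group H" "G \<cong> H" "general_linear_2 F G"
  shows "general_linear_2 F H"
  using assms iso_trans[of H G] group.iso_sym[of G H] by (auto simp: general_linear_2_def)

lemma GO_minus_2_iso:
  assumes "group H" "G \<cong> H" "GO_minus_2 F G"
  shows "GO_minus_2 F H"
  using assms iso_trans[of H G] group.iso_sym[of G H] unfolding GO_minus_2_def by metis

text \<open>
  The stabilisers live on classes of matrices, whereas the model groups live on field
  elements, pairs or matrices of order two. A type of groups is one predicate for each carrier
  type; this relation says that the instances \<open>S\<close> and \<open>T\<close> at two carrier types agree up to
  isomorphism, and it can also hold between different predicates.
\<close>

definition iso_transfer :: "('g monoid \<Rightarrow> bool) \<Rightarrow> ('h monoid \<Rightarrow> bool) \<Rightarrow> bool" where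
  "iso_transfer S T \<longleftrightarrow> (\<forall>G H. group G \<and> group H \<and> G \<cong> H \<and> S G \<longrightarrow> T H)"

lemma iso_transferD: "iso_transfer S T \<Longrightarrow> group G \<Longrightarrow> group H \<Longrightarrow> G \<cong> H \<Longrightarrow> S G \<Longrightarrow> T H"
  by (auto simp: iso_transfer_def)

lemma iso_transfer_basic:
  "iso_transfer (elementary_abelian n) (elementary_abelian n)"
  "iso_transfer (cyclic_of_order n) (cyclic_of_order n)"
  "iso_transfer (symmetric_group n) (symmetric_group n)"
  "iso_transfer (general_linear_2 F) (general_linear_2 F)"
  "iso_transfer (GO_minus_2 F) (GO_minus_2 F)"
  using elementary_abelian_iso cyclic_of_order_iso symmetric_group_iso general_linear_2_iso
    GO_minus_2_iso
  unfolding iso_transfer_def by blast+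

text \<open>
  The predicate \<open>squared\<close> asks for the factor on the carrier type of \<open>G\<close> itself, so a copy of
  \<open>K\<close> inside \<open>G\<close> has to be produced: the image of the first factor.
\<close>

lemma squaredI:
  assumes G: "group G" and K: "group K" and iso: "K \<times>\<times> K \<cong> G"
    and S: "S K" and tr: "iso_transfer S T"
  shows "squared T G"
proof -
  interpret G: group G by fact
  interpret K: group K by fact
  interpret KK: group "K \<times>\<times> K" by (rule DirProd_group[OF K K])
  obtain f where f: "f \<in> iso (K \<times>\<times> K) G" using iso by (auto simp: is_iso_def)
  let ?i = "\<lambda>x. (x, \<one>\<^bsub>K\<^esub>)"
  have i: "?i \<in> hom K (K \<times>\<times> K)" by (auto simp: hom_def)
  have fi: "f \<circ> ?i \<in> hom K G"
    using i f by (auto intro: hom_compose simp: iso_def)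
  then interpret fi: group_hom K G "f \<circ> ?i" by unfold_locales
  define H where "H = G\<lparr>carrier := (f \<circ> ?i) ` carrier K\<rparr>"
  have gH: "group H" unfolding H_def
    by (rule G.subgroup_imp_group[OF fi.img_is_subgroup])
  have "inj_on (f \<circ> ?i) (carrier K)"
    using f by (auto simp: iso_def bij_betw_def inj_on_def)
      (metis K.one_closed)
  then have KH: "K \<cong> H" unfolding H_def
    using fi by (intro is_isoI[of "f \<circ> ?i"]) (auto simp: iso_def hom_def bij_betw_def)
  have "T H" by (rule iso_transferD[OF tr K gH KH S])
  moreover have "G \<cong> H \<times>\<times> H"
    using KK.iso_sym[OF iso] K.DirProd_iso_trans[OF KH KH] iso_trans by blast
  ultimately show ?thesis using G by (auto simp: squared_def)
qed

lemma iso_transfer_squared: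
  fixes S :: "'a monoid \<Rightarrow> bool" and T :: "'b monoid \<Rightarrow> bool"
  assumes tr: "iso_transfer S T" and S: "\<And>K. S K \<Longrightarrow> group K"
  shows "iso_transfer (squared S) (squared T)"
  unfolding iso_transfer_def
proof (intro allI impI)
  fix G :: "'a monoid" and H :: "'b monoid"
  assume a: "group G \<and> group H \<and> G \<cong> H \<and> squared S G"
  then obtain K where K: "S K" "G \<cong> K \<times>\<times> K" by (auto simp: squared_def)
  have "K \<times>\<times> K \<cong> H"
    using a K group.iso_sym iso_trans by blast
  with K tr S a show "squared T H" by (blast intro: squaredI)
qed

lemma elementary_abelian_group: "elementary_abelian n G \<Longrightarrow> group G"
  by (simp add: elementary_abelian_def comm_group.axioms(2))

lemma cyclic_of_order_group: "cyclic_of_order n G \<Longrightarrow> group G"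
  by (simp add: cyclic_of_order_def)

lemma iso_transfer_semidirect:
  fixes S T :: "'a monoid \<Rightarrow> bool" and S' T' :: "'c monoid \<Rightarrow> bool"
  assumes S: "iso_transfer S S'" and T: "iso_transfer T T'"
  shows "iso_transfer (semidirect S T) (semidirect S' T')"
  unfolding iso_transfer_def
proof (intro allI impI)
  fix G :: "'a monoid" and H :: "'c monoid"
  assume a: "group G \<and> group H \<and> G \<cong> H \<and> semidirect S T G"
  then interpret G: group G by simp
  from a interpret H: group H by simp
  obtain f where f: "f \<in> iso G H" using a by (auto simp: is_iso_def)
  then have fh: "f \<in> hom G H" and surj: "f ` carrier G = carrier H" and
    inj: "inj_on f (carrier G)" by (auto simp: iso_iff)
  interpret f: group_hom G H f by standard (rule fh)
  obtain A B where AB: "A \<lhd> G" "subgroup B G" "A \<inter> B = {\<one>\<^bsub>G\<^esub>}" "A <#>\<^bsub>G\<^esub> B = carrier G"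
    "S (G\<lparr>carrier := A\<rparr>)" "T (G\<lparr>carrier := B\<rparr>)"
    using a by (auto simp: semidirect_def)
  have sA: "subgroup A G" using AB(1) by (simp add: normal_imp_subgroup)
  have cA: "A \<subseteq> carrier G" and cB: "B \<subseteq> carrier G"
    using sA AB(2) by (auto dest: subgroup.subset)
  have sA': "subgroup (f ` A) H" and sB': "subgroup (f ` B) H"
    using sA AB(2) by (auto intro: f.subgroup_img_is_subgroup)
  have "f ` A \<lhd> H"
  proof (unfold H.normal_inv_iff, intro conjI ballI)
    fix x h assume "x \<in> carrier H" "h \<in> f ` A"
    then obtain y k where yk: "y \<in> carrier G" "x = f y" "k \<in> A" "h = f k" using surj by blast
    then have "y \<otimes>\<^bsub>G\<^esub> k \<otimes>\<^bsub>G\<^esub> inv\<^bsub>G\<^esub> y \<in> A" using AB(1) by (simp add: G.normal_inv_iff)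
    moreover have "x \<otimes>\<^bsub>H\<^esub> h \<otimes>\<^bsub>H\<^esub> inv\<^bsub>H\<^esub> x = f (y \<otimes>\<^bsub>G\<^esub> k \<otimes>\<^bsub>G\<^esub> inv\<^bsub>G\<^esub> y)"
      using yk cA by (simp add: subset_iff)
    ultimately show "x \<otimes>\<^bsub>H\<^esub> h \<otimes>\<^bsub>H\<^esub> inv\<^bsub>H\<^esub> x \<in> f ` A" by blast
  qed (rule sA')
  moreover have "f ` A \<inter> f ` B = {\<one>\<^bsub>H\<^esub>}"
    using inj_on_image_Int[OF inj cA cB] AB(3) by simp
  moreover have "f ` A <#>\<^bsub>H\<^esub> f ` B = carrier H"
  proof -
    have "f ` A <#>\<^bsub>H\<^esub> f ` B = f ` (A <#>\<^bsub>G\<^esub> B)"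
    proof -
      have "f a \<otimes>\<^bsub>H\<^esub> f b = f (a \<otimes>\<^bsub>G\<^esub> b)" if "a \<in> A" "b \<in> B" for a b
        using that cA cB by (simp add: subset_iff)
      then show ?thesis unfolding set_mult_def by auto
    qed
    then show ?thesis using AB(4) surj by simp
  qed
  moreover have "S' (H\<lparr>carrier := f ` A\<rparr>)"
    using iso_transferD[OF S _ _ iso_induced_subgroup[OF f cA] AB(5)] sA sA'
    by (simp add: G.subgroup_imp_group H.subgroup_imp_group)
  moreover have "T' (H\<lparr>carrier := f ` B\<rparr>)"
    using iso_transferD[OF T _ _ iso_induced_subgroup[OF f cB] AB(6)] AB(2) sB'
    by (simp add: G.subgroup_imp_group H.subgroup_imp_group)
  ultimately show "semidirect S' T' H"
    using sB' unfolding semidirect_def by blast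
qed

text \<open>
  A homomorphism \<open>\<theta>\<close> with a section \<open>\<sigma>\<close> splits \<open>G\<close> into its kernel and the image of the section.
  The kernel is given as the image of an injective homomorphism \<open>\<iota>\<close> from a known group, so that
  a semidirect product can be certified by three explicit formulas.
\<close>

lemma semidirect_of_split_hom:
  assumes G: "group G" and Q: "group Q" and K: "group K"
    and th: "\<theta> \<in> hom G Q" and si: "\<sigma> \<in> hom Q G"
    and split: "\<And>y. y \<in> carrier Q \<Longrightarrow> \<theta> (\<sigma> y) = y"
    and io: "\<iota> \<in> hom K G" and inj: "inj_on \<iota> (carrier K)"
    and ker: "\<iota> ` carrier K = {x \<in> carrier G. \<theta> x = \<one>\<^bsub>Q\<^esub>}"
    and S: "S K" "iso_transfer S S'" and T: "T Q" "iso_transfer T T'"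
  shows "semidirect S' T' G"
proof -
  interpret G: group G by fact
  interpret Q: group Q by fact
  interpret K: group K by fact
  interpret \<theta>: group_hom G Q \<theta> by standard (rule th)
  interpret \<sigma>: group_hom Q G \<sigma> by standard (rule si)
  interpret \<iota>: group_hom K G \<iota> by standard (rule io)
  define A where "A = kernel G Q \<theta>"
  define B where "B = \<sigma> ` carrier Q"
  have A_eq: "A = \<iota> ` carrier K" unfolding A_def ker by (auto simp: kernel_def)
  have A: "A \<lhd> G" unfolding A_def by (rule \<theta>.normal_kernel)
  have sB: "subgroup B G" unfolding B_def by (rule \<sigma>.img_is_subgroup)
  have "A \<inter> B = {\<one>\<^bsub>G\<^esub>}"
  proof -
    have "x = \<one>\<^bsub>G\<^esub>" if x: "x \<in> A" "x \<in> B" for x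
    proof -
      obtain y where y: "y \<in> carrier Q" "x = \<sigma> y" using x(2) B_def by blast
      then have "y = \<one>\<^bsub>Q\<^esub>" using x(1) split[of y] by (simp add: A_def kernel_def)
      then show ?thesis using y by simp
    qed
    moreover have "\<one>\<^bsub>G\<^esub> \<in> A" "\<one>\<^bsub>G\<^esub> \<in> B"
      using A sB by (auto simp: subgroup.one_closed normal_imp_subgroup)
    ultimately show ?thesis by blast
  qed
  moreover have "A <#>\<^bsub>G\<^esub> B = carrier G"
  proof
    show "A <#>\<^bsub>G\<^esub> B \<subseteq> carrier G"
      using A sB by (intro G.set_mult_closed) (auto simp: subgroup.subset normal_imp_subgroup)
    show "carrier G \<subseteq> A <#>\<^bsub>G\<^esub> B"
    proof
      fix x assume x: "x \<in> carrier G"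
      let ?b = "\<sigma> (\<theta> x)"
      have b: "?b \<in> B" "?b \<in> carrier G" using x by (auto simp: B_def)
      have "x \<otimes>\<^bsub>G\<^esub> inv\<^bsub>G\<^esub> ?b \<in> A" using x b split by (simp add: A_def kernel_def)
      moreover have "x = (x \<otimes>\<^bsub>G\<^esub> inv\<^bsub>G\<^esub> ?b) \<otimes>\<^bsub>G\<^esub> ?b" using x b by (simp add: G.m_assoc)
      ultimately show "x \<in> A <#>\<^bsub>G\<^esub> B" using b unfolding set_mult_def by blast
    qed
  qed
  moreover have "S' (G\<lparr>carrier := A\<rparr>)"
  proof (rule iso_transferD[OF S(2) K _ _ S(1)])
    show "group (G\<lparr>carrier := A\<rparr>)"
      using A by (simp add: G.subgroup_imp_group normal_imp_subgroup)
    show "K \<cong> G\<lparr>carrier := A\<rparr>"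
      using inj unfolding A_eq
      by (intro is_isoI[of \<iota>]) (auto simp: iso_def hom_def bij_betw_def)
  qed
  moreover have "T' (G\<lparr>carrier := B\<rparr>)"
  proof (rule iso_transferD[OF T(2) Q _ _ T(1)])
    show "group (G\<lparr>carrier := B\<rparr>)" using sB by (rule G.subgroup_imp_group)
    show "Q \<cong> G\<lparr>carrier := B\<rparr>"
      using split unfolding B_def
      by (intro is_isoI[of \<sigma>]) (auto simp: iso_def hom_def bij_betw_def intro: inj_on_inverseI)
  qed
  ultimately show ?thesis using A sB unfolding semidirect_def by blast
qed

section \<open>The symmetric group of degree three\<close>

text \<open>
  The structure \<open>P\<close> serves as a multiplication table only; closure suffices, since the
  remaining group laws come from \<open>G\<close>.
\<close>

lemma iso_of_common_source:
  assumes "P \<cong> G" "P \<cong> H" and cl: "\<And>x y. x \<in> carrier P \<Longrightarrow> y \<in> carrier P \<Longrightarrow> x \<otimes>\<^bsub>P\<^esub> y \<in> carrier P"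
  shows "G \<cong> H"
proof -
  obtain f h where f: "f \<in> iso P G" and h: "h \<in> iso P H"
    using assms(1,2) by (auto simp: is_iso_def)
  define g where "g = inv_into (carrier P) f"
  have g: "bij_betw g (carrier G) (carrier P)"
    using f unfolding g_def iso_def by (auto intro: bij_betw_inv_into)
  have gf: "g (f x) = x" if "x \<in> carrier P" for x
    using f that unfolding g_def by (auto simp: iso_iff inv_into_f_f)
  have fg: "f (g y) = y" "g y \<in> carrier P" if "y \<in> carrier G" for y
    using f that g unfolding g_def by (auto simp: iso_iff f_inv_into_f bij_betw_def)
  have "g (x \<otimes>\<^bsub>G\<^esub> y) = g x \<otimes>\<^bsub>P\<^esub> g y" if "x \<in> carrier G" "y \<in> carrier G" for x y
  proof -
    have "f (g x \<otimes>\<^bsub>P\<^esub> g y) = x \<otimes>\<^bsub>G\<^esub> y"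
      using f fg that by (auto simp: iso_def hom_def)
    then show ?thesis using gf[of "g x \<otimes>\<^bsub>P\<^esub> g y"] cl fg that by metis
  qed
  then have "g \<in> iso G P" using g fg by (auto simp: iso_def hom_def)
  then have "h \<circ> g \<in> iso G H" using h by (rule iso_set_trans)
  then show ?thesis by (rule is_isoI)
qed

text \<open>
  The pair \<open>(i, j)\<close> stands for \<open>a\<^sup>i b\<^sup>j\<close>, where \<open>a\<close> has order three, \<open>b\<close> is an involution and
  \<open>ba = a\<^sup>2b\<close>.
\<close>

definition dihedral_6 :: "(nat \<times> nat) monoid" where
  "dihedral_6 = \<lparr>carrier = {..<3} \<times> {..<2},
     mult = (\<lambda>(i, j) (k, l). ((i + (if j = 0 then k else 2 * k)) mod 3, (j + l) mod 2)), one = (0, 0)\<rparr>"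

lemma iso_dihedral_6:
  assumes G: "group G" and card: "card (carrier G) = 6"
    and a: "a \<in> carrier G" "a \<otimes>\<^bsub>G\<^esub> a \<otimes>\<^bsub>G\<^esub> a = \<one>\<^bsub>G\<^esub>" "a \<noteq> \<one>\<^bsub>G\<^esub>"
    and b: "b \<in> carrier G" "b \<otimes>\<^bsub>G\<^esub> b = \<one>\<^bsub>G\<^esub>" "b \<otimes>\<^bsub>G\<^esub> a = a \<otimes>\<^bsub>G\<^esub> a \<otimes>\<^bsub>G\<^esub> b" "b \<noteq> \<one>\<^bsub>G\<^esub>"
  shows "dihedral_6 \<cong> G"
proof -
  interpret G: group G by fact
  note [simp] = a(1) b(1)
  define e where "e = (\<lambda>(i, j). a [^]\<^bsub>G\<^esub> (i::nat) \<otimes>\<^bsub>G\<^esub> b [^]\<^bsub>G\<^esub> (j::nat))"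
  have a3: "a [^]\<^bsub>G\<^esub> (3::nat) = \<one>\<^bsub>G\<^esub>" and b2: "b [^]\<^bsub>G\<^esub> (2::nat) = \<one>\<^bsub>G\<^esub>"
    using a b by (simp_all add: numeral_eq_Suc)
  have amod: "a [^]\<^bsub>G\<^esub> (n mod 3) = a [^]\<^bsub>G\<^esub> n" for n :: nat
  proof -
    have "a [^]\<^bsub>G\<^esub> n = a [^]\<^bsub>G\<^esub> (3 * (n div 3) + n mod 3)" by simp
    also have "\<dots> = (a [^]\<^bsub>G\<^esub> (3::nat)) [^]\<^bsub>G\<^esub> (n div 3) \<otimes>\<^bsub>G\<^esub> a [^]\<^bsub>G\<^esub> (n mod 3)"
      by (simp only: G.nat_pow_pow G.nat_pow_mult a(1))
    finally show ?thesis by (simp add: a3)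
  qed
  have bmod: "b [^]\<^bsub>G\<^esub> (n mod 2) = b [^]\<^bsub>G\<^esub> n" for n :: nat
  proof -
    have "b [^]\<^bsub>G\<^esub> n = b [^]\<^bsub>G\<^esub> (2 * (n div 2) + n mod 2)" by simp
    also have "\<dots> = (b [^]\<^bsub>G\<^esub> (2::nat)) [^]\<^bsub>G\<^esub> (n div 2) \<otimes>\<^bsub>G\<^esub> b [^]\<^bsub>G\<^esub> (n mod 2)"
      by (simp only: G.nat_pow_pow G.nat_pow_mult b(1))
    finally show ?thesis by (simp add: b2)
  qed
  have ba: "b \<otimes>\<^bsub>G\<^esub> a [^]\<^bsub>G\<^esub> k = a [^]\<^bsub>G\<^esub> (2 * k) \<otimes>\<^bsub>G\<^esub> b" for k :: nat
  proof (induction k)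
    case (Suc k)
    have "b \<otimes>\<^bsub>G\<^esub> a [^]\<^bsub>G\<^esub> Suc k = (b \<otimes>\<^bsub>G\<^esub> a [^]\<^bsub>G\<^esub> k) \<otimes>\<^bsub>G\<^esub> a" by (simp add: G.m_assoc)
    also have "\<dots> = a [^]\<^bsub>G\<^esub> (2 * k) \<otimes>\<^bsub>G\<^esub> (b \<otimes>\<^bsub>G\<^esub> a)" by (simp add: Suc G.m_assoc)
    also have "\<dots> = a [^]\<^bsub>G\<^esub> (2 * Suc k) \<otimes>\<^bsub>G\<^esub> b" by (simp add: b(3) G.m_assoc)
    finally show ?case .
  qed simp
  have hom: "e \<in> hom dihedral_6 G"
  proof (rule homI)
    fix x y assume "x \<in> carrier dihedral_6" "y \<in> carrier dihedral_6"
    then obtain i j k l where xy: "x = (i, j)" "y = (k, l)" "j = 0 \<or> j = 1"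
      by (auto simp: dihedral_6_def less_2_cases_iff)
    have "e (x \<otimes>\<^bsub>dihedral_6\<^esub> y) =
        a [^]\<^bsub>G\<^esub> (i + (if j = 0 then k else 2 * k)) \<otimes>\<^bsub>G\<^esub> b [^]\<^bsub>G\<^esub> (j + l)"
      by (simp add: xy e_def dihedral_6_def amod bmod)
    also have "\<dots> = e x \<otimes>\<^bsub>G\<^esub> e y"
    proof (cases "j = 0")
      case True
      then show ?thesis by (simp add: xy e_def G.m_assoc flip: G.nat_pow_mult)
    next
      case False
      then have j: "j = 1" using xy by simp
      have "e x \<otimes>\<^bsub>G\<^esub> e y = a [^]\<^bsub>G\<^esub> i \<otimes>\<^bsub>G\<^esub> (b \<otimes>\<^bsub>G\<^esub> a [^]\<^bsub>G\<^esub> k) \<otimes>\<^bsub>G\<^esub> b [^]\<^bsub>G\<^esub> l"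
        by (simp add: xy e_def G.m_assoc j)
      also have "\<dots> = a [^]\<^bsub>G\<^esub> (i + 2 * k) \<otimes>\<^bsub>G\<^esub> (b [^]\<^bsub>G\<^esub> (1::nat) \<otimes>\<^bsub>G\<^esub> b [^]\<^bsub>G\<^esub> l)"
        unfolding ba by (simp add: G.m_assoc flip: G.nat_pow_mult)
      finally show ?thesis using False by (simp only: G.nat_pow_mult b(1) j if_False)
    qed
    finally show "e (x \<otimes>\<^bsub>dihedral_6\<^esub> y) = e x \<otimes>\<^bsub>G\<^esub> e y" .
  qed (auto simp: e_def)
  \<comment> \<open>The six normal forms are distinct: a has order exactly three, and b is not a power of a
      because it does not commute with a.\<close>
  have ainj: "m = n" if "a [^]\<^bsub>G\<^esub> m = a [^]\<^bsub>G\<^esub> n" "m < 3" "n < 3" for m n :: nat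
  proof (rule ccontr)
    assume "m \<noteq> n"
    then have mn: "m = 0 \<or> m = 1 \<or> m = 2" "n = 0 \<or> n = 1 \<or> n = 2" using that(2,3) by auto
    have aa: "a \<otimes>\<^bsub>G\<^esub> a \<noteq> \<one>\<^bsub>G\<^esub>" using a by auto
    have aaa: "a \<otimes>\<^bsub>G\<^esub> a \<noteq> a" using a(3) G.l_cancel_one'[of a a] by auto
    show False
      using mn that(1) \<open>m \<noteq> n\<close> a(3) a(3)[symmetric] aa aa[symmetric] aaa aaa[symmetric]
      by (elim disjE) (simp_all add: numeral_eq_Suc)
  qed
  have b_not: "b \<noteq> a [^]\<^bsub>G\<^esub> n" for n :: nat
  proof
    assume *: "b = a [^]\<^bsub>G\<^esub> n"
    then have "b \<otimes>\<^bsub>G\<^esub> a = a \<otimes>\<^bsub>G\<^esub> b" by (simp add: G.pow_mult_distrib flip: G.nat_pow_Suc2)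
    then have "a \<otimes>\<^bsub>G\<^esub> b = a \<otimes>\<^bsub>G\<^esub> (a \<otimes>\<^bsub>G\<^esub> b)" using b(3) by (simp add: G.m_assoc)
    then show False using a(3) by (metis G.l_cancel G.m_closed G.r_cancel_one' a(1) b(1))
  qed
  have no: False if eq: "a [^]\<^bsub>G\<^esub> i \<otimes>\<^bsub>G\<^esub> b = a [^]\<^bsub>G\<^esub> k" for i k :: nat
  proof -
    have "a [^]\<^bsub>G\<^esub> (2 * i) \<otimes>\<^bsub>G\<^esub> (a [^]\<^bsub>G\<^esub> i \<otimes>\<^bsub>G\<^esub> b) = a [^]\<^bsub>G\<^esub> (2 * i + k)"
      by (simp add: eq G.nat_pow_mult)
    moreover have "a [^]\<^bsub>G\<^esub> (2 * i) \<otimes>\<^bsub>G\<^esub> a [^]\<^bsub>G\<^esub> i = (a [^]\<^bsub>G\<^esub> (3::nat)) [^]\<^bsub>G\<^esub> i"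
      unfolding G.nat_pow_pow[OF a(1)] G.nat_pow_mult[OF a(1)] by simp
    ultimately have "b = a [^]\<^bsub>G\<^esub> (2 * i + k)" using a3 by (simp flip: G.m_assoc)
    then show False using b_not by blast
  qed
  have inj: "inj_on e (carrier dihedral_6)"
  proof (rule inj_onI)
    fix x y assume "x \<in> carrier dihedral_6" "y \<in> carrier dihedral_6" and exy: "e x = e y"
    then obtain i j k l where xy: "x = (i, j)" "y = (k, l)" "j = 0 \<or> j = 1" "l = 0 \<or> l = 1" "i < 3" "k < 3"
      by (auto simp: dihedral_6_def less_2_cases_iff)
    have "j = l" using xy(3,4) exy no[of i k] no[of k i] by (auto simp: xy(1,2) e_def)
    moreover have "i = k" using exy ainj[of i k] xy(5,6) by (simp add: xy(1,2) e_def \<open>j = l\<close>)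
    ultimately show "x = y" by (simp add: xy)
  qed
  have "card (carrier dihedral_6) = 6" by (simp add: dihedral_6_def)
  then have "e ` carrier dihedral_6 = carrier G"
    using hom card card_image[OF inj]
    by (intro card_subset_eq) (auto simp: hom_def card_ge_0_finite)
  with inj hom show ?thesis by (intro is_isoI) (auto simp: iso_def bij_betw_def)
qed

text \<open>
  Both \<open>G\<close> and the symmetric group have six elements and a pair of elements with the relations
  of \<open>dihedral_6\<close>, so each has the normal forms \<open>a\<^sup>i b\<^sup>j\<close> with the same multiplication table.
\<close>

lemma symmetric_group_3I:
  assumes "group G" "card (carrier G) = 6"
    "a \<in> carrier G" "a \<otimes>\<^bsub>G\<^esub> a \<otimes>\<^bsub>G\<^esub> a = \<one>\<^bsub>G\<^esub>" "a \<noteq> \<one>\<^bsub>G\<^esub>"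
    "b \<in> carrier G" "b \<otimes>\<^bsub>G\<^esub> b = \<one>\<^bsub>G\<^esub>" "b \<otimes>\<^bsub>G\<^esub> a = a \<otimes>\<^bsub>G\<^esub> a \<otimes>\<^bsub>G\<^esub> b"
  shows "symmetric_group 3 G"
proof -
  interpret G: group G by fact
  have "b \<noteq> \<one>\<^bsub>G\<^esub>"
  proof
    assume "b = \<one>\<^bsub>G\<^esub>"
    then have "a = a \<otimes>\<^bsub>G\<^esub> a" using assms(3,8) by simp
    then show False using assms(3,5) G.l_cancel_one'[of a a] by simp
  qed
  then have 1: "dihedral_6 \<cong> G" using assms by (intro iso_dihedral_6) auto
  define s t :: "nat \<Rightarrow> nat" where "s = Transposition.transpose 1 2 \<circ> Transposition.transpose 2 3" and "t = Transposition.transpose 1 2"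
  have 12: "Transposition.transpose 1 2 permutes {1..3::nat}" and 23: "Transposition.transpose 2 3 permutes {1..3::nat}"
    by (auto intro: permutes_swap_id)
  have S: "group (sym_group 3)" by (rule sym_group_is_group)
  have "dihedral_6 \<cong> sym_group 3"
  proof (rule iso_dihedral_6[OF S])
    show "card (carrier (sym_group 3)) = 6"
      by (simp add: sym_group_card_carrier fact_numeral)
    show "s \<in> carrier (sym_group 3)" "t \<in> carrier (sym_group 3)"
      using 12 23 by (auto simp: sym_group_def s_def t_def intro: permutes_compose)
    show "s \<otimes>\<^bsub>sym_group 3\<^esub> s \<otimes>\<^bsub>sym_group 3\<^esub> s = \<one>\<^bsub>sym_group 3\<^esub>"
      "t \<otimes>\<^bsub>sym_group 3\<^esub> t = \<one>\<^bsub>sym_group 3\<^esub>"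
      "t \<otimes>\<^bsub>sym_group 3\<^esub> s = s \<otimes>\<^bsub>sym_group 3\<^esub> s \<otimes>\<^bsub>sym_group 3\<^esub> t"
      by (auto simp: sym_group_def s_def t_def fun_eq_iff Transposition.transpose_def)
    have "s 1 \<noteq> 1" "t 1 \<noteq> 1" by (simp_all add: s_def t_def Transposition.transpose_def)
    then show "s \<noteq> \<one>\<^bsub>sym_group 3\<^esub>" "t \<noteq> \<one>\<^bsub>sym_group 3\<^esub>"
      by (auto simp: sym_group_def)
  qed
  with 1 have "G \<cong> sym_group 3"
    by (rule iso_of_common_source) (auto simp: dihedral_6_def)
  then show ?thesis using assms(1) by (simp add: symmetric_group_def)
qed

section \<open>Finite fields of odd order\<close>

definition additive_group :: "'a::field monoid" where
  "additive_group = \<lparr>carrier = UNIV, mult = (+), one = 0\<rparr>"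

definition unit_group :: "'a::field monoid" where
  "unit_group = \<lparr>carrier = UNIV - {0}, mult = (*), one = 1\<rparr>"

lemma additive_group_simps [simp]:
  "carrier (additive_group :: 'a::field monoid) = UNIV"
  "(x::'a) \<otimes>\<^bsub>additive_group\<^esub> y = x + y" "\<one>\<^bsub>additive_group\<^esub> = (0::'a)"
  by (simp_all add: additive_group_def)

lemma unit_group_simps [simp]:
  "carrier (unit_group :: 'a::field monoid) = UNIV - {0}"
  "(x::'a) \<otimes>\<^bsub>unit_group\<^esub> y = x * y" "\<one>\<^bsub>unit_group\<^esub> = (1::'a)"
  by (simp_all add: unit_group_def)

lemma comm_group_additive: "comm_group (additive_group :: 'a::field monoid)"
proof (rule comm_groupI)
  fix x :: 'a
  show "\<exists>y\<in>carrier additive_group. y \<otimes>\<^bsub>additive_group\<^esub> x = \<one>\<^bsub>additive_group\<^esub>"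
    by (rule bexI[of _ "-x"]) auto
qed (auto simp: algebra_simps)

lemma group_additive: "group (additive_group :: 'a::field monoid)"
  using comm_group_additive by (rule comm_group.axioms(2))

lemma group_unit: "group (unit_group :: 'a::field monoid)"
proof (rule groupI)
  fix x :: 'a assume "x \<in> carrier unit_group"
  then show "\<exists>y\<in>carrier unit_group. y \<otimes>\<^bsub>unit_group\<^esub> x = \<one>\<^bsub>unit_group\<^esub>"
    by (intro bexI[of _ "inverse x"]) auto
qed (auto simp: algebra_simps)

lemma additive_group_pow: "(x::'a::field) [^]\<^bsub>additive_group\<^esub> (n::nat) = of_nat n * x"
  by (induction n) (auto simp: nat_pow_def algebra_simps)

lemma unit_group_pow: "(x::'a::field) [^]\<^bsub>unit_group\<^esub> (n::nat) = x ^ n"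
  by (induction n) (auto simp: nat_pow_def algebra_simps)

lemma elementary_abelian_additive:
  "elementary_abelian CARD('a) (additive_group :: 'a::{field,finite} monoid)"
proof -
  have "CHAR('a) > 0" by (rule finite_imp_CHAR_pos) simp
  then have p: "Factorial_Ring.prime CHAR('a)" by (rule prime_CHAR_semidom)
  show ?thesis unfolding elementary_abelian_def
  proof (intro conjI exI[of _ "CHAR('a)"] ballI)
    show "x [^]\<^bsub>additive_group\<^esub> CHAR('a) = \<one>\<^bsub>additive_group\<^esub>" for x :: 'a
      unfolding additive_group_pow by simp
  qed (use p comm_group_additive in \<open>auto simp: order_def\<close>)
qed

lemma cyclic_unit_group:
  "cyclic_of_order (CARD('a) - 1) (unit_group :: 'a::{field,finite} monoid)"
proof -
  let ?R = "ring_of_type_algebra :: 'a ring"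
  interpret R: field ?R by (rule field_from_type_algebra)
  have eq: "mult_of ?R = unit_group"
    by (simp add: mult_of_def unit_group_def ring_of_type_algebra_def)
  obtain a where a: "a \<in> carrier (unit_group :: 'a monoid)"
    "carrier (unit_group :: 'a monoid) = {a [^]\<^bsub>?R\<^esub> i | i::nat. i \<in> UNIV}"
    using R.finite_field_mult_group_has_gen unfolding eq
    by (auto simp: ring_of_type_algebra_def)
  interpret U: group "unit_group :: 'a monoid" by (rule group_unit)
  have pow: "a [^]\<^bsub>?R\<^esub> (i::nat) = a [^]\<^bsub>unit_group\<^esub> i" for i
    by (simp add: nat_pow_mult_of flip: eq)
  have "carrier (unit_group :: 'a monoid) = range (\<lambda>n::int. a [^]\<^bsub>unit_group\<^esub> n)"
  proof
    show "carrier (unit_group :: 'a monoid) \<subseteq> range (\<lambda>n::int. a [^]\<^bsub>unit_group\<^esub> n)"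
    proof
      fix x :: 'a assume "x \<in> carrier unit_group"
      then obtain i :: nat where "x = a [^]\<^bsub>unit_group\<^esub> i" using a(2) pow by auto
      then show "x \<in> range (\<lambda>n::int. a [^]\<^bsub>unit_group\<^esub> n)"
        by (intro image_eqI[of _ _ "int i"]) (auto simp: int_pow_int)
    qed
  qed (use a(1) U.int_pow_closed in blast)
  then have "cyclic_group (unit_group :: 'a monoid)" using a(1) U.cyclic_group by blast
  then show ?thesis
    by (simp add: cyclic_of_order_def group_unit order_def)
qed

lemma unit_group_generator:
  obtains g :: "'a::{field,finite}" where "g \<noteq> 0" "\<And>x. x \<noteq> 0 \<Longrightarrow> \<exists>n. x = g ^ n"
proof -
  let ?R = "ring_of_type_algebra :: 'a ring"
  interpret R: field ?R by (rule field_from_type_algebra)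
  have pow: "(a::'a) [^]\<^bsub>?R\<^esub> (i::nat) = a ^ i" for a i
    by (induction i) (auto simp: nat_pow_def ring_of_type_algebra_def mult.commute)
  obtain g where g: "g \<in> carrier (mult_of ?R)" "carrier (mult_of ?R) = {g [^]\<^bsub>?R\<^esub> i | i::nat. i \<in> UNIV}"
    using R.finite_field_mult_group_has_gen by (auto simp: ring_of_type_algebra_def)
  have "g \<noteq> 0" using g(1) by (simp add: ring_of_type_algebra_def)
  moreover have "\<exists>n. x = g ^ n" if "x \<noteq> 0" for x
  proof -
    have "x \<in> carrier (mult_of ?R)" using that by (simp add: ring_of_type_algebra_def)
    then show ?thesis using g(2) pow by auto
  qed
  ultimately show ?thesis using that by blast
qed

lemma nonsquare_mult_nonsquare:
  fixes a b :: "'a::{field,finite}"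
  assumes "\<nexists>x. a = x\<^sup>2" "\<nexists>x. b = x\<^sup>2"
  shows "\<exists>x. a * b = x\<^sup>2"
proof -
  obtain g :: 'a where g: "g \<noteq> 0" "\<And>x. x \<noteq> 0 \<Longrightarrow> \<exists>n. x = g ^ n"
    using unit_group_generator by blast
  have "a \<noteq> 0" "b \<noteq> 0" using assms by (metis zero_power2)+
  then obtain m n where mn: "a = g ^ m" "b = g ^ n" using g(2) by metis
  have "odd m" "odd n" using assms unfolding mn by (metis dvdE mult.commute power_mult)+
  then have "even (m + n)" by simp
  then obtain k where "m + n = 2 * k" by (rule evenE)
  then have "a * b = (g ^ k)\<^sup>2" by (simp add: mn mult.commute flip: power_add power_mult)
  then show ?thesis by blast
qed

lemma of_nat_CARD_eq_0: "of_nat CARD('a) = (0 :: 'a::{field,finite})"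
proof -
  interpret G: group "additive_group :: 'a monoid" by (rule group_additive)
  have "(1::'a) [^]\<^bsub>additive_group\<^esub> order (additive_group :: 'a monoid) = \<one>\<^bsub>additive_group\<^esub>"
    by (rule G.pow_order_eq_1) simp
  then show ?thesis unfolding additive_group_pow by (simp add: order_def)
qed

lemma two_neq_0_if_odd_card:
  assumes "odd CARD('a::{field,finite})"
  shows "(2 :: 'a) \<noteq> 0"
proof
  assume 2: "(2 :: 'a) = 0"
  obtain k where "CARD('a) = 2 * k + 1" using assms by (auto elim: oddE)
  then have "of_nat CARD('a) = (2 * of_nat k + 1 :: 'a)" by simp
  then show False using of_nat_CARD_eq_0[where 'a='a] 2 by simp
qed

text \<open>
  If three divides the order of the additive group, then Sylow's theorem yields a subgroup
  with three elements, and a nonzero element of it is annihilated by three.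
\<close>

lemma three_eq_0_iff: "(3 :: 'a::{field,finite}) = 0 \<longleftrightarrow> CARD('a) mod 3 = 0"
proof
  assume 3: "(3 :: 'a) = 0"
  define k r where "k = CARD('a) div 3" "r = CARD('a) mod 3"
  have q: "CARD('a) = 3 * k + r" by (simp add: k_r_def)
  have "(of_nat CARD('a) :: 'a) = 3 * of_nat k + of_nat r" unfolding q by simp
  then have r: "(of_nat r :: 'a) = 0" using of_nat_CARD_eq_0[where 'a='a] 3 by simp
  have "r < 3" by (simp add: k_r_def)
  then have "r = 0 \<or> r = 1 \<or> r = 2" by auto
  moreover have "(1::'a) \<noteq> 0" by simp
  moreover have "(2::'a) \<noteq> 0"
  proof
    assume "(2::'a) = 0"
    then have "(3::'a) - 2 = 0" using 3 by simp
    then show False by simp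
  qed
  ultimately have "r = 0" using r by auto
  then show "CARD('a) mod 3 = 0" by (simp add: k_r_def)
next
  assume "CARD('a) mod 3 = 0"
  then have "order (additive_group :: 'a monoid) = 3 ^ 1 * (CARD('a) div 3)"
    by (auto simp: order_def)
  then have "\<exists>H. subgroup H (additive_group :: 'a monoid) \<and> card H = 3 ^ 1"
    by (intro sylow_thm group_additive) simp_all
  then obtain H where H: "subgroup H (additive_group :: 'a monoid)" "card H = 3 ^ 1" by blast
  interpret G: group "additive_group :: 'a monoid" by (rule group_additive)
  have "\<not> H \<subseteq> {0}"
  proof
    assume "H \<subseteq> {0}"
    then have "card H \<le> 1" using card_mono[of "{0}" H] by simp
    then show False using H(2) by simp
  qed
  then obtain x where x: "x \<in> H" "x \<noteq> 0" by blast
  interpret H: group "additive_group\<lparr>carrier := H\<rparr>" using H(1) by (rule G.subgroup_imp_group)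
  have "x [^]\<^bsub>additive_group\<lparr>carrier := H\<rparr>\<^esub> order (additive_group\<lparr>carrier := H\<rparr>) =
    \<one>\<^bsub>additive_group\<lparr>carrier := H\<rparr>\<^esub>"
    by (rule H.pow_order_eq_1) (use x in simp)
  moreover have "order (additive_group\<lparr>carrier := H\<rparr>) = 3" using H(2) by (simp add: order_def)
  ultimately have "x [^]\<^bsub>additive_group\<^esub> (3::nat) = 0"
    by (simp add: nat_pow_def)
  then have "3 * x = 0" unfolding additive_group_pow by simp
  then show "(3::'a) = 0" using x by simp
qed

lemma primitive_cube_root_of_unity:
  fixes r :: "'a::field"
  assumes "(2::'a) \<noteq> 0" "(3::'a) \<noteq> 0" and r: "r\<^sup>2 = - 3"
  obtains w :: 'a where "w ^ 3 = 1" "w \<noteq> 1"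
proof -
  define w where "w = (r - 1) / 2"
  have "2 * w = r - 1" using assms(1) by (simp add: w_def)
  then have rw: "r = 2 * w + 1" by simp
  have "4 * (w\<^sup>2 + w + 1) = 0" using r unfolding rw by (simp add: power2_eq_square algebra_simps)
  moreover have "(4::'a) = 2 * 2" by simp
  then have "(4::'a) \<noteq> 0" using assms(1) by (metis mult_eq_0_iff)
  ultimately have ww: "w\<^sup>2 + w + 1 = 0" using mult_eq_0_iff by blast
  have "w ^ 3 - 1 = (w - 1) * (w\<^sup>2 + w + 1)"
    by (simp add: power2_eq_square power3_eq_cube algebra_simps)
  then have "w ^ 3 = 1" using ww by simp
  moreover have "w \<noteq> 1" using ww assms(2) by auto
  ultimately show ?thesis by (rule that)
qed

text \<open>
  A primitive cube root of unity \<open>w\<close> and a square root of \<open>-3\<close> determine each other by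
  \<open>r = 2w + 1\<close>, and the cyclic group of units has an element of order three if and only if
  three divides \<open>q - 1\<close>.
\<close>

lemma minus3_square_iff:
  assumes "odd CARD('a::{field,finite})" "(3 :: 'a) \<noteq> 0"
  shows "(\<exists>r. - 3 = (r :: 'a)\<^sup>2) \<longleftrightarrow> CARD('a) mod 3 = 1"
proof -
  have 2: "(2::'a) \<noteq> 0" using assms(1) by (rule two_neq_0_if_odd_card)
  have mod3: "3 dvd n - 1 \<longleftrightarrow> n mod 3 = 1" if "n > 0" for n :: nat
    using that by presburger
  have three: "n = 3" if "n dvd 3" "n \<noteq> 1" for n :: nat
  proof -
    have "n \<le> 3" using that(1) by (rule dvd_imp_le) simp
    then have "n = 0 \<or> n = 1 \<or> n = 2 \<or> n = 3" by arith
    then show ?thesis using that by auto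
  qed
  interpret U: group "unit_group :: 'a monoid" by (rule group_unit)
  have ordU: "order (unit_group :: 'a monoid) = CARD('a) - 1" by (simp add: order_def)
  have ord3: "U.ord w = 3" if "w ^ 3 = 1" "w \<noteq> 1" "w \<noteq> 0" for w :: 'a
  proof -
    have w: "w \<in> carrier unit_group" using that by simp
    have "U.ord w dvd 3" using w that U.pow_eq_id[of w 3] by (simp add: unit_group_pow)
    moreover have "U.ord w \<noteq> 1" using w that U.ord_eq_1[of w] by simp
    ultimately show ?thesis using three by blast
  qed
  show ?thesis
  proof
    assume "\<exists>r. - 3 = (r :: 'a)\<^sup>2"
    then obtain r :: 'a where r: "r\<^sup>2 = -3" by metis
    obtain w :: 'a where w: "w ^ 3 = 1" "w \<noteq> 1"
      using primitive_cube_root_of_unity[OF 2 assms(2) r] by blast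
    moreover have "w \<noteq> 0" using w by auto
    ultimately have "U.ord w = 3" by (rule ord3)
    moreover have "U.ord w dvd order (unit_group :: 'a monoid)"
      using \<open>w \<noteq> 0\<close> by (intro U.ord_dvd_group_order) auto
    ultimately have "3 dvd CARD('a) - 1" using ordU by simp
    moreover have "CARD('a) > 0" by simp
    ultimately show "CARD('a) mod 3 = 1" using mod3[of "CARD('a)"] by blast
  next
  assume "CARD('a) mod 3 = 1"
  then have "3 dvd CARD('a) - 1" using mod3[of "CARD('a)"] by simp
  then obtain k where k: "CARD('a) - 1 = 3 * k" by (elim dvdE)
  obtain g :: 'a where g: "g \<noteq> 0" "\<And>x. x \<noteq> 0 \<Longrightarrow> \<exists>n. x = g ^ n"
    using unit_group_generator by blast
  have "k \<noteq> 0"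
  proof
    assume "k = 0"
    then have "CARD('a) \<le> 1" using k by simp
    moreover have "card {0::'a, 1} \<le> CARD('a)" by (rule card_mono) auto
    ultimately show False by simp
  qed
  define w where "w = g ^ k"
  have w3: "w ^ 3 = 1"
  proof -
    have "g [^]\<^bsub>unit_group\<^esub> order (unit_group :: 'a monoid) = 1"
      using U.pow_order_eq_1[of g] g by simp
    then show ?thesis unfolding unit_group_pow ordU k w_def by (simp add: power_mult mult.commute flip: power_mult)
  qed
  have "w \<noteq> 1"
  proof
    assume w1: "w = 1"
    have "g ^ n \<in> (\<lambda>i. g ^ i) ` {..<k}" for n
    proof (rule image_eqI)
      have "g ^ n = g ^ (k * (n div k) + n mod k)" by simp
      also have "\<dots> = g ^ (n mod k)" using w1 by (simp only: power_add power_mult w_def power_one mult_1)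
      finally show "g ^ n = g ^ (n mod k)" .
    qed (use \<open>k \<noteq> 0\<close> in simp)
    then have "UNIV - {0} \<subseteq> (\<lambda>i. g ^ i) ` {..<k}" using g(2) by blast
    then have "card (UNIV - {0::'a}) \<le> card ((\<lambda>i. g ^ i) ` {..<k})" by (intro card_mono) auto
    also have "\<dots> \<le> k" using card_image_le[of "{..<k}" "\<lambda>i. g ^ i"] by simp
    finally show False using k \<open>k \<noteq> 0\<close> by simp
  qed
  have "(w - 1) * (w\<^sup>2 + w + 1) = w ^ 3 - 1" by (simp add: power2_eq_square power3_eq_cube algebra_simps)
  then have ww: "w\<^sup>2 + w + 1 = 0" using w3 \<open>w \<noteq> 1\<close> by simp
  have "(2 * w + 1)\<^sup>2 = 4 * (w\<^sup>2 + w + 1) - 3" by (simp add: power2_eq_square algebra_simps)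
  then show "\<exists>r. - 3 = (r :: 'a)\<^sup>2" using ww by (metis diff_0 mult_zero_right)
qed
qed

section \<open>Adjoining a square root of minus three\<close>

lemma cube_root_of_unity_trivial:
  fixes n :: "'a::field"
  assumes "n ^ 3 = 1" "\<nexists>r. - 3 = (r :: 'a)\<^sup>2"
  shows "n = 1"
proof (rule ccontr)
  assume "n \<noteq> 1"
  have "(n - 1) * (n\<^sup>2 + n + 1) = n ^ 3 - 1" by (simp add: power2_eq_square power3_eq_cube algebra_simps)
  then have "n\<^sup>2 + n + 1 = 0" using assms(1) \<open>n \<noteq> 1\<close> by simp
  moreover have "(2 * n + 1)\<^sup>2 = 4 * (n\<^sup>2 + n + 1) - 3" by (simp add: power2_eq_square algebra_simps)
  ultimately have "-3 = (2 * n + 1)\<^sup>2" by simp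
  then show False using assms(2) by blast
qed

lemma is_subfield_adjoin: "is_subfield (adjoin_sqrt_minus3 :: 'a::field alg_closure set)"
  unfolding adjoin_sqrt_minus3_def is_subfield_def by auto

lemma adjoin_closed:
  fixes x y :: "'a::field alg_closure"
  assumes "x \<in> adjoin_sqrt_minus3" "y \<in> adjoin_sqrt_minus3"
  shows "x - y \<in> adjoin_sqrt_minus3" "x * y \<in> adjoin_sqrt_minus3" "inverse x \<in> adjoin_sqrt_minus3"
    "x + y \<in> adjoin_sqrt_minus3"
proof -
  note sf = is_subfield_adjoin[where 'a='a, unfolded is_subfield_def]
  show "x - y \<in> adjoin_sqrt_minus3" "x * y \<in> adjoin_sqrt_minus3" "inverse x \<in> adjoin_sqrt_minus3"
    using sf assms by auto
  have "0 - y \<in> adjoin_sqrt_minus3" using sf assms by blast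
  then have "x - (0 - y) \<in> adjoin_sqrt_minus3" using sf assms by blast
  then show "x + y \<in> adjoin_sqrt_minus3" by simp
qed

lemma to_ac_in_adjoin: "to_ac x \<in> adjoin_sqrt_minus3"
  unfolding adjoin_sqrt_minus3_def by auto

text \<open>
  The right-hand side is a subfield also when \<open>w\<close> already belongs to the base field. In that
  case an element may have norm \<open>a\<^sup>2 + 3b\<^sup>2\<close> equal to zero without being zero, but then
  \<open>a = bw\<close> and the element \<open>2a\<close> is inverted in the base field.
\<close>

lemma adjoin_subset:
  fixes w :: "'a::field alg_closure"
  assumes w: "w\<^sup>2 = -3"
  shows "adjoin_sqrt_minus3 \<subseteq> {to_ac a + to_ac b * w | a b. True}" (is "_ \<subseteq> ?L")
proof -
  have mult: "(to_ac a + to_ac b * w) * (to_ac c + to_ac d * w) =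
      to_ac (a * c - 3 * b * d) + to_ac (a * d + b * c) * w" for a b c d
  proof -
    have "(to_ac a + to_ac b * w) * (to_ac c + to_ac d * w) =
      to_ac a * to_ac c + (to_ac a * to_ac d + to_ac b * to_ac c) * w + to_ac b * to_ac d * w\<^sup>2"
      by (simp add: algebra_simps power2_eq_square)
    then show ?thesis unfolding w by (simp add: algebra_simps)
  qed
  have "is_subfield ?L" unfolding is_subfield_def
  proof (intro conjI ballI)
    have "0 = to_ac 0 + to_ac 0 * w" "1 = to_ac 1 + to_ac 0 * w" by simp_all
    then show "0 \<in> ?L" "1 \<in> ?L" by blast+
  next
    fix x y assume "x \<in> ?L" "y \<in> ?L"
    then obtain a b c d where xy: "x = to_ac a + to_ac b * w" "y = to_ac c + to_ac d * w" by auto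
    have "x - y = to_ac (a - c) + to_ac (b - d) * w" by (simp add: xy algebra_simps)
    then show "x - y \<in> ?L" by blast
    show "x * y \<in> ?L" unfolding xy mult by blast
  next
    fix x assume "x \<in> ?L"
    then obtain a b where x: "x = to_ac a + to_ac b * w" by auto
    define n where "n = a\<^sup>2 + 3 * b\<^sup>2"
    have xx: "x * (to_ac a + to_ac (-b) * w) = to_ac n"
      unfolding x mult by (simp add: n_def power2_eq_square)
    show "inverse x \<in> ?L"
    proof (cases "n = 0")
      case False
      then have "to_ac n \<noteq> 0" using to_ac_inverse[of n] to_ac_mult[of n "inverse n"] by (metis to_ac_1 mult_zero_left right_inverse zero_neq_one)
      then have "inverse x = (to_ac a + to_ac (-b) * w) / to_ac n"
        using xx by (metis inverse_unique nonzero_mult_div_cancel_left times_divide_eq_right divide_self)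
      also have "\<dots> = to_ac (a / n) + to_ac (- b / n) * w" by (simp add: add_divide_distrib diff_divide_distrib)
      finally show ?thesis by blast
    next
      case True
      then have *: "x = 0 \<or> to_ac a = to_ac b * w" using xx by simp
      have "x = to_ac (2 * a) + to_ac 0 * w \<or> x = 0" using * by (auto simp: x)
      then show ?thesis
      proof
        assume "x = to_ac (2 * a) + to_ac 0 * w"
        then have "inverse x = to_ac (inverse (2 * a)) + to_ac 0 * w" by simp
        then show ?thesis by blast
      qed (auto intro!: exI[of _ 0])
    qed
  qed
  moreover have "range to_ac \<subseteq> ?L"
  proof
    fix x :: "'a alg_closure" assume "x \<in> range to_ac"
    then obtain a where "x = to_ac a + to_ac 0 * w" by auto
    then show "x \<in> ?L" by blast
  qed
  moreover have "{v. v\<^sup>2 = - 3} \<subseteq> ?L"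
  proof
    fix v :: "'a alg_closure" assume "v \<in> {v. v\<^sup>2 = - 3}"
    then have "v\<^sup>2 = w\<^sup>2" using w by simp
    then have "v = w \<or> v = - w" by (simp add: power2_eq_iff)
    then have "v = to_ac 0 + to_ac 1 * w \<or> v = to_ac 0 + to_ac (-1) * w" by auto
    then show "v \<in> ?L" by blast
  qed
  ultimately show ?thesis unfolding adjoin_sqrt_minus3_def by blast
qed

lemma to_ac_eq_0_iff: "to_ac (n :: 'a::field) = 0 \<longleftrightarrow> n = 0"
proof
  assume *: "to_ac n = 0"
  show "n = 0"
  proof (rule ccontr)
    assume "n \<noteq> 0"
    then have "to_ac n * to_ac (inverse n) = 1" by (simp flip: to_ac_mult)
    then show False using * by simp
  qed
qed simp

text \<open>
  The hypotheses on \<open>p\<close> and \<open>r\<close> are the conditions for a reflection in the stabiliser of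
  \<open>\<Sigma>\<^sub>1\<^sub>4\<close>. Let \<open>s\<close> be the square root of \<open>c\<close> and put \<open>z = p + rs\<close>, \<open>z' = p - rs\<close>. Then
  \<open>zz' = 1\<close>, and the two equations combine to \<open>(s - 1)z' = (s + 1)z\<^sup>2\<close>. Multiplying by \<open>z'\<^sup>2\<close>
  shows that \<open>(s + 1)/(s - 1)\<close> is the cube of \<open>z'\<close>, which the choice of \<open>c\<close> excludes.
\<close>

lemma Sigma14_parameter_excludes_reflection:
  fixes c p r :: "'a::field"
  assumes c: "Sigma14_parameter c" and D: "p\<^sup>2 - c * r\<^sup>2 = 1"
    and e1: "p + r = (p\<^sup>2 + c * r\<^sup>2) + 2 * p * r"
    and e2: "- p - c * r = c * (2 * p * r) + (p\<^sup>2 + c * r\<^sup>2)"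
  shows False
proof -
  obtain s where s: "s \<in> adjoin_sqrt_minus3" "s\<^sup>2 = to_ac c"
    and nc: "\<And>t. t \<in> adjoin_sqrt_minus3 \<Longrightarrow> (s + 1) / (s - 1) \<noteq> t ^ 3"
    using c unfolding Sigma14_parameter_def by blast
  define z z' where "z = to_ac p + to_ac r * s" and "z' = to_ac p - to_ac r * s"
  have z': "z' \<in> adjoin_sqrt_minus3"
    unfolding z'_def using s by (intro adjoin_closed to_ac_in_adjoin)
  have zz': "z * z' = 1"
  proof -
    have "z * z' = (to_ac p)\<^sup>2 - s\<^sup>2 * (to_ac r)\<^sup>2"
      by (simp add: z_def z'_def algebra_simps power2_eq_square)
    also have "\<dots> = to_ac (p\<^sup>2 - c * r\<^sup>2)" by (simp add: s)
    finally show ?thesis by (simp add: D)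
  qed
  have "(s - 1) * z' = s * to_ac (p + r) + to_ac (- p - c * r)"
    by (simp add: z'_def algebra_simps power2_eq_square flip: s(2))
  also have "\<dots> = (s + 1) * z\<^sup>2" unfolding e1 e2
    by (simp add: z_def algebra_simps power2_eq_square flip: s(2))
  finally have "(s - 1) * z' * z'\<^sup>2 = (s + 1) * (z * z')\<^sup>2"
    by (simp add: power_mult_distrib)
  then have eq: "s + 1 = (s - 1) * z' ^ 3"
    by (simp add: zz' power2_eq_square power3_eq_cube mult.assoc)
  have "(s + 1) / (s - 1) = z' ^ 3" if "s \<noteq> 1" using eq that by simp
  moreover have "(s + 1) / (s - 1) = 0 ^ 3" if "s = 1" using that by simp
  moreover have "0 \<in> adjoin_sqrt_minus3" using to_ac_in_adjoin[of 0] by simp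
  ultimately show False using nc z' by blast
qed

text \<open>
  The map \<open>s \<mapsto> (s + 1)/(s - 1)\<close> is an involution, so it is enough to find a suitable non-cube
  and to solve for \<open>s\<close>. If \<open>-3\<close> is a square, then no extension takes place, the field contains
  primitive cube roots of unity, cubing is not injective, and by finiteness some element is
  not a cube. If \<open>-3\<close> is not a square, the same argument is applied to the group of elements
  \<open>a + bw\<close> of norm one in the quadratic extension generated by \<open>w = \<surd>-3\<close>, which contains the
  primitive cube root of unity \<open>(-1 + w)/2\<close>. Norm one is what makes the solution \<open>s\<close> a
  multiple of \<open>w\<close>, so that its square lies in the base field.
\<close>

lemma Sigma14_parameter_exists:
  assumes q: "odd CARD('a::{field,finite})" "(3 :: 'a) \<noteq> 0"
  shows "\<exists>c :: 'a. Sigma14_parameter c"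
proof -
  have 2: "(2::'a) \<noteq> 0" using q(1) by (rule two_neq_0_if_odd_card)
  show ?thesis
  proof (cases "\<exists>r. - 3 = (r :: 'a)\<^sup>2")
    case True
    then obtain r :: 'a where r: "r\<^sup>2 = - 3" by metis
    obtain w :: 'a where "w ^ 3 = 1" "w \<noteq> 1"
      using primitive_cube_root_of_unity[OF 2 q(2) r] by blast
    moreover have "(1::'a) ^ 3 = 1" by simp
    ultimately have "\<not> inj (\<lambda>x::'a. x ^ 3)" by (metis injD)
    then have "\<not> surj (\<lambda>x::'a. x ^ 3)" using finite_UNIV_surj_inj[of "\<lambda>x::'a. x ^ 3"] by auto
    then obtain t :: 'a where t: "\<And>x. t \<noteq> x ^ 3" by (auto simp: surj_def)
    have t0: "t \<noteq> 0" "t \<noteq> 1" "t \<noteq> -1" using t[of 0] t[of 1] t[of "-1"] by auto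
    define s where "s = (t + 1) / (t - 1)"
    have s: "s \<noteq> 1" "s \<noteq> -1" "s \<noteq> 0"
    proof -
      show "s \<noteq> 1" using t0 2 by (auto simp: s_def field_simps)
      show "s \<noteq> -1"
      proof
        assume "s = -1"
        then have "2 * t = 0" using t0 by (simp add: s_def field_simps)
        then show False using 2 t0 by simp
      qed
      show "s \<noteq> 0" using t0 by (simp add: s_def add_eq_0_iff2)
    qed
    have ts: "(s + 1) / (s - 1) = t"
    proof -
      have "s * (t - 1) = t + 1" using t0 by (simp add: s_def)
      then have "t * (s - 1) = s + 1" by (simp add: algebra_simps)
      then show ?thesis using s by (simp add: field_simps)
    qed
    have "(to_ac r)\<^sup>2 = - 3" using r by (metis to_ac_power to_ac_minus to_ac_numeral)
    from adjoin_subset[OF this]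
    have ad: "x \<in> range to_ac" if "x \<in> adjoin_sqrt_minus3" for x :: "'a alg_closure"
      using that by (auto simp flip: to_ac_mult to_ac_add)
    have "Sigma14_parameter (s\<^sup>2)" unfolding Sigma14_parameter_def
    proof (intro conjI)
      show "s\<^sup>2 \<noteq> 0" "s\<^sup>2 \<noteq> 1" using s by (auto simp: power2_eq_1_iff)
      show "\<exists>r. - 3 * s\<^sup>2 = r\<^sup>2" using r by (intro exI[of _ "r * s"]) (simp add: power_mult_distrib)
      show "\<exists>u\<in>adjoin_sqrt_minus3. u\<^sup>2 = to_ac (s\<^sup>2) \<and> \<not> (\<exists>t\<in>adjoin_sqrt_minus3. (u + 1) / (u - 1) = t ^ 3)"
      proof (rule bexI[of _ "to_ac s"], intro conjI notI)
        assume "\<exists>t\<in>adjoin_sqrt_minus3. (to_ac s + 1) / (to_ac s - 1) = t ^ 3"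
        then obtain x where "(to_ac s + 1) / (to_ac s - 1) = (to_ac x) ^ 3" using ad by blast
        then have "to_ac ((s + 1) / (s - 1) - x ^ 3) = 0" by simp
        then have "t = x ^ 3" unfolding to_ac_eq_0_iff ts by simp
        then show False using t by blast
      qed (auto intro: to_ac_in_adjoin)
    qed
    then show ?thesis by blast
  next
    case nsq: False
    obtain w :: "'a alg_closure" where w: "w\<^sup>2 = -3"
      using nth_root_exists[of 2 "-3 :: 'a alg_closure"] by auto
    have wad: "w \<in> adjoin_sqrt_minus3" unfolding adjoin_sqrt_minus3_def using w by auto
    have uniq: "a = 0 \<and> b = 0" if "to_ac a + to_ac b * w = 0" for a b
    proof -
      have "b = 0"
      proof (rule ccontr)
        assume "b \<noteq> 0"
        then have "w = to_ac (- a / b)"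
          using that to_ac_eq_0_iff[of b] by (simp add: field_simps add_eq_0_iff)
        then have "to_ac ((- a / b)\<^sup>2 + 3) = 0" using w by simp
        then have "- 3 = (- a / b)\<^sup>2" unfolding to_ac_eq_0_iff by (simp add: eq_neg_iff_add_eq_0 add.commute)
        then show False using nsq by blast
      qed
      then show ?thesis using that by (simp add: to_ac_eq_0_iff)
    qed
    \<comment> \<open>In coordinates with respect to 1 and w, C is cubing and N1 is the group of elements of
        norm one.\<close>
    define C where "C = (\<lambda>(x::'a, y::'a). (x ^ 3 - 9 * x * y\<^sup>2, 3 * x\<^sup>2 * y - 3 * y ^ 3))"
    define N1 where "N1 = {(x::'a, y::'a). x\<^sup>2 + 3 * y\<^sup>2 = 1}"
    have norm3: "(fst (C (x, y)))\<^sup>2 + 3 * (snd (C (x, y)))\<^sup>2 = (x\<^sup>2 + 3 * y\<^sup>2) ^ 3" for x y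
      by (simp add: C_def power2_eq_square power3_eq_cube algebra_simps)
    have cube: "(to_ac x + to_ac y * w) ^ 3 = to_ac (fst (C (x, y))) + to_ac (snd (C (x, y))) * w" for x y
    proof -
      have "(to_ac x + to_ac y * w) ^ 3 = to_ac x ^ 3 + 3 * (to_ac x)\<^sup>2 * to_ac y * w
        + 3 * to_ac x * (to_ac y)\<^sup>2 * w\<^sup>2 + (to_ac y) ^ 3 * w\<^sup>2 * w"
        by (simp add: power2_eq_square power3_eq_cube algebra_simps)
      then show ?thesis unfolding w by (simp add: C_def algebra_simps)
    qed
    have CN: "C ` N1 \<subseteq> N1"
    proof
      fix v assume "v \<in> C ` N1"
      then obtain x y where "v = C (x, y)" "x\<^sup>2 + 3 * y\<^sup>2 = 1" by (auto simp: N1_def)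
      then show "v \<in> N1" using norm3[of x y] by (auto simp: N1_def case_prod_beta)
    qed
    have "\<not> inj_on C N1"
    proof
      assume inj: "inj_on C N1"
      have half: "2 * (1 / 2 :: 'a) = 1" using 2 by simp
      define h where "h = (1 / 2 :: 'a)"
      have h: "2 * h = 1" "h \<noteq> 0" using half 2 by (auto simp: h_def)
      have h2: "4 * h\<^sup>2 = 1"
      proof -
        have "4 * h\<^sup>2 = (2 * h)\<^sup>2" by (simp add: power2_eq_square)
        then show ?thesis by (simp add: h)
      qed
      have h3: "8 * h ^ 3 = 1"
      proof -
        have "8 * h ^ 3 = (2 * h) ^ 3" by (simp add: power3_eq_cube)
        then show ?thesis by (simp add: h)
      qed
      have "(1, 0) \<in> N1" "(- h, h) \<in> N1" using h2 by (auto simp: N1_def)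
      moreover have "C (1, 0) = C (- h, h)" using h3 by (simp add: C_def power2_eq_square power3_eq_cube mult.assoc)
      ultimately show False using inj h by (auto dest: inj_onD)
    qed
    then have "C ` N1 \<noteq> N1" using finite_surj_inj[of N1 C] by auto
    then obtain a b where ab: "(a, b) \<in> N1" "(a, b) \<notin> C ` N1" using CN by (metis subsetI subset_antisym surj_pair)
    have abn: "a\<^sup>2 + 3 * b\<^sup>2 = 1" using ab(1) by (simp add: N1_def)
    have "C (1, 0) = (1, 0)" "C (-1, 0) = (-1, 0)" "(1, 0) \<in> N1" "(-1, 0) \<in> N1"
      by (simp_all add: C_def N1_def)
    then have "(1, 0) \<in> C ` N1" "(-1, 0) \<in> C ` N1" by force+
    then have ab1: "(a, b) \<noteq> (1, 0)" "(a, b) \<noteq> (-1, 0)" using ab(2) by metis+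
    have "b \<noteq> 0" using ab1 abn by (auto simp: power2_eq_1_iff)
    have "a \<noteq> 1" using abn \<open>b \<noteq> 0\<close> q(2) by auto
    define d where "d = b / (a - 1)"
    have d: "d \<noteq> 0" "d * (a - 1) = b" using \<open>b \<noteq> 0\<close> \<open>a \<noteq> 1\<close> by (auto simp: d_def)
    define s where "s = to_ac d * w"
    have s2: "s\<^sup>2 = to_ac (- 3 * d\<^sup>2)" by (simp add: s_def power_mult_distrib w)
    have c1: "- 3 * d\<^sup>2 \<noteq> 1"
    proof
      assume "- 3 * d\<^sup>2 = 1"
      then have "- 3 = (1 / d)\<^sup>2" using d(1) by (simp add: field_simps power2_eq_square)
      then show False using nsq by blast
    qed
    have s1: "s \<noteq> 1" using s2 c1 to_ac_eq_0_iff[of "- 3 * d\<^sup>2 - 1"] by auto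
    have quot: "(s + 1) / (s - 1) = to_ac a + to_ac b * w"
    proof -
      have "(a - 1) * (a + 1 + 3 * b * d) = a\<^sup>2 + 3 * b * (d * (a - 1)) - 1"
        by (simp add: power2_eq_square algebra_simps)
      also have "\<dots> = 0" unfolding d(2) using abn by (simp add: power2_eq_square algebra_simps)
      finally have e: "a + 1 + 3 * b * d = 0" using \<open>a \<noteq> 1\<close> by simp
      have "(to_ac a + to_ac b * w) * (s - 1) = - to_ac a + (to_ac a * to_ac d - to_ac b) * w + to_ac b * to_ac d * w\<^sup>2"
        by (simp add: s_def algebra_simps power2_eq_square)
      also have "\<dots> = to_ac (1 - (a + 1 + 3 * b * d)) + to_ac (a * d - d * (a - 1)) * w"
        unfolding w d(2) by (simp add: algebra_simps)
      also have "\<dots> = s + 1" unfolding e by (simp add: s_def algebra_simps)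
      finally show ?thesis using s1 by (simp add: field_simps)
    qed
    have "Sigma14_parameter (- 3 * d\<^sup>2)" unfolding Sigma14_parameter_def
    proof (intro conjI)
      show "- 3 * d\<^sup>2 \<noteq> 0" using d q(2) by simp
      show "- 3 * d\<^sup>2 \<noteq> 1" by (rule c1)
      show "\<exists>r. - 3 * (- 3 * d\<^sup>2) = r\<^sup>2" by (intro exI[of _ "3 * d"]) (simp add: power_mult_distrib)
      show "\<exists>u\<in>adjoin_sqrt_minus3. u\<^sup>2 = to_ac (- 3 * d\<^sup>2) \<and> \<not> (\<exists>t\<in>adjoin_sqrt_minus3. (u + 1) / (u - 1) = t ^ 3)"
      proof (rule bexI[of _ s], intro conjI notI)
        show "s\<^sup>2 = to_ac (- 3 * d\<^sup>2)" by (rule s2)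
      next
        assume "\<exists>t\<in>adjoin_sqrt_minus3. (s + 1) / (s - 1) = t ^ 3"
        then obtain x y where "(s + 1) / (s - 1) = (to_ac x + to_ac y * w) ^ 3"
          using adjoin_subset[OF w] by blast
        then have "to_ac (a - fst (C (x, y))) + to_ac (b - snd (C (x, y))) * w = 0"
          unfolding quot cube by (simp add: algebra_simps)
        from uniq[OF this] have ab': "(a, b) = C (x, y)" by (simp add: prod_eq_iff)
        then have "(x\<^sup>2 + 3 * y\<^sup>2) ^ 3 = 1" using norm3[of x y] abn by (metis fst_conv snd_conv)
        \<comment> \<open>A cube root of an element of norm one has norm one itself, because the base field
            has no cube root of unity other than 1.\<close>
        then have "(x, y) \<in> N1" using cube_root_of_unity_trivial nsq by (auto simp: N1_def)
        then show False using ab' ab(2) by blast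
      next
        show "s \<in> adjoin_sqrt_minus3" unfolding s_def by (intro adjoin_closed to_ac_in_adjoin wad)
      qed
    qed
    then show ?thesis by blast
  qed
qed

section \<open>Linear groups modulo scalars\<close>

lemma GL_simps [simp]:
  "A \<in> carrier (GL :: ('a::field ^ 'n ^ 'n) monoid) \<longleftrightarrow> invertible A"
  "A \<otimes>\<^bsub>GL\<^esub> B = A ** B" "\<one>\<^bsub>GL\<^esub> = (mat 1 :: 'a ^ 'n ^ 'n)"
  by (simp_all add: GL_def)

lemma matrix_inv_mult:
  fixes A :: "'a::field ^ 'n ^ 'n"
  assumes "invertible A"
  shows "A ** matrix_inv A = mat 1" "matrix_inv A ** A = mat 1"
proof -
  have "\<exists>B. A ** B = mat 1 \<and> B ** A = mat 1" using assms by (simp add: invertible_def)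
  from someI_ex[OF this] show "A ** matrix_inv A = mat 1" "matrix_inv A ** A = mat 1"
    unfolding matrix_inv_def by auto
qed

lemma invertible_of_right_inverse:
  fixes A :: "'a::field ^ 'n ^ 'n"
  assumes "A ** B = mat 1"
  shows "invertible A" "invertible B" "matrix_inv A = B"
proof -
  have BA: "B ** A = mat 1" using assms by (simp add: matrix_left_right_inverse)
  show i: "invertible A" "invertible B" using assms BA by (auto simp: invertible_def)
  have "matrix_inv A ** (A ** B) = B" by (simp add: matrix_mul_assoc matrix_inv_mult i)
  then show "matrix_inv A = B" by (simp add: assms)
qed

lemma invertible_mat_1 [simp]: "invertible (mat 1 :: 'a::field ^ 'n ^ 'n)"
  by (rule invertible_of_right_inverse(1)[of _ "mat 1"]) simp

lemma invertible_matrix_inv: "invertible (A :: 'a::field ^ 'n ^ 'n) \<Longrightarrow> invertible (matrix_inv A)"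
  using invertible_of_right_inverse(2)[OF matrix_inv_mult(1)] .

lemma group_GL: "group (GL :: ('a::field ^ 'n ^ 'n) monoid)"
proof (rule groupI)
  fix A :: "'a ^ 'n ^ 'n" assume "A \<in> carrier GL"
  then show "\<exists>B\<in>carrier GL. B \<otimes>\<^bsub>GL\<^esub> A = \<one>\<^bsub>GL\<^esub>"
    by (intro bexI[of _ "matrix_inv A"]) (auto simp: matrix_inv_mult invertible_matrix_inv)
qed (auto simp: invertible_mult matrix_mul_assoc)

lemma finite_matrices [simp]: "finite (S :: ('a::{field,finite} ^ 'n ^ 'm) set)"
  by (rule finite_subset[of _ UNIV]) simp_all

lemma scalar_matrix_mult:
  fixes A :: "'a::field ^ 'n ^ 'm"
  shows "mat c ** A = (vec_lambda (\<lambda>i. vec_lambda (\<lambda>j. c * A $ i $ j)))" "A ** mat c = vec_lambda (\<lambda>i. vec_lambda (\<lambda>j. A $ i $ j * c))"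
  by (simp_all add: matrix_matrix_mult_def mat_def vec_eq_iff if_distrib[of "\<lambda>x. x * _"]
      if_distrib[of "\<lambda>x. _ * x"] sum.delta sum.delta' cong: if_cong)

lemma scalar_matrix_commute: "A ** mat c = mat c ** (A :: 'a::field ^ 'n ^ 'n)"
  by (simp add: scalar_matrix_mult mult.commute)

lemma scalar_matrix_times_scalar: "mat c ** mat d = (mat (c * d) :: 'a::field ^ 'n ^ 'n)"
  unfolding scalar_matrix_mult(1) by (simp add: vec_eq_iff mat_def)

lemma scalar_matrix_move:
  fixes A B :: "'a::field ^ 'n ^ 'n"
  shows "A ** (mat c ** B) = mat c ** (A ** B)"
  by (metis matrix_mul_assoc scalar_matrix_commute)

lemma scalar_matrix_inv:
  assumes "c \<noteq> 0"
  shows "invertible (mat c :: 'a::field ^ 'n ^ 'n)" "matrix_inv (mat c) = (mat (inverse c) :: 'a ^ 'n ^ 'n)"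
  using invertible_of_right_inverse[of "mat c :: 'a ^ 'n ^ 'n" "mat (inverse c)"] assms
  by (auto simp: scalar_matrix_times_scalar)

lemma mat_inject: "(mat c :: 'a::field ^ 'n ^ 'n) = mat d \<longleftrightarrow> c = d"
  by (auto simp: mat_def vec_eq_iff split: if_splits)

lemma scalar_matrices_simps:
  "A \<in> scalar_matrices \<longleftrightarrow> (\<exists>c. c \<noteq> 0 \<and> A = mat c)"
  by (auto simp: scalar_matrices_def)

lemma card_scalar_matrices: "card (scalar_matrices :: ('a::{field,finite} ^ 'n ^ 'n) set) = CARD('a) - 1"
proof -
  have eq: "scalar_matrices = (mat :: 'a \<Rightarrow> 'a ^ 'n ^ 'n) ` (UNIV - {0})"
    by (auto simp: scalar_matrices_simps)
  have "card ((mat :: 'a \<Rightarrow> 'a ^ 'n ^ 'n) ` (UNIV - {0})) = card (UNIV - {0 :: 'a})"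
    by (intro card_image inj_onI) (simp add: mat_inject)
  then show ?thesis unfolding eq by simp
qed

lemma scalar_matrices_normal: "scalar_matrices \<lhd> (GL :: ('a::field ^ 'n ^ 'n) monoid)"
proof -
  interpret GL: group "GL :: ('a::field ^ 'n ^ 'n) monoid" by (rule group_GL)
  have inv: "inv\<^bsub>GL\<^esub> A = matrix_inv A" if "invertible A" for A :: "'a ^ 'n ^ 'n"
    using that by (intro GL.inv_equality) (auto simp: matrix_inv_mult invertible_matrix_inv)
  have sub: "subgroup scalar_matrices (GL :: ('a::field ^ 'n ^ 'n) monoid)"
  proof (rule GL.subgroupI)
    show "scalar_matrices \<subseteq> carrier (GL :: ('a::field ^ 'n ^ 'n) monoid)"
      by (auto simp: scalar_matrices_simps scalar_matrix_inv)
    show "(scalar_matrices :: ('a::field ^ 'n ^ 'n) set) \<noteq> {}"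
      by (auto simp: scalar_matrices_def intro: exI[of _ 1])
  next
    fix A B :: "'a ^ 'n ^ 'n" assume A: "A \<in> scalar_matrices"
    then obtain c where "c \<noteq> 0" "A = mat c" by (auto simp: scalar_matrices_simps)
    then have "inv\<^bsub>GL\<^esub> A = mat (inverse c)" "inverse c \<noteq> 0" by (auto simp: inv scalar_matrix_inv)
    then show "inv\<^bsub>GL\<^esub> A \<in> scalar_matrices" unfolding scalar_matrices_simps by blast
    assume "B \<in> scalar_matrices"
    with A show "A \<otimes>\<^bsub>GL\<^esub> B \<in> scalar_matrices"
      by (auto simp: scalar_matrices_simps scalar_matrix_times_scalar mat_inject)
  qed
  show ?thesis unfolding GL.normal_inv_iff
  proof (intro conjI ballI sub)
    fix A C :: "'a ^ 'n ^ 'n" assume A: "A \<in> carrier GL" and "C \<in> scalar_matrices"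
    then obtain c where c: "C = mat c" "c \<noteq> 0" by (auto simp: scalar_matrices_simps)
    have "A ** mat c ** matrix_inv A = mat c ** (A ** matrix_inv A)"
      by (simp add: scalar_matrix_commute matrix_mul_assoc)
    then have "A \<otimes>\<^bsub>GL\<^esub> C \<otimes>\<^bsub>GL\<^esub> inv\<^bsub>GL\<^esub> A = mat c" using A c by (simp add: matrix_inv_mult inv)
    then show "A \<otimes>\<^bsub>GL\<^esub> C \<otimes>\<^bsub>GL\<^esub> inv\<^bsub>GL\<^esub> A \<in> scalar_matrices"
      using c by (auto simp: scalar_matrices_simps)
  qed
qed

text \<open>
  The elements of \<open>PGL\<close>, as cosets of the group of scalar matrices.
\<close>

definition proj_class :: "'a::field ^ 'n ^ 'n \<Rightarrow> ('a ^ 'n ^ 'n) set" where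
  "proj_class A = {mat c ** A | c. c \<noteq> 0}"

lemma proj_class_eq_coset: "proj_class A = scalar_matrices #>\<^bsub>GL\<^esub> A"
  by (auto simp: proj_class_def r_coset_def scalar_matrices_def)

lemma proj_class_self: "A \<in> proj_class A"
  unfolding proj_class_def by (rule CollectI, rule exI[of _ 1]) simp

lemma proj_class_eq_iff:
  "proj_class A = proj_class B \<longleftrightarrow> (\<exists>c. c \<noteq> 0 \<and> A = mat c ** B)"
proof
  assume "proj_class A = proj_class B"
  then show "\<exists>c. c \<noteq> 0 \<and> A = mat c ** B" using proj_class_self[of A] by (auto simp: proj_class_def)
next
  assume "\<exists>c. c \<noteq> 0 \<and> A = mat c ** B"
  then obtain c where c: "c \<noteq> 0" "A = mat c ** B" by blast
  have "mat d ** A = mat (d * c) ** B" for d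
    by (simp add: c matrix_mul_assoc scalar_matrix_times_scalar)
  moreover have "mat d ** B = mat (d / c) ** A" for d
    using c by (simp add: matrix_mul_assoc scalar_matrix_times_scalar)
  moreover have "d * c \<noteq> 0" "d / c \<noteq> 0" if "d \<noteq> 0" for d :: 'a using c(1) that by auto
  ultimately show "proj_class A = proj_class B" unfolding proj_class_def by blast
qed

lemma group_PGL: "group (PGL :: ('a::field ^ 'n ^ 'n) set monoid)"
  unfolding PGL_def by (rule normal.factorgroup_is_group[OF scalar_matrices_normal])

lemma PGL_simps:
  "carrier (PGL :: ('a::field ^ 'n ^ 'n) set monoid) = proj_class ` {A. invertible A}"
  "C \<otimes>\<^bsub>PGL\<^esub> D = C <#>\<^bsub>GL\<^esub> D" "\<one>\<^bsub>PGL\<^esub> = (scalar_matrices :: ('a ^ 'n ^ 'n) set)"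
proof -
  show "carrier (PGL :: ('a::field ^ 'n ^ 'n) set monoid) = proj_class ` {A. invertible A}"
    unfolding PGL_def FactGroup_def RCOSETS_def proj_class_eq_coset by (auto simp: GL_def)
qed (simp_all add: PGL_def FactGroup_def)

lemma proj_class_mult:
  assumes "invertible A" "invertible B"
  shows "proj_class A \<otimes>\<^bsub>PGL\<^esub> proj_class B = proj_class (A ** B)"
  using assms normal.rcos_sum[OF scalar_matrices_normal, of A B]
  by (simp add: PGL_simps proj_class_eq_coset)

lemma proj_class_hom: "proj_class \<in> hom GL PGL"
  by (auto simp: hom_def PGL_simps(1) proj_class_mult)

lemma group_hom_proj_class: "group_hom GL PGL proj_class"
  unfolding group_hom_def group_hom_axioms_def using group_GL group_PGL proj_class_hom by blast

text \<open>
  Translation by an element of \<open>H\<close> is an injective map of the finite set \<open>H\<close> to itself, hence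
  surjective; this produces the neutral element and inverses.
\<close>

lemma finite_closed_subgroup:
  assumes G: "group G" and fin: "finite (carrier G)" and H: "H \<subseteq> carrier G" "H \<noteq> {}"
    and cl: "\<And>x y. x \<in> H \<Longrightarrow> y \<in> H \<Longrightarrow> x \<otimes>\<^bsub>G\<^esub> y \<in> H"
  shows "subgroup H G"
proof -
  interpret G: group G by fact
  have solve: "\<exists>z\<in>H. x \<otimes>\<^bsub>G\<^esub> z = y" if "x \<in> H" "y \<in> H" for x y
  proof -
    have "inj_on (\<lambda>z. x \<otimes>\<^bsub>G\<^esub> z) H" using that H by (auto simp: inj_on_def subset_iff)
    moreover have "(\<lambda>z. x \<otimes>\<^bsub>G\<^esub> z) ` H \<subseteq> H" using that cl by auto
    ultimately have "(\<lambda>z. x \<otimes>\<^bsub>G\<^esub> z) ` H = H"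
      using fin H(1) by (intro endo_inj_surj) (auto intro: finite_subset)
    then have "y \<in> (\<lambda>z. x \<otimes>\<^bsub>G\<^esub> z) ` H" using that(2) by blast
    then show ?thesis by (rule imageE) auto
  qed
  obtain x where x: "x \<in> H" using H(2) by blast
  then obtain e where e: "e \<in> H" "x \<otimes>\<^bsub>G\<^esub> e = x" using solve by blast
  then have "e = \<one>\<^bsub>G\<^esub>" using x H(1) by (auto simp: subset_iff)
  then have one: "\<one>\<^bsub>G\<^esub> \<in> H" using e by simp
  show ?thesis
  proof (rule G.subgroupI)
    fix y assume y: "y \<in> H"
    then obtain z where z: "z \<in> H" "y \<otimes>\<^bsub>G\<^esub> z = \<one>\<^bsub>G\<^esub>" using solve one by blast
    then have yz: "y \<in> carrier G" "z \<in> carrier G" using y H(1) by auto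
    have "z \<otimes>\<^bsub>G\<^esub> y = \<one>\<^bsub>G\<^esub>" by (rule G.inv_comm[OF z(2) yz])
    then have "inv\<^bsub>G\<^esub> y = z" using yz by (rule G.inv_equality)
    then show "inv\<^bsub>G\<^esub> y \<in> H" using z by simp
  qed (use H cl in auto)
qed

section \<open>Matrices of order three with explicit entries\<close>

text \<open>
  A constant with nine arguments is used for computations because its products, transposes and
  equalities rewrite entry by entry.
\<close>

definition m3 :: "'a::field \<Rightarrow> 'a \<Rightarrow> 'a \<Rightarrow> 'a \<Rightarrow> 'a \<Rightarrow> 'a \<Rightarrow> 'a \<Rightarrow> 'a \<Rightarrow> 'a \<Rightarrow> 'a ^ 3 ^ 3" where
  "m3 a b c d e f g h i = mat3 [a, b, c] [d, e, f] [g, h, i]"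

lemma m3_nth [simp]:
  "m3 a b c d e f g h i $ 1 $ 1 = a" "m3 a b c d e f g h i $ 1 $ 2 = b" "m3 a b c d e f g h i $ 1 $ 3 = c"
  "m3 a b c d e f g h i $ 2 $ 1 = d" "m3 a b c d e f g h i $ 2 $ 2 = e" "m3 a b c d e f g h i $ 2 $ 3 = f"
  "m3 a b c d e f g h i $ 3 $ 1 = g" "m3 a b c d e f g h i $ 3 $ 2 = h" "m3 a b c d e f g h i $ 3 $ 3 = i"
  by (simp_all add: m3_def mat3_def)

lemma matrix3_eq_iff:
  fixes A B :: "'a ^ 3 ^ 3"
  shows "A = B \<longleftrightarrow> A$1$1 = B$1$1 \<and> A$1$2 = B$1$2 \<and> A$1$3 = B$1$3 \<and>
    A$2$1 = B$2$1 \<and> A$2$2 = B$2$2 \<and> A$2$3 = B$2$3 \<and> A$3$1 = B$3$1 \<and> A$3$2 = B$3$2 \<and> A$3$3 = B$3$3"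
  by (simp add: vec_eq_iff forall_3)

lemma m3_eq_iff [simp]:
  "m3 a b c d e f g h i = m3 a' b' c' d' e' f' g' h' i' \<longleftrightarrow>
   a = a' \<and> b = b' \<and> c = c' \<and> d = d' \<and> e = e' \<and> f = f' \<and> g = g' \<and> h = h' \<and> i = i'"
  by (simp add: matrix3_eq_iff)

lemma m3_cases:
  obtains a b c d e f g h i where "A = m3 a b c d e f g h i"
proof -
  have "A = m3 (A$1$1) (A$1$2) (A$1$3) (A$2$1) (A$2$2) (A$2$3) (A$3$1) (A$3$2) (A$3$3)"
    by (simp add: matrix3_eq_iff)
  then show ?thesis by (rule that)
qed

lemma m3_mult:
  "m3 a b c d e f g h i ** m3 a' b' c' d' e' f' g' h' i' =
   m3 (a * a' + b * d' + c * g') (a * b' + b * e' + c * h') (a * c' + b * f' + c * i')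
      (d * a' + e * d' + f * g') (d * b' + e * e' + f * h') (d * c' + e * f' + f * i')
      (g * a' + h * d' + i * g') (g * b' + h * e' + i * h') (g * c' + h * f' + i * i')"
  by (simp add: matrix3_eq_iff matrix_matrix_mult_def sum_3)

lemma m3_transpose: "transpose (m3 a b c d e f g h i) = m3 a d g b e h c f i"
  by (simp add: matrix3_eq_iff transpose_def)

lemma m3_scale:
  "mat k ** m3 a b c d e f g h i = m3 (k * a) (k * b) (k * c) (k * d) (k * e) (k * f) (k * g) (k * h) (k * i)"
  by (simp add: scalar_matrix_mult matrix3_eq_iff)

lemma m3_scalar: "mat k = m3 k 0 0 0 k 0 0 0 k"
  by (simp add: matrix3_eq_iff mat_def)

lemma m3_invertible:
  "invertible (m3 a b c d e f g h i) \<longleftrightarrow>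
     a * (e * i - f * h) - b * (d * i - f * g) + c * (d * h - e * g) \<noteq> (0 :: 'a::field)"
  by (simp add: invertible_det_nz det_3 algebra_simps)

section \<open>Orders of the linear groups\<close>

definition cross :: "'a::field \<times> 'a \<times> 'a \<Rightarrow> 'a \<times> 'a \<times> 'a \<Rightarrow> 'a \<times> 'a \<times> 'a" where
  "cross = (\<lambda>(a, b, c) (d, e, f). (b * f - c * e, c * d - a * f, a * e - b * d))"

definition dot :: "'a::field \<times> 'a \<times> 'a \<Rightarrow> 'a \<times> 'a \<times> 'a \<Rightarrow> 'a" where
  "dot = (\<lambda>(a, b, c) (d, e, f). a * d + b * e + c * f)"

lemma card_dot_eq_0:
  fixes n :: "'a::{field,finite} \<times> 'a \<times> 'a"
  assumes "n \<noteq> 0"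
  shows "card {w. dot n w = 0} = CARD('a)^2"
proof -
  obtain x y z where n: "n = (x, y, z)" by (cases n)
  have "\<exists>g :: 'a \<times> 'a \<Rightarrow> 'a \<times> 'a \<times> 'a. inj g \<and> range g = {w. dot n w = 0}"
  proof -
    consider "x \<noteq> 0" | "y \<noteq> 0" | "z \<noteq> 0" using assms by (auto simp: n zero_prod_def)
    then show ?thesis
    proof cases
      case 1
      have "inj (\<lambda>(a, b). (- (y * a + z * b) / x, a, b))" by (auto simp: inj_def)
      moreover have "w \<in> range (\<lambda>(a, b). (- (y * a + z * b) / x, a, b))" if "dot n w = 0" for w
        using that 1 by (cases w) (auto simp: n dot_def image_iff field_simps eq_neg_iff_add_eq_0)
      ultimately show ?thesis using 1
        by (intro exI[of _ "\<lambda>(a, b). (- (y * a + z * b) / x, a, b)"]) (auto simp: n dot_def)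
    next
      case 2
      have "inj (\<lambda>(a, b). (a, - (x * a + z * b) / y, b))" by (auto simp: inj_def)
      moreover have "w \<in> range (\<lambda>(a, b). (a, - (x * a + z * b) / y, b))" if "dot n w = 0" for w
        using that 2 by (cases w) (auto simp: n dot_def image_iff field_simps eq_neg_iff_add_eq_0)
      ultimately show ?thesis using 2
        by (intro exI[of _ "\<lambda>(a, b). (a, - (x * a + z * b) / y, b)"]) (auto simp: n dot_def)
    next
      case 3
      have "inj (\<lambda>(a, b). (a, b, - (x * a + y * b) / z))" by (auto simp: inj_def)
      moreover have "w \<in> range (\<lambda>(a, b). (a, b, - (x * a + y * b) / z))" if "dot n w = 0" for w
        using that 3 by (cases w) (auto simp: n dot_def image_iff field_simps eq_neg_iff_add_eq_0)
      ultimately show ?thesis using 3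
        by (intro exI[of _ "\<lambda>(a, b). (a, b, - (x * a + y * b) / z)"]) (auto simp: n dot_def)
    qed
  qed
  then obtain g :: "'a \<times> 'a \<Rightarrow> 'a \<times> 'a \<times> 'a" where g: "inj g" "range g = {w. dot n w = 0}" by blast
  have "card (range g) = CARD('a \<times> 'a)" using g(1) by (rule card_image)
  then show ?thesis by (simp add: g(2) power2_eq_square)
qed

lemma cross_eq_0:
  fixes u :: "'a::field \<times> 'a \<times> 'a"
  assumes "u = (a, b, c)" "u \<noteq> 0"
  shows "{v. cross u v = 0} = range (\<lambda>t. (t * a, t * b, t * c))"
proof
  show "range (\<lambda>t. (t * a, t * b, t * c)) \<subseteq> {v. cross u v = 0}"
    by (auto simp: cross_def assms(1) zero_prod_def)
  show "{v. cross u v = 0} \<subseteq> range (\<lambda>t. (t * a, t * b, t * c))"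
  proof
    fix v assume v: "v \<in> {v. cross u v = 0}"
    obtain d e f where [simp]: "v = (d, e, f)" by (cases v)
    have eq: "b * f = c * e" "c * d = a * f" "a * e = b * d"
      using v by (auto simp: cross_def assms(1) zero_prod_def)
    consider "a \<noteq> 0" | "b \<noteq> 0" | "c \<noteq> 0" using assms by (auto simp: zero_prod_def)
    then show "v \<in> range (\<lambda>t. (t * a, t * b, t * c))"
    proof cases
      case 1 then show ?thesis using eq by (intro range_eqI[of _ _ "d / a"]) (auto simp: field_simps)
    next
      case 2 then show ?thesis using eq by (intro range_eqI[of _ _ "e / b"]) (auto simp: field_simps)
    next
      case 3 then show ?thesis using eq by (intro range_eqI[of _ _ "f / c"]) (auto simp: field_simps)
    qed
  qed
qed

lemma card_cross_eq_0:
  fixes u :: "'a::{field,finite} \<times> 'a \<times> 'a"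
  assumes "u \<noteq> 0"
  shows "card {v. cross u v = 0} = CARD('a)"
proof -
  obtain a b c where u: "u = (a, b, c)" by (cases u)
  have "inj (\<lambda>t. (t * a, t * b, t * c))" using assms by (auto simp: u zero_prod_def inj_def)
  then show ?thesis unfolding cross_eq_0[OF u assms] by (rule card_image)
qed

text \<open>
  The determinant is the triple product of the rows. So the first row can be any nonzero
  vector, the second must have nonzero cross product with the first, and the third must lie
  outside the plane orthogonal to that cross product.
\<close>

lemma card_GL3:
  "card {A :: 'a::{field,finite} ^ 3 ^ 3. invertible A} =
     (CARD('a)^3 - 1) * (CARD('a)^3 - CARD('a)) * (CARD('a)^3 - CARD('a)^2)"
proof -
  let ?V = "UNIV :: ('a \<times> 'a \<times> 'a) set"
  have V: "card ?V = CARD('a)^3" by (simp add: power3_eq_cube)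
  define S where "S = (SIGMA p:(SIGMA u:?V - {0}. ?V - {v. cross u v = 0}).
     ?V - {w. dot (cross (fst p) (snd p)) w = 0})"
  define m where "m = (\<lambda>(((a, b, c), (d, e, f)), (g, h, i)). m3 a b c d e f g h i :: 'a ^ 3 ^ 3)"
  have det: "dot (cross (a, b, c) (d, e, f)) (g, h, i) = a * (e * i - f * h) - b * (d * i - f * g) + c * (d * h - e * g)"
    for a b c d e f g h i :: 'a
    by (simp add: dot_def cross_def algebra_simps)
  have "bij_betw m S {A. invertible A}"
  proof (rule bij_betwI')
    fix x y :: "(('a \<times> 'a \<times> 'a) \<times> ('a \<times> 'a \<times> 'a)) \<times> ('a \<times> 'a \<times> 'a)"
    obtain a b c d e f g h i where x: "x = (((a, b, c), (d, e, f)), (g, h, i))"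
      by (cases x, cases "fst x", cases "fst (fst x)", cases "snd (fst x)", cases "snd x") auto
    obtain a' b' c' d' e' f' g' h' i' where y: "y = (((a', b', c'), (d', e', f')), (g', h', i'))"
      by (cases y, cases "fst y", cases "fst (fst y)", cases "snd (fst y)", cases "snd y") auto
    show "(m x = m y) = (x = y)" by (simp add: m_def x y)
    assume "x \<in> S"
    then have "dot (cross (a, b, c) (d, e, f)) (g, h, i) \<noteq> 0" by (simp add: S_def x)
    then show "m x \<in> {A. invertible A}"
      unfolding det by (simp add: m_def m3_invertible x)
  next
    fix A assume "A \<in> {A :: 'a ^ 3 ^ 3. invertible A}"
    obtain a b c d e f g h i where A: "A = m3 a b c d e f g h i" by (rule m3_cases)
    have "dot (cross (a, b, c) (d, e, f)) (g, h, i) \<noteq> 0"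
      unfolding det using \<open>A \<in> _\<close> by (simp add: A m3_invertible)
    moreover from this have "cross (a, b, c) (d, e, f) \<noteq> 0" by (auto simp: dot_def zero_prod_def)
    moreover from this have "(a, b, c) \<noteq> 0" by (auto simp: cross_def zero_prod_def)
    ultimately have "(((a, b, c), (d, e, f)), (g, h, i)) \<in> S" by (simp add: S_def)
    then show "\<exists>x\<in>S. A = m x" by (rule bexI[rotated]) (simp add: A m_def)
  qed
  then have "card {A :: 'a ^ 3 ^ 3. invertible A} = card S" by (simp add: bij_betw_same_card)
  also have "\<dots> = (CARD('a)^3 - 1) * (CARD('a)^3 - CARD('a)) * (CARD('a)^3 - CARD('a)^2)"
  proof -
    have 1: "card (?V - {v. cross u v = 0}) = CARD('a)^3 - CARD('a)" if "u \<noteq> 0" for u :: "'a \<times> 'a \<times> 'a"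
      using card_cross_eq_0[OF that] by (subst card_Diff_subset) (auto simp: V power3_eq_cube power2_eq_square mult.assoc)
    have 2: "card (?V - {w. dot n w = 0}) = CARD('a)^3 - CARD('a)^2" if "n \<noteq> 0" for n :: "'a \<times> 'a \<times> 'a"
      using card_dot_eq_0[OF that] by (subst card_Diff_subset) (auto simp: V power3_eq_cube power2_eq_square mult.assoc)
    have 3: "card (?V - {0}) = CARD('a)^3 - 1" by (subst card_Diff_subset) (auto simp: V power3_eq_cube power2_eq_square mult.assoc)
    have 4: "card (SIGMA u:?V - {0}. ?V - {v. cross u v = 0}) = (CARD('a)^3 - 1) * (CARD('a)^3 - CARD('a))"
      by (subst card_SigmaI) (auto simp: 1 3 simp del: card_prod UNIV_Times_UNIV)
    have "card S = (\<Sum>p\<in>(SIGMA u:?V - {0}. ?V - {v. cross u v = 0}).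
        card (?V - {w. dot (cross (fst p) (snd p)) w = 0}))"
      unfolding S_def by (subst card_SigmaI) auto
    also have "\<dots> = (\<Sum>p\<in>(SIGMA u:?V - {0}. ?V - {v. cross u v = 0}). CARD('a)^3 - CARD('a)^2)"
      by (intro sum.cong refl 2) auto
    finally show ?thesis by (simp add: 4 del: card_prod UNIV_Times_UNIV)
  qed
  finally show ?thesis .
qed

definition m2 :: "'a::field \<Rightarrow> 'a \<Rightarrow> 'a \<Rightarrow> 'a \<Rightarrow> 'a ^ 2 ^ 2" where
  "m2 a b c d = vector [vector [a, b], vector [c, d]]"

lemma m2_nth [simp]: "m2 a b c d $ 1 $ 1 = a" "m2 a b c d $ 1 $ 2 = b"
    "m2 a b c d $ 2 $ 1 = c" "m2 a b c d $ 2 $ 2 = d"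
  by (simp_all add: m2_def)

lemma m2_eq_iff [simp]: "m2 a b c d = m2 a' b' c' d' \<longleftrightarrow> a = a' \<and> b = b' \<and> c = c' \<and> d = d'"
  by (simp add: vec_eq_iff forall_2)

lemma m2_cases:
  obtains a b c d where "A = m2 a b c d"
proof -
  have "A = m2 (A$1$1) (A$1$2) (A$2$1) (A$2$2)" by (simp add: vec_eq_iff forall_2)
  then show ?thesis using that by blast
qed

lemma m2_mult:
  "m2 a b c d ** m2 a' b' c' d' =
   m2 (a * a' + b * c') (a * b' + b * d') (c * a' + d * c') (c * b' + d * d')"
  by (simp add: vec_eq_iff forall_2 matrix_matrix_mult_def sum_2)

lemma m2_one: "mat 1 = m2 1 0 0 1"
  by (simp add: vec_eq_iff forall_2 mat_def)

lemma m2_invertible: "invertible (m2 a b c d) \<longleftrightarrow> a * d - b * c \<noteq> (0 :: 'a::field)"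
  by (simp add: invertible_det_nz det_2)

lemma card_GL2:
  "card {A :: 'a::{field,finite} ^ 2 ^ 2. invertible A} =
     (CARD('a)^2 - 1) * (CARD('a)^2 - CARD('a))"
proof -
  let ?V = "UNIV :: ('a \<times> 'a) set"
  have V: "card ?V = CARD('a)^2" by (simp add: power2_eq_square)
  define S where "S = (SIGMA u:?V - {0}. ?V - range (\<lambda>t. (t * fst u, t * snd u)))"
  define m where "m = (\<lambda>((a, b), (c, d)). m2 a b c d :: 'a ^ 2 ^ 2)"
  have det: "a * d = b * c \<longleftrightarrow> (c, d) \<in> range (\<lambda>t. (t * a, t * b))" if ab: "(a, b) \<noteq> 0" for a b c d :: 'a
  proof
    assume *: "a * d = b * c"
    consider "a \<noteq> 0" | "b \<noteq> 0" using ab by (auto simp: zero_prod_def)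
    then show "(c, d) \<in> range (\<lambda>t. (t * a, t * b))"
    proof cases
      case 1 then show ?thesis using * by (intro range_eqI[of _ _ "c / a"]) (auto simp: field_simps)
    next
      case 2 then show ?thesis using * by (intro range_eqI[of _ _ "d / b"]) (auto simp: field_simps)
    qed
  qed auto
  have "bij_betw m S {A. invertible A}"
  proof (rule bij_betwI')
    show "(m x = m y) = (x = y)" for x y by (auto simp: m_def split: prod.splits)
    show "m x \<in> {A. invertible A}" if "x \<in> S" for x
    proof -
      obtain a b c d where x: "x = ((a, b), (c, d))" by (metis surj_pair)
      then have "(a, b) \<noteq> 0" "(c, d) \<notin> range (\<lambda>t. (t * a, t * b))" using that by (auto simp: S_def)
      then show ?thesis using det[of a b d c] by (simp add: x m_def m2_invertible)
    qed
    fix A assume "A \<in> {A :: 'a ^ 2 ^ 2. invertible A}"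
    obtain a b c d where A: "A = m2 a b c d" by (rule m2_cases)
    have "a * d \<noteq> b * c" using \<open>A \<in> _\<close> by (simp add: A m2_invertible)
    moreover from this have "(a, b) \<noteq> 0" by (auto simp: zero_prod_def)
    ultimately have "((a, b), (c, d)) \<in> S" using det[of a b d c] by (simp add: S_def)
    then show "\<exists>x\<in>S. A = m x" by (rule bexI[rotated]) (simp add: A m_def)
  qed
  then have "card {A :: 'a ^ 2 ^ 2. invertible A} = card S" by (simp add: bij_betw_same_card)
  also have "\<dots> = (CARD('a)^2 - 1) * (CARD('a)^2 - CARD('a))"
  proof -
    have 1: "card (?V - range (\<lambda>t. (t * fst u, t * snd u))) = CARD('a)^2 - CARD('a)" if "u \<noteq> 0" for u :: "'a \<times> 'a"
    proof -
      have "inj (\<lambda>t. (t * fst u, t * snd u))" using that by (auto simp: zero_prod_def inj_def prod_eq_iff)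
      then have "card (range (\<lambda>t. (t * fst u, t * snd u))) = CARD('a)" by (rule card_image)
      then show ?thesis by (subst card_Diff_subset) (auto simp: V power3_eq_cube power2_eq_square mult.assoc)
    qed
    have 3: "card (?V - {0}) = CARD('a)^2 - 1" by (subst card_Diff_subset) (auto simp: V power3_eq_cube power2_eq_square mult.assoc)
    show ?thesis unfolding S_def
      by (subst card_SigmaI) (auto simp: 1 3 simp del: card_prod UNIV_Times_UNIV)
  qed
  finally show ?thesis .
qed

section \<open>Quadratic forms and Gram matrices\<close>

definition qf :: "'a::field ^ 3 ^ 3 \<Rightarrow> 'a ^ 3 \<Rightarrow> 'a" where
  "qf M x = (\<Sum>i\<in>UNIV. \<Sum>j\<in>UNIV. x $ i * M $ i $ j * x $ j)"

definition symmetric_matrix :: "'a::field ^ 3 ^ 3 \<Rightarrow> bool" where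
  "symmetric_matrix M \<longleftrightarrow> transpose M = M"

lemma qf_eq_sum: "qf M x = (\<Sum>i\<in>UNIV. x $ i * (M *v x) $ i)"
  by (simp add: qf_def matrix_vector_mult_def sum_distrib_left mult.assoc)

lemma sum_transpose:
  fixes x y :: "'a::field ^ 'n"
  shows "(\<Sum>i\<in>UNIV. x $ i * (A *v y) $ i) = (\<Sum>i\<in>UNIV. (transpose A *v x) $ i * y $ i)"
  unfolding matrix_vector_mult_def
  by (simp add: sum_distrib_left sum_distrib_right transpose_def, subst sum.swap,
      simp add: mult_ac)

lemma qf_congruence: "qf (A ** M ** transpose A) x = qf M (transpose A *v x)"
  unfolding qf_eq_sum
  by (simp add: matrix_vector_mul_assoc[symmetric] sum_transpose[of x A])

lemma qf_add: "qf (M + M') x = qf M x + qf M' x"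
  by (simp add: qf_def sum.distrib algebra_simps)

lemma qf_scale: "qf (mat c ** M) x = c * qf M x"
  by (simp add: qf_def scalar_matrix_mult sum_distrib_left algebra_simps)

lemma qf_inject:
  fixes M M' :: "'a::field ^ 3 ^ 3"
  assumes 2: "(2 :: 'a) \<noteq> 0" and sym: "symmetric_matrix M" "symmetric_matrix M'" and eq: "qf M = qf M'"
  shows "M = M'"
proof -
  obtain a b c d e f g h i where M: "M = m3 a b c d e f g h i" by (rule m3_cases)
  obtain a' b' c' d' e' f' g' h' i' where M': "M' = m3 a' b' c' d' e' f' g' h' i'" by (rule m3_cases)
  have s: "d = b" "g = c" "h = f" "d' = b'" "g' = c'" "h' = f'"
    using sym unfolding M M' symmetric_matrix_def m3_transpose m3_eq_iff by blast+
  have ev: "qf M (vector [x, y, z]) = qf M' (vector [x, y, z])" for x y z by (simp add: eq)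
  have 100: "a = a'" using ev[of 1 0 0] by (simp add: qf_def M M' sum_3)
  have 010: "e = e'" using ev[of 0 1 0] by (simp add: qf_def M M' sum_3)
  have 001: "i = i'" using ev[of 0 0 1] by (simp add: qf_def M M' sum_3)
  have "2 * b = 2 * b'" using ev[of 1 1 0] 100 010 by (simp add: qf_def M M' sum_3 s algebra_simps)
  then have 110: "b = b'" using 2 by simp
  have "2 * c = 2 * c'" using ev[of 1 0 1] 100 001 by (simp add: qf_def M M' sum_3 s algebra_simps)
  then have 101: "c = c'" using 2 by simp
  have "2 * f = 2 * f'" using ev[of 0 1 1] 010 001 by (simp add: qf_def M M' sum_3 s algebra_simps)
  then have 011: "f = f'" using 2 by simp
  show ?thesis using 100 010 001 110 101 011 s by (simp add: M M')
qed

lemma quadratic_form_qf: "quadratic_form (qf M)"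
  unfolding quadratic_form_def
  by (rule exI[of _ "\<lambda>i j. M $ i $ j"]) (simp add: qf_def mult_ac)

lemma quadratic_form_imp_qf:
  fixes f :: "'a::field ^ 3 \<Rightarrow> 'a"
  assumes 2: "(2 :: 'a) \<noteq> 0" and "quadratic_form f"
  obtains M where "symmetric_matrix M" "f = qf M"
proof -
  obtain a where a: "\<And>x. f x = (\<Sum>i\<in>UNIV. \<Sum>j\<in>UNIV. a i j * x $ i * x $ j)"
    using assms(2) by (auto simp: quadratic_form_def)
  define h where "h = (1 / 2 :: 'a)"
  have h: "h * 2 = 1" using 2 by (simp add: h_def)
  define M :: "'a ^ 3 ^ 3" where "M = vec_lambda (\<lambda>i. vec_lambda (\<lambda>j. h * (a i j + a j i)))"
  have "symmetric_matrix M" by (simp add: symmetric_matrix_def M_def transpose_def vec_eq_iff add.commute)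
  moreover have "f x = qf M x" for x
  proof -
    have "qf M x = h * ((\<Sum>i\<in>UNIV. \<Sum>j\<in>UNIV. a i j * x $ i * x $ j) + (\<Sum>i\<in>UNIV. \<Sum>j\<in>UNIV. a j i * x $ i * x $ j))"
      by (simp add: qf_def M_def sum_distrib_left sum.distrib[symmetric] algebra_simps)
    also have "(\<Sum>i\<in>UNIV. \<Sum>j\<in>UNIV. a j i * x $ i * x $ j) = (\<Sum>i\<in>UNIV. \<Sum>j\<in>UNIV. a i j * x $ i * x $ j)"
      by (subst sum.swap) (simp add: mult_ac)
    also have "h * ((\<Sum>i\<in>UNIV. \<Sum>j\<in>UNIV. a i j * x $ i * x $ j) + (\<Sum>i\<in>UNIV. \<Sum>j\<in>UNIV. a i j * x $ i * x $ j)) = h * 2 * f x"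
      by (simp only: a mult_2 mult.assoc)
    finally show ?thesis by (simp add: h)
  qed
  ultimately show ?thesis using that by blast
qed

lemma gram_qf:
  fixes M :: "'a::field ^ 3 ^ 3"
  assumes 2: "(2 :: 'a) \<noteq> 0" and M: "symmetric_matrix M"
  shows "gram (qf M) = M"
  unfolding gram_def
proof (rule the_equality)
  show "transpose M = M \<and> (\<forall>x. qf M x = (\<Sum>i\<in>UNIV. \<Sum>j\<in>UNIV. x $ i * M $ i $ j * x $ j))"
    using M by (simp add: symmetric_matrix_def qf_def)
next
  fix M'
  assume *: "transpose M' = M' \<and> (\<forall>x. qf M x = (\<Sum>i\<in>UNIV. \<Sum>j\<in>UNIV. x $ i * M' $ i $ j * x $ j))"
  have "qf M' = qf M" using * by (auto simp: qf_def)
  then show "M' = M" using * M by (intro qf_inject[OF 2]) (auto simp: symmetric_matrix_def)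
qed

lemma gram_image_qf:
  fixes P :: "('a::field ^ 3 ^ 3) set"
  assumes 2: "(2 :: 'a) \<noteq> 0" and P: "\<And>M. M \<in> P \<Longrightarrow> symmetric_matrix M"
  shows "plane_of_net (qf ` P) = P"
proof -
  have "gram ` (qf ` P) = (\<lambda>M. M) ` P"
    unfolding image_image by (rule image_cong) (simp_all add: gram_qf 2 P)
  then show ?thesis by (simp add: plane_of_net_def)
qed

lemma qf_image_gram:
  fixes N :: "('a::field ^ 3 \<Rightarrow> 'a) set"
  assumes 2: "(2 :: 'a) \<noteq> 0" and N: "\<And>f. f \<in> N \<Longrightarrow> quadratic_form f"
  shows "qf ` plane_of_net N = N"
proof -
  have "qf (gram f) = f" if f: "f \<in> N" for f
  proof -
    obtain M where "symmetric_matrix M" "f = qf M" using quadratic_form_imp_qf[OF 2 N[OF f]] by blast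
    then show ?thesis by (simp add: gram_qf 2)
  qed
  then have "(\<lambda>f. qf (gram f)) ` N = (\<lambda>f. f) ` N" by (intro image_cong) simp_all
  then show ?thesis by (simp add: plane_of_net_def image_image)
qed

section \<open>Planes with a point of rank one\<close>

text \<open>
  Being a three-dimensional space is expressed by an injective linear parametrisation from the
  space of vectors. Each representative plane is given in parametrised form, and congruence
  and the passage to forms preserve such a description.
\<close>

definition rank_one_plane :: "('a::field ^ 3 ^ 3) set \<Rightarrow> bool" where
  "rank_one_plane P \<longleftrightarrow>
     (\<exists>S :: 'a ^ 3 \<Rightarrow> 'a ^ 3 ^ 3. P = range S \<and> (\<forall>x y. S (x + y) = S x + S y) \<and>
        (\<forall>c x. S (c *s x) = mat c ** S x) \<and> (\<forall>x. S x = 0 \<longrightarrow> x = 0)) \<and>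
     (\<forall>M\<in>P. symmetric_matrix M) \<and>
     (\<exists>M\<in>P. \<exists>c v. M \<noteq> 0 \<and> (\<forall>i j. M $ i $ j = c * v $ i * v $ j))"

lemma rank_one_planeI:
  fixes S :: "'a::field \<Rightarrow> 'a \<Rightarrow> 'a \<Rightarrow> 'a ^ 3 ^ 3"
  assumes P: "P = {S \<alpha> \<beta> \<gamma> | \<alpha> \<beta> \<gamma>. True}"
    and add: "\<And>a b c a' b' c'. S (a + a') (b + b') (c + c') = S a b c + S a' b' c'"
    and scale: "\<And>k a b c. S (k * a) (k * b) (k * c) = mat k ** S a b c"
    and inj: "\<And>a b c. S a b c = 0 \<Longrightarrow> a = 0 \<and> b = 0 \<and> c = 0"
    and sym: "\<And>a b c. transpose (S a b c) = S a b c"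
    and one: "S a b c \<noteq> 0" "\<And>i j. S a b c $ i $ j = k * v $ i * v $ j"
  shows "rank_one_plane P"
proof -
  let ?S = "\<lambda>x :: 'a ^ 3. S (x $ 1) (x $ 2) (x $ 3)"
  show ?thesis unfolding rank_one_plane_def
  proof (intro conjI exI[of _ ?S])
  have "S \<alpha> \<beta> \<gamma> = ?S (vector [\<alpha>, \<beta>, \<gamma>])" for \<alpha> \<beta> \<gamma> by simp
  then show "P = range ?S" unfolding P by blast
  show "\<forall>x y. ?S (x + y) = ?S x + ?S y"
      unfolding vector_add_component by (intro allI add)
  show "\<forall>c x. ?S (c *s x) = mat c ** ?S x"
      unfolding vector_smult_component by (intro allI scale)
  show "\<forall>x. ?S x = 0 \<longrightarrow> x = 0"
  proof (intro allI impI)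
    fix x :: "'a ^ 3" assume "?S x = 0"
    then have "x $ 1 = 0 \<and> x $ 2 = 0 \<and> x $ 3 = 0" by (rule inj)
    then show "x = 0" by (simp add: vec_eq_iff forall_3)
  qed
  show "\<forall>M\<in>P. symmetric_matrix M" using sym by (auto simp: P symmetric_matrix_def)
  show "\<exists>M\<in>P. \<exists>c v. M \<noteq> 0 \<and> (\<forall>i j. M $ i $ j = c * v $ i * v $ j)"
    using one by (intro bexI[of _ "S a b c"]) (auto simp: P)
qed
qed

lemma rank_one_plane_param:
  assumes "rank_one_plane P"
  obtains S :: "'a::field ^ 3 \<Rightarrow> 'a ^ 3 ^ 3" where "P = range S" "\<forall>x y. S (x + y) = S x + S y"
    "\<forall>c x. S (c *s x) = mat c ** S x" "\<forall>x. S x = 0 \<longrightarrow> x = 0"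
proof -
  have "\<exists>S :: 'a ^ 3 \<Rightarrow> 'a ^ 3 ^ 3. P = range S \<and> (\<forall>x y. S (x + y) = S x + S y) \<and>
        (\<forall>c x. S (c *s x) = mat c ** S x) \<and> (\<forall>x. S x = 0 \<longrightarrow> x = 0)"
    using assms unfolding rank_one_plane_def by (rule conjunct1)
  then show ?thesis by (elim exE conjE) (rule that)
qed

lemma rank_one_plane_sym: "rank_one_plane P \<Longrightarrow> M \<in> P \<Longrightarrow> symmetric_matrix M"
  unfolding rank_one_plane_def by (elim conjE) (rule bspec)

lemma rank_one_plane_one:
  assumes "rank_one_plane P"
  obtains M c v where "M \<in> P" "M \<noteq> 0" "\<forall>i j. M $ i $ j = c * v $ i * v $ j"
  using assms unfolding rank_one_plane_def by (elim conjE bexE exE) (rule that)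

lemma congruence_sym: "symmetric_matrix M \<Longrightarrow> symmetric_matrix (A ** M ** transpose A)"
  by (simp add: symmetric_matrix_def matrix_transpose_mul matrix_mul_assoc)

lemma transpose_inv:
  fixes A :: "'a::field ^ 'n ^ 'n"
  assumes "invertible A"
  shows "invertible (transpose A)" "matrix_inv (transpose A) = transpose (matrix_inv A)"
proof -
  have "transpose A ** transpose (matrix_inv A) = mat 1"
    by (simp add: matrix_transpose_mul[symmetric] matrix_inv_mult assms)
  then show "invertible (transpose A)" "matrix_inv (transpose A) = transpose (matrix_inv A)"
    by (auto dest: invertible_of_right_inverse)
qed

lemma congruence_cancel:
  fixes A M :: "'a::field ^ 'n ^ 'n"
  assumes "invertible A"
  shows "matrix_inv A ** (A ** M ** transpose A) ** transpose (matrix_inv A) = M"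
proof -
  have "matrix_inv A ** (A ** M ** transpose A) ** transpose (matrix_inv A) =
      (matrix_inv A ** A) ** M ** (transpose A ** transpose (matrix_inv A))"
    by (simp add: matrix_mul_assoc)
  then show ?thesis using assms
    by (simp add: matrix_inv_mult matrix_transpose_mul[symmetric])
qed

lemma matrix_mult_add_left:
  fixes A B C :: "'a::field ^ 'n ^ 'n"
  shows "(A + B) ** C = A ** C + B ** C"
  by (simp add: matrix_matrix_mult_def vec_eq_iff sum.distrib distrib_right)

lemma congruence_scale:
  fixes A M :: "'a::field ^ 'n ^ 'n"
  shows "A ** (mat c ** M) ** transpose A = mat c ** (A ** M ** transpose A)"
  by (simp add: matrix_mul_assoc scalar_matrix_commute[of A])

lemma rank_one_plane_congruence:
  fixes A :: "'a::field ^ 3 ^ 3"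
  assumes P: "rank_one_plane P" and A: "invertible A"
  shows "rank_one_plane (K_on_planes A P)"
proof -
  obtain S :: "'a ^ 3 \<Rightarrow> 'a ^ 3 ^ 3" where S: "P = range S" "\<forall>x y. S (x + y) = S x + S y"
    "\<forall>c x. S (c *s x) = mat c ** S x" "\<forall>x. S x = 0 \<longrightarrow> x = 0"
    by (rule rank_one_plane_param[OF P])
  obtain M c v where M: "M \<in> P" "M \<noteq> 0" "\<forall>i j. M $ i $ j = c * v $ i * v $ j"
    by (rule rank_one_plane_one[OF P])
  let ?T = "\<lambda>M. A ** M ** transpose A"
  have T0: "M = 0" if "?T M = 0" for M
    using congruence_cancel[OF A, of M] that by simp
  show ?thesis unfolding rank_one_plane_def
  proof (intro conjI exI[of _ "\<lambda>x. ?T (S x)"])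
    show "K_on_planes A P = range (\<lambda>x. ?T (S x))" by (auto simp: K_on_planes_def S(1))
    show "\<forall>x y. ?T (S (x + y)) = ?T (S x) + ?T (S y)"
      by (simp add: S(2) matrix_add_ldistrib matrix_mult_add_left)
    show "\<forall>c x. ?T (S (c *s x)) = mat c ** ?T (S x)"
      by (simp add: S(3) congruence_scale)
    show "\<forall>x. ?T (S x) = 0 \<longrightarrow> x = 0" using T0 S(4) by blast
    show "\<forall>M\<in>K_on_planes A P. symmetric_matrix M"
      using rank_one_plane_sym[OF P] congruence_sym by (auto simp: K_on_planes_def)
    show "\<exists>M\<in>K_on_planes A P. \<exists>c v. M \<noteq> 0 \<and> (\<forall>i j. M $ i $ j = c * v $ i * v $ j)"
    proof (intro bexI exI conjI allI)
      show "?T M \<in> K_on_planes A P" using M(1) by (auto simp: K_on_planes_def)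
      show "?T M \<noteq> 0" using M(2) T0 by blast
      show "?T M $ i $ j = c * (A *v v) $ i * (A *v v) $ j" for i j
        by (simp add: matrix_matrix_mult_def matrix_vector_mult_def transpose_def M(3)
            sum_distrib_left sum_distrib_right mult_ac, subst sum.swap, simp add: mult_ac)
    qed
  qed
qed

text \<open>
  Composing the parametrisation with \<open>qf\<close> gives an injective linear map, since in odd
  characteristic a symmetric matrix is determined by its form; this yields the dimension of
  the net.
\<close>

lemma rank_one_plane_imp_net:
  fixes P :: "('a::field ^ 3 ^ 3) set"
  assumes 2: "(2 :: 'a) \<noteq> 0" and P: "rank_one_plane P"
  shows "net_of_rank_one (qf ` P)"
proof -
  obtain S :: "'a ^ 3 \<Rightarrow> 'a ^ 3 ^ 3" where S: "P = range S" "\<forall>x y. S (x + y) = S x + S y"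
    "\<forall>c x. S (c *s x) = mat c ** S x" "\<forall>x. S x = 0 \<longrightarrow> x = 0"
    by (rule rank_one_plane_param[OF P])
  have sym: "symmetric_matrix M" if "M \<in> P" for M using P that by (rule rank_one_plane_sym)
  obtain M c v where M: "M \<in> P" "M \<noteq> 0" "\<forall>i j. M $ i $ j = c * v $ i * v $ j"
    by (rule rank_one_plane_one[OF P])
  have sym0: "symmetric_matrix (0 :: 'a ^ 3 ^ 3)"
    by (simp add: symmetric_matrix_def transpose_def vec_eq_iff)
  let ?g = "\<lambda>x. qf (S x)"
  have "module_hom (*s) form_scale ?g"
    by unfold_locales
       (auto simp: fun_eq_iff S(2,3) qf_add qf_scale form_scale_def algebra_simps)
  then interpret g: module_hom "(*s)" form_scale ?g .
  have "qf 0 = (\<lambda>x. 0)" by (simp add: qf_def fun_eq_iff)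
  have inj: "inj ?g"
  proof (rule injI)
    fix x y assume "?g x = ?g y"
    then have "?g (x - y) = 0" by (simp add: g.diff)
    then have "qf (S (x - y)) = qf 0" by (simp add: qf_def fun_eq_iff)
    then have "S (x - y) = 0"
      by (intro qf_inject[OF 2] sym0 sym) (simp_all add: S(1))
    then show "x = y" using S(4) by force
  qed
  have range: "qf ` P = range ?g" by (auto simp: S(1))
  have sub: "form_subspace (qf ` P)"
    unfolding range form_subspace_def by (rule g.subspace_image) (rule vec.subspace_UNIV)
  have "form.independent (?g ` cart_basis)"
    by (rule g.independent_injective_image[OF independent_cart_basis]) (use inj in simp)
  moreover have "form.span (?g ` cart_basis) = range ?g" by (simp add: g.span_image)
  moreover have "card (?g ` cart_basis) = 3"
    using card_image[OF inj_on_subset[OF inj subset_UNIV], of cart_basis]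
    by (simp add: card_cart_basis)
  ultimately have "form_dim (qf ` P) = 3"
    unfolding range by (metis form.dim_span_eq_card_independent)
  moreover have "repeated_line (qf M)"
    unfolding repeated_line_def
  proof (intro conjI exI allI)
    show "qf M \<noteq> 0"
    proof
      assume "qf M = 0"
      then have "qf M = qf 0" by (simp add: qf_def fun_eq_iff)
      then have "M = 0"
        by (intro qf_inject[OF 2] sym0 sym M(1))
      then show False using M(2) by simp
    qed
    show "linear_form (\<lambda>x. \<Sum>i\<in>UNIV. v $ i * x $ i)" unfolding linear_form_def by (rule exI[of _ "\<lambda>i. v $ i"]) simp
    show "qf M x = c * (\<Sum>i\<in>UNIV. v $ i * x $ i)\<^sup>2" for x
      by (simp add: qf_def M(3) power2_eq_square sum_distrib_left sum_distrib_right mult_ac)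
  qed
  ultimately show ?thesis using sub M(1)
    by (auto simp: net_of_rank_one_def net_of_conics_def quadratic_form_qf)
qed

lemma K_on_planes_mult: "K_on_planes (A ** B) P = K_on_planes A (K_on_planes B P)"
  by (simp add: K_on_planes_def image_image matrix_transpose_mul matrix_mul_assoc)

lemma K_on_planes_one [simp]: "K_on_planes (mat 1) P = P"
  by (simp add: K_on_planes_def)

lemma matrix_inv_product:
  fixes A B :: "'a::field ^ 'n ^ 'n"
  assumes "invertible A" "invertible B"
  shows "matrix_inv (A ** B) = matrix_inv B ** matrix_inv A"
proof (rule invertible_of_right_inverse(3))
  have "A ** B ** (matrix_inv B ** matrix_inv A) = A ** (B ** matrix_inv B) ** matrix_inv A"
    by (simp add: matrix_mul_assoc)
  then show "A ** B ** (matrix_inv B ** matrix_inv A) = mat 1"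
    using assms by (simp add: matrix_inv_mult)
qed

lemma matrix_inv_inv: "invertible (A :: 'a::field ^ 'n ^ 'n) \<Longrightarrow> matrix_inv (matrix_inv A) = A"
  by (rule invertible_of_right_inverse(3)) (simp add: matrix_inv_mult)

lemma rank_one_plane_scale:
  assumes "rank_one_plane P" "M \<in> P"
  shows "mat c ** M \<in> P"
proof -
  obtain S :: "'a ^ 3 \<Rightarrow> 'a ^ 3 ^ 3" where S: "P = range S" "\<forall>x y. S (x + y) = S x + S y"
    "\<forall>c x. S (c *s x) = mat c ** S x" "\<forall>x. S x = 0 \<longrightarrow> x = 0"
    by (rule rank_one_plane_param[OF assms(1)])
  obtain x where "M = S x" using assms(2) S(1) by blast
  then have "mat c ** M = S (c *s x)" using S(3) by simp
  then show ?thesis using S(1) by simp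
qed

lemma K_on_planes_scalar:
  fixes P :: "('a::field ^ 3 ^ 3) set"
  assumes P: "rank_one_plane P" and c: "c \<noteq> 0"
  shows "K_on_planes (mat c) P = P"
proof -
  have sub: "K_on_planes (mat d) P \<subseteq> P" for d
  proof
    fix M assume "M \<in> K_on_planes (mat d) P"
    then obtain M' where "M' \<in> P" "M = mat d ** M' ** mat d"
      by (auto simp: K_on_planes_def transpose_mat)
    then have "M = mat d ** (mat d ** M')" by (simp add: scalar_matrix_commute[of "mat d ** M'"])
    then show "M \<in> P" using P \<open>M' \<in> P\<close> by (simp add: rank_one_plane_scale)
  qed
  have "P = K_on_planes (mat c) (K_on_planes (mat (1 / c)) P)"
    using c by (simp add: K_on_planes_mult[symmetric] scalar_matrix_times_scalar)
  also have "\<dots> \<subseteq> K_on_planes (mat c) P"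
    unfolding K_on_planes_def[of "mat c"] by (intro image_mono sub)
  finally show ?thesis using sub[of c] by blast
qed

section \<open>Stabilisers of nets and stabilisers of planes\<close>

definition plane_stabiliser :: "('a::field ^ 3 ^ 3) set \<Rightarrow> ('a ^ 3 ^ 3) set" where
  "plane_stabiliser P = {A. invertible A \<and> K_on_planes A P = P}"

definition proj_plane_stabiliser :: "('a::field ^ 3 ^ 3) set \<Rightarrow> ('a ^ 3 ^ 3) set monoid" where
  "proj_plane_stabiliser P = PGL\<lparr>carrier := proj_class ` plane_stabiliser P\<rparr>"

lemma group_action_planes:
  "group_action (GL :: ('a::field ^ 3 ^ 3) monoid) UNIV K_on_planes"
proof -
  have bij: "bij (K_on_planes A)" if "invertible A" for A :: "'a ^ 3 ^ 3"
  proof (rule o_bij)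
    show "K_on_planes (matrix_inv A) \<circ> K_on_planes A = id"
      using that by (simp add: fun_eq_iff K_on_planes_mult[symmetric] matrix_inv_mult)
    show "K_on_planes A \<circ> K_on_planes (matrix_inv A) = id"
      using that by (simp add: fun_eq_iff K_on_planes_mult[symmetric] matrix_inv_mult)
  qed
  show ?thesis
    unfolding group_action_def group_hom_def group_hom_axioms_def
  proof (intro conjI group_GL group_BijGroup homI)
    fix A :: "'a ^ 3 ^ 3" assume "A \<in> carrier GL"
    then show "K_on_planes A \<in> carrier (BijGroup UNIV)"
      using bij by (simp add: BijGroup_def Bij_def)
  next
    fix A B :: "'a ^ 3 ^ 3" assume "A \<in> carrier GL" "B \<in> carrier GL"
    then show "K_on_planes (A \<otimes>\<^bsub>GL\<^esub> B) = K_on_planes A \<otimes>\<^bsub>BijGroup UNIV\<^esub> K_on_planes B"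
      using bij by (auto simp: BijGroup_def Bij_def compose_def fun_eq_iff K_on_planes_mult)
  qed
qed

lemma plane_stabiliser_eq: "plane_stabiliser P = stabilizer GL K_on_planes P"
  by (auto simp: plane_stabiliser_def stabilizer_def)

lemma subgroup_plane_stabiliser: "subgroup (plane_stabiliser P) GL"
  unfolding plane_stabiliser_eq
  by (rule group_action.stabilizer_subgroup[OF group_action_planes]) simp

lemma group_proj_plane_stabiliser: "group (proj_plane_stabiliser P)"
  unfolding proj_plane_stabiliser_def
  by (intro group.subgroup_imp_group[OF group_PGL]
      group_hom.subgroup_img_is_subgroup[OF group_hom_proj_class] subgroup_plane_stabiliser)

text \<open>
  The stabiliser of the plane in \<open>GL(3,q)\<close> contains the scalar matrices, and its quotient by
  them is the stabiliser in \<open>PGL(3,q)\<close>.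
\<close>

lemma card_K_orbit:
  fixes P :: "('a::{field,finite} ^ 3 ^ 3) set"
  assumes P: "rank_one_plane P"
  shows "card (K_orbit P) * (card (carrier (proj_plane_stabiliser P)) * (CARD('a) - 1)) =
    card {A :: 'a ^ 3 ^ 3. invertible A}"
proof -
  interpret GL: group "GL :: ('a ^ 3 ^ 3) monoid" by (rule group_GL)
  interpret S: group "GL\<lparr>carrier := plane_stabiliser P\<rparr>"
    by (rule GL.subgroup_imp_group[OF subgroup_plane_stabiliser])
  have sub: "scalar_matrices \<subseteq> plane_stabiliser P"
    using P by (auto simp: scalar_matrices_def plane_stabiliser_def scalar_matrix_inv K_on_planes_scalar)
  have "subgroup scalar_matrices (GL\<lparr>carrier := plane_stabiliser P\<rparr>)"
    using normal_imp_subgroup[OF scalar_matrices_normal] subgroup_plane_stabiliser sub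
    by (rule GL.subgroup_incl)
  then have "card (rcosets\<^bsub>GL\<lparr>carrier := plane_stabiliser P\<rparr>\<^esub> scalar_matrices) * card (scalar_matrices :: ('a ^ 3 ^ 3) set)
      = order (GL\<lparr>carrier := plane_stabiliser P\<rparr>)"
    by (intro S.lagrange) auto
  moreover have "rcosets\<^bsub>GL\<lparr>carrier := plane_stabiliser P\<rparr>\<^esub> scalar_matrices = proj_class ` plane_stabiliser P"
    by (auto simp: RCOSETS_def proj_class_eq_coset r_coset_def)
  ultimately have "card (plane_stabiliser P) = card (proj_class ` plane_stabiliser P) * (CARD('a) - 1)"
    by (simp add: card_scalar_matrices order_def)
  moreover have "card (K_orbit P) * card (plane_stabiliser P) = order (GL :: ('a ^ 3 ^ 3) monoid)"
    unfolding K_orbit_def plane_stabiliser_eq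
    by (rule group_action.orbit_stabilizer_theorem[OF group_action_planes]) simp
  ultimately show ?thesis by (simp add: order_def proj_plane_stabiliser_def GL_def)
qed

text \<open>
  The substitution of \<open>A\<^sup>-\<^sup>1\<close> in a form acts on its Gram matrix as congruence by this matrix.
\<close>

definition contragredient :: "'a::field ^ 3 ^ 3 \<Rightarrow> 'a ^ 3 ^ 3" where
  "contragredient A = transpose (matrix_inv A)"

lemma contragredient_invertible: "invertible A \<Longrightarrow> invertible (contragredient A)"
  by (simp add: contragredient_def transpose_inv invertible_matrix_inv)

lemma contragredient_mult:
  "invertible A \<Longrightarrow> invertible B \<Longrightarrow> contragredient (A ** B) = contragredient A ** contragredient B"
  by (simp add: contragredient_def matrix_inv_product matrix_transpose_mul)

lemma contragredient_involution: "invertible A \<Longrightarrow> contragredient (contragredient A) = A"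
  by (simp add: contragredient_def transpose_inv(2) invertible_matrix_inv matrix_inv_inv transpose_transpose)

lemma contragredient_scalar: "c \<noteq> 0 \<Longrightarrow> contragredient (mat c) = mat (inverse c)"
  by (simp add: contragredient_def scalar_matrix_inv transpose_mat)

lemma contragredient_scale:
  assumes "c \<noteq> 0" "invertible A"
  shows "contragredient (mat c ** A) = mat (inverse c) ** contragredient A"
  using assms by (simp add: contragredient_mult scalar_matrix_inv contragredient_scalar)

lemma GL_on_nets_qf: "GL_on_nets A (qf ` P) = qf ` K_on_planes (contragredient A) P"
proof -
  have "(\<lambda>x. qf M (matrix_inv A *v x)) = qf (contragredient A ** M ** transpose (contragredient A))" for M
    unfolding fun_eq_iff qf_congruence by (simp add: contragredient_def transpose_transpose)
  then show ?thesis by (simp add: GL_on_nets_def K_on_planes_def image_image)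
qed

lemma PGL_on_nets_qf:
  fixes P :: "('a::field ^ 3 ^ 3) set"
  assumes P: "rank_one_plane P" and A: "invertible A"
  shows "PGL_on_nets (proj_class A) (qf ` P) = qf ` K_on_planes (contragredient A) P"
proof -
  have "GL_on_nets (mat c ** A) (qf ` P) = qf ` K_on_planes (contragredient A) P" if "c \<noteq> 0" for c
  proof -
    have "K_on_planes (contragredient (mat c ** A)) P = K_on_planes (mat (inverse c)) (K_on_planes (contragredient A) P)"
      using that A by (simp add: contragredient_scale K_on_planes_mult)
    also have "\<dots> = K_on_planes (contragredient A) P"
      using that A P by (simp add: K_on_planes_scalar rank_one_plane_congruence contragredient_invertible)
    finally show ?thesis by (simp add: GL_on_nets_qf)
  qed
  then have "(\<lambda>A. GL_on_nets A (qf ` P)) ` proj_class A = {qf ` K_on_planes (contragredient A) P}"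
    using proj_class_self[of A] by (auto simp: proj_class_def intro: exI[of _ "1::'a"])
  then show ?thesis by (simp add: PGL_on_nets_def)
qed

lemma net_stabiliser_qf:
  fixes P :: "('a::field ^ 3 ^ 3) set"
  assumes 2: "(2 :: 'a) \<noteq> 0" and P: "rank_one_plane P"
  shows "net_stabiliser (qf ` P) =
    PGL\<lparr>carrier := proj_class ` {A. invertible A \<and> K_on_planes (contragredient A) P = P}\<rparr>"
proof -
  have eq: "qf ` K_on_planes (contragredient A) P = qf ` P \<longleftrightarrow> K_on_planes (contragredient A) P = P"
    if "invertible A" for A
  proof
    assume *: "qf ` K_on_planes (contragredient A) P = qf ` P"
    have P': "rank_one_plane (K_on_planes (contragredient A) P)"
      using P that by (simp add: rank_one_plane_congruence contragredient_invertible)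
    have "plane_of_net (qf ` K_on_planes (contragredient A) P) = K_on_planes (contragredient A) P"
      by (rule gram_image_qf[OF 2 rank_one_plane_sym[OF P']])
    moreover have "plane_of_net (qf ` P) = P"
      by (rule gram_image_qf[OF 2 rank_one_plane_sym[OF P]])
    ultimately show "K_on_planes (contragredient A) P = P" using * by simp
  qed simp
  have "stabilizer PGL PGL_on_nets (qf ` P) =
      proj_class ` {A. invertible A \<and> K_on_planes (contragredient A) P = P}"
    using eq by (auto simp: stabilizer_def PGL_simps(1) PGL_on_nets_qf P)
  then show ?thesis by (simp add: net_stabiliser_def)
qed

text \<open>
  An element \<open>C\<close> of the stabiliser of \<open>P\<close> corresponds to the conjugate \<open>BCB\<^sup>-\<^sup>1\<close> in the
  stabiliser of the congruent plane, and this in turn to its inverse transpose, which acts on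
  forms as the conjugate acts on Gram matrices. The map is multiplicative and sends scalar
  multiples to scalar multiples, hence descends to classes modulo scalars.
\<close>

lemma net_stabiliser_iso:
  fixes P :: "('a::field ^ 3 ^ 3) set"
  assumes 2: "(2 :: 'a) \<noteq> 0" and P: "rank_one_plane P" and B: "invertible B"
  shows "proj_plane_stabiliser P \<cong> net_stabiliser (qf ` K_on_planes B P)"
proof -
  define f where "f C = contragredient (B ** C ** matrix_inv B)" for C
  have BB: "matrix_inv B ** B = mat 1" "B ** matrix_inv B = mat 1" and iB: "invertible (matrix_inv B)"
    using B by (auto simp: matrix_inv_mult invertible_matrix_inv)
  have f_inv: "invertible (f C)" if "invertible C" for C
    using that B iB by (simp add: f_def contragredient_invertible invertible_mult)
  have f_mult: "f (C ** D) = f C ** f D" if "invertible C" "invertible D" for C D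
  proof -
    have "B ** (C ** D) ** matrix_inv B = B ** C ** (matrix_inv B ** B) ** D ** matrix_inv B"
      by (simp add: BB matrix_mul_assoc)
    also have "\<dots> = (B ** C ** matrix_inv B) ** (B ** D ** matrix_inv B)" by (simp add: matrix_mul_assoc)
    finally show ?thesis using that B iB by (simp add: f_def contragredient_mult invertible_mult)
  qed
  have f_scale: "f (mat c ** C) = mat (inverse c) ** f C" if "c \<noteq> 0" "invertible C" for c C
  proof -
    have "B ** (mat c ** C) ** matrix_inv B = mat c ** (B ** C ** matrix_inv B)"
      by (simp add: scalar_matrix_move matrix_mul_assoc[symmetric])
    then show ?thesis using that B iB by (simp add: f_def contragredient_scale invertible_mult)
  qed
  have f_contra: "contragredient (f C) = B ** C ** matrix_inv B" if "invertible C" for C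
    using that B iB by (simp add: f_def contragredient_involution invertible_mult)
  have f_inj: "C = D" if "f C = f D" "invertible C" "invertible D" for C D
  proof -
    have "B ** C ** matrix_inv B = B ** D ** matrix_inv B" using that f_contra by metis
    then have "matrix_inv B ** (B ** C ** matrix_inv B) ** B = matrix_inv B ** (B ** D ** matrix_inv B) ** B" by simp
    moreover have "matrix_inv B ** (B ** E ** matrix_inv B) ** B = (matrix_inv B ** B) ** E ** (matrix_inv B ** B)" for E
      by (simp add: matrix_mul_assoc)
    ultimately show ?thesis by (simp add: BB)
  qed
  have f_stab: "f ` plane_stabiliser P = {A. invertible A \<and> K_on_planes (contragredient A) (K_on_planes B P) = K_on_planes B P}"
    (is "_ = ?R")
  proof
    show "f ` plane_stabiliser P \<subseteq> ?R"
    proof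
      fix A assume "A \<in> f ` plane_stabiliser P"
      then obtain C where C: "invertible C" "K_on_planes C P = P" "A = f C"
        by (auto simp: plane_stabiliser_def)
      have "B ** C ** matrix_inv B ** B = B ** C" by (simp add: matrix_mul_assoc[symmetric] BB)
      then have "K_on_planes (contragredient A) (K_on_planes B P) = K_on_planes (B ** C) P"
        by (simp add: C(1,3) f_contra K_on_planes_mult[symmetric])
      also have "\<dots> = K_on_planes B P" by (simp add: K_on_planes_mult C(2))
      finally have "K_on_planes (contragredient A) (K_on_planes B P) = K_on_planes B P" .
      then show "A \<in> ?R" using C f_inv by simp
    qed
    show "?R \<subseteq> f ` plane_stabiliser P"
    proof
      fix A assume A: "A \<in> ?R"
      define C where "C = matrix_inv B ** contragredient A ** B"
      have iC: "invertible C" using A B iB by (simp add: C_def contragredient_invertible invertible_mult)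
      have "B ** C ** matrix_inv B = (B ** matrix_inv B) ** contragredient A ** (B ** matrix_inv B)"
        by (simp add: C_def matrix_mul_assoc)
      then have "f C = A" using A by (simp add: f_def BB contragredient_involution)
      moreover have "K_on_planes C P = P"
      proof -
        have "K_on_planes C P = K_on_planes (matrix_inv B) (K_on_planes (contragredient A) (K_on_planes B P))"
          by (simp add: C_def K_on_planes_mult)
        also have "\<dots> = K_on_planes (matrix_inv B ** B) P" using A by (simp add: K_on_planes_mult)
        finally show ?thesis by (simp add: BB)
      qed
      ultimately show "A \<in> f ` plane_stabiliser P" using iC by (auto simp: plane_stabiliser_def)
    qed
  qed
  have f_class: "f ` proj_class C = proj_class (f C)" if C: "invertible C" for C
  proof
    show "f ` proj_class C \<subseteq> proj_class (f C)"
    proof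
      fix D assume "D \<in> f ` proj_class C"
      then obtain c where "c \<noteq> 0" "D = f (mat c ** C)" by (auto simp: proj_class_def)
      then have "D = mat (inverse c) ** f C" "inverse c \<noteq> 0" using f_scale C by auto
      then show "D \<in> proj_class (f C)" unfolding proj_class_def by blast
    qed
    show "proj_class (f C) \<subseteq> f ` proj_class C"
    proof
      fix D assume "D \<in> proj_class (f C)"
      then obtain c where c: "c \<noteq> 0" "D = mat c ** f C" by (auto simp: proj_class_def)
      then have "D = f (mat (inverse c) ** C)" using f_scale[of "inverse c" C] C by simp
      moreover have "mat (inverse c) ** C \<in> proj_class C" using c(1) unfolding proj_class_def by auto
      ultimately show "D \<in> f ` proj_class C" by blast
    qed
  qed
  have inv: "invertible C" if "C \<in> plane_stabiliser P" for C using that by (simp add: plane_stabiliser_def)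
  have "image f \<in> iso (proj_plane_stabiliser P) (net_stabiliser (qf ` K_on_planes B P))"
    unfolding iso_def
  proof (intro CollectI conjI homI)
    have carr: "carrier (net_stabiliser (qf ` K_on_planes B P)) = proj_class ` f ` plane_stabiliser P"
      using net_stabiliser_qf[OF 2 rank_one_plane_congruence[OF P B]] f_stab by simp
    have mult: "(\<otimes>\<^bsub>net_stabiliser (qf ` K_on_planes B P)\<^esub>) = (\<otimes>\<^bsub>PGL\<^esub>)" by (simp add: net_stabiliser_def)
    show "f ` C \<in> carrier (net_stabiliser (qf ` K_on_planes B P))" if "C \<in> carrier (proj_plane_stabiliser P)" for C
    proof -
      obtain D where "D \<in> plane_stabiliser P" "C = proj_class D"
        using \<open>C \<in> _\<close> by (auto simp: proj_plane_stabiliser_def)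
      then show ?thesis using f_class[of D] inv by (simp add: carr)
    qed
    fix C C' assume "C \<in> carrier (proj_plane_stabiliser P)" "C' \<in> carrier (proj_plane_stabiliser P)"
    then obtain D D' where D: "D \<in> plane_stabiliser P" "C = proj_class D" "D' \<in> plane_stabiliser P" "C' = proj_class D'"
      by (auto simp: proj_plane_stabiliser_def)
    then show "f ` (C \<otimes>\<^bsub>proj_plane_stabiliser P\<^esub> C') = f ` C \<otimes>\<^bsub>net_stabiliser (qf ` K_on_planes B P)\<^esub> f ` C'"
      using inv by (simp add: proj_plane_stabiliser_def mult proj_class_mult f_class f_inv f_mult invertible_mult)
  next
    have carr: "carrier (net_stabiliser (qf ` K_on_planes B P)) = proj_class ` f ` plane_stabiliser P"
      using net_stabiliser_qf[OF 2 rank_one_plane_congruence[OF P B]] f_stab by simp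
    have "inj_on (image f) (proj_class ` plane_stabiliser P)"
    proof (rule inj_onI, elim imageE)
      fix C D C' D' assume C: "f ` C' = f ` D'" "C' = proj_class C" "D' = proj_class D"
        "C \<in> plane_stabiliser P" "D \<in> plane_stabiliser P"
      then have iC: "invertible C" "invertible D" using inv by auto
      then have "proj_class (f C) = proj_class (f D)" using C f_class by simp
      then obtain c where c: "c \<noteq> 0" "f C = mat c ** f D" by (auto simp: proj_class_eq_iff)
      then have "f C = f (mat (inverse c) ** D)" using f_scale[of "inverse c" D] iC by simp
      from this iC(1) have "C = mat (inverse c) ** D"
        by (rule f_inj) (use iC c(1) in \<open>simp add: invertible_mult scalar_matrix_inv\<close>)
      moreover have "inverse c \<noteq> 0" using c(1) by simp
      ultimately have "proj_class C = proj_class D" unfolding proj_class_eq_iff by blast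
      then show "C' = D'" using C by simp
    qed
    moreover have "image f ` proj_class ` plane_stabiliser P = proj_class ` f ` plane_stabiliser P"
      unfolding image_image by (intro image_cong refl f_class inv)
    ultimately show "bij_betw (image f) (carrier (proj_plane_stabiliser P)) (carrier (net_stabiliser (qf ` K_on_planes B P)))"
      by (simp add: bij_betw_def carr proj_plane_stabiliser_def)
  qed
  then show ?thesis by (rule is_isoI)
qed

lemma group_net_stabiliser_qf:
  fixes P :: "('a::{field,finite} ^ 3 ^ 3) set"
  assumes 2: "(2 :: 'a) \<noteq> 0" and P: "rank_one_plane P"
  shows "group (net_stabiliser (qf ` P))"
proof -
  have "contragredient (mat 1 :: 'a ^ 3 ^ 3) = mat 1" by (simp add: contragredient_scalar)
  then have "subgroup {A. invertible A \<and> K_on_planes (contragredient A) P = P} GL"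
    by (intro finite_closed_subgroup[OF group_GL])
       (auto simp: contragredient_mult K_on_planes_mult invertible_mult intro: exI[of _ "mat 1"])
  then show ?thesis
    unfolding net_stabiliser_qf[OF assms]
    by (intro group.subgroup_imp_group[OF group_PGL]
        group_hom.subgroup_img_is_subgroup[OF group_hom_proj_class])
qed

lemma nets_of_type_eq:
  fixes P :: "('a::field ^ 3 ^ 3) set"
  assumes 2: "(2 :: 'a) \<noteq> 0" and P: "rank_one_plane P"
  shows "nets_of_type P = (\<lambda>P'. qf ` P') ` K_orbit P"
proof
  show "nets_of_type P \<subseteq> (\<lambda>P'. qf ` P') ` K_orbit P"
  proof
    fix N assume N: "N \<in> nets_of_type P"
    then have "qf ` plane_of_net N = N"
      by (intro qf_image_gram[OF 2]) (auto simp: nets_of_type_def net_of_rank_one_def net_of_conics_def)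
    then show "N \<in> (\<lambda>P'. qf ` P') ` K_orbit P" using N by (auto simp: nets_of_type_def)
  qed
  show "(\<lambda>P'. qf ` P') ` K_orbit P \<subseteq> nets_of_type P"
  proof (rule image_subsetI)
    fix P' assume P': "P' \<in> K_orbit P"
    then have r: "rank_one_plane P'" using P by (auto simp: K_orbit_def orbit_def rank_one_plane_congruence)
    have "plane_of_net (qf ` P') = P'" by (rule gram_image_qf[OF 2 rank_one_plane_sym[OF r]])
    then show "qf ` P' \<in> nets_of_type P"
      using P' rank_one_plane_imp_net[OF 2 r] by (simp add: nets_of_type_def)
  qed
qed

lemma card_nets_of_type:
  fixes P :: "('a::field ^ 3 ^ 3) set"
  assumes 2: "(2 :: 'a) \<noteq> 0" and P: "rank_one_plane P"
  shows "card (nets_of_type P) = card (K_orbit P)"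
  unfolding nets_of_type_eq[OF assms]
proof (intro card_image inj_onI)
  fix P' P'' assume *: "P' \<in> K_orbit P" "P'' \<in> K_orbit P" "qf ` P' = qf ` P''"
  then have r: "rank_one_plane P'" "rank_one_plane P''" using P by (auto simp: K_orbit_def orbit_def rank_one_plane_congruence)
  have "P' = plane_of_net (qf ` P')" by (rule gram_image_qf[OF 2 rank_one_plane_sym[OF r(1)], symmetric])
  also have "\<dots> = plane_of_net (qf ` P'')" by (rule arg_cong[OF *(3)])
  also have "\<dots> = P''" by (rule gram_image_qf[OF 2 rank_one_plane_sym[OF r(2)]])
  finally show "P' = P''" .
qed

section \<open>From one plane stabiliser to types and numbers\<close>

text \<open>
  By finiteness, mapping the plane into itself is the same as stabilising it.
\<close>

lemma plane_stabiliserI: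
  fixes P :: "('a::{field,finite} ^ 3 ^ 3) set"
  assumes A: "invertible A" and pres: "\<And>M. M \<in> P \<Longrightarrow> A ** M ** transpose A \<in> P"
  shows "A \<in> plane_stabiliser P"
proof -
  have "K_on_planes A P \<subseteq> P" using pres by (auto simp: K_on_planes_def)
  moreover have "inj_on (\<lambda>M. A ** M ** transpose A) P"
    by (rule inj_on_inverseI) (rule congruence_cancel[OF A])
  then have "card (K_on_planes A P) = card P" unfolding K_on_planes_def by (rule card_image)
  ultimately have "K_on_planes A P = P" by (intro card_subset_eq) auto
  then show ?thesis using A by (simp add: plane_stabiliser_def)
qed

lemma plane_stabiliserD:
  "A \<in> plane_stabiliser P \<Longrightarrow> invertible A" "A \<in> plane_stabiliser P \<Longrightarrow> M \<in> P \<Longrightarrow> A ** M ** transpose A \<in> P"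
  by (auto simp: plane_stabiliser_def K_on_planes_def)

definition order_PGL3 :: "nat \<Rightarrow> real" where
  "order_PGL3 q = real q^3 * (real q^3 - 1) * (real q^2 - 1)"

lemma card_GL3_PGL3:
  "real (card {A :: 'a::{field,finite} ^ 3 ^ 3. invertible A}) = order_PGL3 CARD('a) * (real CARD('a) - 1)"
proof -
  have q: "CARD('a) \<ge> 1" by (simp add: Suc_leI)
  then have le: "CARD('a)^3 \<ge> 1" "CARD('a)^3 \<ge> CARD('a)" "CARD('a)^3 \<ge> CARD('a)^2"
    by (auto simp: power_increasing self_le_power)
  have "real (card {A :: 'a ^ 3 ^ 3. invertible A}) =
      (real CARD('a)^3 - 1) * (real CARD('a)^3 - real CARD('a)) * (real CARD('a)^3 - real CARD('a)^2)"
    unfolding card_GL3 by (simp only: of_nat_mult of_nat_diff[OF le(1)] of_nat_diff[OF le(2)]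
        of_nat_diff[OF le(3)] of_nat_power of_nat_1)
  then show ?thesis unfolding order_PGL3_def
    by (simp add: algebra_simps power2_eq_square power3_eq_cube)
qed

text \<open>
  All nets of the type have isomorphic stabilisers, because each comes from a plane congruent
  to \<open>P\<close>; their number is the index of the plane stabiliser. The group \<open>R\<close> is any convenient
  isomorphic copy of the stabiliser on a type of its own.
\<close>

lemma stabiliser_and_number_PGL:
  fixes P :: "('a::{field,finite} ^ 3 ^ 3) set" and R :: "'r monoid"
  assumes odd: "odd CARD('a)" and P: "rank_one_plane P"
    and R: "group R" "R \<cong> proj_plane_stabiliser P" "finite (carrier R)"
    and T: "T R" "iso_transfer T T'"
    and m: "m * real (card (carrier R)) = order_PGL3 CARD('a)"
  shows "stabiliser_and_number P T' m"
  unfolding stabiliser_and_number_def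
proof (intro conjI ballI)
  have 2: "(2 :: 'a) \<noteq> 0" using odd by (rule two_neq_0_if_odd_card)
  have card_R: "card (carrier R) = card (carrier (proj_plane_stabiliser P))"
    using R(2) by (rule iso_same_card)
  have pos: "card (carrier R) > 0"
    using R(1,3) group.is_monoid[OF R(1)] monoid.one_closed by (fastforce simp: card_gt_0_iff)
  note m = m[unfolded card_R] and pos = pos[unfolded card_R]
  show "T' (net_stabiliser N)" if N: "N \<in> nets_of_type P" for N
  proof -
    obtain B where B: "invertible B" "N = qf ` K_on_planes B P"
      using N unfolding nets_of_type_eq[OF 2 P] by (auto simp: K_orbit_def orbit_def)
    have "group (net_stabiliser N)"
      unfolding B(2) by (rule group_net_stabiliser_qf[OF 2 rank_one_plane_congruence[OF P B(1)]])
    moreover have "R \<cong> net_stabiliser N"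
      unfolding B(2) using R(2) net_stabiliser_iso[OF 2 P B(1)] by (rule iso_trans)
    ultimately show ?thesis using iso_transferD[OF T(2) R(1)] T(1) by blast
  qed
  have q: "real CARD('a) - 1 \<noteq> 0"
  proof -
    have "card {0::'a, 1} \<le> CARD('a)" by (rule card_mono) auto
    then show ?thesis by simp
  qed
  have "real (card (K_orbit P)) * (real (card (carrier (proj_plane_stabiliser P))) * (real CARD('a) - 1)) =
      order_PGL3 CARD('a) * (real CARD('a) - 1)"
    using arg_cong[OF card_K_orbit[OF P], of real] unfolding card_GL3_PGL3 by (simp add: of_nat_diff Suc_leI)
  then have "real (card (K_orbit P)) * real (card (carrier (proj_plane_stabiliser P))) = order_PGL3 CARD('a)"
    using q by simp
  then have "real (card (K_orbit P)) = m" using m pos by (metis mult_right_cancel of_nat_0_less_iff less_irrefl)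
  then show "real (card (nets_of_type P)) = m" by (simp add: card_nets_of_type[OF 2 P])
qed

text \<open>
  If every stabilising matrix is a scalar multiple of a unique matrix in the group \<open>H\<close>, then
  the projection to classes modulo scalars restricts to an isomorphism from \<open>H\<close> to the
  stabiliser.
\<close>

lemma stabiliser_and_number_complement:
  fixes P H :: "('a::{field,finite} ^ 3 ^ 3) set"
  assumes odd: "odd CARD('a)" and P: "rank_one_plane P"
    and H: "H \<noteq> {}" "\<And>h. h \<in> H \<Longrightarrow> invertible h" "\<And>h k. h \<in> H \<Longrightarrow> k \<in> H \<Longrightarrow> h ** k \<in> H"
    and pres: "\<And>h M. h \<in> H \<Longrightarrow> M \<in> P \<Longrightarrow> h ** M ** transpose h \<in> P"
    and compl: "\<And>A. invertible A \<Longrightarrow> (\<And>M. M \<in> P \<Longrightarrow> A ** M ** transpose A \<in> P) \<Longrightarrow>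
      \<exists>c. \<exists>h\<in>H. c \<noteq> 0 \<and> A = mat c ** h"
    and uniq: "\<And>c h. h \<in> H \<Longrightarrow> mat c ** h \<in> H \<Longrightarrow> c = 1"
    and T: "T (GL\<lparr>carrier := H\<rparr>)" "iso_transfer T T'"
    and m: "m * real (card H) = order_PGL3 CARD('a)"
  shows "stabiliser_and_number P T' m"
proof (rule stabiliser_and_number_PGL[OF odd P _ _ _ T])
  have "subgroup H GL"
    by (rule finite_closed_subgroup[OF group_GL]) (use H in auto)
  then show "group (GL\<lparr>carrier := H\<rparr>)" by (rule group.subgroup_imp_group[OF group_GL])
  have stab: "h \<in> plane_stabiliser P" if "h \<in> H" for h
    using H(2)[OF that] pres[OF that] by (rule plane_stabiliserI)
  show "GL\<lparr>carrier := H\<rparr> \<cong> proj_plane_stabiliser P"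
  proof (rule is_isoI, unfold iso_iff, intro conjI)
    show "proj_class \<in> hom (GL\<lparr>carrier := H\<rparr>) (proj_plane_stabiliser P)"
      using H stab by (auto simp: hom_def proj_plane_stabiliser_def proj_class_mult)
    show "inj_on proj_class (carrier (GL\<lparr>carrier := H\<rparr>))"
    proof (rule inj_onI)
      fix h k assume "h \<in> carrier (GL\<lparr>carrier := H\<rparr>)" "k \<in> carrier (GL\<lparr>carrier := H\<rparr>)"
        "proj_class h = proj_class k"
      then obtain c where "h = mat c ** k" "h \<in> H" "k \<in> H" by (auto simp: proj_class_eq_iff)
      moreover from this have "c = 1" using uniq by blast
      ultimately show "h = k" by simp
    qed
    show "proj_class ` carrier (GL\<lparr>carrier := H\<rparr>) = carrier (proj_plane_stabiliser P)"
    proof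
      show "carrier (proj_plane_stabiliser P) \<subseteq> proj_class ` carrier (GL\<lparr>carrier := H\<rparr>)"
      proof
        fix C assume "C \<in> carrier (proj_plane_stabiliser P)"
        then obtain A where A: "C = proj_class A" "invertible A" "K_on_planes A P = P"
          by (auto simp: proj_plane_stabiliser_def plane_stabiliser_def)
        have "A ** M ** transpose A \<in> P" if "M \<in> P" for M
          using A(3) that by (auto simp: K_on_planes_def)
        from compl[OF A(2) this] obtain c h where "c \<noteq> 0" "h \<in> H" "A = mat c ** h" by blast
        then have "C = proj_class h" by (auto simp: A proj_class_eq_iff)
        then show "C \<in> proj_class ` carrier (GL\<lparr>carrier := H\<rparr>)" using \<open>h \<in> H\<close> by simp
      qed
    qed (use stab in \<open>auto simp: proj_plane_stabiliser_def\<close>)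
  qed
  show "m * real (card (carrier (GL\<lparr>carrier := H\<rparr>))) = order_PGL3 CARD('a)" using m by simp
qed simp

text \<open>
  The orbit, and with it the set of nets of the type, does not depend on the representative; a
  better one can be chosen.
\<close>

lemma stabiliser_and_number_congruent:
  assumes "stabiliser_and_number P T m" "invertible C" "K_on_planes C P = P'"
  shows "stabiliser_and_number P' T m"
proof -
  have "K_orbit P' = K_orbit P"
  proof
    show "K_orbit P' \<subseteq> K_orbit P"
    proof
      fix Q assume "Q \<in> K_orbit P'"
      then obtain A where "invertible A" "Q = K_on_planes (A ** C) P"
        by (auto simp: K_orbit_def orbit_def assms(3)[symmetric] K_on_planes_mult)
      then show "Q \<in> K_orbit P" using assms(2) by (auto simp: K_orbit_def orbit_def invertible_mult)
    qed
    show "K_orbit P \<subseteq> K_orbit P'"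
    proof
      fix Q assume "Q \<in> K_orbit P"
      then obtain A where A: "invertible A" "Q = K_on_planes A P"
        by (auto simp: K_orbit_def orbit_def)
      have "A ** matrix_inv C ** C = A"
        using assms(2) by (simp add: matrix_mul_assoc[symmetric] matrix_inv_mult)
      then have "Q = K_on_planes (A ** matrix_inv C) P'"
        by (simp add: A assms(3)[symmetric] K_on_planes_mult[symmetric])
      moreover have "invertible (A ** matrix_inv C)"
        using A assms(2) by (simp add: invertible_mult invertible_matrix_inv)
      ultimately show "Q \<in> K_orbit P'" by (auto simp: K_orbit_def orbit_def)
    qed
  qed
  then show ?thesis using assms(1) by (simp add: stabiliser_and_number_def nets_of_type_def)
qed

lemma m3_add: "m3 a b c d e f g h i + m3 a' b' c' d' e' f' g' h' i' =
    m3 (a + a') (b + b') (c + c') (d + d') (e + e') (f + f') (g + g') (h + h') (i + i')"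
  by (simp add: matrix3_eq_iff)

lemma m3_eq_0_iff: "m3 a b c d e f g h i = 0 \<longleftrightarrow>
    a = 0 \<and> b = 0 \<and> c = 0 \<and> d = 0 \<and> e = 0 \<and> f = 0 \<and> g = 0 \<and> h = 0 \<and> i = 0"
  by (simp add: matrix3_eq_iff)

text \<open>
  The matrix of rank one is exhibited as the product of a column \<open>(x, y, z)\<close> with its
  transpose.
\<close>

lemma rank_one_planeI3:
  fixes S :: "'a::field \<Rightarrow> 'a \<Rightarrow> 'a \<Rightarrow> 'a ^ 3 ^ 3"
  assumes P: "P = {S \<alpha> \<beta> \<gamma> | \<alpha> \<beta> \<gamma>. True}"
    and add: "\<And>a b c a' b' c'. S (a + a') (b + b') (c + c') = S a b c + S a' b' c'"
    and scale: "\<And>k a b c. S (k * a) (k * b) (k * c) = mat k ** S a b c"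
    and inj: "\<And>a b c. S a b c = 0 \<Longrightarrow> a = 0 \<and> b = 0 \<and> c = 0"
    and sym: "\<And>a b c. transpose (S a b c) = S a b c"
    and one: "S a b c = m3 (x * x) (x * y) (x * z) (y * x) (y * y) (y * z) (z * x) (z * y) (z * z)"
      "x \<noteq> 0 \<or> y \<noteq> 0 \<or> z \<noteq> 0"
  shows "rank_one_plane P"
proof (rule rank_one_planeI[OF P add scale inj sym])
  show "S a b c \<noteq> 0" unfolding one(1) m3_eq_0_iff using one(2) by auto
  have "\<forall>i j. S a b c $ i $ j = 1 * vector [x, y, z] $ i * vector [x, y, z] $ j"
    unfolding one(1) by (simp add: forall_3)
  then show "\<And>i j. S a b c $ i $ j = 1 * vector [x, y, z] $ i * vector [x, y, z] $ j" by blast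
qed

section \<open>Groups of order two and three, signs, and squares\<close>

lemma cyclic_groupI:
  assumes "group G" "a \<in> carrier G" "\<And>x. x \<in> carrier G \<Longrightarrow> \<exists>n::nat. x = a [^]\<^bsub>G\<^esub> n"
  shows "cyclic_group G"
proof -
  interpret group G by fact
  have "carrier G = range (\<lambda>n::int. a [^]\<^bsub>G\<^esub> n)"
  proof
    show "carrier G \<subseteq> range (\<lambda>n::int. a [^]\<^bsub>G\<^esub> n)"
    proof
      fix x assume "x \<in> carrier G"
      then obtain n :: nat where "x = a [^]\<^bsub>G\<^esub> n" using assms(3) by blast
      then have "x = a [^]\<^bsub>G\<^esub> int n" by (simp add: int_pow_int)
      then show "x \<in> range (\<lambda>n::int. a [^]\<^bsub>G\<^esub> n)" by blast
    qed
  qed (use assms(2) int_pow_closed in blast)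
  then show ?thesis using assms(2) cyclic_group by blast
qed

lemma cyclic_of_order_2I:
  assumes "group G" "carrier G = {\<one>\<^bsub>G\<^esub>, a}" "a \<noteq> \<one>\<^bsub>G\<^esub>"
  shows "cyclic_of_order 2 G"
proof -
  interpret group G by fact
  have "cyclic_group G"
  proof (rule cyclic_groupI[OF assms(1), of a])
    fix x assume "x \<in> carrier G"
    then have "x = a [^]\<^bsub>G\<^esub> (0::nat) \<or> x = a [^]\<^bsub>G\<^esub> (1::nat)" using assms(2) by auto
    then show "\<exists>n::nat. x = a [^]\<^bsub>G\<^esub> n" by blast
  qed (simp add: assms(2))
  moreover have "card (carrier G) = 2" using assms(2,3) by simp
  ultimately show ?thesis using assms(1) by (simp add: cyclic_of_order_def order_def)
qed

lemma cyclic_of_order_3I: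
  assumes "group G" "carrier G = {\<one>\<^bsub>G\<^esub>, a, a \<otimes>\<^bsub>G\<^esub> a}" "card (carrier G) = 3"
  shows "cyclic_of_order 3 G"
proof -
  interpret group G by fact
  have a: "a \<in> carrier G" unfolding assms(2) by simp
  have pow: "\<one>\<^bsub>G\<^esub> = a [^]\<^bsub>G\<^esub> (0::nat)" "a = a [^]\<^bsub>G\<^esub> (1::nat)" "a \<otimes>\<^bsub>G\<^esub> a = a [^]\<^bsub>G\<^esub> (2::nat)"
    using a by (simp_all add: numeral_2_eq_2)
  have "cyclic_group G"
  proof (rule cyclic_groupI[OF assms(1) a])
    fix x assume "x \<in> carrier G"
    then have "x = \<one>\<^bsub>G\<^esub> \<or> x = a \<or> x = a \<otimes>\<^bsub>G\<^esub> a" unfolding assms(2) by simp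
    then show "\<exists>n::nat. x = a [^]\<^bsub>G\<^esub> n" using pow by metis
  qed
  then show ?thesis using assms(1,3) by (simp add: cyclic_of_order_def order_def)
qed

definition sign_group :: "'a::field monoid" where
  "sign_group = \<lparr>carrier = {1, -1}, mult = (*), one = 1\<rparr>"

lemma sign_group_simps [simp]:
  "carrier (sign_group :: 'a::field monoid) = {1, -1}"
  "(x::'a) \<otimes>\<^bsub>sign_group\<^esub> y = x * y" "\<one>\<^bsub>sign_group\<^esub> = (1::'a)"
  by (simp_all add: sign_group_def)

lemma group_sign: "group (sign_group :: 'a::field monoid)"
  by (rule groupI) auto

lemma cyclic_sign_group: "(2 :: 'a::field) \<noteq> 0 \<Longrightarrow> cyclic_of_order 2 (sign_group :: 'a monoid)"
  by (rule cyclic_of_order_2I[OF group_sign, of "-1"]) (auto simp: eq_neg_iff_add_eq_0)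

abbreviation subgroup_GL :: "('a::field ^ 'n ^ 'n) set \<Rightarrow> ('a ^ 'n ^ 'n) monoid" where
  "subgroup_GL H \<equiv> GL\<lparr>carrier := H\<rparr>"

lemma group_subgroup_GL:
  fixes H :: "('a::{field,finite} ^ 'n ^ 'n) set"
  assumes "H \<noteq> {}" "\<And>h. h \<in> H \<Longrightarrow> invertible h" "\<And>h k. h \<in> H \<Longrightarrow> k \<in> H \<Longrightarrow> h ** k \<in> H"
  shows "group (subgroup_GL H)"
  by (rule group.subgroup_imp_group[OF group_GL finite_closed_subgroup[OF group_GL]])
     (use assms in auto)

lemma squared_additive:
  "squared (elementary_abelian CARD('a)) ((additive_group :: 'a::{field,finite} monoid) \<times>\<times> (additive_group :: 'a monoid))"
  by (rule squaredI[OF DirProd_group[OF group_additive group_additive] group_additive iso_refl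
        elementary_abelian_additive iso_transfer_basic(1)])

lemma squared_unit_group:
  "squared (cyclic_of_order (CARD('a) - 1)) ((unit_group :: 'a::{field,finite} monoid) \<times>\<times> (unit_group :: 'a monoid))"
  by (rule squaredI[OF DirProd_group[OF group_unit group_unit] group_unit iso_refl
        cyclic_unit_group iso_transfer_basic(2)])

lemma iso_transfer_squares:
  "iso_transfer (squared (elementary_abelian n)) (squared (elementary_abelian n))"
  "iso_transfer (squared (cyclic_of_order n)) (squared (cyclic_of_order n))"
  by (intro iso_transfer_squared iso_transfer_basic; erule elementary_abelian_group cyclic_of_order_group)+

section \<open>Groups with centre \<open>E\<^sub>q\<close> and quotient \<open>E\<^sub>q\<^sup>2\<close>\<close>

text \<open>
  The predicate \<open>E_1_plus_2\<close> describes the quotient by the centre on the type of cosets. Here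
  the quotient is described by a homomorphism onto pairs of field elements whose kernel is the
  centre, which can be written down for matrices and composed with isomorphisms.
\<close>

definition central_extension :: "'a::{field,finite} itself \<Rightarrow> 'g monoid \<Rightarrow> bool" where
  "central_extension F G \<longleftrightarrow> elementary_abelian CARD('a) (G\<lparr>carrier := group_centre G\<rparr>) \<and>
     (\<exists>\<pi>\<in>hom G ((additive_group :: 'a monoid) \<times>\<times> (additive_group :: 'a monoid)).
        \<pi> ` carrier G = UNIV \<and> {x \<in> carrier G. \<pi> x = (0, 0)} = group_centre G)"

lemma iso_group_centre:
  assumes G: "group G" and f: "f \<in> iso G H"
  shows "f ` group_centre G = group_centre H"
proof -
  have fh: "f \<in> hom G H" and surj: "f ` carrier G = carrier H" and inj: "inj_on f (carrier G)"
    using f by (auto simp: iso_iff)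
  have mult: "f (x \<otimes>\<^bsub>G\<^esub> y) = f x \<otimes>\<^bsub>H\<^esub> f y" if "x \<in> carrier G" "y \<in> carrier G" for x y
    using fh that by (simp add: hom_def)
  show ?thesis
  proof
    show "f ` group_centre G \<subseteq> group_centre H"
    proof
      fix w assume "w \<in> f ` group_centre G"
      then obtain z where z: "z \<in> carrier G" "w = f z" "\<forall>x\<in>carrier G. z \<otimes>\<^bsub>G\<^esub> x = x \<otimes>\<^bsub>G\<^esub> z"
        by (auto simp: group_centre_def)
      have "w \<otimes>\<^bsub>H\<^esub> y = y \<otimes>\<^bsub>H\<^esub> w" if "y \<in> carrier H" for y
      proof -
        obtain x where x: "x \<in> carrier G" "y = f x" using \<open>y \<in> carrier H\<close> surj by blast
        then show ?thesis using z mult by metis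
      qed
      then show "w \<in> group_centre H" using z surj by (auto simp: group_centre_def)
    qed
    show "group_centre H \<subseteq> f ` group_centre G"
    proof
      fix w assume w: "w \<in> group_centre H"
      then obtain z where z: "z \<in> carrier G" "w = f z" using surj by (auto simp: group_centre_def)
      have "z \<otimes>\<^bsub>G\<^esub> x = x \<otimes>\<^bsub>G\<^esub> z" if x: "x \<in> carrier G" for x
      proof -
        have "f x \<in> carrier H" using x surj by blast
        then have "f (z \<otimes>\<^bsub>G\<^esub> x) = f (x \<otimes>\<^bsub>G\<^esub> z)"
          using w z x by (simp add: mult group_centre_def)
        moreover have "z \<otimes>\<^bsub>G\<^esub> x \<in> carrier G" "x \<otimes>\<^bsub>G\<^esub> z \<in> carrier G"
          using G x z(1) by (simp_all add: monoid.m_closed group.is_monoid)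
        ultimately show ?thesis using inj by (simp add: inj_on_eq_iff)
      qed
      then show "w \<in> f ` group_centre G" using z by (auto simp: group_centre_def)
    qed
  qed
qed

lemma central_extension_iso:
  fixes G :: "'b monoid" and H :: "'c monoid" and F :: "'a::{field,finite} itself"
  assumes "group G" "group H" "G \<cong> H" "central_extension F G"
  shows "central_extension F H"
proof -
  interpret G: group G by fact
  interpret H: group H by fact
  let ?E = "(additive_group :: 'a monoid) \<times>\<times> (additive_group :: 'a monoid)"
  obtain f where f: "f \<in> iso H G" using assms(3) G.iso_sym by (auto simp: is_iso_def)
  note centre = iso_group_centre[OF H.group_axioms f]
  have fh: "f \<in> hom H G" and surj: "f ` carrier H = carrier G" using f by (auto simp: iso_iff)
  obtain \<pi> where \<pi>: "\<pi> \<in> hom G ?E"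
    "\<pi> ` carrier G = UNIV" "{x \<in> carrier G. \<pi> x = (0, 0)} = group_centre G"
    using assms(4) unfolding central_extension_def by blast
  have gE: "group ?E" by (rule DirProd_group[OF group_additive group_additive])
  have cH: "group_centre H \<subseteq> carrier H" by (auto simp: group_centre_def)
  have hom: "\<pi> \<circ> f \<in> hom H ?E" using fh \<pi>(1) by (rule hom_compose)
  interpret p: group_hom H ?E "\<pi> \<circ> f"
    unfolding group_hom_def group_hom_axioms_def using hom gE H.group_axioms by blast
  have ker: "{x \<in> carrier H. (\<pi> \<circ> f) x = (0, 0)} = group_centre H"
  proof -
    have "x \<in> group_centre H \<longleftrightarrow> f x \<in> group_centre G" if "x \<in> carrier H" for x
      using that f cH unfolding centre[symmetric] by (auto simp: iso_iff inj_on_def subset_iff)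
    moreover have "\<pi> (f x) = (0, 0) \<longleftrightarrow> f x \<in> group_centre G" if "x \<in> carrier H" for x
      using that surj unfolding \<pi>(3)[symmetric] by auto
    ultimately show ?thesis using cH by auto
  qed
  have centre_sub: "subgroup (group_centre H) H"
    using p.subgroup_kernel ker by (simp add: kernel_def)
  have "elementary_abelian CARD('a) (H\<lparr>carrier := group_centre H\<rparr>)"
  proof (rule elementary_abelian_iso)
    show "group (H\<lparr>carrier := group_centre H\<rparr>)" using centre_sub by (rule H.subgroup_imp_group)
    show "G\<lparr>carrier := group_centre G\<rparr> \<cong> H\<lparr>carrier := group_centre H\<rparr>"
      using iso_induced_subgroup[OF f cH] unfolding centre
      by (rule group.iso_sym[OF H.subgroup_imp_group[OF centre_sub]])
    show "elementary_abelian CARD('a) (G\<lparr>carrier := group_centre G\<rparr>)"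
      using assms(4) by (simp add: central_extension_def)
  qed
  moreover have "(\<pi> \<circ> f) ` carrier H = UNIV" unfolding image_comp[symmetric] surj by (rule \<pi>(2))
  ultimately show ?thesis using hom ker unfolding central_extension_def by blast
qed

lemma central_extension_imp_E_1_plus_2:
  fixes H :: "'c monoid" and F :: "'a::{field,finite} itself"
  assumes "group H" "central_extension F H"
  shows "E_1_plus_2 CARD('a) H"
proof -
  interpret H: group H by fact
  let ?E = "(additive_group :: 'a monoid) \<times>\<times> (additive_group :: 'a monoid)"
  obtain \<pi> where \<pi>: "\<pi> \<in> hom H ?E"
    "\<pi> ` carrier H = UNIV" "{x \<in> carrier H. \<pi> x = (0, 0)} = group_centre H"
    using assms(2) unfolding central_extension_def by blast
  have gE: "group ?E" by (rule DirProd_group[OF group_additive group_additive])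
  interpret p: group_hom H ?E \<pi>
    unfolding group_hom_def group_hom_axioms_def using \<pi>(1) gE H.group_axioms by blast
  have ker: "kernel H ?E \<pi> = group_centre H" using \<pi>(3) by (simp add: kernel_def)
  have "squared (elementary_abelian CARD('a)) (H Mod group_centre H)"
  proof (rule squaredI[OF _ group_additive _ elementary_abelian_additive iso_transfer_basic(1)])
    show gr: "group (H Mod group_centre H)"
      unfolding ker[symmetric] by (rule normal.factorgroup_is_group[OF p.normal_kernel])
    have "\<pi> ` carrier H = carrier ?E" using \<pi>(2) by simp
    then have "H Mod group_centre H \<cong> ?E" unfolding ker[symmetric] by (rule p.FactGroup_iso)
    with gr show "?E \<cong> H Mod group_centre H" by (rule group.iso_sym)
  qed
  then show ?thesis using assms by (simp add: E_1_plus_2_def central_extension_def)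
qed

lemma iso_transfer_central_extension:
  "iso_transfer (central_extension (F :: 'a::{field,finite} itself)) (central_extension F)"
  "iso_transfer (central_extension (F :: 'a::{field,finite} itself)) (E_1_plus_2 CARD('a))"
  unfolding iso_transfer_def
  by (blast intro: central_extension_iso central_extension_imp_E_1_plus_2)+

section \<open>Entrywise computation and change of basis\<close>

lemma matrix3_mult_nth: "(A ** B) $ i $ j = A $ i $ 1 * B $ 1 $ j + A $ i $ 2 * B $ 2 $ j + A $ i $ 3 * B $ 3 $ j"
  for A B :: "'a::field ^ 3 ^ 3"
  by (simp add: matrix_matrix_mult_def sum_3)

lemma matrix3_scale_nth: "(mat c ** A) $ i $ j = c * A $ i $ j" for A :: "'a::field ^ 3 ^ 3"
  by (simp add: scalar_matrix_mult)

lemma invertible3: "invertible (A :: 'a::field ^ 3 ^ 3) \<longleftrightarrow>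
    A$1$1 * (A$2$2 * A$3$3 - A$2$3 * A$3$2) - A$1$2 * (A$2$1 * A$3$3 - A$2$3 * A$3$1) +
    A$1$3 * (A$2$1 * A$3$2 - A$2$2 * A$3$1) \<noteq> 0"
  by (simp add: invertible_det_nz det_3 algebra_simps)

lemma card_eq_card_param: "H = f ` Y \<Longrightarrow> inj_on f Y \<Longrightarrow> card H = card Y"
  by (simp add: card_image)

lemmas mat3_m3 = m3_def[symmetric]

lemma real_card_minus_1: "real (CARD('a::finite) - 1) = real CARD('a) - 1"
  by (simp add: of_nat_diff Suc_leI)

text \<open>
  All planes have the same number of elements, so a congruence that maps one plane into
  another maps it onto the other.
\<close>

lemma card_rank_one_plane:
  fixes P :: "('a::{field,finite} ^ 3 ^ 3) set"
  assumes P: "rank_one_plane P"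
  shows "card P = CARD('a ^ 3)"
proof -
  obtain S :: "'a ^ 3 \<Rightarrow> 'a ^ 3 ^ 3" where S: "P = range S" "\<forall>x y. S (x + y) = S x + S y"
    "\<forall>c x. S (c *s x) = mat c ** S x" "\<forall>x. S x = 0 \<longrightarrow> x = 0"
    by (rule rank_one_plane_param[OF P])
  have "inj S"
  proof (rule injI)
    fix x y assume "S x = S y"
    moreover have "S x = S (x - y) + S y" using S(2)[rule_format, of "x - y" y] by simp
    ultimately have "S (x - y) = 0" by simp
    then have "x - y = 0" using S(4) by blast
    then show "x = y" by simp
  qed
  then show ?thesis unfolding S(1) by (rule card_image)
qed

lemma stabiliser_and_number_base_change:
  fixes P P' :: "('a::{field,finite} ^ 3 ^ 3) set"
  assumes "stabiliser_and_number P T m" and C: "invertible C"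
    and planes: "rank_one_plane P" "rank_one_plane P'"
    and sub: "\<And>M. M \<in> P \<Longrightarrow> C ** M ** transpose C \<in> P'"
  shows "stabiliser_and_number P' T m"
proof (rule stabiliser_and_number_congruent[OF assms(1) C])
  show "K_on_planes C P = P'"
  proof (rule card_subset_eq)
    show "K_on_planes C P \<subseteq> P'" using sub by (auto simp: K_on_planes_def)
    show "card (K_on_planes C P) = card P'"
      by (simp only: card_rank_one_plane planes rank_one_plane_congruence C)
  qed simp
qed

section \<open>The types \<open>\<Sigma>\<^sub>3\<close> and \<open>\<Sigma>\<^sub>8\<close>\<close>

lemma Sigma3_mem: "m3 a b c d e f g h i \<in> Sigma3 \<longleftrightarrow> b = 0 \<and> d = 0 \<and> f = 0 \<and> h = 0 \<and> i = 0 \<and> g = c"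
  unfolding Sigma3_def mat3_m3 by auto

lemma rank_one_Sigma3: "rank_one_plane Sigma3"
  unfolding Sigma3_def mat3_m3
  by (rule rank_one_planeI3[where a=1 and b=0 and c=0 and x=1 and y=0 and z=0, OF refl])
     (simp_all add: m3_add m3_scale m3_eq_0_iff m3_transpose)

text \<open>
  Diagonal matrices with first entry one, extended by the transvections with parameter in
  position \<open>(1, 3)\<close>. Both \<open>\<Sigma>\<^sub>3\<close> and \<open>\<Sigma>\<^sub>8\<close> have this group as stabiliser, up to scalars.
\<close>

definition torus_unipotent :: "('a::field ^ 3 ^ 3) set" where
  "torus_unipotent = {A. A$1$1 = 1 \<and> A$1$2 = 0 \<and> A$2$1 = 0 \<and> A$2$3 = 0 \<and>
    A$3$1 = 0 \<and> A$3$2 = 0 \<and> A$2$2 \<noteq> 0 \<and> A$3$3 \<noteq> 0}"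

lemma torus_unipotent_param:
  "A \<in> torus_unipotent \<longleftrightarrow> (\<exists>p b c. b \<noteq> 0 \<and> c \<noteq> 0 \<and> A = m3 1 0 p 0 b 0 0 0 c)"
proof
  assume A: "A \<in> torus_unipotent"
  then have "A = m3 1 0 (A$1$3) 0 (A$2$2) 0 0 0 (A$3$3)"
    by (simp add: torus_unipotent_def matrix3_eq_iff)
  then show "\<exists>p b c. b \<noteq> 0 \<and> c \<noteq> 0 \<and> A = m3 1 0 p 0 b 0 0 0 c"
    using A unfolding torus_unipotent_def by blast
qed (auto simp: torus_unipotent_def)

lemma torus_unipotent_closed:
  "(torus_unipotent :: ('a::field ^ 3 ^ 3) set) \<noteq> {}"
  "A \<in> (torus_unipotent :: ('a::field ^ 3 ^ 3) set) \<Longrightarrow> invertible A"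
  "A \<in> torus_unipotent \<Longrightarrow> B \<in> torus_unipotent \<Longrightarrow> A ** B \<in> (torus_unipotent :: ('a::field ^ 3 ^ 3) set)"
proof -
  have "m3 1 0 0 0 1 0 0 0 1 \<in> (torus_unipotent :: ('a ^ 3 ^ 3) set)" by (simp add: torus_unipotent_def)
  then show "(torus_unipotent :: ('a::field ^ 3 ^ 3) set) \<noteq> {}" by blast
qed (simp_all add: torus_unipotent_def invertible3 matrix3_mult_nth)

lemma card_torus_unipotent:
  "card (torus_unipotent :: ('a::{field,finite} ^ 3 ^ 3) set) = CARD('a) * ((CARD('a) - 1) * (CARD('a) - 1))"
proof -
  have "torus_unipotent = (\<lambda>(p, b, c). m3 1 0 p 0 b 0 0 0 c :: 'a ^ 3 ^ 3) ` (UNIV \<times> (UNIV - {0}) \<times> (UNIV - {0}))"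
    by (auto simp: torus_unipotent_param image_iff)
  from card_eq_card_param[OF this] show ?thesis by (simp add: inj_on_def card_cartesian_product)
qed

lemma torus_unipotent_semidirect:
  "semidirect (elementary_abelian CARD('a)) (squared (cyclic_of_order (CARD('a) - 1)))
     (GL\<lparr>carrier := torus_unipotent :: ('a::{field,finite} ^ 3 ^ 3) set\<rparr>)"
proof (rule semidirect_of_split_hom[where \<theta> = "\<lambda>A. (A$2$2, A$3$3)" and \<sigma> = "\<lambda>(b, c). m3 1 0 0 0 b 0 0 0 c"
      and \<iota> = "\<lambda>p. m3 1 0 p 0 1 0 0 0 1", OF _ DirProd_group[OF group_unit group_unit] group_additive _ _ _ _ _ _
        elementary_abelian_additive iso_transfer_basic(1) squared_unit_group iso_transfer_squares(2)])
  let ?H = "torus_unipotent :: ('a ^ 3 ^ 3) set"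
  show "group (GL\<lparr>carrier := ?H\<rparr>)" by (intro group_subgroup_GL torus_unipotent_closed)
  show "(\<lambda>A. (A$2$2, A$3$3)) \<in> hom (GL\<lparr>carrier := ?H\<rparr>) ((unit_group :: 'a monoid) \<times>\<times> unit_group)"
    by (auto simp: hom_def torus_unipotent_def matrix3_mult_nth)
  show "(\<lambda>(b, c). m3 1 0 0 0 b 0 0 0 c) \<in> hom ((unit_group :: 'a monoid) \<times>\<times> unit_group) (GL\<lparr>carrier := ?H\<rparr>)"
    by (auto simp: hom_def torus_unipotent_def m3_mult)
  show "(\<lambda>p. m3 1 0 p 0 1 0 0 0 1) \<in> hom additive_group (GL\<lparr>carrier := ?H\<rparr>)"
    by (auto simp: hom_def torus_unipotent_def m3_mult add.commute)
  show "(\<lambda>p. m3 1 0 p 0 1 0 0 0 1) ` carrier additive_group =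
      {A \<in> carrier (GL\<lparr>carrier := ?H\<rparr>). (A $ 2 $ 2, A $ 3 $ 3) = \<one>\<^bsub>(unit_group :: 'a monoid) \<times>\<times> unit_group\<^esub>}"
    by (auto simp: torus_unipotent_param image_iff)
qed (auto simp: inj_on_def)

lemma stabiliser_and_number_torus_unipotent:
  fixes P :: "('a::{field,finite} ^ 3 ^ 3) set"
  assumes odd: "odd CARD('a)" and P: "rank_one_plane P"
    and pres: "\<And>p b c M. b \<noteq> 0 \<Longrightarrow> c \<noteq> 0 \<Longrightarrow> M \<in> P \<Longrightarrow>
       m3 1 0 p 0 b 0 0 0 c ** M ** transpose (m3 1 0 p 0 b 0 0 0 c) \<in> P"
    and compl: "\<And>a b c d e f g h i. invertible (m3 a b c d e f g h i) \<Longrightarrow>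
       (\<And>M. M \<in> P \<Longrightarrow> m3 a b c d e f g h i ** M ** transpose (m3 a b c d e f g h i) \<in> P) \<Longrightarrow>
       b = 0 \<and> d = 0 \<and> f = 0 \<and> g = 0 \<and> h = 0"
  shows "stabiliser_and_number P
     (semidirect (elementary_abelian CARD('a)) (squared (cyclic_of_order (CARD('a) - 1))))
     (real CARD('a)^2 * (real CARD('a)^2 + real CARD('a) + 1) * (real CARD('a) + 1))"
proof (rule stabiliser_and_number_complement[OF odd P torus_unipotent_closed])
  show "A ** M ** transpose A \<in> P" if "A \<in> torus_unipotent" "M \<in> P" for A M
    using that pres unfolding torus_unipotent_param by blast
  show "\<exists>k. \<exists>h\<in>torus_unipotent. k \<noteq> 0 \<and> A = mat k ** h"
    if inv: "invertible A" and pres: "\<And>M. M \<in> P \<Longrightarrow> A ** M ** transpose A \<in> P" for A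
  proof -
    obtain a b c d e f g h i where A: "A = m3 a b c d e f g h i" by (rule m3_cases)
    have z: "b = 0" "d = 0" "f = 0" "g = 0" "h = 0" using compl[OF inv[unfolded A] pres[unfolded A]] by auto
    then have nz: "a \<noteq> 0" "e \<noteq> 0" "i \<noteq> 0" using inv by (auto simp: A m3_invertible)
    then have "A = mat a ** m3 1 0 (c / a) 0 (e / a) 0 0 0 (i / a)" using z by (simp add: A m3_scale)
    moreover have "m3 1 0 (c / a) 0 (e / a) 0 0 0 (i / a) \<in> torus_unipotent"
      using nz by (simp add: torus_unipotent_def)
    ultimately show ?thesis using nz(1) by blast
  qed
  show "c = 1" if "A \<in> torus_unipotent" "mat c ** A \<in> torus_unipotent" for A and c :: 'a
    using that by (simp add: torus_unipotent_def matrix3_scale_nth)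
  show "semidirect (elementary_abelian CARD('a)) (squared (cyclic_of_order (CARD('a) - 1)))
      (GL\<lparr>carrier := torus_unipotent :: ('a ^ 3 ^ 3) set\<rparr>)" by (rule torus_unipotent_semidirect)
  show "real CARD('a)^2 * (real CARD('a)^2 + real CARD('a) + 1) * (real CARD('a) + 1) *
      real (card (torus_unipotent :: ('a ^ 3 ^ 3) set)) = order_PGL3 CARD('a)"
    unfolding card_torus_unipotent order_PGL3_def of_nat_mult real_card_minus_1
    by (simp add: power2_eq_square power3_eq_cube algebra_simps)
qed (assumption+, intro iso_transfer_semidirect iso_transfer_basic iso_transfer_squares)

text \<open>
  In terms of coordinate points \<open>x, y, z\<close>, the plane is spanned by \<open>x\<^sup>2\<close>, \<open>y\<^sup>2\<close> and \<open>xz\<close>. Its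
  only points of rank one are \<open>x\<^sup>2\<close> and \<open>y\<^sup>2\<close>, and \<open>xz\<close> distinguishes them.
\<close>

lemma stabiliser_and_number_Sigma3:
  assumes odd: "odd CARD('a::{field,finite})"
  shows "stabiliser_and_number (Sigma3 :: ('a ^ 3 ^ 3) set)
     (semidirect (elementary_abelian CARD('a)) (squared (cyclic_of_order (CARD('a) - 1))))
     (real CARD('a)^2 * (real CARD('a)^2 + real CARD('a) + 1) * (real CARD('a) + 1))"
proof (rule stabiliser_and_number_torus_unipotent[OF odd rank_one_Sigma3])
  fix p b c :: 'a and M :: "'a ^ 3 ^ 3" assume "M \<in> Sigma3"
  then obtain \<alpha> \<beta> \<gamma> where M: "M = m3 \<alpha> 0 \<gamma> 0 \<beta> 0 \<gamma> 0 0" unfolding Sigma3_def mat3_m3 by blast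
  show "m3 1 0 p 0 b 0 0 0 c ** M ** transpose (m3 1 0 p 0 b 0 0 0 c) \<in> Sigma3"
    by (simp add: M m3_mult m3_transpose Sigma3_mem algebra_simps)
next
  fix a b c d e f g h i :: 'a
  assume inv: "invertible (m3 a b c d e f g h i)"
    and pres: "\<And>M. M \<in> Sigma3 \<Longrightarrow> m3 a b c d e f g h i ** M ** transpose (m3 a b c d e f g h i) \<in> Sigma3"
  have 1: "g = 0 \<and> a * d = 0"
    using pres[of "m3 1 0 0 0 0 0 0 0 0"] by (simp add: m3_mult m3_transpose Sigma3_mem)
  have 2: "h = 0 \<and> b * e = 0"
    using pres[of "m3 0 0 0 0 1 0 0 0 0"] by (simp add: m3_mult m3_transpose Sigma3_mem)
  have i: "i \<noteq> 0" using inv 1 2 by (auto simp: m3_invertible)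
  have 3: "d = 0 \<and> a * f = 0"
    using pres[of "m3 0 0 1 0 0 0 1 0 0"] i 1 by (auto simp: m3_mult m3_transpose Sigma3_mem)
  have "a \<noteq> 0" "e \<noteq> 0" using inv 1 2 3 by (auto simp: m3_invertible)
  then show "b = 0 \<and> d = 0 \<and> f = 0 \<and> g = 0 \<and> h = 0" using 1 2 3 by simp
qed

lemma Sigma8_mem: "m3 a b c d e f g h i \<in> Sigma8 \<longleftrightarrow> d = b \<and> c = 0 \<and> e = 0 \<and> g = 0 \<and> h = f \<and> i = 0"
  unfolding Sigma8_def mat3_m3 by auto

lemma rank_one_Sigma8: "rank_one_plane Sigma8"
  unfolding Sigma8_def mat3_m3
  by (rule rank_one_planeI3[where a=1 and b=0 and c=0 and x=1 and y=0 and z=0, OF refl])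
     (simp_all add: m3_add m3_scale m3_eq_0_iff m3_transpose)

text \<open>
  The plane is spanned by \<open>x\<^sup>2\<close>, \<open>xy\<close>, \<open>yz\<close>. The image of \<open>x\<^sup>2\<close> fixes the first column of the
  matrix, that of \<open>xy\<close> then removes the entry \<open>(3, 2)\<close>, and that of \<open>yz\<close> the entries \<open>(1, 2)\<close>
  and \<open>(2, 3)\<close>.
\<close>

lemma stabiliser_and_number_Sigma8:
  assumes odd: "odd CARD('a::{field,finite})"
  shows "stabiliser_and_number (Sigma8 :: ('a ^ 3 ^ 3) set)
     (semidirect (elementary_abelian CARD('a)) (squared (cyclic_of_order (CARD('a) - 1))))
     (real CARD('a)^2 * (real CARD('a)^2 + real CARD('a) + 1) * (real CARD('a) + 1))"
proof (rule stabiliser_and_number_torus_unipotent[OF odd rank_one_Sigma8])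
  fix p b c :: 'a and M :: "'a ^ 3 ^ 3" assume "M \<in> Sigma8"
  then obtain \<alpha> \<beta> \<gamma> where M: "M = m3 \<alpha> \<beta> 0 \<beta> 0 \<gamma> 0 \<gamma> 0" unfolding Sigma8_def mat3_m3 by blast
  show "m3 1 0 p 0 b 0 0 0 c ** M ** transpose (m3 1 0 p 0 b 0 0 0 c) \<in> Sigma8"
    by (simp add: M m3_mult m3_transpose Sigma8_mem algebra_simps)
next
  have 2: "(2 :: 'a) \<noteq> 0" using odd by (rule two_neq_0_if_odd_card)
  fix a b c d e f g h i :: 'a
  assume inv: "invertible (m3 a b c d e f g h i)"
    and pres: "\<And>M. M \<in> Sigma8 \<Longrightarrow> m3 a b c d e f g h i ** M ** transpose (m3 a b c d e f g h i) \<in> Sigma8"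
  have 1: "d = 0 \<and> g = 0"
    using pres[of "m3 1 0 0 0 0 0 0 0 0"] by (simp add: m3_mult m3_transpose Sigma8_mem)
  then have a: "a \<noteq> 0" using inv by (auto simp: m3_invertible)
  have 3: "h = 0"
    using pres[of "m3 0 1 0 1 0 0 0 0 0"] 1 a by (simp add: m3_mult m3_transpose Sigma8_mem)
  then have ei: "e \<noteq> 0" "i \<noteq> 0" using inv 1 by (auto simp: m3_invertible)
  have "b * i = 0 \<and> e * f + f * e = 0"
    using pres[of "m3 0 0 0 0 0 1 0 1 0"] 1 3 by (simp add: m3_mult m3_transpose Sigma8_mem algebra_simps)
  moreover have "e * f + f * e = 2 * (e * f)" by simp
  ultimately show "b = 0 \<and> d = 0 \<and> f = 0 \<and> g = 0 \<and> h = 0" using 1 2 3 ei by simp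
qed

section \<open>The types \<open>\<Sigma>\<^sub>1\<close> and \<open>\<Sigma>\<^sub>7\<close>\<close>

lemma general_linear_2_GL: "general_linear_2 TYPE('a::field) (GL :: ('a ^ 2 ^ 2) monoid)"
  by (simp add: general_linear_2_def group_GL iso_refl)

text \<open>
  The stabiliser of the line spanned by the first two coordinate points, modulo scalars: \<open>\<Sigma>\<^sub>1\<close>
  consists of all quadratic expressions in these two points.
\<close>

definition affine_group :: "('a::field ^ 3 ^ 3) set" where
  "affine_group = {A. A$3$1 = 0 \<and> A$3$2 = 0 \<and> A$3$3 = 1 \<and> A$1$1 * A$2$2 - A$1$2 * A$2$1 \<noteq> 0}"

text \<open>
  The stabiliser of the first coordinate point, modulo scalars: \<open>\<Sigma>\<^sub>7\<close> consists of all products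
  of this point with another one.
\<close>

definition dual_affine_group :: "('a::field ^ 3 ^ 3) set" where
  "dual_affine_group = {A. A$1$1 = 1 \<and> A$2$1 = 0 \<and> A$3$1 = 0 \<and> A$2$2 * A$3$3 - A$2$3 * A$3$2 \<noteq> 0}"

lemma det2_mult_neq:
  fixes a b c d :: "'a::field"
  assumes "a * d \<noteq> b * c" "a' * d' \<noteq> b' * c'"
  shows "(a * a' + b * c') * (c * b' + d * d') \<noteq> (a * b' + b * d') * (c * a' + d * c')"
proof -
  have "(a * a' + b * c') * (c * b' + d * d') - (a * b' + b * d') * (c * a' + d * c') =
      (a * d - b * c) * (a' * d' - b' * c')"
    by (simp add: algebra_simps)
  also have "\<dots> \<noteq> 0" using assms by simp
  finally show ?thesis by simp
qed

lemma affine_group_closed: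
  "(affine_group :: ('a::field ^ 3 ^ 3) set) \<noteq> {}"
  "A \<in> (affine_group :: ('a::field ^ 3 ^ 3) set) \<Longrightarrow> invertible A"
  "A \<in> affine_group \<Longrightarrow> B \<in> affine_group \<Longrightarrow> A ** B \<in> (affine_group :: ('a::field ^ 3 ^ 3) set)"
proof -
  have "m3 1 0 0 0 1 0 0 0 1 \<in> (affine_group :: ('a ^ 3 ^ 3) set)" by (simp add: affine_group_def)
  then show "(affine_group :: ('a::field ^ 3 ^ 3) set) \<noteq> {}" by blast
  show "invertible A" if "A \<in> (affine_group :: ('a::field ^ 3 ^ 3) set)"
    using that by (simp add: affine_group_def invertible3)
  show "A ** B \<in> (affine_group :: ('a::field ^ 3 ^ 3) set)" if "A \<in> affine_group" "B \<in> affine_group"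
    using that by (simp add: affine_group_def matrix3_mult_nth) (rule det2_mult_neq; simp)
qed

lemma dual_affine_group_closed:
  "(dual_affine_group :: ('a::field ^ 3 ^ 3) set) \<noteq> {}"
  "A \<in> (dual_affine_group :: ('a::field ^ 3 ^ 3) set) \<Longrightarrow> invertible A"
  "A \<in> dual_affine_group \<Longrightarrow> B \<in> dual_affine_group \<Longrightarrow> A ** B \<in> (dual_affine_group :: ('a::field ^ 3 ^ 3) set)"
proof -
  have "m3 1 0 0 0 1 0 0 0 1 \<in> (dual_affine_group :: ('a ^ 3 ^ 3) set)" by (simp add: dual_affine_group_def)
  then show "(dual_affine_group :: ('a::field ^ 3 ^ 3) set) \<noteq> {}" by blast
  show "invertible A" if "A \<in> (dual_affine_group :: ('a::field ^ 3 ^ 3) set)"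
    using that by (simp add: dual_affine_group_def invertible3)
  show "A ** B \<in> (dual_affine_group :: ('a::field ^ 3 ^ 3) set)" if "A \<in> dual_affine_group" "B \<in> dual_affine_group"
    using that by (simp add: dual_affine_group_def matrix3_mult_nth) (rule det2_mult_neq; simp)
qed

lemma m2_invertible_nth: "invertible (B :: 'a::field ^ 2 ^ 2) \<longleftrightarrow> B$1$1 * B$2$2 - B$1$2 * B$2$1 \<noteq> 0"
  by (simp add: invertible_det_nz det_2)

lemma matrix2_mult_nth: "(A ** B) $ i $ j = A $ i $ 1 * B $ 1 $ j + A $ i $ 2 * B $ 2 $ j"
  for A B :: "'a::field ^ 2 ^ 2"
  by (simp add: matrix_matrix_mult_def sum_2)

lemma matrix2_eq_iff:
  fixes A B :: "'a ^ 2 ^ 2"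
  shows "A = B \<longleftrightarrow> A$1$1 = B$1$1 \<and> A$1$2 = B$1$2 \<and> A$2$1 = B$2$1 \<and> A$2$2 = B$2$2"
  by (simp add: vec_eq_iff forall_2)

lemma card_affine_group:
  "card (affine_group :: ('a::{field,finite} ^ 3 ^ 3) set) = card {B :: 'a ^ 2 ^ 2. invertible B} * (CARD('a) * CARD('a))"
proof -
  let ?h = "\<lambda>(B :: 'a ^ 2 ^ 2, p, r). m3 (B$1$1) (B$1$2) p (B$2$1) (B$2$2) r 0 0 1"
  have "affine_group = ?h ` ({B. invertible B} \<times> UNIV \<times> UNIV)"
  proof
    show "affine_group \<subseteq> ?h ` ({B. invertible B} \<times> UNIV \<times> UNIV)"
    proof
      fix A :: "'a ^ 3 ^ 3" assume "A \<in> affine_group"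
      then show "A \<in> ?h ` ({B. invertible B} \<times> UNIV \<times> UNIV)"
        by (intro image_eqI[of _ _ "(m2 (A$1$1) (A$1$2) (A$2$1) (A$2$2), A$1$3, A$2$3)"])
           (simp_all add: affine_group_def matrix3_eq_iff m2_invertible_nth)
    qed
  qed (auto simp: affine_group_def m2_invertible_nth)
  moreover have "inj_on ?h ({B. invertible B} \<times> UNIV \<times> UNIV)"
    by (auto simp: inj_on_def matrix2_eq_iff)
  ultimately have "card (affine_group :: ('a ^ 3 ^ 3) set) = card ({B :: 'a ^ 2 ^ 2. invertible B} \<times> (UNIV :: 'a set) \<times> (UNIV :: 'a set))"
    by (rule card_eq_card_param)
  then show ?thesis by (simp add: card_cartesian_product)
qed

lemma card_dual_affine_group:
  "card (dual_affine_group :: ('a::{field,finite} ^ 3 ^ 3) set) = card {B :: 'a ^ 2 ^ 2. invertible B} * (CARD('a) * CARD('a))"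
proof -
  let ?h = "\<lambda>(B :: 'a ^ 2 ^ 2, p, r). m3 1 p r 0 (B$1$1) (B$1$2) 0 (B$2$1) (B$2$2)"
  have "dual_affine_group = ?h ` ({B. invertible B} \<times> UNIV \<times> UNIV)"
  proof
    show "dual_affine_group \<subseteq> ?h ` ({B. invertible B} \<times> UNIV \<times> UNIV)"
    proof
      fix A :: "'a ^ 3 ^ 3" assume "A \<in> dual_affine_group"
      then show "A \<in> ?h ` ({B. invertible B} \<times> UNIV \<times> UNIV)"
        by (intro image_eqI[of _ _ "(m2 (A$2$2) (A$2$3) (A$3$2) (A$3$3), A$1$2, A$1$3)"])
           (simp_all add: dual_affine_group_def matrix3_eq_iff m2_invertible_nth)
    qed
  qed (auto simp: dual_affine_group_def m2_invertible_nth)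
  moreover have "inj_on ?h ({B. invertible B} \<times> UNIV \<times> UNIV)"
    by (auto simp: inj_on_def matrix2_eq_iff)
  ultimately have "card (dual_affine_group :: ('a ^ 3 ^ 3) set) = card ({B :: 'a ^ 2 ^ 2. invertible B} \<times> (UNIV :: 'a set) \<times> (UNIV :: 'a set))"
    by (rule card_eq_card_param)
  then show ?thesis by (simp add: card_cartesian_product)
qed

lemma affine_group_semidirect:
  "semidirect (squared (elementary_abelian CARD('a))) (general_linear_2 TYPE('a))
     (GL\<lparr>carrier := affine_group :: ('a::{field,finite} ^ 3 ^ 3) set\<rparr>)"
proof (rule semidirect_of_split_hom[where \<theta> = "\<lambda>A. m2 (A$1$1) (A$1$2) (A$2$1) (A$2$2)"
      and \<sigma> = "\<lambda>B :: 'a ^ 2 ^ 2. m3 (B$1$1) (B$1$2) 0 (B$2$1) (B$2$2) 0 0 0 1"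
      and \<iota> = "\<lambda>(p, r). m3 1 0 p 0 1 r 0 0 1", OF _ group_GL DirProd_group[OF group_additive group_additive] _ _ _ _ _ _
        squared_additive iso_transfer_squares(1) general_linear_2_GL iso_transfer_basic(4)])
  let ?H = "affine_group :: ('a ^ 3 ^ 3) set"
  show "group (GL\<lparr>carrier := ?H\<rparr>)" by (intro group_subgroup_GL affine_group_closed)
  show "(\<lambda>A. m2 (A$1$1) (A$1$2) (A$2$1) (A$2$2)) \<in> hom (GL\<lparr>carrier := ?H\<rparr>) GL"
    by (auto simp: hom_def affine_group_def matrix3_mult_nth m2_mult m2_invertible)
  show "(\<lambda>B :: 'a ^ 2 ^ 2. m3 (B$1$1) (B$1$2) 0 (B$2$1) (B$2$2) 0 0 0 1) \<in> hom GL (GL\<lparr>carrier := ?H\<rparr>)"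
    by (auto simp: hom_def affine_group_def m3_mult m2_invertible_nth matrix2_mult_nth)
  show "(\<lambda>(p, r). m3 1 0 p 0 1 r 0 0 1) \<in> hom ((additive_group :: 'a monoid) \<times>\<times> (additive_group :: 'a monoid)) (GL\<lparr>carrier := ?H\<rparr>)"
    by (auto simp: hom_def affine_group_def m3_mult add.commute)
  show "(\<lambda>(p, r). m3 1 0 p 0 1 r 0 0 1) ` carrier ((additive_group :: 'a monoid) \<times>\<times> (additive_group :: 'a monoid)) =
      {A \<in> carrier (GL\<lparr>carrier := ?H\<rparr>). m2 (A$1$1) (A$1$2) (A$2$1) (A$2$2) = \<one>\<^bsub>GL\<^esub>}"
    by (auto simp: affine_group_def m2_one image_iff matrix3_eq_iff)
qed (auto simp: inj_on_def matrix2_eq_iff)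

lemma dual_affine_group_semidirect:
  "semidirect (squared (elementary_abelian CARD('a))) (general_linear_2 TYPE('a))
     (GL\<lparr>carrier := dual_affine_group :: ('a::{field,finite} ^ 3 ^ 3) set\<rparr>)"
proof (rule semidirect_of_split_hom[where \<theta> = "\<lambda>A. m2 (A$2$2) (A$2$3) (A$3$2) (A$3$3)"
      and \<sigma> = "\<lambda>B :: 'a ^ 2 ^ 2. m3 1 0 0 0 (B$1$1) (B$1$2) 0 (B$2$1) (B$2$2)"
      and \<iota> = "\<lambda>(p, r). m3 1 p r 0 1 0 0 0 1", OF _ group_GL DirProd_group[OF group_additive group_additive] _ _ _ _ _ _
        squared_additive iso_transfer_squares(1) general_linear_2_GL iso_transfer_basic(4)])
  let ?H = "dual_affine_group :: ('a ^ 3 ^ 3) set"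
  show "group (GL\<lparr>carrier := ?H\<rparr>)" by (intro group_subgroup_GL dual_affine_group_closed)
  show "(\<lambda>A. m2 (A$2$2) (A$2$3) (A$3$2) (A$3$3)) \<in> hom (GL\<lparr>carrier := ?H\<rparr>) GL"
    by (auto simp: hom_def dual_affine_group_def matrix3_mult_nth m2_mult m2_invertible)
  show "(\<lambda>B :: 'a ^ 2 ^ 2. m3 1 0 0 0 (B$1$1) (B$1$2) 0 (B$2$1) (B$2$2)) \<in> hom GL (GL\<lparr>carrier := ?H\<rparr>)"
    by (auto simp: hom_def dual_affine_group_def m3_mult m2_invertible_nth matrix2_mult_nth)
  show "(\<lambda>(p, r). m3 1 p r 0 1 0 0 0 1) \<in> hom ((additive_group :: 'a monoid) \<times>\<times> (additive_group :: 'a monoid)) (GL\<lparr>carrier := ?H\<rparr>)"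
    by (auto simp: hom_def dual_affine_group_def m3_mult add.commute)
  show "(\<lambda>(p, r). m3 1 p r 0 1 0 0 0 1) ` carrier ((additive_group :: 'a monoid) \<times>\<times> (additive_group :: 'a monoid)) =
      {A \<in> carrier (GL\<lparr>carrier := ?H\<rparr>). m2 (A$2$2) (A$2$3) (A$3$2) (A$3$3) = \<one>\<^bsub>GL\<^esub>}"
    by (auto simp: dual_affine_group_def m2_one image_iff matrix3_eq_iff)
qed (auto simp: inj_on_def matrix2_eq_iff)

lemma affine_group_number:
  "(real CARD('a)^2 + real CARD('a) + 1) * real (card {B :: 'a::{field,finite} ^ 2 ^ 2. invertible B} * (CARD('a) * CARD('a)))
    = order_PGL3 CARD('a)"
proof -
  have le: "CARD('a)^2 \<ge> 1" "CARD('a)^2 \<ge> CARD('a)" by (simp_all add: Suc_leI self_le_power)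
  have card: "real (card {B :: 'a ^ 2 ^ 2. invertible B}) = (real CARD('a)^2 - 1) * (real CARD('a)^2 - real CARD('a))"
    unfolding card_GL2 by (simp only: of_nat_mult of_nat_diff[OF le(1)] of_nat_diff[OF le(2)] of_nat_power of_nat_1)
  show ?thesis unfolding order_PGL3_def of_nat_mult card
    by (simp add: power2_eq_square power3_eq_cube algebra_simps)
qed

lemma Sigma1_mem: "m3 a b c d e f g h i \<in> Sigma1 \<longleftrightarrow> d = b \<and> c = 0 \<and> f = 0 \<and> g = 0 \<and> h = 0 \<and> i = 0"
  unfolding Sigma1_def mat3_m3 by auto

lemma rank_one_Sigma1: "rank_one_plane Sigma1"
  unfolding Sigma1_def mat3_m3
  by (rule rank_one_planeI3[where a=1 and b=0 and c=0 and x=1 and y=0 and z=0, OF refl])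
     (simp_all add: m3_add m3_scale m3_eq_0_iff m3_transpose)

lemma stabiliser_and_number_Sigma1:
  assumes odd: "odd CARD('a::{field,finite})"
  shows "stabiliser_and_number (Sigma1 :: ('a ^ 3 ^ 3) set)
     (semidirect (squared (elementary_abelian CARD('a))) (general_linear_2 TYPE('a)))
     (real CARD('a)^2 + real CARD('a) + 1)"
proof (rule stabiliser_and_number_complement[OF odd rank_one_Sigma1 affine_group_closed])
  show "A ** M ** transpose A \<in> Sigma1" if A': "A \<in> affine_group" and M': "M \<in> Sigma1" for A M :: "'a ^ 3 ^ 3"
  proof -
    obtain a b c d e f g h i where A: "A = m3 a b c d e f g h i" by (rule m3_cases)
    obtain \<alpha> \<beta> \<gamma> where M: "M = m3 \<alpha> \<gamma> 0 \<gamma> \<beta> 0 0 0 0" using M' unfolding Sigma1_def mat3_m3 by blast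
    show ?thesis using A' by (simp add: A M m3_mult m3_transpose Sigma1_mem affine_group_def algebra_simps)
  qed
  show "\<exists>k. \<exists>h\<in>affine_group. k \<noteq> 0 \<and> A = mat k ** h"
    if inv: "invertible A" and pres: "\<And>M. M \<in> Sigma1 \<Longrightarrow> A ** M ** transpose A \<in> Sigma1" for A :: "'a ^ 3 ^ 3"
  proof -
    obtain a b c d e f g h i where A: "A = m3 a b c d e f g h i" by (rule m3_cases)
    have g: "g = 0" using pres[of "m3 1 0 0 0 0 0 0 0 0"] by (simp add: A m3_mult m3_transpose Sigma1_mem)
    have h: "h = 0" using pres[of "m3 0 0 0 0 1 0 0 0 0"] by (simp add: A m3_mult m3_transpose Sigma1_mem)
    have i: "i \<noteq> 0" and det: "a * e - b * d \<noteq> 0" using inv g h by (auto simp: A m3_invertible algebra_simps)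
    have "A = mat i ** m3 (a / i) (b / i) (c / i) (d / i) (e / i) (f / i) 0 0 1" using g h i by (simp add: A m3_scale)
    moreover have "m3 (a / i) (b / i) (c / i) (d / i) (e / i) (f / i) 0 0 1 \<in> affine_group"
      using det i by (simp add: affine_group_def field_simps)
    ultimately show ?thesis using i by blast
  qed
  show "c = 1" if "A \<in> affine_group" "mat c ** A \<in> affine_group" for A and c :: 'a
    using that by (simp add: affine_group_def matrix3_scale_nth)
  show "semidirect (squared (elementary_abelian CARD('a))) (general_linear_2 TYPE('a))
     (GL\<lparr>carrier := affine_group :: ('a ^ 3 ^ 3) set\<rparr>)" by (rule affine_group_semidirect)
  show "(real CARD('a)^2 + real CARD('a) + 1) * real (card (affine_group :: ('a ^ 3 ^ 3) set)) = order_PGL3 CARD('a)"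
    unfolding card_affine_group by (rule affine_group_number)
qed (assumption+, intro iso_transfer_semidirect iso_transfer_basic iso_transfer_squares)

lemma Sigma7_mem: "m3 a b c d e f g h i \<in> Sigma7 \<longleftrightarrow> d = b \<and> g = c \<and> e = 0 \<and> f = 0 \<and> h = 0 \<and> i = 0"
  unfolding Sigma7_def mat3_m3 by auto

lemma rank_one_Sigma7: "rank_one_plane Sigma7"
  unfolding Sigma7_def mat3_m3
  by (rule rank_one_planeI3[where a=1 and b=0 and c=0 and x=1 and y=0 and z=0, OF refl])
     (simp_all add: m3_add m3_scale m3_eq_0_iff m3_transpose)

lemma stabiliser_and_number_Sigma7:
  assumes odd: "odd CARD('a::{field,finite})"
  shows "stabiliser_and_number (Sigma7 :: ('a ^ 3 ^ 3) set)
     (semidirect (squared (elementary_abelian CARD('a))) (general_linear_2 TYPE('a)))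
     (real CARD('a)^2 + real CARD('a) + 1)"
proof (rule stabiliser_and_number_complement[OF odd rank_one_Sigma7 dual_affine_group_closed])
  show "A ** M ** transpose A \<in> Sigma7" if A': "A \<in> dual_affine_group" and M': "M \<in> Sigma7" for A M :: "'a ^ 3 ^ 3"
  proof -
    obtain a b c d e f g h i where A: "A = m3 a b c d e f g h i" by (rule m3_cases)
    obtain \<alpha> \<beta> \<gamma> where M: "M = m3 \<alpha> \<beta> \<gamma> \<beta> 0 0 \<gamma> 0 0" using M' unfolding Sigma7_def mat3_m3 by blast
    show ?thesis using A' by (simp add: A M m3_mult m3_transpose Sigma7_mem dual_affine_group_def algebra_simps)
  qed
  show "\<exists>k. \<exists>h\<in>dual_affine_group. k \<noteq> 0 \<and> A = mat k ** h"
    if inv: "invertible A" and pres: "\<And>M. M \<in> Sigma7 \<Longrightarrow> A ** M ** transpose A \<in> Sigma7" for A :: "'a ^ 3 ^ 3"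
  proof -
    obtain a b c d e f g h i where A: "A = m3 a b c d e f g h i" by (rule m3_cases)
    have g: "d = 0" "g = 0" using pres[of "m3 1 0 0 0 0 0 0 0 0"] by (simp_all add: A m3_mult m3_transpose Sigma7_mem)
    have a: "a \<noteq> 0" and det: "e * i - f * h \<noteq> 0" using inv g by (auto simp: A m3_invertible)
    have "A = mat a ** m3 1 (b / a) (c / a) 0 (e / a) (f / a) 0 (h / a) (i / a)" using g a by (simp add: A m3_scale)
    moreover have "m3 1 (b / a) (c / a) 0 (e / a) (f / a) 0 (h / a) (i / a) \<in> dual_affine_group"
      using det a by (simp add: dual_affine_group_def field_simps)
    ultimately show ?thesis using a by blast
  qed
  show "c = 1" if "A \<in> dual_affine_group" "mat c ** A \<in> dual_affine_group" for A and c :: 'a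
    using that by (simp add: dual_affine_group_def matrix3_scale_nth)
  show "semidirect (squared (elementary_abelian CARD('a))) (general_linear_2 TYPE('a))
     (GL\<lparr>carrier := dual_affine_group :: ('a ^ 3 ^ 3) set\<rparr>)" by (rule dual_affine_group_semidirect)
  show "(real CARD('a)^2 + real CARD('a) + 1) * real (card (dual_affine_group :: ('a ^ 3 ^ 3) set)) = order_PGL3 CARD('a)"
    unfolding card_dual_affine_group by (rule affine_group_number)
qed (assumption+, intro iso_transfer_semidirect iso_transfer_basic iso_transfer_squares)

section \<open>The type \<open>\<Sigma>\<^sub>4\<close>\<close>

lemma card_signs: "(2 :: 'a::field) \<noteq> 0 \<Longrightarrow> card {1, - 1 :: 'a} = 2"
  by (simp add: eq_neg_iff_add_eq_0)

lemma one_neq_minus_one: "(2 :: 'a::field) \<noteq> 0 \<Longrightarrow> (1 :: 'a) \<noteq> - 1" "(2 :: 'a::field) \<noteq> 0 \<Longrightarrow> (- 1 :: 'a) \<noteq> 1"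
  by (simp_all add: eq_neg_iff_add_eq_0 neg_eq_iff_add_eq_0)

text \<open>
  Splitting off an involution: the form in which \<open>C\<^sub>2\<close> appears as a complement below.
\<close>

lemma semidirect_of_sign:
  fixes H :: "('a::{field,finite} ^ 3 ^ 3) set"
  assumes 2: "(2 :: 'a) \<noteq> 0" and H: "group (GL\<lparr>carrier := H\<rparr>)"
    and th: "\<theta> \<in> hom (GL\<lparr>carrier := H\<rparr>) sign_group"
    and t: "t \<in> H" "t ** t = mat 1" "\<theta> t = (- 1 :: 'a)"
    and S: "S (GL\<lparr>carrier := {A \<in> H. \<theta> A = 1}\<rparr>)" "iso_transfer S S"
  shows "semidirect S (cyclic_of_order 2) (GL\<lparr>carrier := H\<rparr>)"
proof -
  interpret H: group "GL\<lparr>carrier := H\<rparr>" by (rule H)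
  interpret \<theta>: group_hom "GL\<lparr>carrier := H\<rparr>" sign_group \<theta>
    unfolding group_hom_def group_hom_axioms_def using H group_sign th by blast
  have one: "mat 1 \<in> H" "\<theta> (mat 1) = 1" using H.one_closed \<theta>.hom_one by simp_all
  have K: "group (GL\<lparr>carrier := {A \<in> H. \<theta> A = 1}\<rparr>)"
    using H.subgroup_imp_group[OF \<theta>.subgroup_kernel] by (simp add: kernel_def)
  show ?thesis
  proof (rule semidirect_of_split_hom[where \<theta> = \<theta> and \<sigma> = "\<lambda>s. if s = 1 then mat 1 else t" and \<iota> = "\<lambda>A. A",
        OF H group_sign K th _ _ _ _ _ S cyclic_sign_group[OF 2] iso_transfer_basic(2)])
    show "(\<lambda>s. if s = 1 then mat 1 else t) \<in> hom sign_group (GL\<lparr>carrier := H\<rparr>)"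
      using one t by (auto simp: hom_def one_neq_minus_one[OF 2])
  qed (use one t in \<open>auto simp: hom_def\<close>)
qed

lemma iso_transfer_E_C: "iso_transfer (semidirect (elementary_abelian m) (cyclic_of_order n))
   (semidirect (elementary_abelian m) (cyclic_of_order n))"
  by (intro iso_transfer_semidirect iso_transfer_basic)

lemma number_of_order_two_extension:
  "1 / 2 * real q^2 * (real q^3 - 1) * (real q + 1) * (2 * ((real q - 1) * real q)) = order_PGL3 q"
  unfolding order_PGL3_def by (simp add: power2_eq_square power3_eq_cube algebra_simps)

lemma Sigma4_mem: "m3 a b c d e f g h i \<in> Sigma4 \<longleftrightarrow> b = 0 \<and> d = 0 \<and> f = c \<and> g = c \<and> h = c \<and> i = 0"
  unfolding Sigma4_def mat3_m3 by auto

lemma rank_one_Sigma4: "rank_one_plane Sigma4"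
  unfolding Sigma4_def mat3_m3
  by (rule rank_one_planeI3[where a=1 and b=0 and c=0 and x=1 and y=0 and z=0, OF refl])
     (simp_all add: m3_add m3_scale m3_eq_0_iff m3_transpose)

text \<open>
  The plane is spanned by \<open>x\<^sup>2\<close>, \<open>y\<^sup>2\<close> and \<open>z(x + y)\<close>. Its stabiliser fixes or exchanges \<open>x\<close> and
  \<open>y\<close>, scaling both by the same factor, and moves \<open>z\<close> by a multiple of \<open>x - y\<close>, which changes
  \<open>z(x + y)\<close> by a combination of \<open>x\<^sup>2\<close> and \<open>y\<^sup>2\<close>. The last condition says that exactly one of
  the entries \<open>(1, 1)\<close> and \<open>(1, 2)\<close> vanishes.
\<close>

definition Sigma4_group :: "('a::field ^ 3 ^ 3) set" where
  "Sigma4_group = {A. A$3$1 = 0 \<and> A$3$2 = 0 \<and> A$3$3 = 1 \<and> A$2$2 = A$1$1 \<and> A$2$1 = A$1$2 \<and>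
     A$2$3 = - A$1$3 \<and> (A$1$1 = 0 \<longleftrightarrow> A$1$2 \<noteq> 0)}"

lemma Sigma4_group_param:
  "A \<in> Sigma4_group \<longleftrightarrow> (\<exists>a p. a \<noteq> 0 \<and> (A = m3 a 0 p 0 a (- p) 0 0 1 \<or> A = m3 0 a p a 0 (- p) 0 0 1))"
proof
  assume A: "A \<in> Sigma4_group"
  show "\<exists>a p. a \<noteq> 0 \<and> (A = m3 a 0 p 0 a (- p) 0 0 1 \<or> A = m3 0 a p a 0 (- p) 0 0 1)"
  proof (cases "A$1$1 = 0")
    case True
    then have "A = m3 0 (A$1$2) (A$1$3) (A$1$2) 0 (- A$1$3) 0 0 1" "A$1$2 \<noteq> 0"
      using A by (simp_all add: Sigma4_group_def matrix3_eq_iff)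
    then show ?thesis by blast
  next
    case False
    then have "A = m3 (A$1$1) 0 (A$1$3) 0 (A$1$1) (- A$1$3) 0 0 1"
      using A by (simp add: Sigma4_group_def matrix3_eq_iff)
    then show ?thesis using False by blast
  qed
qed (auto simp: Sigma4_group_def)

lemma Sigma4_group_closed:
  "(Sigma4_group :: ('a::field ^ 3 ^ 3) set) \<noteq> {}"
  "A \<in> (Sigma4_group :: ('a::field ^ 3 ^ 3) set) \<Longrightarrow> invertible A"
  "A \<in> Sigma4_group \<Longrightarrow> B \<in> Sigma4_group \<Longrightarrow> A ** B \<in> (Sigma4_group :: ('a::field ^ 3 ^ 3) set)"
proof -
  have "m3 1 0 0 0 1 0 0 0 1 \<in> (Sigma4_group :: ('a ^ 3 ^ 3) set)" by (simp add: Sigma4_group_def)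
  then show "(Sigma4_group :: ('a::field ^ 3 ^ 3) set) \<noteq> {}" by blast
  show "invertible A" if "A \<in> (Sigma4_group :: ('a::field ^ 3 ^ 3) set)"
    using that by (auto simp: Sigma4_group_param m3_invertible)
  show "A ** B \<in> (Sigma4_group :: ('a::field ^ 3 ^ 3) set)" if "A \<in> Sigma4_group" "B \<in> Sigma4_group"
    using that by (auto simp: Sigma4_group_def matrix3_mult_nth algebra_simps)
qed

lemma card_Sigma4_group:
  assumes 2: "(2 :: 'a::{field,finite}) \<noteq> 0"
  shows "card (Sigma4_group :: ('a ^ 3 ^ 3) set) = 2 * ((CARD('a) - 1) * CARD('a))"
proof -
  let ?h = "\<lambda>(s :: 'a, a :: 'a, p :: 'a). if s = 1 then m3 a 0 p 0 a (- p) 0 0 1 else m3 0 a p a 0 (- p) 0 0 1"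
  have img: "Sigma4_group = ?h ` ({1, - 1} \<times> (UNIV - {0}) \<times> UNIV)"
  proof
    show "Sigma4_group \<subseteq> ?h ` ({1, - 1} \<times> (UNIV - {0}) \<times> UNIV)"
    proof
      fix A :: "'a ^ 3 ^ 3" assume "A \<in> Sigma4_group"
      then obtain a p where "a \<noteq> 0" "A = m3 a 0 p 0 a (- p) 0 0 1 \<or> A = m3 0 a p a 0 (- p) 0 0 1"
        unfolding Sigma4_group_param by blast
      then have "\<exists>s\<in>{1, - 1}. A = ?h (s, a, p)" by (auto simp: one_neq_minus_one[OF 2])
      then obtain s :: 'a where "s \<in> {1, - 1}" "A = ?h (s, a, p)" by blast
      then show "A \<in> ?h ` ({1, - 1} \<times> (UNIV - {0}) \<times> UNIV)"
        using \<open>a \<noteq> 0\<close> by (intro image_eqI[where x = "(s, a, p)" and f = "?h"]) auto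
    qed
    show "?h ` ({1, - 1} \<times> (UNIV - {0}) \<times> UNIV) \<subseteq> Sigma4_group"
      using 2 2[symmetric] by (auto simp: Sigma4_group_def)
  qed
  have "inj_on ?h ({1, - 1} \<times> (UNIV - {0}) \<times> UNIV)" by (auto simp: inj_on_def one_neq_minus_one[OF 2])
  from card_eq_card_param[OF img this] show ?thesis
    by (simp add: card_cartesian_product card_signs[OF 2])
qed

lemma Sigma4_group_semidirect:
  assumes 2: "(2 :: 'a::{field,finite}) \<noteq> 0"
  shows "semidirect (semidirect (elementary_abelian CARD('a)) (cyclic_of_order (CARD('a) - 1))) (cyclic_of_order 2)
     (GL\<lparr>carrier := Sigma4_group :: ('a ^ 3 ^ 3) set\<rparr>)"
proof (rule semidirect_of_sign[OF 2 _ _ _ _ _ _ iso_transfer_E_C,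
      where \<theta> = "\<lambda>A. if A$1$2 = 0 then 1 else - 1" and t = "m3 0 1 0 1 0 0 0 0 1"])
  let ?H = "Sigma4_group :: ('a ^ 3 ^ 3) set"
  let ?\<theta> = "\<lambda>A :: 'a ^ 3 ^ 3. if A$1$2 = 0 then 1 else - 1 :: 'a"
  show "group (GL\<lparr>carrier := ?H\<rparr>)" by (intro group_subgroup_GL Sigma4_group_closed)
  show "?\<theta> \<in> hom (GL\<lparr>carrier := ?H\<rparr>) sign_group"
    by (auto simp: hom_def Sigma4_group_def matrix3_mult_nth)
  show "m3 0 1 0 1 0 0 0 0 1 \<in> ?H" by (simp add: Sigma4_group_def)
  show "m3 0 1 0 1 0 0 0 0 1 ** m3 0 1 0 1 0 0 0 0 1 = (mat 1 :: 'a ^ 3 ^ 3)" by (simp add: m3_mult m3_scalar)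
  show "?\<theta> (m3 0 1 0 1 0 0 0 0 1) = - 1" by simp
  have K: "{A \<in> ?H. ?\<theta> A = 1} = {A \<in> ?H. A$1$2 = 0}" by (auto simp: one_neq_minus_one[OF 2])
  have K': "A \<in> ?H \<and> A$1$2 = 0 \<longleftrightarrow> (\<exists>a p. a \<noteq> 0 \<and> A = m3 a 0 p 0 a (- p) 0 0 1)" for A
    by (auto simp: Sigma4_group_param)
  show "semidirect (elementary_abelian CARD('a)) (cyclic_of_order (CARD('a) - 1)) (GL\<lparr>carrier := {A \<in> ?H. ?\<theta> A = 1}\<rparr>)"
    unfolding K
  proof (rule semidirect_of_split_hom[where \<theta> = "\<lambda>A. A$1$1" and \<sigma> = "\<lambda>a. m3 a 0 0 0 a 0 0 0 1"
      and \<iota> = "\<lambda>p. m3 1 0 p 0 1 (- p) 0 0 1", OF _ group_unit group_additive _ _ _ _ _ _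
        elementary_abelian_additive iso_transfer_basic(1) cyclic_unit_group iso_transfer_basic(2)])
    show "group (GL\<lparr>carrier := {A \<in> ?H. A$1$2 = 0}\<rparr>)"
    proof (intro group_subgroup_GL)
      have "m3 1 0 0 0 1 0 0 0 1 \<in> {A \<in> ?H. A$1$2 = 0}" by (simp add: Sigma4_group_def)
      then show "{A \<in> ?H. A$1$2 = 0} \<noteq> {}" by blast
    qed (auto simp: Sigma4_group_closed matrix3_mult_nth Sigma4_group_def)
    show "(\<lambda>A. A$1$1) \<in> hom (GL\<lparr>carrier := {A \<in> ?H. A$1$2 = 0}\<rparr>) unit_group"
      by (auto simp: hom_def Sigma4_group_def matrix3_mult_nth)
    show "(\<lambda>a. m3 a 0 0 0 a 0 0 0 1) \<in> hom unit_group (GL\<lparr>carrier := {A \<in> ?H. A$1$2 = 0}\<rparr>)"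
      by (auto simp: hom_def Sigma4_group_def m3_mult)
    show "(\<lambda>p. m3 1 0 p 0 1 (- p) 0 0 1) \<in> hom additive_group (GL\<lparr>carrier := {A \<in> ?H. A$1$2 = 0}\<rparr>)"
      by (auto simp: hom_def Sigma4_group_def m3_mult algebra_simps)
    show "(\<lambda>p. m3 1 0 p 0 1 (- p) 0 0 1) ` carrier additive_group =
        {A \<in> carrier (GL\<lparr>carrier := {A \<in> ?H. A$1$2 = 0}\<rparr>). A$1$1 = \<one>\<^bsub>unit_group\<^esub>}"
      by (auto simp: K' image_iff)
  qed (auto simp: inj_on_def)
qed

lemma stabiliser_and_number_Sigma4:
  assumes odd: "odd CARD('a::{field,finite})"
  shows "stabiliser_and_number (Sigma4 :: ('a ^ 3 ^ 3) set)
     (semidirect (semidirect (elementary_abelian CARD('a)) (cyclic_of_order (CARD('a) - 1))) (cyclic_of_order 2))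
     (1/2 * real CARD('a)^2 * (real CARD('a)^3 - 1) * (real CARD('a) + 1))"
proof (rule stabiliser_and_number_complement[OF odd rank_one_Sigma4 Sigma4_group_closed])
  have 2: "(2 :: 'a) \<noteq> 0" using odd by (rule two_neq_0_if_odd_card)
  show "A ** M ** transpose A \<in> Sigma4" if A': "A \<in> Sigma4_group" and M': "M \<in> Sigma4" for A M :: "'a ^ 3 ^ 3"
  proof -
    obtain \<alpha> \<beta> \<gamma> where M: "M = m3 \<alpha> 0 \<gamma> 0 \<beta> \<gamma> \<gamma> \<gamma> 0" using M' unfolding Sigma4_def mat3_m3 by blast
    show ?thesis using A' unfolding Sigma4_group_param
      by (auto simp: M m3_mult m3_transpose Sigma4_mem algebra_simps)
  qed
  show "\<exists>k. \<exists>h\<in>Sigma4_group. k \<noteq> 0 \<and> A = mat k ** h"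
    if inv: "invertible A" and pres: "\<And>M. M \<in> Sigma4 \<Longrightarrow> A ** M ** transpose A \<in> Sigma4" for A :: "'a ^ 3 ^ 3"
  proof -
    obtain a b c d e f g h i where A: "A = m3 a b c d e f g h i" by (rule m3_cases)
    have 1: "g = 0" "a * d = 0"
      using pres[of "m3 1 0 0 0 0 0 0 0 0"] by (simp_all add: A m3_mult m3_transpose Sigma4_mem)
    have 2: "h = 0" "b * e = 0"
      using pres[of "m3 0 0 0 0 1 0 0 0 0"] by (simp_all add: A m3_mult m3_transpose Sigma4_mem)
    have i: "i \<noteq> 0" using inv 1 2 by (auto simp: A m3_invertible)
    have 3: "(a + b) * i = (d + e) * i" "c * (d + e) + (a + b) * f = 0"
      using pres[of "m3 0 0 1 0 0 1 1 1 0"] 1 2 by (simp_all add: A m3_mult m3_transpose Sigma4_mem algebra_simps)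
    have ab: "a + b = d + e" using 3(1) i by simp
    show ?thesis
    proof (cases "a = 0")
      case False
      then have "d = 0" using 1 by simp
      then have e: "e \<noteq> 0" using inv 1 2 by (auto simp: A m3_invertible)
      then have "b = 0" using 2 by simp
      then have "e = a" using ab \<open>d = 0\<close> by simp
      have "a * (c + f) = 0" using 3(2) \<open>e = a\<close> \<open>b = 0\<close> \<open>d = 0\<close> by (simp add: algebra_simps)
      then have "f = - c" using False by (simp add: eq_neg_iff_add_eq_0 add.commute)
      then have "A = mat i ** m3 (a / i) 0 (c / i) 0 (a / i) (- (c / i)) 0 0 1"
        using i 1 2 \<open>d = 0\<close> \<open>b = 0\<close> \<open>e = a\<close> by (simp add: A m3_scale)
      moreover have "m3 (a / i) 0 (c / i) 0 (a / i) (- (c / i)) 0 0 1 \<in> Sigma4_group"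
        using False i by (simp add: Sigma4_group_def)
      ultimately show ?thesis using i by blast
    next
      case True
      then have b: "b \<noteq> 0" using inv 1 2 by (auto simp: A m3_invertible)
      then have "e = 0" using 2 by simp
      then have "d = b" using ab True by simp
      have "b * (c + f) = 0" using 3(2) \<open>d = b\<close> \<open>e = 0\<close> True by (simp add: algebra_simps)
      then have "f = - c" using b by (simp add: eq_neg_iff_add_eq_0 add.commute)
      then have "A = mat i ** m3 0 (b / i) (c / i) (b / i) 0 (- (c / i)) 0 0 1"
        using i 1 2 \<open>e = 0\<close> \<open>d = b\<close> True by (simp add: A m3_scale)
      moreover have "m3 0 (b / i) (c / i) (b / i) 0 (- (c / i)) 0 0 1 \<in> Sigma4_group"
        using b i by (simp add: Sigma4_group_def)
      ultimately show ?thesis using i by blast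
    qed
  qed
  show "c = 1" if "A \<in> Sigma4_group" "mat c ** A \<in> Sigma4_group" for A and c :: 'a
    using that by (simp add: Sigma4_group_def matrix3_scale_nth)
  show "semidirect (semidirect (elementary_abelian CARD('a)) (cyclic_of_order (CARD('a) - 1))) (cyclic_of_order 2)
     (GL\<lparr>carrier := Sigma4_group :: ('a ^ 3 ^ 3) set\<rparr>)" using 2 by (rule Sigma4_group_semidirect)
  show "1/2 * real CARD('a)^2 * (real CARD('a)^3 - 1) * (real CARD('a) + 1) * real (card (Sigma4_group :: ('a ^ 3 ^ 3) set)) = order_PGL3 CARD('a)"
    unfolding card_Sigma4_group[OF 2] of_nat_mult real_card_minus_1 of_nat_numeral by (rule number_of_order_two_extension)
qed (assumption+, intro iso_transfer_semidirect iso_transfer_basic)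

section \<open>The types \<open>\<Sigma>\<^sub>9\<close> and \<open>\<Sigma>\<^sub>1\<^sub>0\<close>\<close>

text \<open>
  For \<open>k \<noteq> 0\<close> the determinant \<open>-k\<gamma>(\<alpha>\<gamma> - \<beta>\<^sup>2)\<close> describes a conic together with one of its
  tangents. The two types are the cases \<open>k = 1\<close> and \<open>k = \<epsilon>\<close>. The stabiliser does not depend on
  \<open>k\<close>, because the entries \<open>e\<close> and \<open>i\<close> in positions \<open>(2, 2)\<close> and \<open>(3, 3)\<close> are only constrained
  by \<open>ki\<^sup>2 = ke\<^sup>2\<close>.
\<close>

definition tangent_conic_plane :: "'a::field \<Rightarrow> ('a ^ 3 ^ 3) set" where
  "tangent_conic_plane k = {m3 \<alpha> \<beta> 0 \<beta> \<gamma> 0 0 0 (- (k * \<gamma>)) | \<alpha> \<beta> \<gamma>. True}"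

lemma Sigma9_eq: "Sigma9 = tangent_conic_plane 1" and Sigma10_eq: "Sigma10 \<epsilon> = tangent_conic_plane \<epsilon>"
  unfolding Sigma9_def Sigma10_def tangent_conic_plane_def mat3_m3 by simp_all

lemma tangent_conic_plane_mem:
  "m3 a b c d e f g h i \<in> tangent_conic_plane k \<longleftrightarrow> c = 0 \<and> d = b \<and> f = 0 \<and> g = 0 \<and> h = 0 \<and> i = - (k * e)"
  unfolding tangent_conic_plane_def by auto

lemma rank_one_tangent_conic_plane: "rank_one_plane (tangent_conic_plane k)"
  unfolding tangent_conic_plane_def
  by (rule rank_one_planeI3[where a=1 and b=0 and c=0 and x=1 and y=0 and z=0, OF refl])
     (simp_all add: m3_add m3_scale m3_eq_0_iff m3_transpose algebra_simps)

definition tangent_conic_group :: "('a::field ^ 3 ^ 3) set" where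
  "tangent_conic_group = {A. A$1$1 = 1 \<and> A$1$3 = 0 \<and> A$2$1 = 0 \<and> A$2$3 = 0 \<and> A$3$1 = 0 \<and> A$3$2 = 0 \<and>
     A$2$2 \<noteq> 0 \<and> (A$3$3 = A$2$2 \<or> A$3$3 = - A$2$2)}"

lemma tangent_conic_group_param:
  "A \<in> tangent_conic_group \<longleftrightarrow> (\<exists>s b u. (s = 1 \<or> s = - 1) \<and> b \<noteq> 0 \<and> A = m3 1 u 0 0 b 0 0 0 (s * b))"
proof
  assume A: "A \<in> tangent_conic_group"
  then have "A = m3 1 (A$1$2) 0 0 (A$2$2) 0 0 0 (1 * A$2$2) \<or> A = m3 1 (A$1$2) 0 0 (A$2$2) 0 0 0 (- 1 * A$2$2)"
    by (auto simp: tangent_conic_group_def matrix3_eq_iff)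
  moreover have "A$2$2 \<noteq> 0" using A by (simp add: tangent_conic_group_def)
  ultimately show "\<exists>s b u. (s = 1 \<or> s = - 1) \<and> b \<noteq> 0 \<and> A = m3 1 u 0 0 b 0 0 0 (s * b)" by blast
qed (auto simp: tangent_conic_group_def)

lemma tangent_conic_group_closed:
  "(tangent_conic_group :: ('a::field ^ 3 ^ 3) set) \<noteq> {}"
  "A \<in> (tangent_conic_group :: ('a::field ^ 3 ^ 3) set) \<Longrightarrow> invertible A"
  "A \<in> tangent_conic_group \<Longrightarrow> B \<in> tangent_conic_group \<Longrightarrow> A ** B \<in> (tangent_conic_group :: ('a::field ^ 3 ^ 3) set)"
proof -
  have "m3 1 0 0 0 1 0 0 0 1 \<in> (tangent_conic_group :: ('a ^ 3 ^ 3) set)" by (simp add: tangent_conic_group_def)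
  then show "(tangent_conic_group :: ('a::field ^ 3 ^ 3) set) \<noteq> {}" by blast
  show "invertible A" if "A \<in> (tangent_conic_group :: ('a::field ^ 3 ^ 3) set)"
    using that by (auto simp: tangent_conic_group_def invertible3)
  show "A ** B \<in> (tangent_conic_group :: ('a::field ^ 3 ^ 3) set)" if "A \<in> tangent_conic_group" "B \<in> tangent_conic_group"
    using that by (auto simp: tangent_conic_group_def matrix3_mult_nth)
qed

lemma card_tangent_conic_group:
  assumes 2: "(2 :: 'a::{field,finite}) \<noteq> 0"
  shows "card (tangent_conic_group :: ('a ^ 3 ^ 3) set) = 2 * ((CARD('a) - 1) * CARD('a))"
proof -
  let ?h = "\<lambda>(s :: 'a, b, u). m3 1 u 0 0 b 0 0 0 (s * b)"
  have img: "tangent_conic_group = ?h ` ({1, - 1} \<times> (UNIV - {0}) \<times> UNIV)"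
  proof
    show "tangent_conic_group \<subseteq> ?h ` ({1, - 1} \<times> (UNIV - {0}) \<times> UNIV)"
    proof
      fix A :: "'a ^ 3 ^ 3" assume "A \<in> tangent_conic_group"
      then obtain s b u where "s = 1 \<or> s = - 1" "b \<noteq> 0" "A = m3 1 u 0 0 b 0 0 0 (s * b)"
        unfolding tangent_conic_group_param by blast
      then show "A \<in> ?h ` ({1, - 1} \<times> (UNIV - {0}) \<times> UNIV)"
        by (intro image_eqI[of _ _ "(s, b, u)"]) auto
    qed
    show "?h ` ({1, - 1} \<times> (UNIV - {0}) \<times> UNIV) \<subseteq> tangent_conic_group" by (auto simp: tangent_conic_group_def)
  qed
  have "inj_on ?h ({1, - 1} \<times> (UNIV - {0}) \<times> UNIV)" by (auto simp: inj_on_def)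
  from card_eq_card_param[OF img this] show ?thesis
    by (simp add: card_cartesian_product card_signs[OF 2])
qed

lemma tangent_conic_group_semidirect:
  assumes 2: "(2 :: 'a::{field,finite}) \<noteq> 0"
  shows "semidirect (semidirect (elementary_abelian CARD('a)) (cyclic_of_order (CARD('a) - 1))) (cyclic_of_order 2)
     (GL\<lparr>carrier := tangent_conic_group :: ('a ^ 3 ^ 3) set\<rparr>)"
proof (rule semidirect_of_sign[OF 2 _ _ _ _ _ _ iso_transfer_E_C,
      where \<theta> = "\<lambda>A. A$3$3 / A$2$2" and t = "m3 1 0 0 0 1 0 0 0 (- 1)"])
  let ?H = "tangent_conic_group :: ('a ^ 3 ^ 3) set"
  let ?\<theta> = "\<lambda>A :: 'a ^ 3 ^ 3. A$3$3 / A$2$2"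
  show "group (GL\<lparr>carrier := ?H\<rparr>)" by (intro group_subgroup_GL tangent_conic_group_closed)
  show "?\<theta> \<in> hom (GL\<lparr>carrier := ?H\<rparr>) sign_group"
    by (auto simp: hom_def tangent_conic_group_def matrix3_mult_nth)
  show "m3 1 0 0 0 1 0 0 0 (- 1) \<in> ?H" by (simp add: tangent_conic_group_def)
  show "m3 1 0 0 0 1 0 0 0 (- 1) ** m3 1 0 0 0 1 0 0 0 (- 1) = (mat 1 :: 'a ^ 3 ^ 3)" by (simp add: m3_mult m3_scalar)
  show "?\<theta> (m3 1 0 0 0 1 0 0 0 (- 1)) = - 1" by simp
  have K: "{A \<in> ?H. ?\<theta> A = 1} = {A \<in> ?H. A$3$3 = A$2$2}" by (auto simp: tangent_conic_group_def)
  have K': "A \<in> ?H \<and> A$3$3 = A$2$2 \<longleftrightarrow> (\<exists>b u. b \<noteq> 0 \<and> A = m3 1 u 0 0 b 0 0 0 b)" for A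
    by (auto simp: tangent_conic_group_def matrix3_eq_iff)
  show "semidirect (elementary_abelian CARD('a)) (cyclic_of_order (CARD('a) - 1)) (GL\<lparr>carrier := {A \<in> ?H. ?\<theta> A = 1}\<rparr>)"
    unfolding K
  proof (rule semidirect_of_split_hom[where \<theta> = "\<lambda>A. A$2$2" and \<sigma> = "\<lambda>b. m3 1 0 0 0 b 0 0 0 b"
      and \<iota> = "\<lambda>u. m3 1 u 0 0 1 0 0 0 1", OF _ group_unit group_additive _ _ _ _ _ _
        elementary_abelian_additive iso_transfer_basic(1) cyclic_unit_group iso_transfer_basic(2)])
    show "group (GL\<lparr>carrier := {A \<in> ?H. A$3$3 = A$2$2}\<rparr>)"
    proof (intro group_subgroup_GL)
      have "m3 1 0 0 0 1 0 0 0 1 \<in> {A \<in> ?H. A$3$3 = A$2$2}" by (simp add: tangent_conic_group_def)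
      then show "{A \<in> ?H. A$3$3 = A$2$2} \<noteq> {}" by blast
    qed (auto simp: tangent_conic_group_closed matrix3_mult_nth tangent_conic_group_def)
    show "(\<lambda>A. A$2$2) \<in> hom (GL\<lparr>carrier := {A \<in> ?H. A$3$3 = A$2$2}\<rparr>) unit_group"
      by (auto simp: hom_def tangent_conic_group_def matrix3_mult_nth)
    show "(\<lambda>b. m3 1 0 0 0 b 0 0 0 b) \<in> hom unit_group (GL\<lparr>carrier := {A \<in> ?H. A$3$3 = A$2$2}\<rparr>)"
      by (auto simp: hom_def tangent_conic_group_def m3_mult)
    show "(\<lambda>u. m3 1 u 0 0 1 0 0 0 1) \<in> hom additive_group (GL\<lparr>carrier := {A \<in> ?H. A$3$3 = A$2$2}\<rparr>)"
      by (auto simp: hom_def tangent_conic_group_def m3_mult algebra_simps)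
    show "(\<lambda>u. m3 1 u 0 0 1 0 0 0 1) ` carrier additive_group =
        {A \<in> carrier (GL\<lparr>carrier := {A \<in> ?H. A$3$3 = A$2$2}\<rparr>). A$2$2 = \<one>\<^bsub>unit_group\<^esub>}"
      by (auto simp: K' image_iff)
  qed (auto simp: inj_on_def)
qed

lemma stabiliser_and_number_tangent_conic_plane:
  assumes odd: "odd CARD('a::{field,finite})" and k: "k \<noteq> 0"
  shows "stabiliser_and_number (tangent_conic_plane k :: ('a ^ 3 ^ 3) set)
     (semidirect (semidirect (elementary_abelian CARD('a)) (cyclic_of_order (CARD('a) - 1))) (cyclic_of_order 2))
     (1/2 * real CARD('a)^2 * (real CARD('a)^3 - 1) * (real CARD('a) + 1))"
proof (rule stabiliser_and_number_complement[OF odd rank_one_tangent_conic_plane tangent_conic_group_closed])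
  let ?P = "tangent_conic_plane k"
  have 2: "(2 :: 'a) \<noteq> 0" using odd by (rule two_neq_0_if_odd_card)
  show "A ** M ** transpose A \<in> ?P" if A': "A \<in> tangent_conic_group" and M': "M \<in> ?P" for A M :: "'a ^ 3 ^ 3"
  proof -
    obtain \<alpha> \<beta> \<gamma> where M: "M = m3 \<alpha> \<beta> 0 \<beta> \<gamma> 0 0 0 (- (k * \<gamma>))" using M' unfolding tangent_conic_plane_def by blast
    show ?thesis using A' unfolding tangent_conic_group_param
      by (auto simp: M m3_mult m3_transpose tangent_conic_plane_mem algebra_simps)
  qed
  show "\<exists>k. \<exists>h\<in>tangent_conic_group. k \<noteq> 0 \<and> A = mat k ** h"
    if inv: "invertible A" and pres: "\<And>M. M \<in> ?P \<Longrightarrow> A ** M ** transpose A \<in> ?P" for A :: "'a ^ 3 ^ 3"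
  proof -
    obtain a b c d e f g h i where A: "A = m3 a b c d e f g h i" by (rule m3_cases)
    have 1: "a * g = 0" "d * g = 0" "g * g = - (k * (d * d))"
      using pres[of "m3 1 0 0 0 0 0 0 0 0"] by (simp_all add: A m3_mult m3_transpose tangent_conic_plane_mem)
    have g0: "g = 0"
    proof (rule ccontr)
      assume "g \<noteq> 0"
      then have "d = 0" using 1(2) by simp
      then show False using 1(3) \<open>g \<noteq> 0\<close> by simp
    qed
    then have g: "g = 0" "d = 0" using 1(3) k by simp_all
    have a: "a \<noteq> 0" using inv g by (auto simp: A m3_invertible)
    have h: "h = 0"
      using pres[of "m3 0 1 0 1 0 0 0 0 0"] g a by (simp add: A m3_mult m3_transpose tangent_conic_plane_mem)
    have ei: "e \<noteq> 0" "i \<noteq> 0" using inv g h by (auto simp: A m3_invertible)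
    have 3: "c * k * i = 0" "f * k * i = 0" "i * k * i = k * (e * e - k * f * f)"
      using pres[of "m3 0 0 0 0 1 0 0 0 (- k)"] g h by (simp_all add: A m3_mult m3_transpose tangent_conic_plane_mem algebra_simps)
    have cf: "c = 0" "f = 0" using 3 k ei by auto
    have "k * (i\<^sup>2 - e\<^sup>2) = 0" using 3(3) cf by (simp add: algebra_simps power2_eq_square)
    then have "i = e \<or> i = - e" using k by (simp add: power2_eq_iff)
    then have "m3 1 (b / a) 0 0 (e / a) 0 0 0 (i / a) \<in> tangent_conic_group"
      using a ei by (auto simp: tangent_conic_group_def)
    moreover have "A = mat a ** m3 1 (b / a) 0 0 (e / a) 0 0 0 (i / a)" using a g h cf by (simp add: A m3_scale)
    ultimately show ?thesis using a by blast
  qed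
  show "c = 1" if "A \<in> tangent_conic_group" "mat c ** A \<in> tangent_conic_group" for A and c :: 'a
    using that by (simp add: tangent_conic_group_def matrix3_scale_nth)
  show "semidirect (semidirect (elementary_abelian CARD('a)) (cyclic_of_order (CARD('a) - 1))) (cyclic_of_order 2)
     (GL\<lparr>carrier := tangent_conic_group :: ('a ^ 3 ^ 3) set\<rparr>)" using 2 by (rule tangent_conic_group_semidirect)
  show "1/2 * real CARD('a)^2 * (real CARD('a)^3 - 1) * (real CARD('a) + 1) * real (card (tangent_conic_group :: ('a ^ 3 ^ 3) set)) = order_PGL3 CARD('a)"
    unfolding card_tangent_conic_group[OF 2] of_nat_mult real_card_minus_1 of_nat_numeral by (rule number_of_order_two_extension)
qed (assumption+, intro iso_transfer_semidirect iso_transfer_basic)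

section \<open>The type \<open>\<Sigma>\<^sub>1\<^sub>5\<close>\<close>

lemma Sigma15_mem: "m3 a b c d e f g h i \<in> Sigma15 \<longleftrightarrow> d = b \<and> e = c \<and> g = c \<and> f = 0 \<and> h = 0 \<and> i = 0"
  unfolding Sigma15_def mat3_m3 by auto

lemma rank_one_Sigma15: "rank_one_plane Sigma15"
  unfolding Sigma15_def mat3_m3
  by (rule rank_one_planeI3[where a=1 and b=0 and c=0 and x=1 and y=0 and z=0, OF refl])
     (simp_all add: m3_add m3_scale m3_eq_0_iff m3_transpose)

definition unitriangular :: "('a::field ^ 3 ^ 3) set" where
  "unitriangular = {A. A$1$1 = 1 \<and> A$2$2 = 1 \<and> A$3$3 = 1 \<and> A$2$1 = 0 \<and> A$3$1 = 0 \<and> A$3$2 = 0}"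

text \<open>
  The plane is spanned by \<open>x\<^sup>2\<close>, \<open>xy\<close> and \<open>y\<^sup>2 + 2xz\<close>; upper triangular matrices preserve it as
  soon as the diagonal has the form \<open>1, d, d\<^sup>2\<close> up to scalars. The unitriangular matrices are
  the factor of order \<open>q\<^sup>3\<close>.
\<close>

definition Sigma15_group :: "('a::field ^ 3 ^ 3) set" where
  "Sigma15_group = {A. A$1$1 = 1 \<and> A$2$1 = 0 \<and> A$3$1 = 0 \<and> A$3$2 = 0 \<and> A$2$2 \<noteq> 0 \<and> A$3$3 = A$2$2 * A$2$2}"

lemma unitriangular_param: "A \<in> unitriangular \<longleftrightarrow> (\<exists>u v w. A = m3 1 u w 0 1 v 0 0 1)"
  by (auto simp: unitriangular_def matrix3_eq_iff)

lemma Sigma15_group_param: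
  "A \<in> Sigma15_group \<longleftrightarrow> (\<exists>d u v w. d \<noteq> 0 \<and> A = m3 1 u w 0 d v 0 0 (d * d))"
  by (auto simp: Sigma15_group_def matrix3_eq_iff)

lemma group_unitriangular: "group (GL\<lparr>carrier := unitriangular :: ('a::{field,finite} ^ 3 ^ 3) set\<rparr>)"
proof (rule group_subgroup_GL)
  have "m3 1 0 0 0 1 0 0 0 1 \<in> (unitriangular :: ('a ^ 3 ^ 3) set)" by (simp add: unitriangular_def)
  then show "(unitriangular :: ('a ^ 3 ^ 3) set) \<noteq> {}" by blast
qed (auto simp: unitriangular_def invertible3 matrix3_mult_nth)

lemma Sigma15_group_closed:
  "(Sigma15_group :: ('a::field ^ 3 ^ 3) set) \<noteq> {}"
  "A \<in> (Sigma15_group :: ('a::field ^ 3 ^ 3) set) \<Longrightarrow> invertible A"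
  "A \<in> Sigma15_group \<Longrightarrow> B \<in> Sigma15_group \<Longrightarrow> A ** B \<in> (Sigma15_group :: ('a::field ^ 3 ^ 3) set)"
proof -
  have "m3 1 0 0 0 1 0 0 0 1 \<in> (Sigma15_group :: ('a ^ 3 ^ 3) set)" by (simp add: Sigma15_group_def)
  then show "(Sigma15_group :: ('a::field ^ 3 ^ 3) set) \<noteq> {}" by blast
qed (auto simp: Sigma15_group_def invertible3 matrix3_mult_nth)

lemma card_Sigma15_group:
  "card (Sigma15_group :: ('a::{field,finite} ^ 3 ^ 3) set) = (CARD('a) - 1) * (CARD('a) * (CARD('a) * CARD('a)))"
proof -
  let ?h = "\<lambda>(d :: 'a, u, v, w). m3 1 u w 0 d v 0 0 (d * d)"
  have img: "Sigma15_group = ?h ` ((UNIV - {0}) \<times> UNIV \<times> UNIV \<times> UNIV)"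
  proof
    show "Sigma15_group \<subseteq> ?h ` ((UNIV - {0}) \<times> UNIV \<times> UNIV \<times> UNIV)"
    proof
      fix A :: "'a ^ 3 ^ 3" assume "A \<in> Sigma15_group"
      then obtain d u v w where "d \<noteq> 0" "A = m3 1 u w 0 d v 0 0 (d * d)" unfolding Sigma15_group_param by blast
      then show "A \<in> ?h ` ((UNIV - {0}) \<times> UNIV \<times> UNIV \<times> UNIV)"
        by (intro image_eqI[where x = "(d, u, v, w)" and f = "?h"]) auto
    qed
  qed (auto simp: Sigma15_group_def)
  have "inj_on ?h ((UNIV - {0}) \<times> UNIV \<times> UNIV \<times> UNIV)" by (auto simp: inj_on_def)
  from card_eq_card_param[OF img this] show ?thesis by (simp add: card_cartesian_product)
qed

lemma central_extension_unitriangular: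
  "central_extension TYPE('a::{field,finite}) (GL\<lparr>carrier := unitriangular :: ('a ^ 3 ^ 3) set\<rparr>)"
  unfolding central_extension_def
proof
  let ?U = "GL\<lparr>carrier := unitriangular :: ('a ^ 3 ^ 3) set\<rparr>"
  interpret U: group ?U by (rule group_unitriangular)
  have centre: "group_centre ?U = range (\<lambda>w. m3 1 0 w 0 1 0 0 0 1)"
  proof
    show "group_centre ?U \<subseteq> range (\<lambda>w. m3 1 0 w 0 1 0 0 0 1)"
    proof
      fix A assume A: "A \<in> group_centre ?U"
      then obtain u v w where uvw: "A = m3 1 u w 0 1 v 0 0 1" by (auto simp: group_centre_def unitriangular_param)
      have "m3 1 1 0 0 1 0 0 0 1 \<in> (unitriangular :: ('a ^ 3 ^ 3) set)" "m3 1 0 0 0 1 1 0 0 1 \<in> (unitriangular :: ('a ^ 3 ^ 3) set)"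
        by (auto simp: unitriangular_def)
      then have "A ** m3 1 1 0 0 1 0 0 0 1 = m3 1 1 0 0 1 0 0 0 1 ** A" "A ** m3 1 0 0 0 1 1 0 0 1 = m3 1 0 0 0 1 1 0 0 1 ** A"
        using A by (simp_all add: group_centre_def)
      then have "u = 0" "v = 0" by (simp_all add: uvw m3_mult)
      then show "A \<in> range (\<lambda>w. m3 1 0 w 0 1 0 0 0 1)" by (simp add: uvw)
    qed
    show "range (\<lambda>w. m3 1 0 w 0 1 0 0 0 1) \<subseteq> group_centre ?U"
      by (auto simp: group_centre_def unitriangular_param m3_mult)
  qed
  have io: "(\<lambda>w. m3 1 0 w 0 1 0 0 0 1) \<in> hom (additive_group :: 'a monoid) ?U"
    by (auto simp: hom_def unitriangular_def m3_mult add.commute)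
  have "subgroup ((\<lambda>w. m3 1 0 w 0 1 0 0 0 1) ` carrier (additive_group :: 'a monoid)) ?U"
    using io by (intro group_hom.img_is_subgroup) (simp add: group_hom_def group_hom_axioms_def group_additive U.group_axioms)
  then have sub: "subgroup (group_centre ?U) ?U" unfolding centre by simp
  show "elementary_abelian CARD('a) (?U\<lparr>carrier := group_centre ?U\<rparr>)"
  proof (rule elementary_abelian_iso[OF _ _ elementary_abelian_additive])
    show "group (?U\<lparr>carrier := group_centre ?U\<rparr>)" by (rule U.subgroup_imp_group[OF sub])
    show "(additive_group :: 'a monoid) \<cong> ?U\<lparr>carrier := group_centre ?U\<rparr>"
      unfolding centre
      by (rule is_isoI[where h = "\<lambda>w. m3 1 0 w 0 1 0 0 0 1"])
         (use io in \<open>auto simp: iso_def hom_def bij_betw_def inj_on_def\<close>)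
  qed
  show "\<exists>\<pi>\<in>hom ?U ((additive_group :: 'a monoid) \<times>\<times> (additive_group :: 'a monoid)).
      \<pi> ` carrier ?U = UNIV \<and> {x \<in> carrier ?U. \<pi> x = (0, 0)} = group_centre ?U"
  proof (intro bexI conjI)
    show "(\<lambda>A. (A$1$2, A$2$3)) \<in> hom ?U ((additive_group :: 'a monoid) \<times>\<times> (additive_group :: 'a monoid))"
      by (auto simp: hom_def unitriangular_def matrix3_mult_nth)
    have "(u, v) \<in> (\<lambda>A. (A$1$2, A$2$3)) ` carrier ?U" for u v :: 'a
      by (rule image_eqI[of _ _ "m3 1 u 0 0 1 v 0 0 1"]) (auto simp: unitriangular_def)
    then show "(\<lambda>A. (A$1$2, A$2$3)) ` carrier ?U = UNIV" by auto
    show "{x \<in> carrier ?U. (x$1$2, x$2$3) = (0, 0)} = group_centre ?U"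
      unfolding centre by (auto simp: unitriangular_param)
  qed
qed

lemma Sigma15_group_semidirect:
  "semidirect (central_extension TYPE('a)) (cyclic_of_order (CARD('a) - 1))
     (GL\<lparr>carrier := Sigma15_group :: ('a::{field,finite} ^ 3 ^ 3) set\<rparr>)"
proof (rule semidirect_of_split_hom[where \<theta> = "\<lambda>A. A$2$2" and \<sigma> = "\<lambda>d. m3 1 0 0 0 d 0 0 0 (d * d)"
      and \<iota> = "\<lambda>A. A", OF _ group_unit group_unitriangular _ _ _ _ _ _
        central_extension_unitriangular iso_transfer_central_extension(1) cyclic_unit_group iso_transfer_basic(2)])
  let ?H = "Sigma15_group :: ('a ^ 3 ^ 3) set"
  show "group (GL\<lparr>carrier := ?H\<rparr>)" by (intro group_subgroup_GL Sigma15_group_closed)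
  show "(\<lambda>A. A$2$2) \<in> hom (GL\<lparr>carrier := ?H\<rparr>) unit_group"
    by (auto simp: hom_def Sigma15_group_def matrix3_mult_nth)
  show "(\<lambda>d. m3 1 0 0 0 d 0 0 0 (d * d)) \<in> hom unit_group (GL\<lparr>carrier := ?H\<rparr>)"
    by (auto simp: hom_def Sigma15_group_def m3_mult)
  show "(\<lambda>A. A) \<in> hom (GL\<lparr>carrier := unitriangular\<rparr>) (GL\<lparr>carrier := ?H\<rparr>)"
    by (auto simp: hom_def Sigma15_group_def unitriangular_def)
  show "(\<lambda>A. A) ` carrier (GL\<lparr>carrier := unitriangular\<rparr>) = {A \<in> carrier (GL\<lparr>carrier := ?H\<rparr>). A$2$2 = \<one>\<^bsub>unit_group\<^esub>}"
    by (auto simp: Sigma15_group_def unitriangular_def)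
qed auto

lemma stabiliser_and_number_Sigma15:
  assumes odd: "odd CARD('a::{field,finite})"
  shows "stabiliser_and_number (Sigma15 :: ('a ^ 3 ^ 3) set)
     (semidirect (E_1_plus_2 CARD('a)) (cyclic_of_order (CARD('a) - 1)))
     ((real CARD('a)^3 - 1) * (real CARD('a) + 1))"
proof (rule stabiliser_and_number_complement[where T = "semidirect (central_extension TYPE('a)) (cyclic_of_order (CARD('a) - 1))",
      OF odd rank_one_Sigma15 Sigma15_group_closed])
  show "A ** M ** transpose A \<in> Sigma15" if A': "A \<in> Sigma15_group" and M': "M \<in> Sigma15" for A M :: "'a ^ 3 ^ 3"
  proof -
    obtain \<alpha> \<beta> \<gamma> where M: "M = m3 \<alpha> \<beta> \<gamma> \<beta> \<gamma> 0 \<gamma> 0 0" using M' unfolding Sigma15_def mat3_m3 by blast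
    show ?thesis using A' unfolding Sigma15_group_param
      by (auto simp: M m3_mult m3_transpose Sigma15_mem algebra_simps)
  qed
  show "\<exists>k. \<exists>h\<in>Sigma15_group. k \<noteq> 0 \<and> A = mat k ** h"
    if inv: "invertible A" and pres: "\<And>M. M \<in> Sigma15 \<Longrightarrow> A ** M ** transpose A \<in> Sigma15" for A :: "'a ^ 3 ^ 3"
  proof -
    obtain a b c d e f g h i where A: "A = m3 a b c d e f g h i" by (rule m3_cases)
    have 1: "g = 0" "d = 0"
      using pres[of "m3 1 0 0 0 0 0 0 0 0"] by (auto simp: A m3_mult m3_transpose Sigma15_mem)
    have a: "a \<noteq> 0" using inv 1 by (auto simp: A m3_invertible)
    have h: "h = 0"
      using pres[of "m3 0 1 0 1 0 0 0 0 0"] 1 a by (simp add: A m3_mult m3_transpose Sigma15_mem)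
    have e: "e \<noteq> 0" using inv 1 h by (auto simp: A m3_invertible)
    have i: "e * e = a * i"
      using pres[of "m3 0 0 1 0 1 0 1 0 0"] 1 h by (simp add: A m3_mult m3_transpose Sigma15_mem algebra_simps)
    have "A = mat a ** m3 1 (b / a) (c / a) 0 (e / a) (f / a) 0 0 (i / a)" using 1 h a by (simp add: A m3_scale)
    moreover have "m3 1 (b / a) (c / a) 0 (e / a) (f / a) 0 0 (i / a) \<in> Sigma15_group"
      using a e i by (simp add: Sigma15_group_def)
    ultimately show ?thesis using a by blast
  qed
  show "c = 1" if "A \<in> Sigma15_group" "mat c ** A \<in> Sigma15_group" for A and c :: 'a
    using that by (simp add: Sigma15_group_def matrix3_scale_nth)
  show "(real CARD('a)^3 - 1) * (real CARD('a) + 1) * real (card (Sigma15_group :: ('a ^ 3 ^ 3) set)) = order_PGL3 CARD('a)"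
    unfolding card_Sigma15_group order_PGL3_def of_nat_mult real_card_minus_1
    by (simp add: power2_eq_square power3_eq_cube algebra_simps)
  show "semidirect (central_extension TYPE('a)) (cyclic_of_order (CARD('a) - 1)) (GL\<lparr>carrier := Sigma15_group :: ('a ^ 3 ^ 3) set\<rparr>)"
    by (rule Sigma15_group_semidirect)
qed (assumption+, intro iso_transfer_semidirect iso_transfer_basic iso_transfer_central_extension(2))

section \<open>The types \<open>\<Sigma>\<^sub>1\<^sub>1\<close> and \<open>\<Sigma>\<^sub>1\<^sub>4'\<close>\<close>

text \<open>
  The determinant \<open>-(\<alpha>\<beta>\<^sup>2 + \<gamma>(k\<beta> + \<gamma>)\<^sup>2)\<close> is a cubic with a cusp at the point of rank one. Up
  to a change of basis, \<open>\<Sigma>\<^sub>1\<^sub>1\<close> is the case \<open>k = -1\<close> in every characteristic, and in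
  characteristic three \<open>\<Sigma>\<^sub>1\<^sub>4'\<close> is the case \<open>k = 0\<close>.
\<close>

definition cuspidal_plane :: "'a::field \<Rightarrow> ('a ^ 3 ^ 3) set" where
  "cuspidal_plane k = {m3 \<alpha> (k * \<beta> + \<gamma>) 0 (k * \<beta> + \<gamma>) 0 \<beta> 0 \<beta> \<gamma> | \<alpha> \<beta> \<gamma>. True}"

lemma cuspidal_plane_mem:
  "m3 a b c d e f g h i \<in> cuspidal_plane k \<longleftrightarrow> b = k * f + i \<and> d = b \<and> c = 0 \<and> g = 0 \<and> e = 0 \<and> h = f"
  unfolding cuspidal_plane_def by auto

lemma rank_one_cuspidal_plane: "rank_one_plane (cuspidal_plane k)"
  unfolding cuspidal_plane_def
  by (rule rank_one_planeI3[where a=1 and b=0 and c=0 and x=1 and y=0 and z=0, OF refl])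
     (auto simp: m3_add m3_scale m3_eq_0_iff m3_transpose algebra_simps)

definition cuspidal_matrix :: "'a::field \<Rightarrow> 'a \<Rightarrow> 'a \<Rightarrow> 'a ^ 3 ^ 3" where
  "cuspidal_matrix k d t = m3 1 (t * (t + k)) t 0 (d * d) 0 0 (- (d * t)) d"

text \<open>
  The relation \<open>3t = k(d - 1)\<close> decides the structure. If three is invertible, it makes \<open>t\<close> a
  function of \<open>d\<close>. In characteristic three it forces \<open>d = 1\<close> and leaves \<open>t\<close> free if \<open>k = -1\<close>,
  and it is void if \<open>k = 0\<close>.
\<close>

definition cuspidal_group :: "'a::field \<Rightarrow> ('a ^ 3 ^ 3) set" where
  "cuspidal_group k = {cuspidal_matrix k d t | d t. d \<noteq> 0 \<and> 3 * t = k * (d - 1)}"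

lemma cuspidal_matrix_eq_iff: "cuspidal_matrix k d t = cuspidal_matrix k d' t' \<longleftrightarrow> d = d' \<and> t = t'"
  by (auto simp: cuspidal_matrix_def)

lemma cuspidal_matrix_mult:
  assumes "3 * t' = k * (d' - 1)"
  shows "cuspidal_matrix k d t ** cuspidal_matrix k d' t' = cuspidal_matrix k (d * d') (t' + t * d')"
proof -
  have "t' * (t' + k) + t * (t + k) * (d' * d') + t * - (d' * t') - (t' + t * d') * (t' + t * d' + k) =
      t * d' * (k * (d' - 1) - 3 * t')"
    by (simp add: algebra_simps)
  then have "t' * (t' + k) + t * (t + k) * (d' * d') + t * - (d' * t') = (t' + t * d') * (t' + t * d' + k)"
    using assms by simp
  then show ?thesis by (simp add: cuspidal_matrix_def m3_mult algebra_simps)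
qed

lemma cuspidal_group_closed:
  "(cuspidal_group k :: ('a::field ^ 3 ^ 3) set) \<noteq> {}"
  "A \<in> (cuspidal_group k :: ('a::field ^ 3 ^ 3) set) \<Longrightarrow> invertible A"
  "A \<in> cuspidal_group k \<Longrightarrow> B \<in> cuspidal_group k \<Longrightarrow> A ** B \<in> (cuspidal_group k :: ('a::field ^ 3 ^ 3) set)"
proof -
  have "cuspidal_matrix k 1 0 \<in> (cuspidal_group k :: ('a ^ 3 ^ 3) set)" unfolding cuspidal_group_def by force
  then show "(cuspidal_group k :: ('a::field ^ 3 ^ 3) set) \<noteq> {}" by blast
  show "invertible A" if "A \<in> (cuspidal_group k :: ('a::field ^ 3 ^ 3) set)"
    using that by (auto simp: cuspidal_group_def cuspidal_matrix_def m3_invertible)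
  show "A ** B \<in> (cuspidal_group k :: ('a::field ^ 3 ^ 3) set)" if "A \<in> cuspidal_group k" "B \<in> cuspidal_group k"
  proof -
    obtain d t d' t' where *: "A = cuspidal_matrix k d t" "d \<noteq> 0" "3 * t = k * (d - 1)"
       "B = cuspidal_matrix k d' t'" "d' \<noteq> 0" "3 * t' = k * (d' - 1)"
      using \<open>A \<in> cuspidal_group k\<close> \<open>B \<in> cuspidal_group k\<close> unfolding cuspidal_group_def by blast
    have "3 * (t' + t * d') = 3 * t' + 3 * t * d'" by (simp add: algebra_simps)
    also have "\<dots> = k * (d * d' - 1)" unfolding * by (simp add: algebra_simps)
    finally have "3 * (t' + t * d') = k * (d * d' - 1)" .
    moreover have "A ** B = cuspidal_matrix k (d * d') (t' + t * d')" using cuspidal_matrix_mult[OF *(6)] * by simp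
    moreover have "d * d' \<noteq> 0" using * by simp
    ultimately show ?thesis unfolding cuspidal_group_def by blast
  qed
qed

lemma stabiliser_and_number_cuspidal_plane:
  fixes k :: "'a::{field,finite}"
  assumes odd: "odd CARD('a)"
    and T: "T (GL\<lparr>carrier := cuspidal_group k\<rparr>)" "iso_transfer T T'"
    and m: "m * real (card (cuspidal_group k)) = order_PGL3 CARD('a)"
  shows "stabiliser_and_number (cuspidal_plane k) T' m"
proof (rule stabiliser_and_number_complement[where T = T, OF odd rank_one_cuspidal_plane cuspidal_group_closed(1) _ _ _ _ _ T m])
  let ?P = "cuspidal_plane k"
  show "invertible A" if "A \<in> cuspidal_group k" for A using that by (rule cuspidal_group_closed(2))
  show "A ** B \<in> cuspidal_group k" if "A \<in> cuspidal_group k" "B \<in> cuspidal_group k" for A B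
    using that by (rule cuspidal_group_closed(3))
  show "A ** M ** transpose A \<in> ?P" if A': "A \<in> cuspidal_group k" and M': "M \<in> ?P" for A M
  proof -
    obtain \<alpha> \<beta> \<gamma> where M: "M = m3 \<alpha> (k * \<beta> + \<gamma>) 0 (k * \<beta> + \<gamma>) 0 \<beta> 0 \<beta> \<gamma>" using M' unfolding cuspidal_plane_def by blast
    obtain d t where A: "A = cuspidal_matrix k d t" "d \<noteq> 0" "3 * t = k * (d - 1)" using A' unfolding cuspidal_group_def by blast
    have "3 * (\<beta> * (d * (d * t))) = d * d * \<beta> * (3 * t)" by (simp add: algebra_simps)
    then have eq3: "3 * (\<beta> * (d * (d * t))) + d * d * (k * \<beta>) = k * (d * d * d * \<beta>)"
      unfolding A(3) by (simp add: algebra_simps)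
    show ?thesis using eq3 by (simp add: A(1) cuspidal_matrix_def M m3_mult m3_transpose cuspidal_plane_mem algebra_simps)
  qed
  show "\<exists>c. \<exists>h\<in>cuspidal_group k. c \<noteq> 0 \<and> A = mat c ** h"
    if inv: "invertible A" and pres: "\<And>M. M \<in> ?P \<Longrightarrow> A ** M ** transpose A \<in> ?P" for A
  proof -
    obtain a b c d e f g h i where A: "A = m3 a b c d e f g h i" by (rule m3_cases)
    have 1: "d = 0" "g = 0"
      using pres[of "m3 1 0 0 0 0 0 0 0 0"] by (auto simp: A m3_mult m3_transpose cuspidal_plane_mem)
    have a: "a \<noteq> 0" using inv 1 by (auto simp: A m3_invertible)
    have 2: "f = 0" "c * i + a * h = 0" "a * e = i * i"
      using pres[of "m3 0 1 0 1 0 0 0 0 1"] 1 by (auto simp: A m3_mult m3_transpose cuspidal_plane_mem algebra_simps)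
    have ei: "e \<noteq> 0" "i \<noteq> 0" using inv 1 2 by (auto simp: A m3_invertible)
    have 3: "b * i + c * h + k * (a * h) = 0" "e * c + k * (a * e) = k * (e * i) + 2 * (h * i)"
      using pres[of "m3 0 k 0 k 0 1 0 1 0"] 1 2(1) by (auto simp: A m3_mult m3_transpose cuspidal_plane_mem algebra_simps)
    \<comment> \<open>After normalising a = 1, the entries in positions (1, 3) and (3, 3) determine all
        others.\<close>
    define t D where "t = c / a" and "D = i / a"
    have c: "c = a * t" and i: "i = a * D" and D: "D \<noteq> 0" using a ei by (auto simp: t_def D_def)
    have e: "e = a * (D * D)" using 2(3) a by (simp add: i mult.left_commute)
    have "a * (h + a * (D * t)) = 0" using 2(2) by (simp add: c i algebra_simps)
    then have h: "h = a * (- (D * t))" using a by (simp add: eq_neg_iff_add_eq_0)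
    have "a * D * (b - a * (t * (t + k))) = 0" using 3(1) by (simp add: c i h algebra_simps)
    then have b: "b = a * (t * (t + k))" using a D by simp
    have "a * a * (D * D) * (3 * t - k * (D - 1)) = 0" using 3(2) by (simp add: c i h e algebra_simps)
    then have t: "3 * t = k * (D - 1)" using a D by simp
    have "A = mat a ** cuspidal_matrix k D t" using 1 2(1) by (simp add: A cuspidal_matrix_def m3_scale b c e h i)
    moreover have "cuspidal_matrix k D t \<in> cuspidal_group k" using D t unfolding cuspidal_group_def by blast
    ultimately show ?thesis using a by blast
  qed
  show "c = 1" if "A \<in> cuspidal_group k" "mat c ** A \<in> cuspidal_group k" for A c
    using that by (auto simp: cuspidal_group_def cuspidal_matrix_def m3_scale)
qed

text \<open>
  The new basis consists of \<open>(0, 1, 1)\<close>, which spans the point of rank one, and of the first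
  and third coordinate vectors.
\<close>

lemma Sigma11_from_cuspidal_plane:
  assumes "stabiliser_and_number (cuspidal_plane (- 1 :: 'a::{field,finite})) T m"
  shows "stabiliser_and_number (Sigma11 :: ('a ^ 3 ^ 3) set) T m"
proof -
  have mem: "m3 a b c d e f g h i \<in> Sigma11 \<longleftrightarrow> a = 0 \<and> d = b \<and> g = c \<and> f = e \<and> h = e \<and> i = e + c"
    for a b c d e f g h i :: 'a unfolding Sigma11_def mat3_m3 by auto
  show ?thesis
  proof (rule stabiliser_and_number_base_change[OF assms _ rank_one_cuspidal_plane])
    show "invertible (m3 0 1 0 1 0 0 1 0 1 :: 'a ^ 3 ^ 3)" by (simp add: m3_invertible)
    show "rank_one_plane (Sigma11 :: ('a ^ 3 ^ 3) set)"
      unfolding Sigma11_def mat3_m3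
      by (rule rank_one_planeI3[where a=1 and b=0 and c=0 and x=0 and y=1 and z=1, OF refl])
         (auto simp: m3_add m3_scale m3_eq_0_iff m3_transpose algebra_simps)
    fix M :: "'a ^ 3 ^ 3" assume "M \<in> cuspidal_plane (- 1)"
    then obtain \<alpha> \<beta> \<gamma> where M: "M = m3 \<alpha> (- 1 * \<beta> + \<gamma>) 0 (- 1 * \<beta> + \<gamma>) 0 \<beta> 0 \<beta> \<gamma>"
      unfolding cuspidal_plane_def by blast
    show "m3 0 1 0 1 0 0 1 0 1 ** M ** transpose (m3 0 1 0 1 0 0 1 0 1) \<in> Sigma11"
      by (simp add: M m3_mult m3_transpose mem algebra_simps)
  qed
qed

text \<open>
  The first basis vector spans the point of rank one in both planes; the other two vectors are
  \<open>(1, 1, 0)\<close> and \<open>(1, 1, -1)\<close>.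
\<close>

lemma Sigma14'_from_cuspidal_plane:
  assumes 3: "(3 :: 'a::{field,finite}) = 0"
    and "stabiliser_and_number (cuspidal_plane (0 :: 'a)) T m"
  shows "stabiliser_and_number (Sigma14' :: ('a ^ 3 ^ 3) set) T m"
proof -
  have mem: "m3 a b c d e f g h i \<in> Sigma14' \<longleftrightarrow> b = d \<and> c = d \<and> f = d \<and> g = d \<and> h = d \<and> e = d - i"
    for a b c d e f g h i :: 'a
  proof
    assume "m3 a b c d e f g h i \<in> Sigma14'"
    then show "b = d \<and> c = d \<and> f = d \<and> g = d \<and> h = d \<and> e = d - i" unfolding Sigma14'_def mat3_m3 by (auto simp: algebra_simps)
  next
    assume *: "b = d \<and> c = d \<and> f = d \<and> g = d \<and> h = d \<and> e = d - i"
    then have "m3 a b c d e f g h i = m3 ((a - d) + d) d d d (- i + d) d d d (- (- i))" by auto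
    then show "m3 a b c d e f g h i \<in> Sigma14'" unfolding Sigma14'_def mat3_m3 by blast
  qed
  show ?thesis
  proof (rule stabiliser_and_number_base_change[OF assms(2) _ rank_one_cuspidal_plane])
    show "invertible (m3 1 1 1 0 1 1 0 0 (- 1) :: 'a ^ 3 ^ 3)" by (simp add: m3_invertible)
    show "rank_one_plane (Sigma14' :: ('a ^ 3 ^ 3) set)"
      unfolding Sigma14'_def mat3_m3
      by (rule rank_one_planeI3[where a=1 and b=0 and c=0 and x=1 and y=0 and z=0, OF refl])
         (auto simp: m3_add m3_scale m3_eq_0_iff m3_transpose algebra_simps)
    fix M :: "'a ^ 3 ^ 3" assume "M \<in> cuspidal_plane 0"
    then obtain \<alpha> \<beta> \<gamma> where M: "M = m3 \<alpha> (0 * \<beta> + \<gamma>) 0 (0 * \<beta> + \<gamma>) 0 \<beta> 0 \<beta> \<gamma>"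
      unfolding cuspidal_plane_def by blast
    show "m3 1 1 1 0 1 1 0 0 (- 1) ** M ** transpose (m3 1 1 1 0 1 1 0 0 (- 1)) \<in> Sigma14'"
      by (simp add: M m3_mult m3_transpose mem 3 algebra_simps)
  qed
qed

lemma stabiliser_and_number_Sigma11_if_3_neq_0:
  assumes odd: "odd CARD('a::{field,finite})" and 3: "(3 :: 'a) \<noteq> 0"
  shows "stabiliser_and_number (Sigma11 :: ('a ^ 3 ^ 3) set) (cyclic_of_order (CARD('a) - 1))
     (real CARD('a)^3 * (real CARD('a)^3 - 1) * (real CARD('a) + 1))"
proof (rule Sigma11_from_cuspidal_plane, rule stabiliser_and_number_cuspidal_plane[OF odd _ iso_transfer_basic(2)])
  let ?H = "cuspidal_group (- 1 :: 'a)" and ?h = "\<lambda>d :: 'a. cuspidal_matrix (- 1) d ((1 - d) / 3)"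
  have img: "?H = ?h ` (UNIV - {0})"
  proof
    show "?H \<subseteq> ?h ` (UNIV - {0})"
    proof
      fix A assume "A \<in> ?H"
      then obtain d t where A: "A = cuspidal_matrix (- 1) d t" "d \<noteq> 0" "3 * t = - 1 * (d - 1)"
        unfolding cuspidal_group_def by blast
      then have "t = (1 - d) / 3" using 3 by (simp add: eq_divide_eq mult.commute)
      then show "A \<in> ?h ` (UNIV - {0})" using A by blast
    qed
    show "?h ` (UNIV - {0}) \<subseteq> ?H" unfolding cuspidal_group_def using 3 by force
  qed
  have inj: "inj_on ?h (UNIV - {0})" by (auto simp: inj_on_def cuspidal_matrix_eq_iff)
  have card: "card ?H = CARD('a) - 1" using card_eq_card_param[OF img inj] by simp
  have gr: "group (GL\<lparr>carrier := ?H\<rparr>)" by (rule group_subgroup_GL) (rule cuspidal_group_closed; assumption)+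
  have "?h \<in> iso unit_group (GL\<lparr>carrier := ?H\<rparr>)"
  proof -
    have "?h (d * d') = ?h d ** ?h d'" for d d' :: 'a
    proof -
      have "3 * ((1 - d') / 3) = - 1 * (d' - 1)" using 3 by simp
      from cuspidal_matrix_mult[OF this, of d "(1 - d) / 3"]
      have mult: "?h d ** ?h d' = cuspidal_matrix (- 1) (d * d') ((1 - d') / 3 + (1 - d) / 3 * d')" .
      have eq: "(1 - d') / 3 + (1 - d) / 3 * d' = (1 - d * d') / 3" using 3 by (simp add: field_simps)
      show ?thesis unfolding mult eq ..
    qed
    moreover have "?h d \<in> ?H" if "d \<noteq> 0" for d unfolding img using that by blast
    ultimately show ?thesis using img inj by (auto simp: iso_def hom_def bij_betw_def)
  qed
  then have "(unit_group :: 'a monoid) \<cong> GL\<lparr>carrier := ?H\<rparr>" by (rule is_isoI)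
  then show "cyclic_of_order (CARD('a) - 1) (GL\<lparr>carrier := ?H\<rparr>)"
    by (rule cyclic_of_order_iso[OF gr _ cyclic_unit_group])
  show "real CARD('a)^3 * (real CARD('a)^3 - 1) * (real CARD('a) + 1) * real (card ?H) = order_PGL3 CARD('a)"
    unfolding card order_PGL3_def real_card_minus_1 by (simp add: power2_eq_square power3_eq_cube algebra_simps)
qed

lemma stabiliser_and_number_Sigma11_if_3_eq_0:
  assumes odd: "odd CARD('a::{field,finite})" and 3: "(3 :: 'a) = 0"
  shows "stabiliser_and_number (Sigma11 :: ('a ^ 3 ^ 3) set) (elementary_abelian CARD('a))
     (real CARD('a)^2 * (real CARD('a)^3 - 1) * (real CARD('a)^2 - 1))"
proof (rule Sigma11_from_cuspidal_plane, rule stabiliser_and_number_cuspidal_plane[OF odd _ iso_transfer_basic(1)])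
  let ?H = "cuspidal_group (- 1 :: 'a)" and ?h = "\<lambda>t :: 'a. cuspidal_matrix (- 1) 1 t"
  have img: "?H = ?h ` UNIV" unfolding cuspidal_group_def using 3 by auto
  have inj: "inj_on ?h UNIV" by (auto simp: inj_on_def cuspidal_matrix_eq_iff)
  have card: "card ?H = CARD('a)" using card_eq_card_param[OF img inj] by simp
  have gr: "group (GL\<lparr>carrier := ?H\<rparr>)" by (rule group_subgroup_GL) (rule cuspidal_group_closed; assumption)+
  have "?h \<in> iso additive_group (GL\<lparr>carrier := ?H\<rparr>)"
  proof -
    have "?h (t + t') = ?h t ** ?h t'" for t t' :: 'a
    proof -
      have "3 * t' = - 1 * (1 - 1)" using 3 by simp
      from cuspidal_matrix_mult[OF this, of 1 t] show ?thesis by (simp add: add.commute)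
    qed
    moreover have "?h t \<in> ?H" for t unfolding img by blast
    ultimately show ?thesis using img inj by (auto simp: iso_def hom_def bij_betw_def)
  qed
  then have "(additive_group :: 'a monoid) \<cong> GL\<lparr>carrier := ?H\<rparr>" by (rule is_isoI)
  then show "elementary_abelian CARD('a) (GL\<lparr>carrier := ?H\<rparr>)"
    by (rule elementary_abelian_iso[OF gr _ elementary_abelian_additive])
  show "real CARD('a)^2 * (real CARD('a)^3 - 1) * (real CARD('a)^2 - 1) * real (card ?H) = order_PGL3 CARD('a)"
    unfolding card order_PGL3_def by (simp add: power2_eq_square power3_eq_cube algebra_simps)
qed

lemma stabiliser_and_number_Sigma14':
  assumes odd: "odd CARD('a::{field,finite})" and 3: "(3 :: 'a) = 0"
  shows "stabiliser_and_number (Sigma14' :: ('a ^ 3 ^ 3) set)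
     (semidirect (elementary_abelian CARD('a)) (cyclic_of_order (CARD('a) - 1)))
     (real CARD('a)^2 * (real CARD('a)^3 - 1) * (real CARD('a) + 1))"
proof (rule Sigma14'_from_cuspidal_plane[OF 3], rule stabiliser_and_number_cuspidal_plane[OF odd])
  let ?H = "cuspidal_group (0 :: 'a)" and ?h = "\<lambda>(d :: 'a, t). cuspidal_matrix 0 d t"
  have mem: "A \<in> ?H \<longleftrightarrow> (\<exists>d t. d \<noteq> 0 \<and> A = cuspidal_matrix 0 d t)" for A
    unfolding cuspidal_group_def using 3 by auto
  have img: "?H = ?h ` ((UNIV - {0}) \<times> UNIV)"
  proof (intro equalityI subsetI)
    fix A assume "A \<in> ?H"
    then obtain d t where "d \<noteq> 0" "A = cuspidal_matrix 0 d t" unfolding mem by blast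
    then show "A \<in> ?h ` ((UNIV - {0}) \<times> UNIV)" by (intro image_eqI[where x = "(d, t)" and f = "?h"]) auto
  next
    fix A assume "A \<in> ?h ` ((UNIV - {0}) \<times> UNIV)"
    then obtain d t where "d \<noteq> 0" "A = cuspidal_matrix 0 d t" by auto
    then show "A \<in> ?H" unfolding mem by blast
  qed
  have inj: "inj_on ?h ((UNIV - {0}) \<times> UNIV)" by (auto simp: inj_on_def cuspidal_matrix_eq_iff)
  have card: "card ?H = (CARD('a) - 1) * CARD('a)"
    using card_eq_card_param[OF img inj] by (simp add: card_cartesian_product)
  have gr: "group (GL\<lparr>carrier := ?H\<rparr>)" by (rule group_subgroup_GL) (rule cuspidal_group_closed; assumption)+
  have mult: "cuspidal_matrix 0 d t ** cuspidal_matrix 0 d' t' = cuspidal_matrix 0 (d * d') (t' + t * d')" for d t d' t' :: 'a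
    by (rule cuspidal_matrix_mult) (simp add: 3)
  have mem': "cuspidal_matrix 0 d t \<in> ?H \<longleftrightarrow> d \<noteq> 0" for d t
    unfolding mem by (auto simp: cuspidal_matrix_eq_iff)
  have nth: "cuspidal_matrix 0 d t $ 3 $ 3 = d" for d t :: 'a by (simp add: cuspidal_matrix_def)
  show "semidirect (elementary_abelian CARD('a)) (cyclic_of_order (CARD('a) - 1)) (GL\<lparr>carrier := ?H\<rparr>)"
  proof (rule semidirect_of_split_hom[where \<theta> = "\<lambda>A. A$3$3" and \<sigma> = "\<lambda>d. cuspidal_matrix 0 d 0"
      and \<iota> = "\<lambda>t. cuspidal_matrix 0 1 t", OF gr group_unit group_additive _ _ _ _ _ _
        elementary_abelian_additive iso_transfer_basic(1) cyclic_unit_group iso_transfer_basic(2)])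
    show "(\<lambda>A. A$3$3) \<in> hom (GL\<lparr>carrier := ?H\<rparr>) unit_group"
      by (auto simp: hom_def mem mult nth)
    show "(\<lambda>d. cuspidal_matrix 0 d 0) \<in> hom unit_group (GL\<lparr>carrier := ?H\<rparr>)"
      by (auto simp: hom_def mem' mult)
    show "(\<lambda>t. cuspidal_matrix 0 1 t) \<in> hom additive_group (GL\<lparr>carrier := ?H\<rparr>)"
      by (auto simp: hom_def mem' mult add.commute)
    show "(\<lambda>t. cuspidal_matrix 0 1 t) ` carrier additive_group = {A \<in> carrier (GL\<lparr>carrier := ?H\<rparr>). A$3$3 = \<one>\<^bsub>unit_group\<^esub>}"
      by (auto simp: mem' nth) (auto simp: mem nth)
  qed (auto simp: inj_on_def cuspidal_matrix_eq_iff nth)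
  show "real CARD('a)^2 * (real CARD('a)^3 - 1) * (real CARD('a) + 1) * real (card ?H) = order_PGL3 CARD('a)"
    unfolding card order_PGL3_def of_nat_mult real_card_minus_1 by (simp add: power2_eq_square power3_eq_cube algebra_simps)
qed (intro iso_transfer_semidirect iso_transfer_basic)

section \<open>The type \<open>\<Sigma>\<^sub>5\<close>\<close>

text \<open>
  The plane of \<open>\<Sigma>\<^sub>5\<close> is spanned by \<open>x\<^sup>2\<close>, \<open>y\<^sup>2\<close> and \<open>z\<^sup>2 + 2xz + 2yz\<close>. In terms of
  \<open>w = x + y + z\<close> the last generator becomes \<open>w\<^sup>2 - 2xy\<close> modulo the first two, so that in this
  basis the stabiliser is monomial.
\<close>

definition Sigma5_normal_form :: "('a::field ^ 3 ^ 3) set" where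
  "Sigma5_normal_form = {m3 \<alpha> (- \<gamma>) 0 (- \<gamma>) \<beta> 0 0 0 \<gamma> | \<alpha> \<beta> \<gamma>. True}"

lemma Sigma5_normal_form_mem:
  "m3 a b c d e f g h i \<in> Sigma5_normal_form \<longleftrightarrow> b = - i \<and> d = - i \<and> c = 0 \<and> f = 0 \<and> g = 0 \<and> h = 0"
  unfolding Sigma5_normal_form_def by auto

lemma rank_one_Sigma5_normal_form: "rank_one_plane Sigma5_normal_form"
  unfolding Sigma5_normal_form_def
  by (rule rank_one_planeI3[where a=1 and b=0 and c=0 and x=1 and y=0 and z=0, OF refl])
     (simp_all add: m3_add m3_scale m3_eq_0_iff m3_transpose)

definition Sigma5_group :: "('a::field ^ 3 ^ 3) set" where
  "Sigma5_group = {A. A$1$3 = 0 \<and> A$2$3 = 0 \<and> A$3$1 = 0 \<and> A$3$2 = 0 \<and> A$3$3 = 1 \<and>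
     (A$1$2 = 0 \<and> A$2$1 = 0 \<and> A$1$1 * A$2$2 = 1 \<or> A$1$1 = 0 \<and> A$2$2 = 0 \<and> A$1$2 * A$2$1 = 1)}"

lemma Sigma5_group_param:
  "A \<in> Sigma5_group \<longleftrightarrow> (\<exists>a. a \<noteq> 0 \<and> (A = m3 a 0 0 0 (1 / a) 0 0 0 1 \<or> A = m3 0 a 0 (1 / a) 0 0 0 0 1))"
proof
  assume A: "A \<in> Sigma5_group"
  have inv: "a \<noteq> 0 \<and> b = 1 / a" if "a * b = 1" for a b :: 'a
    using that by (auto simp: eq_divide_eq mult.commute)
  show "\<exists>a. a \<noteq> 0 \<and> (A = m3 a 0 0 0 (1 / a) 0 0 0 1 \<or> A = m3 0 a 0 (1 / a) 0 0 0 0 1)"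
  proof (cases "A$1$2 = 0")
    case True
    then have "A = m3 (A$1$1) 0 0 0 (1 / A$1$1) 0 0 0 1" "A$1$1 \<noteq> 0"
      using A inv by (auto simp: Sigma5_group_def matrix3_eq_iff)
    then show ?thesis by blast
  next
    case False
    then have "A = m3 0 (A$1$2) 0 (1 / A$1$2) 0 0 0 0 1"
      using A inv by (auto simp: Sigma5_group_def matrix3_eq_iff)
    then show ?thesis using False by blast
  qed
qed (auto simp: Sigma5_group_def)

lemma Sigma5_group_closed:
  "(Sigma5_group :: ('a::field ^ 3 ^ 3) set) \<noteq> {}"
  "A \<in> (Sigma5_group :: ('a::field ^ 3 ^ 3) set) \<Longrightarrow> invertible A"
  "A \<in> Sigma5_group \<Longrightarrow> B \<in> Sigma5_group \<Longrightarrow> A ** B \<in> (Sigma5_group :: ('a::field ^ 3 ^ 3) set)"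
proof -
  have "m3 1 0 0 0 1 0 0 0 1 \<in> (Sigma5_group :: ('a ^ 3 ^ 3) set)" by (simp add: Sigma5_group_def)
  then show "(Sigma5_group :: ('a::field ^ 3 ^ 3) set) \<noteq> {}" by blast
  show "invertible A" if "A \<in> (Sigma5_group :: ('a::field ^ 3 ^ 3) set)"
    using that by (auto simp: Sigma5_group_param m3_invertible)
  show "A ** B \<in> (Sigma5_group :: ('a::field ^ 3 ^ 3) set)" if "A \<in> Sigma5_group" "B \<in> Sigma5_group"
    using that unfolding Sigma5_group_param[of A] Sigma5_group_param[of B]
    by (auto simp: Sigma5_group_def m3_mult)
qed

lemma card_Sigma5_group:
  assumes 2: "(2 :: 'a::{field,finite}) \<noteq> 0"
  shows "card (Sigma5_group :: ('a ^ 3 ^ 3) set) = 2 * (CARD('a) - 1)"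
proof -
  let ?h = "\<lambda>(s :: 'a, a :: 'a). if s = 1 then m3 a 0 0 0 (1 / a) 0 0 0 1 else m3 0 a 0 (1 / a) 0 0 0 0 1"
  have img: "Sigma5_group = ?h ` ({1, - 1} \<times> (UNIV - {0}))"
  proof
    show "Sigma5_group \<subseteq> ?h ` ({1, - 1} \<times> (UNIV - {0}))"
    proof
      fix A :: "'a ^ 3 ^ 3" assume "A \<in> Sigma5_group"
      then obtain a where "a \<noteq> 0" "A = m3 a 0 0 0 (1 / a) 0 0 0 1 \<or> A = m3 0 a 0 (1 / a) 0 0 0 0 1"
        unfolding Sigma5_group_param by blast
      then have "\<exists>s\<in>{1, - 1}. A = ?h (s, a)" by (auto simp: one_neq_minus_one[OF 2])
      then obtain s :: 'a where "s \<in> {1, - 1}" "A = ?h (s, a)" by blast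
      then show "A \<in> ?h ` ({1, - 1} \<times> (UNIV - {0}))"
        using \<open>a \<noteq> 0\<close> by (intro image_eqI[where x = "(s, a)" and f = "?h"]) auto
    qed
    show "?h ` ({1, - 1} \<times> (UNIV - {0})) \<subseteq> Sigma5_group"
      using 2 2[symmetric] by (auto simp: Sigma5_group_def)
  qed
  have "inj_on ?h ({1, - 1} \<times> (UNIV - {0}))" by (auto simp: inj_on_def one_neq_minus_one[OF 2])
  from card_eq_card_param[OF img this] show ?thesis
    by (simp add: card_cartesian_product card_signs[OF 2])
qed

lemma Sigma5_group_semidirect:
  assumes 2: "(2 :: 'a::{field,finite}) \<noteq> 0"
  shows "semidirect (cyclic_of_order (CARD('a) - 1)) (cyclic_of_order 2)
     (GL\<lparr>carrier := Sigma5_group :: ('a ^ 3 ^ 3) set\<rparr>)"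
proof (rule semidirect_of_sign[OF 2 _ _ _ _ _ _ iso_transfer_basic(2),
      where \<theta> = "\<lambda>A. if A$1$2 = 0 then 1 else - 1" and t = "m3 0 1 0 1 0 0 0 0 1"])
  let ?H = "Sigma5_group :: ('a ^ 3 ^ 3) set"
  let ?\<theta> = "\<lambda>A :: 'a ^ 3 ^ 3. if A$1$2 = 0 then 1 else - 1 :: 'a"
  show gH: "group (GL\<lparr>carrier := ?H\<rparr>)" by (intro group_subgroup_GL Sigma5_group_closed)
  show "?\<theta> \<in> hom (GL\<lparr>carrier := ?H\<rparr>) sign_group"
    by (auto simp: hom_def Sigma5_group_param m3_mult)
  show "m3 0 1 0 1 0 0 0 0 1 \<in> ?H" by (simp add: Sigma5_group_def)
  show "m3 0 1 0 1 0 0 0 0 1 ** m3 0 1 0 1 0 0 0 0 1 = (mat 1 :: 'a ^ 3 ^ 3)" by (simp add: m3_mult m3_scalar)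
  show "?\<theta> (m3 0 1 0 1 0 0 0 0 1) = - 1" by simp
  let ?K = "{A \<in> ?H. ?\<theta> A = 1}" and ?h = "\<lambda>a :: 'a. m3 a 0 0 0 (1 / a) 0 0 0 1"
  have K: "?K = ?h ` (UNIV - {0})"
    by (auto simp: Sigma5_group_param one_neq_minus_one[OF 2] split: if_splits)
  have gr: "group (GL\<lparr>carrier := ?K\<rparr>)"
  proof (unfold K, rule group_subgroup_GL)
    have "?h 1 \<in> ?h ` (UNIV - {0})" by (rule imageI) simp
    then show "?h ` (UNIV - {0}) \<noteq> {}" by blast
  qed (auto simp: m3_invertible m3_mult split: if_splits)
  have "?h \<in> iso unit_group (GL\<lparr>carrier := ?K\<rparr>)"
    unfolding K by (auto simp: iso_def hom_def bij_betw_def inj_on_def m3_mult)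
  then have "(unit_group :: 'a monoid) \<cong> GL\<lparr>carrier := ?K\<rparr>" by (rule is_isoI)
  then show "cyclic_of_order (CARD('a) - 1) (GL\<lparr>carrier := ?K\<rparr>)"
    by (rule cyclic_of_order_iso[OF gr _ cyclic_unit_group])
qed

lemma stabiliser_and_number_Sigma5_normal_form:
  assumes odd: "odd CARD('a::{field,finite})"
  shows "stabiliser_and_number (Sigma5_normal_form :: ('a ^ 3 ^ 3) set)
     (semidirect (cyclic_of_order (CARD('a) - 1)) (cyclic_of_order 2))
     (1/2 * real CARD('a)^3 * (real CARD('a)^3 - 1) * (real CARD('a) + 1))"
proof (rule stabiliser_and_number_complement[OF odd rank_one_Sigma5_normal_form Sigma5_group_closed])
  let ?P = "Sigma5_normal_form :: ('a ^ 3 ^ 3) set"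
  have 2: "(2 :: 'a) \<noteq> 0" using odd by (rule two_neq_0_if_odd_card)
  show "A ** M ** transpose A \<in> ?P" if A': "A \<in> Sigma5_group" and M': "M \<in> ?P" for A M :: "'a ^ 3 ^ 3"
  proof -
    obtain \<alpha> \<beta> \<gamma> where M: "M = m3 \<alpha> (- \<gamma>) 0 (- \<gamma>) \<beta> 0 0 0 \<gamma>" using M' unfolding Sigma5_normal_form_def by blast
    show ?thesis using A' unfolding Sigma5_group_param
      by (auto simp: M m3_mult m3_transpose Sigma5_normal_form_mem)
  qed
  show "\<exists>k. \<exists>h\<in>Sigma5_group. k \<noteq> 0 \<and> A = mat k ** h"
    if inv: "invertible A" and pres: "\<And>M. M \<in> ?P \<Longrightarrow> A ** M ** transpose A \<in> ?P" for A :: "'a ^ 3 ^ 3"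
  proof -
    obtain a b c d e f g h i where A: "A = m3 a b c d e f g h i" by (rule m3_cases)
    have 1: "g = 0 \<and> a * d = 0"
    proof -
      have *: "a * d = - (g * g)" "a * g = 0" "d * g = 0"
        using pres[of "m3 1 0 0 0 0 0 0 0 0"] by (simp_all add: A m3_mult m3_transpose Sigma5_normal_form_mem)
      have "g = 0"
      proof (rule ccontr)
        assume "g \<noteq> 0"
        then have "a = 0" using *(2) by simp
        then show False using *(1) \<open>g \<noteq> 0\<close> by simp
      qed
      then show ?thesis using *(1) by simp
    qed
    have 2: "h = 0 \<and> b * e = 0"
    proof -
      have *: "b * e = - (h * h)" "b * h = 0" "e * h = 0"
        using pres[of "m3 0 0 0 0 1 0 0 0 0"] by (simp_all add: A m3_mult m3_transpose Sigma5_normal_form_mem)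
      have "h = 0"
      proof (rule ccontr)
        assume "h \<noteq> 0"
        then have "b = 0" using *(2) by simp
        then show False using *(1) \<open>h \<noteq> 0\<close> by simp
      qed
      then show ?thesis using *(1) by simp
    qed
    have i: "i \<noteq> 0" using inv 1 2 by (auto simp: A m3_invertible)
    have M: "m3 0 (- 1) 0 (- 1) 0 0 0 0 1 \<in> ?P" by (simp add: Sigma5_normal_form_mem)
    have 3: "c = 0" "f = 0"
      using pres[OF M] 1 2 i by (simp_all add: A m3_mult m3_transpose Sigma5_normal_form_mem)
    have 4: "a * e + b * d = i * i"
      using pres[OF M] 1 2 3 by (simp add: A m3_mult m3_transpose Sigma5_normal_form_mem algebra_simps)
    have eq: "A = mat i ** m3 (a / i) (b / i) 0 (d / i) (e / i) 0 0 0 1"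
      using i 1 2 3 by (simp add: A m3_scale)
    have "m3 (a / i) (b / i) 0 (d / i) (e / i) 0 0 0 1 \<in> Sigma5_group"
    proof (cases "a = 0")
      case True
      then have "b \<noteq> 0" using inv 1 2 by (auto simp: A m3_invertible)
      then have "e = 0" using 2 by simp
      then show ?thesis using True 4 i by (simp add: Sigma5_group_def)
    next
      case False
      then have "d = 0" using 1 by simp
      then have "e \<noteq> 0" using inv 1 2 by (auto simp: A m3_invertible)
      then have "b = 0" using 2 by simp
      then show ?thesis using \<open>d = 0\<close> 4 i by (simp add: Sigma5_group_def)
    qed
    then show ?thesis using i eq by blast
  qed
  show "c = 1" if "A \<in> Sigma5_group" "mat c ** A \<in> Sigma5_group" for A and c :: 'a
    using that by (simp add: Sigma5_group_def matrix3_scale_nth)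
  show "semidirect (cyclic_of_order (CARD('a) - 1)) (cyclic_of_order 2)
     (GL\<lparr>carrier := Sigma5_group :: ('a ^ 3 ^ 3) set\<rparr>)" using 2 by (rule Sigma5_group_semidirect)
  show "1/2 * real CARD('a)^3 * (real CARD('a)^3 - 1) * (real CARD('a) + 1) * real (card (Sigma5_group :: ('a ^ 3 ^ 3) set)) = order_PGL3 CARD('a)"
    unfolding card_Sigma5_group[OF 2] of_nat_mult real_card_minus_1 order_PGL3_def
    by (simp add: power2_eq_square power3_eq_cube algebra_simps)
qed (assumption+, intro iso_transfer_semidirect iso_transfer_basic)

lemma stabiliser_and_number_Sigma5:
  assumes odd: "odd CARD('a::{field,finite})"
  shows "stabiliser_and_number (Sigma5 :: ('a ^ 3 ^ 3) set)
     (semidirect (cyclic_of_order (CARD('a) - 1)) (cyclic_of_order 2))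
     (1/2 * real CARD('a)^3 * (real CARD('a)^3 - 1) * (real CARD('a) + 1))"
proof (rule stabiliser_and_number_base_change[OF stabiliser_and_number_Sigma5_normal_form[OF odd] _ rank_one_Sigma5_normal_form])
  have mem: "m3 a b c d e f g h i \<in> Sigma5 \<longleftrightarrow> b = 0 \<and> d = 0 \<and> c = i \<and> f = i \<and> g = i \<and> h = i"
    for a b c d e f g h i :: 'a unfolding Sigma5_def mat3_m3 by auto
  show "invertible (m3 1 0 1 0 1 1 0 0 1 :: 'a ^ 3 ^ 3)" by (simp add: m3_invertible)
  show "rank_one_plane (Sigma5 :: ('a ^ 3 ^ 3) set)"
    unfolding Sigma5_def mat3_m3
    by (rule rank_one_planeI3[where a=1 and b=0 and c=0 and x=1 and y=0 and z=0, OF refl])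
       (simp_all add: m3_add m3_scale m3_eq_0_iff m3_transpose)
  fix M :: "'a ^ 3 ^ 3" assume "M \<in> Sigma5_normal_form"
  then obtain \<alpha> \<beta> \<gamma> where M: "M = m3 \<alpha> (- \<gamma>) 0 (- \<gamma>) \<beta> 0 0 0 \<gamma>" unfolding Sigma5_normal_form_def by blast
  show "m3 1 0 1 0 1 1 0 0 1 ** M ** transpose (m3 1 0 1 0 1 1 0 0 1) \<in> Sigma5"
    by (simp add: M m3_mult m3_transpose mem)
qed

section \<open>The type \<open>\<Sigma>\<^sub>6\<close>\<close>

lemma Sigma6_mem: "m3 a b c d e f g h i \<in> Sigma6 \<epsilon> \<longleftrightarrow> d = b \<and> e = \<epsilon> * a \<and> c = 0 \<and> f = 0 \<and> g = 0 \<and> h = 0"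
  unfolding Sigma6_def mat3_m3 by auto

lemma rank_one_Sigma6: "rank_one_plane (Sigma6 \<epsilon>)"
  unfolding Sigma6_def mat3_m3
  by (rule rank_one_planeI3[where a=0 and b=0 and c=1 and x=0 and y=0 and z=1, OF refl])
     (simp_all add: m3_add m3_scale m3_eq_0_iff m3_transpose algebra_simps)

text \<open>
  Up to sign, the norm of \<open>x\<^sub>2 + x\<^sub>1\<surd>\<epsilon>\<close> from the quadratic extension. The symmetric matrices in
  the upper left corner of \<open>\<Sigma>\<^sub>6\<close> are those orthogonal to its Gram matrix under the trace
  pairing, so a matrix preserves them if and only if it is a similarity.
\<close>

definition norm_form :: "'a::field \<Rightarrow> 'a ^ 2 \<Rightarrow> 'a" where
  "norm_form \<epsilon> x = \<epsilon> * (x $ 1)\<^sup>2 - (x $ 2)\<^sup>2"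

lemma quadratic_form_norm_form: "quadratic_form (norm_form \<epsilon> :: 'a::field ^ 2 \<Rightarrow> 'a)"
  unfolding quadratic_form_def
  by (rule exI[of _ "\<lambda>i j. if i = j then (if i = 1 then \<epsilon> else - 1) else 0"])
     (simp add: norm_form_def sum_2 power2_eq_square)

lemma anisotropic_norm_form:
  assumes "\<not> (\<exists>x. \<epsilon> = x\<^sup>2)"
  shows "anisotropic (norm_form \<epsilon> :: 'a::field ^ 2 \<Rightarrow> 'a)"
  unfolding anisotropic_def
proof (intro allI impI)
  fix x :: "'a ^ 2" assume *: "norm_form \<epsilon> x = 0"
  have "x $ 1 = 0"
  proof (rule ccontr)
    assume "x $ 1 \<noteq> 0"
    then have "\<epsilon> = (x $ 2 / x $ 1)\<^sup>2" using * by (simp add: norm_form_def power_divide eq_divide_eq)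
    then show False using assms by blast
  qed
  then show "x = 0" using * by (simp add: norm_form_def vec_eq_iff forall_2)
qed

text \<open>
  Together the equations give \<open>(p\<^sup>2 - t\<^sup>2)(t\<^sup>2 - \<epsilon>r\<^sup>2) = 0\<close>. Since \<open>\<epsilon>\<close> is not a square, the
  second factor vanishes only for \<open>r = t = 0\<close>, against the determinant. So \<open>t = \<plusminus>p\<close>, and the
  matrix is multiplication by an element of the quadratic extension, possibly composed with
  conjugation up to sign.
\<close>

lemma norm_similarity_equations:
  fixes \<epsilon> p r s t :: "'a::field"
  assumes \<epsilon>: "\<not> (\<exists>x. \<epsilon> = x\<^sup>2)" and det: "p * t - r * s \<noteq> 0"
    and e1: "s * t = \<epsilon> * (p * r)" and e2: "\<epsilon> * p\<^sup>2 + \<epsilon>\<^sup>2 * r\<^sup>2 = s\<^sup>2 + \<epsilon> * t\<^sup>2"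
  shows "s = \<epsilon> * r \<and> t = p \<or> s = - (\<epsilon> * r) \<and> t = - p"
proof -
  have \<epsilon>0: "\<epsilon> \<noteq> 0" using \<epsilon> by (metis zero_power2)
  have "\<epsilon> * ((p\<^sup>2 - t\<^sup>2) * (t\<^sup>2 - \<epsilon> * r\<^sup>2)) = t\<^sup>2 * (\<epsilon> * p\<^sup>2 + \<epsilon>\<^sup>2 * r\<^sup>2) - \<epsilon> * (t\<^sup>2 * t\<^sup>2) - (\<epsilon> * (p * r))\<^sup>2"
    by (simp add: power2_eq_square algebra_simps)
  also have "\<dots> = 0" unfolding e2 e1[symmetric] by (simp add: power2_eq_square algebra_simps)
  finally have "p\<^sup>2 = t\<^sup>2 \<or> t\<^sup>2 = \<epsilon> * r\<^sup>2" using \<epsilon>0 by simp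
  moreover have "t\<^sup>2 \<noteq> \<epsilon> * r\<^sup>2"
  proof
    assume *: "t\<^sup>2 = \<epsilon> * r\<^sup>2"
    have "r = 0"
    proof (rule ccontr)
      assume "r \<noteq> 0"
      then have "\<epsilon> = (t / r)\<^sup>2" using * by (simp add: power_divide)
      then show False using \<epsilon> by blast
    qed
    then show False using * det by simp
  qed
  ultimately have "t = p \<or> t = - p" by (auto simp: power2_eq_iff)
  then show ?thesis
  proof (cases "p = 0")
    case True
    then have "t = 0" using \<open>t = p \<or> t = - p\<close> by auto
    then have "s\<^sup>2 = (\<epsilon> * r)\<^sup>2" using e2 True by (simp add: power_mult_distrib)
    then show ?thesis using True \<open>t = 0\<close> by (auto simp: power2_eq_iff)
  next
    case False
    from \<open>t = p \<or> t = - p\<close> show ?thesis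
    proof
      assume t: "t = p"
      then have "p * (s - \<epsilon> * r) = 0" using e1 by (simp add: algebra_simps)
      then show ?thesis using False t by simp
    next
      assume t: "t = - p"
      then have "p * (s + \<epsilon> * r) = 0" using e1 by (simp add: algebra_simps add_eq_0_iff)
      then show ?thesis using False t by (simp add: add_eq_0_iff2)
    qed
  qed
qed

lemma norm_neq_0:
  fixes \<epsilon> p r :: "'a::field"
  assumes \<epsilon>: "\<not> (\<exists>x. \<epsilon> = x\<^sup>2)" and "p \<noteq> 0 \<or> r \<noteq> 0"
  shows "p\<^sup>2 - \<epsilon> * r\<^sup>2 \<noteq> 0"
proof
  assume *: "p\<^sup>2 - \<epsilon> * r\<^sup>2 = 0"
  have "r = 0"
  proof (rule ccontr)
    assume "r \<noteq> 0"
    then have "\<epsilon> = (p / r)\<^sup>2" using * by (simp add: power_divide)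
    then show False using \<epsilon> by blast
  qed
  then show False using * assms(2) by simp
qed

lemma m2_mult_vector: "m2 p r s t *v x = vector [p * x $ 1 + r * x $ 2, s * x $ 1 + t * x $ 2]"
  by (simp add: vec_eq_iff forall_2 matrix_vector_mult_def sum_2)

lemma similarity_group_mem:
  "A \<in> carrier (similarity_group Q) \<longleftrightarrow> invertible A \<and> (\<exists>c. c \<noteq> 0 \<and> (\<forall>x. Q (A *v x) = c * Q x))"
  by (simp add: similarity_group_def)

lemma similarity_norm_form:
  fixes \<epsilon> :: "'a::field"
  assumes \<epsilon>: "\<not> (\<exists>x. \<epsilon> = x\<^sup>2)" and 2: "(2 :: 'a) \<noteq> 0"
  shows "m2 p r s t \<in> carrier (similarity_group (norm_form \<epsilon>)) \<longleftrightarrow>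
    (p \<noteq> 0 \<or> r \<noteq> 0) \<and> (s = \<epsilon> * r \<and> t = p \<or> s = - (\<epsilon> * r) \<and> t = - p)"
proof
  assume "m2 p r s t \<in> carrier (similarity_group (norm_form \<epsilon>))"
  then obtain c where det: "p * t - r * s \<noteq> 0" and c: "\<And>x. norm_form \<epsilon> (m2 p r s t *v x) = c * norm_form \<epsilon> x"
    by (auto simp: similarity_group_def m2_invertible)
  have 10: "\<epsilon> * p\<^sup>2 - s\<^sup>2 = c * \<epsilon>" using c[of "vector [1, 0]"] by (simp add: norm_form_def m2_mult_vector)
  have 01: "\<epsilon> * r\<^sup>2 - t\<^sup>2 = - c" using c[of "vector [0, 1]"] by (simp add: norm_form_def m2_mult_vector)
  have 11: "\<epsilon> * (p + r)\<^sup>2 - (s + t)\<^sup>2 = c * (\<epsilon> - 1)" using c[of "vector [1, 1]"] by (simp add: norm_form_def m2_mult_vector)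
  have "2 * (\<epsilon> * (p * r) - s * t) = (\<epsilon> * (p + r)\<^sup>2 - (s + t)\<^sup>2) - (\<epsilon> * p\<^sup>2 - s\<^sup>2) - (\<epsilon> * r\<^sup>2 - t\<^sup>2)"
    by (simp add: power2_eq_square algebra_simps)
  also have "\<dots> = 0" unfolding 10 01 11 by (simp add: algebra_simps)
  finally have "s * t = \<epsilon> * (p * r)" using 2 by simp
  moreover have "(\<epsilon> * p\<^sup>2 - s\<^sup>2) + \<epsilon> * (\<epsilon> * r\<^sup>2 - t\<^sup>2) = 0" unfolding 10 01 by simp
  then have "\<epsilon> * p\<^sup>2 + \<epsilon>\<^sup>2 * r\<^sup>2 = s\<^sup>2 + \<epsilon> * t\<^sup>2" by (simp add: power2_eq_square algebra_simps)
  ultimately have "s = \<epsilon> * r \<and> t = p \<or> s = - (\<epsilon> * r) \<and> t = - p" by (rule norm_similarity_equations[OF \<epsilon> det])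
  moreover have "p \<noteq> 0 \<or> r \<noteq> 0" using det by auto
  ultimately show "(p \<noteq> 0 \<or> r \<noteq> 0) \<and> (s = \<epsilon> * r \<and> t = p \<or> s = - (\<epsilon> * r) \<and> t = - p)" by blast
next
  assume *: "(p \<noteq> 0 \<or> r \<noteq> 0) \<and> (s = \<epsilon> * r \<and> t = p \<or> s = - (\<epsilon> * r) \<and> t = - p)"
  then have n: "p\<^sup>2 - \<epsilon> * r\<^sup>2 \<noteq> 0" using norm_neq_0[OF \<epsilon>] by blast
  have "p * t - r * s = p\<^sup>2 - \<epsilon> * r\<^sup>2 \<or> p * t - r * s = - (p\<^sup>2 - \<epsilon> * r\<^sup>2)"
    using * by (auto simp: power2_eq_square algebra_simps)
  then have "invertible (m2 p r s t)" using n unfolding m2_invertible by (metis neg_equal_0_iff_equal)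
  moreover have "norm_form \<epsilon> (m2 p r s t *v x) = (p\<^sup>2 - \<epsilon> * r\<^sup>2) * norm_form \<epsilon> x" for x
    using * by (auto simp: norm_form_def m2_mult_vector power2_eq_square algebra_simps)
  then have "\<exists>c. c \<noteq> 0 \<and> (\<forall>x. norm_form \<epsilon> (m2 p r s t *v x) = c * norm_form \<epsilon> x)"
    using n by blast
  ultimately show "m2 p r s t \<in> carrier (similarity_group (norm_form \<epsilon>))"
    unfolding similarity_group_mem by blast
qed

lemma similarity_group_mult_closed:
  assumes "A \<in> carrier (similarity_group Q)" "B \<in> carrier (similarity_group Q)"
  shows "A ** B \<in> carrier (similarity_group Q)"
proof -
  obtain c d where c: "invertible A" "c \<noteq> 0" "\<And>x. Q (A *v x) = c * Q x"
    and d: "invertible B" "d \<noteq> 0" "\<And>x. Q (B *v x) = d * Q x"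
    using assms by (auto simp: similarity_group_def)
  have "Q (A ** B *v x) = (c * d) * Q x" for x
    by (simp add: c d matrix_vector_mul_assoc[symmetric] mult.assoc)
  then show ?thesis using c d by (auto simp: similarity_group_def invertible_mult intro!: exI[of _ "c * d"])
qed

definition Sigma6_group :: "'a::field \<Rightarrow> ('a ^ 3 ^ 3) set" where
  "Sigma6_group \<epsilon> = {A. A$1$3 = 0 \<and> A$2$3 = 0 \<and> A$3$1 = 0 \<and> A$3$2 = 0 \<and> A$3$3 = 1 \<and>
     m2 (A$1$1) (A$1$2) (A$2$1) (A$2$2) \<in> carrier (similarity_group (norm_form \<epsilon>))}"

lemma Sigma6_group_closed:
  fixes \<epsilon> :: "'a::field"
  assumes \<epsilon>: "\<not> (\<exists>x. \<epsilon> = x\<^sup>2)" and 2: "(2 :: 'a) \<noteq> 0"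
  shows "Sigma6_group \<epsilon> \<noteq> {}" "A \<in> Sigma6_group \<epsilon> \<Longrightarrow> invertible A"
    "A \<in> Sigma6_group \<epsilon> \<Longrightarrow> B \<in> Sigma6_group \<epsilon> \<Longrightarrow> A ** B \<in> Sigma6_group \<epsilon>"
proof -
  have "m3 1 0 0 0 1 0 0 0 1 \<in> Sigma6_group \<epsilon>"
    unfolding Sigma6_group_def mem_Collect_eq similarity_norm_form[OF \<epsilon> 2] by simp
  then show "Sigma6_group \<epsilon> \<noteq> {}" by blast
  show "invertible A" if A: "A \<in> Sigma6_group \<epsilon>" for A
  proof -
    have "invertible (m2 (A$1$1) (A$1$2) (A$2$1) (A$2$2))"
      using A by (simp add: Sigma6_group_def similarity_group_def)
    then show ?thesis using A by (simp add: m2_invertible invertible3 Sigma6_group_def)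
  qed
  show "A ** B \<in> Sigma6_group \<epsilon>" if AB: "A \<in> Sigma6_group \<epsilon>" "B \<in> Sigma6_group \<epsilon>" for A B
  proof -
    have "m2 (A$1$1) (A$1$2) (A$2$1) (A$2$2) ** m2 (B$1$1) (B$1$2) (B$2$1) (B$2$2) \<in> carrier (similarity_group (norm_form \<epsilon>))"
      using AB by (intro similarity_group_mult_closed) (simp_all add: Sigma6_group_def)
    then show ?thesis using AB by (simp add: Sigma6_group_def matrix3_mult_nth m2_mult)
  qed
qed

lemma Sigma6_group_GO:
  fixes \<epsilon> :: "'a::{field,finite}"
  assumes \<epsilon>: "\<not> (\<exists>x. \<epsilon> = x\<^sup>2)" and 2: "(2 :: 'a) \<noteq> 0"
  shows "GO_minus_2 TYPE('a) (GL\<lparr>carrier := Sigma6_group \<epsilon>\<rparr>)"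
proof -
  let ?H = "Sigma6_group \<epsilon>" and ?f = "\<lambda>A :: 'a ^ 3 ^ 3. m2 (A$1$1) (A$1$2) (A$2$1) (A$2$2)"
  have gr: "group (GL\<lparr>carrier := ?H\<rparr>)" by (rule group_subgroup_GL) (rule Sigma6_group_closed[OF \<epsilon> 2]; assumption)+
  have "?f \<in> iso (GL\<lparr>carrier := ?H\<rparr>) (similarity_group (norm_form \<epsilon>))"
    unfolding iso_iff
  proof (intro conjI homI)
    show "?f A \<in> carrier (similarity_group (norm_form \<epsilon>))" if "A \<in> carrier (GL\<lparr>carrier := ?H\<rparr>)" for A
      using that by (simp add: Sigma6_group_def)
    show "?f (A \<otimes>\<^bsub>GL\<lparr>carrier := ?H\<rparr>\<^esub> B) = ?f A \<otimes>\<^bsub>similarity_group (norm_form \<epsilon>)\<^esub> ?f B"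
      if "A \<in> carrier (GL\<lparr>carrier := ?H\<rparr>)" "B \<in> carrier (GL\<lparr>carrier := ?H\<rparr>)" for A B
      using that by (simp add: Sigma6_group_def similarity_group_def matrix3_mult_nth m2_mult)
    show "?f ` carrier (GL\<lparr>carrier := ?H\<rparr>) = carrier (similarity_group (norm_form \<epsilon>))"
    proof (intro equalityI subsetI)
      fix B assume B: "B \<in> carrier (similarity_group (norm_form \<epsilon>))"
      obtain p r s t where pr: "B = m2 p r s t" by (rule m2_cases)
      then have "m3 p r 0 s t 0 0 0 1 \<in> ?H" using B by (simp add: Sigma6_group_def)
      then show "B \<in> ?f ` carrier (GL\<lparr>carrier := ?H\<rparr>)"
        by (intro image_eqI[of _ _ "m3 p r 0 s t 0 0 0 1"]) (simp_all add: pr)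
    qed (auto simp: Sigma6_group_def)
    show "inj_on ?f (carrier (GL\<lparr>carrier := ?H\<rparr>))"
      by (rule inj_onI) (simp add: Sigma6_group_def matrix3_eq_iff)
  qed
  then show ?thesis using gr quadratic_form_norm_form anisotropic_norm_form[OF \<epsilon>] is_isoI
    unfolding GO_minus_2_def by blast
qed

lemma card_Sigma6_group:
  fixes \<epsilon> :: "'a::{field,finite}"
  assumes \<epsilon>: "\<not> (\<exists>x. \<epsilon> = x\<^sup>2)" and 2: "(2 :: 'a) \<noteq> 0"
  shows "card (Sigma6_group \<epsilon>) = 2 * (CARD('a) * CARD('a) - 1)"
proof -
  let ?h = "\<lambda>(s :: 'a, p :: 'a, r :: 'a). m3 p r 0 (s * (\<epsilon> * r)) (s * p) 0 0 0 1"
  have img: "Sigma6_group \<epsilon> = ?h ` ({1, - 1} \<times> (UNIV - {(0, 0)}))"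
  proof (intro equalityI subsetI)
    fix A assume A: "A \<in> Sigma6_group \<epsilon>"
    obtain p r c s t f g h i where pr: "A = m3 p r c s t f g h i" by (rule m3_cases)
    have A': "c = 0" "f = 0" "g = 0" "h = 0" "i = 1" "m2 p r s t \<in> carrier (similarity_group (norm_form \<epsilon>))"
      using A by (simp_all add: pr Sigma6_group_def)
    then have *: "(p, r) \<noteq> (0, 0)" "s = \<epsilon> * r \<and> t = p \<or> s = - (\<epsilon> * r) \<and> t = - p"
      unfolding similarity_norm_form[OF \<epsilon> 2] by auto
    then have "\<exists>\<sigma>\<in>{1, - 1}. A = ?h (\<sigma>, p, r)" using A' by (auto simp: pr)
    then obtain \<sigma> :: 'a where "\<sigma> \<in> {1, - 1}" "A = ?h (\<sigma>, p, r)" by blast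
    then show "A \<in> ?h ` ({1, - 1} \<times> (UNIV - {(0, 0)}))"
      using * by (intro image_eqI[where x = "(\<sigma>, p, r)" and f = "?h"]) auto
  next
    fix A assume "A \<in> ?h ` ({1, - 1} \<times> (UNIV - {(0, 0)}))"
    then show "A \<in> Sigma6_group \<epsilon>" by (auto simp: Sigma6_group_def similarity_norm_form[OF \<epsilon> 2])
  qed
  have inj: "inj_on ?h ({1, - 1} \<times> (UNIV - {(0, 0)}))"
  proof -
    have \<epsilon>0: "\<epsilon> \<noteq> 0" using \<epsilon> by (metis zero_power2)
    show ?thesis
    proof (rule inj_onI)
      fix x y assume xy: "x \<in> {1, - 1} \<times> (UNIV - {(0, 0)})" "?h x = ?h y"
      obtain s p r where x: "x = (s, p, r)" by (rule prod_cases3)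
      obtain s' p' r' where y: "y = (s', p', r')" by (rule prod_cases3)
      have e: "p = p'" "r = r'" "s * (\<epsilon> * r) = s' * (\<epsilon> * r')" "s * p = s' * p'"
        using xy(2) unfolding x y prod.case m3_eq_iff by blast+
      moreover have "p \<noteq> 0 \<or> \<epsilon> * r \<noteq> 0" using xy(1) \<epsilon>0 unfolding x by auto
      ultimately have "s = s'" by (metis mult_cancel_right)
      then show "x = y" using e x y by simp
    qed
  qed
  have "card (UNIV - {(0, 0)} :: ('a \<times> 'a) set) = CARD('a) * CARD('a) - 1"
    by (subst card_Diff_subset) auto
  then show ?thesis using card_eq_card_param[OF img inj] by (simp add: card_cartesian_product card_signs[OF 2])
qed

lemma stabiliser_and_number_Sigma6:
  fixes \<epsilon> :: "'a::{field,finite}"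
  assumes odd: "odd CARD('a)" and \<epsilon>: "\<not> (\<exists>x. \<epsilon> = x\<^sup>2)"
  shows "stabiliser_and_number (Sigma6 \<epsilon>) (GO_minus_2 TYPE('a))
     (1/2 * real CARD('a)^3 * (real CARD('a)^3 - 1))"
proof -
  have 2: "(2 :: 'a) \<noteq> 0" using odd by (rule two_neq_0_if_odd_card)
  note grp = Sigma6_group_closed[OF \<epsilon> 2]
  have \<epsilon>0: "\<epsilon> \<noteq> 0" using \<epsilon> by (metis zero_power2)
  show ?thesis
  proof (rule stabiliser_and_number_complement[OF odd rank_one_Sigma6 grp(1), of \<epsilon>])
    show "invertible A" if "A \<in> Sigma6_group \<epsilon>" for A using that by (rule grp(2))
    show "A ** B \<in> Sigma6_group \<epsilon>" if "A \<in> Sigma6_group \<epsilon>" "B \<in> Sigma6_group \<epsilon>" for A B using that by (rule grp(3))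
    show "A ** M ** transpose A \<in> Sigma6 \<epsilon>" if A: "A \<in> Sigma6_group \<epsilon>" and M': "M \<in> Sigma6 \<epsilon>" for A M
    proof -
      obtain \<alpha> \<beta> \<gamma> where M: "M = m3 \<alpha> \<beta> 0 \<beta> (\<epsilon> * \<alpha>) 0 0 0 \<gamma>" using M' unfolding Sigma6_def mat3_m3 by blast
      obtain p r c s t f g h i where pr: "A = m3 p r c s t f g h i" by (rule m3_cases)
      have A': "c = 0" "f = 0" "g = 0" "h = 0" "i = 1" "m2 p r s t \<in> carrier (similarity_group (norm_form \<epsilon>))"
        using A by (simp_all add: pr Sigma6_group_def)
      then have "s = \<epsilon> * r \<and> t = p \<or> s = - (\<epsilon> * r) \<and> t = - p" unfolding similarity_norm_form[OF \<epsilon> 2] by auto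
      then show ?thesis using A' by (auto simp: pr M m3_mult m3_transpose Sigma6_mem algebra_simps)
    qed
    show "\<exists>k. \<exists>h\<in>Sigma6_group \<epsilon>. k \<noteq> 0 \<and> A = mat k ** h"
      if inv: "invertible A" and pres: "\<And>M. M \<in> Sigma6 \<epsilon> \<Longrightarrow> A ** M ** transpose A \<in> Sigma6 \<epsilon>" for A
    proof -
      obtain p r c s t f g h i where A: "A = m3 p r c s t f g h i" by (rule m3_cases)
      have c: "c * i = 0" "f * i = 0" "f * f = \<epsilon> * (c * c)"
        using pres[of "m3 0 0 0 0 0 0 0 0 1"] by (simp_all add: A m3_mult m3_transpose Sigma6_mem)
      have "c = 0"
      proof (rule ccontr)
        assume "c \<noteq> 0"
        then have "\<epsilon> = (f / c)\<^sup>2" using c(3) by (simp add: power2_eq_square eq_divide_eq)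
        then show False using \<epsilon> by blast
      qed
      then have cf: "c = 0" "f = 0" using c(3) by simp_all
      have i: "i \<noteq> 0" and det: "p * t - r * s \<noteq> 0" using inv cf by (auto simp: A m3_invertible algebra_simps)
      have gh: "p * g + r * \<epsilon> * h = 0" "s * g + t * \<epsilon> * h = 0" and e2: "s * s + t * \<epsilon> * t = \<epsilon> * (p * p + r * \<epsilon> * r)"
        using pres[of "m3 1 0 0 0 \<epsilon> 0 0 0 0"] cf by (simp_all add: A m3_mult m3_transpose Sigma6_mem)
      have "t * (p * g + r * \<epsilon> * h) - r * (s * g + t * \<epsilon> * h) = (p * t - r * s) * g" by (simp add: algebra_simps)
      then have g: "g = 0" using gh det by simp
      have "p * (s * g + t * \<epsilon> * h) - s * (p * g + r * \<epsilon> * h) = (p * t - r * s) * (\<epsilon> * h)" by (simp add: algebra_simps)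
      then have h: "h = 0" using gh det \<epsilon>0 by simp
      have "t * s + s * t = \<epsilon> * (r * p + p * r)"
        using pres[of "m3 0 1 0 1 0 0 0 0 0"] cf g h by (simp add: A m3_mult m3_transpose Sigma6_mem)
      then have "2 * (s * t - \<epsilon> * (p * r)) = 0" by (simp add: algebra_simps)
      then have e1: "s * t = \<epsilon> * (p * r)" using 2 by simp
      have "\<epsilon> * p\<^sup>2 + \<epsilon>\<^sup>2 * r\<^sup>2 = s\<^sup>2 + \<epsilon> * t\<^sup>2" using e2 by (simp add: power2_eq_square algebra_simps)
      from norm_similarity_equations[OF \<epsilon> det e1 this]
      have "s / i = \<epsilon> * (r / i) \<and> t / i = p / i \<or> s / i = - (\<epsilon> * (r / i)) \<and> t / i = - (p / i)" by auto
      moreover have "p / i \<noteq> 0 \<or> r / i \<noteq> 0" using det i by auto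
      ultimately have "m3 (p / i) (r / i) 0 (s / i) (t / i) 0 0 0 1 \<in> Sigma6_group \<epsilon>"
        unfolding Sigma6_group_def mem_Collect_eq m3_nth similarity_norm_form[OF \<epsilon> 2] by blast
      moreover have "A = mat i ** m3 (p / i) (r / i) 0 (s / i) (t / i) 0 0 0 1" using i cf g h by (simp add: A m3_scale)
      ultimately show ?thesis using i by blast
    qed
    show "c = 1" if "A \<in> Sigma6_group \<epsilon>" "mat c ** A \<in> Sigma6_group \<epsilon>" for A c
      using that by (simp add: Sigma6_group_def matrix3_scale_nth)
    show "GO_minus_2 TYPE('a) (GL\<lparr>carrier := Sigma6_group \<epsilon>\<rparr>)" by (rule Sigma6_group_GO[OF \<epsilon> 2])
    have card: "real (card (Sigma6_group \<epsilon>)) = 2 * (real CARD('a) * real CARD('a) - 1)"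
      unfolding card_Sigma6_group[OF \<epsilon> 2] by (simp add: of_nat_diff Suc_leI)
    show "1/2 * real CARD('a)^3 * (real CARD('a)^3 - 1) * real (card (Sigma6_group \<epsilon>)) = order_PGL3 CARD('a)"
      unfolding card order_PGL3_def by (simp add: power2_eq_square power3_eq_cube algebra_simps)
  qed (rule iso_transfer_basic)
qed

section \<open>The type \<open>\<Sigma>\<^sub>2\<close>\<close>

lemma Sigma2_mem: "m3 a b c d e f g h i \<in> Sigma2 \<longleftrightarrow> b = 0 \<and> c = 0 \<and> d = 0 \<and> f = 0 \<and> g = 0 \<and> h = 0"
  unfolding Sigma2_def mat3_m3 by auto

lemma rank_one_Sigma2: "rank_one_plane Sigma2"
  unfolding Sigma2_def mat3_m3
  by (rule rank_one_planeI3[where a=1 and b=0 and c=0 and x=1 and y=0 and z=0, OF refl])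
     (simp_all add: m3_add m3_scale m3_eq_0_iff m3_transpose)

definition permutation_matrices :: "('a::field ^ 3 ^ 3) set" where
  "permutation_matrices = {m3 1 0 0 0 1 0 0 0 1, m3 1 0 0 0 0 1 0 1 0, m3 0 1 0 1 0 0 0 0 1,
     m3 0 1 0 0 0 1 1 0 0, m3 0 0 1 1 0 0 0 1 0, m3 0 0 1 0 1 0 1 0 0}"

abbreviation diag3 :: "'a::field \<Rightarrow> 'a \<Rightarrow> 'a \<Rightarrow> 'a ^ 3 ^ 3" where
  "diag3 a b c \<equiv> m3 a 0 0 0 b 0 0 0 c"

lemma permutation_matrices_mult:
  "v \<in> permutation_matrices \<Longrightarrow> w \<in> permutation_matrices \<Longrightarrow> v ** w \<in> permutation_matrices"
  unfolding permutation_matrices_def insert_iff empty_iff by (elim disjE FalseE) (simp_all add: m3_mult)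

lemma permutation_matrix_diagonal:
  assumes "w \<in> permutation_matrices" "a \<noteq> 0" "b \<noteq> 0" "c \<noteq> 0"
  obtains a' b' c' where "a' \<noteq> 0" "b' \<noteq> 0" "c' \<noteq> 0" "w ** diag3 a b c = diag3 a' b' c' ** w"
proof -
  have "\<exists>a' b' c'. a' \<noteq> 0 \<and> b' \<noteq> 0 \<and> c' \<noteq> 0 \<and> w ** diag3 a b c = diag3 a' b' c' ** w"
    using assms unfolding permutation_matrices_def insert_iff empty_iff
    by (elim disjE FalseE) (simp_all add: m3_mult)
  then show thesis using that by blast
qed

text \<open>
  The points of rank one of the plane of diagonal matrices are the three coordinate points,
  and the stabiliser permutes them.
\<close>

lemma Sigma2_stabiliser:
  "plane_stabiliser (Sigma2 :: ('a::{field,finite} ^ 3 ^ 3) set) =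
    {diag3 a b c ** w | a b c w. a \<noteq> 0 \<and> b \<noteq> 0 \<and> c \<noteq> 0 \<and> w \<in> permutation_matrices}" (is "_ = ?S")
proof (intro equalityI subsetI)
  fix A :: "'a ^ 3 ^ 3" assume "A \<in> ?S"
  then obtain x y z w where A: "A = diag3 x y z ** w" "x \<noteq> 0" "y \<noteq> 0" "z \<noteq> 0" "w \<in> permutation_matrices" by blast
  show "A \<in> plane_stabiliser Sigma2"
  proof (rule plane_stabiliserI)
    show "invertible A" using A unfolding permutation_matrices_def insert_iff empty_iff
      by (elim disjE FalseE) (simp_all add: m3_mult m3_invertible)
    fix M :: "'a ^ 3 ^ 3" assume "M \<in> Sigma2"
    then obtain \<alpha> \<beta> \<gamma> where M: "M = diag3 \<alpha> \<beta> \<gamma>" unfolding Sigma2_def mat3_m3 by blast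
    show "A ** M ** transpose A \<in> Sigma2" using A(5) unfolding A(1) M permutation_matrices_def insert_iff empty_iff
      by (elim disjE FalseE) (simp_all add: m3_mult m3_transpose Sigma2_mem)
  qed
next
  fix A :: "'a ^ 3 ^ 3" assume A': "A \<in> plane_stabiliser Sigma2"
  obtain a b c d e f g h i where A: "A = m3 a b c d e f g h i" by (rule m3_cases)
  have pres: "M \<in> Sigma2 \<Longrightarrow> A ** M ** transpose A \<in> Sigma2" for M using plane_stabiliserD(2)[OF A'] .
  have inv: "a * (e * i - f * h) - b * (d * i - f * g) + c * (d * h - e * g) \<noteq> 0"
    using plane_stabiliserD(1)[OF A'] by (auto simp: A m3_invertible algebra_simps)
  have col1: "a = 0 \<and> d = 0 \<or> a = 0 \<and> g = 0 \<or> d = 0 \<and> g = 0"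
    using pres[of "m3 1 0 0 0 0 0 0 0 0"] by (auto simp: A m3_mult m3_transpose Sigma2_mem)
  have col2: "b = 0 \<and> e = 0 \<or> b = 0 \<and> h = 0 \<or> e = 0 \<and> h = 0"
    using pres[of "m3 0 0 0 0 1 0 0 0 0"] by (auto simp: A m3_mult m3_transpose Sigma2_mem)
  have col3: "c = 0 \<and> f = 0 \<or> c = 0 \<and> i = 0 \<or> f = 0 \<and> i = 0"
    using pres[of "m3 0 0 0 0 0 0 0 0 1"] by (auto simp: A m3_mult m3_transpose Sigma2_mem)
  have "\<exists>x y z. x \<noteq> 0 \<and> y \<noteq> 0 \<and> z \<noteq> 0 \<and> (\<exists>w\<in>permutation_matrices. A = diag3 x y z ** w)"
    using col1
  proof (elim disjE)
    assume 1: "a = 0 \<and> d = 0"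
    show ?thesis using col2 col3 inv 1 unfolding permutation_matrices_def
      by (elim disjE conjE) (simp_all add: A m3_mult)
  next
    assume 1: "a = 0 \<and> g = 0"
    show ?thesis using col2 col3 inv 1 unfolding permutation_matrices_def
      by (elim disjE conjE) (simp_all add: A m3_mult)
  next
    assume 1: "d = 0 \<and> g = 0"
    show ?thesis using col2 col3 inv 1 unfolding permutation_matrices_def
      by (elim disjE conjE) (simp_all add: A m3_mult)
  qed
  then show "A \<in> ?S" by blast
qed

text \<open>
  Scaling makes the first diagonal entry one, so every class has a unique representative
  \<open>diag(1, b, c)w\<close> with a permutation matrix \<open>w\<close>. The matrices of this form are not closed
  under multiplication, which is why the two factors of the semidirect product are sets of
  classes.
\<close>

lemma stabiliser_and_number_Sigma2:
  assumes odd: "odd CARD('a::{field,finite})"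
  shows "stabiliser_and_number (Sigma2 :: ('a ^ 3 ^ 3) set)
     (semidirect (squared (cyclic_of_order (CARD('a) - 1))) (symmetric_group 3))
     (1/6 * real CARD('a)^3 * (real CARD('a)^2 + real CARD('a) + 1) * (real CARD('a) + 1))"
proof (rule stabiliser_and_number_PGL[OF odd rank_one_Sigma2 group_proj_plane_stabiliser iso_refl,
      where T = "semidirect (squared (cyclic_of_order (CARD('a) - 1))) (symmetric_group 3)"])
  let ?R = "proj_plane_stabiliser (Sigma2 :: ('a ^ 3 ^ 3) set)"
  let ?W = "permutation_matrices :: ('a ^ 3 ^ 3) set"
  let ?A = "{proj_class (diag3 1 b c) | b c :: 'a. b \<noteq> 0 \<and> c \<noteq> 0}" and ?B = "proj_class ` ?W"
  interpret R: group ?R by (rule group_proj_plane_stabiliser)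
  have inv: "invertible (diag3 a b c)" if "a \<noteq> 0" "b \<noteq> 0" "c \<noteq> 0" for a b c :: 'a
    using that by (simp add: m3_invertible)
  have invW: "invertible w" if "w \<in> ?W" for w
    using that unfolding permutation_matrices_def insert_iff empty_iff by (elim disjE FalseE) (simp_all add: m3_invertible)
  have mult: "proj_class M \<otimes>\<^bsub>?R\<^esub> proj_class N = proj_class (M ** N)" if "invertible M" "invertible N" for M N :: "'a ^ 3 ^ 3"
    using that by (simp add: proj_plane_stabiliser_def proj_class_mult)
  have one: "\<one>\<^bsub>?R\<^esub> = proj_class (diag3 1 1 1)"
    by (simp add: proj_plane_stabiliser_def PGL_simps m3_scalar[symmetric] proj_class_def scalar_matrices_def)
  have normalise: "proj_class (diag3 a b c ** w) = proj_class (diag3 1 (b / a) (c / a) ** w)"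
    if "a \<noteq> 0" for a b c :: 'a and w
  proof -
    have "diag3 a b c = mat a ** diag3 1 (b / a) (c / a)" using that by (simp add: m3_scale)
    then have "diag3 a b c ** w = mat a ** (diag3 1 (b / a) (c / a) ** w)" by (simp add: matrix_mul_assoc)
    then show ?thesis using that unfolding proj_class_eq_iff by blast
  qed
  have carrier: "carrier ?R = {proj_class (diag3 1 b c ** w) | b c w. b \<noteq> 0 \<and> c \<noteq> 0 \<and> w \<in> ?W}"
  proof
    show "carrier ?R \<subseteq> {proj_class (diag3 1 b c ** w) | b c w. b \<noteq> 0 \<and> c \<noteq> 0 \<and> w \<in> ?W}"
    proof
      fix C assume "C \<in> carrier ?R"
      then obtain M :: "'a ^ 3 ^ 3" where M: "M \<in> plane_stabiliser Sigma2" "C = proj_class M"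
        unfolding proj_plane_stabiliser_def by auto
      from M(1) obtain a b c w where abc: "a \<noteq> 0" "b \<noteq> 0" "c \<noteq> 0" "w \<in> ?W" "M = diag3 a b c ** w"
        unfolding Sigma2_stabiliser by blast
      have "C = proj_class (diag3 1 (b / a) (c / a) ** w)" unfolding M(2) abc(5) using abc(1) by (rule normalise)
      moreover have "b / a \<noteq> 0" "c / a \<noteq> 0" using abc by simp_all
      moreover note abc(4)
      ultimately
      show "C \<in> {proj_class (diag3 1 b c ** w) | b c w. b \<noteq> 0 \<and> c \<noteq> 0 \<and> w \<in> ?W}" by blast
    qed
    show "{proj_class (diag3 1 b c ** w) | b c w. b \<noteq> 0 \<and> c \<noteq> 0 \<and> w \<in> ?W} \<subseteq> carrier ?R"
    proof
      fix C assume "C \<in> {proj_class (diag3 1 b c ** w) | b c w. b \<noteq> 0 \<and> c \<noteq> 0 \<and> w \<in> ?W}"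
      then obtain b c w where "b \<noteq> 0" "c \<noteq> 0" "w \<in> ?W" "C = proj_class (diag3 1 b c ** w)" by blast
      moreover from this have "diag3 1 b c ** w \<in> plane_stabiliser Sigma2"
        unfolding Sigma2_stabiliser by (intro CollectI exI conjI) (rule refl | assumption | simp)+
      ultimately show "C \<in> carrier ?R" by (simp add: proj_plane_stabiliser_def)
    qed
  qed
  have id_W: "diag3 1 1 1 \<in> ?W" by (simp add: permutation_matrices_def)
  \<comment> \<open>The class determines the permutation as the pattern of zeros, and then the entries up to
      a scalar that the first row shows to be one.\<close>
  have inj_class: "b = b' \<and> c = c' \<and> w = w'"
    if "proj_class (diag3 1 b c ** w) = proj_class (diag3 1 b' c' ** w')" "b \<noteq> 0" "c \<noteq> 0" "w \<in> ?W" "w' \<in> ?W"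
    for b c b' c' :: 'a and w w'
  proof -
    from that(1) obtain k where k: "k \<noteq> 0" "diag3 1 b c ** w = mat k ** (diag3 1 b' c' ** w')"
      unfolding proj_class_eq_iff by blast
    show ?thesis using that(4)
      unfolding permutation_matrices_def insert_iff empty_iff
    proof (elim disjE FalseE)
    qed (use that(2,3,5) k in \<open>unfold permutation_matrices_def insert_iff empty_iff,
        elim disjE FalseE; simp add: m3_mult m3_scale\<close>)+
  qed
  have A_sub: "?A \<subseteq> carrier ?R"
  proof
    fix C assume "C \<in> ?A"
    then obtain b c where "b \<noteq> 0" "c \<noteq> 0" "C = proj_class (diag3 1 b c ** diag3 1 1 1)" by (auto simp: m3_mult)
    then show "C \<in> carrier ?R" unfolding carrier using id_W by blast
  qed
  have B_sub: "?B \<subseteq> carrier ?R"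
  proof
    fix C assume "C \<in> ?B"
    then obtain w where "w \<in> ?W" "C = proj_class (diag3 1 1 1 ** w)"
      by (auto simp: m3_scalar[symmetric])
    then show "C \<in> carrier ?R" unfolding carrier using one_neq_zero by blast
  qed
  have A_mult: "x \<otimes>\<^bsub>?R\<^esub> y \<in> ?A" if x: "x \<in> ?A" and y: "y \<in> ?A" for x y
  proof -
    obtain b c where 1: "b \<noteq> 0" "c \<noteq> 0" "x = proj_class (diag3 1 b c)" using x by blast
    obtain b' c' where 2: "b' \<noteq> 0" "c' \<noteq> 0" "y = proj_class (diag3 1 b' c')" using y by blast
    have "x \<otimes>\<^bsub>?R\<^esub> y = proj_class (diag3 1 (b * b') (c * c'))" "b * b' \<noteq> 0" "c * c' \<noteq> 0"
      using 1 2 by (simp_all add: mult inv m3_mult)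
    then show ?thesis by blast
  qed
  have sub_A: "subgroup ?A ?R"
  proof (rule finite_closed_subgroup[OF R.group_axioms])
    have "proj_class (diag3 1 1 1) \<in> ?A" using one_neq_zero by blast
    then show "?A \<noteq> {}" by blast
  qed (use A_sub A_mult in auto)
  have sub_B: "subgroup ?B ?R"
  proof (rule finite_closed_subgroup[OF R.group_axioms])
    show "?B \<noteq> {}" using id_W by blast
    show "x \<otimes>\<^bsub>?R\<^esub> y \<in> ?B" if xy: "x \<in> ?B" "y \<in> ?B" for x y
    proof -
      obtain v w where "v \<in> ?W" "w \<in> ?W" "x = proj_class v" "y = proj_class w" using xy by blast
      then show ?thesis using invW permutation_matrices_mult by (auto simp: mult)
    qed
  qed (use B_sub in auto)
  \<comment> \<open>Permutation matrices normalise the diagonal matrices, which commute with each other.\<close>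
  have normal: "?A \<lhd> ?R"
    unfolding R.normal_inv_iff
  proof (intro conjI ballI sub_A)
    fix x y assume x: "x \<in> carrier ?R" and y: "y \<in> ?A"
    obtain b c w where 1: "b \<noteq> 0" "c \<noteq> 0" "w \<in> ?W" "x = proj_class (diag3 1 b c ** w)"
      using x unfolding carrier by blast
    obtain b' c' where 2: "b' \<noteq> 0" "c' \<noteq> 0" "y = proj_class (diag3 1 b' c')" using y by blast
    obtain a'' b'' c'' where 3: "a'' \<noteq> 0" "b'' \<noteq> 0" "c'' \<noteq> 0" "w ** diag3 1 b' c' = diag3 a'' b'' c'' ** w"
      using permutation_matrix_diagonal[OF 1(3) one_neq_zero 2(1,2)] .
    let ?z = "proj_class (diag3 a'' b'' c'')"
    have "?z = proj_class (diag3 1 (b'' / a'') (c'' / a''))"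
      using normalise[OF 3(1), of b'' c'' "diag3 1 1 1"] by (simp add: m3_mult)
    then have z: "?z \<in> ?A" using divide_eq_0_iff[of b'' a''] divide_eq_0_iff[of c'' a''] 3(1-3) by blast
    have "diag3 1 b c ** w ** diag3 1 b' c' = diag3 a'' b'' c'' ** (diag3 1 b c ** w)"
    proof -
      have "diag3 1 b c ** w ** diag3 1 b' c' = diag3 1 b c ** diag3 a'' b'' c'' ** w"
        using 3(4) by (simp add: matrix_mul_assoc[symmetric])
      also have "diag3 1 b c ** diag3 a'' b'' c'' = diag3 a'' b'' c'' ** diag3 1 b c" by (simp add: m3_mult mult.commute)
      finally show ?thesis by (simp add: matrix_mul_assoc)
    qed
    then have "x \<otimes>\<^bsub>?R\<^esub> y = ?z \<otimes>\<^bsub>?R\<^esub> x"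
      using 1 2 3 by (simp add: mult inv invW invertible_mult)
    moreover have "?z \<in> carrier ?R" using z A_sub by blast
    ultimately have "x \<otimes>\<^bsub>?R\<^esub> y \<otimes>\<^bsub>?R\<^esub> inv\<^bsub>?R\<^esub> x = ?z"
      using x by (simp add: R.m_assoc)
    then show "x \<otimes>\<^bsub>?R\<^esub> y \<otimes>\<^bsub>?R\<^esub> inv\<^bsub>?R\<^esub> x \<in> ?A" using z by simp
  qed
  have meet: "?A \<inter> ?B = {\<one>\<^bsub>?R\<^esub>}"
  proof
    show "?A \<inter> ?B \<subseteq> {\<one>\<^bsub>?R\<^esub>}"
    proof
      fix x assume "x \<in> ?A \<inter> ?B"
      then obtain b c w where *: "b \<noteq> 0" "c \<noteq> 0" "w \<in> ?W" "x = proj_class (diag3 1 b c)" "x = proj_class w" by blast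
      have "proj_class (diag3 1 b c ** diag3 1 1 1) = proj_class (diag3 1 1 1 ** w)"
        using *(4,5) by (simp add: m3_scalar[symmetric])
      from inj_class[OF this *(1,2) id_W *(3)] have "b = 1" "c = 1" by blast+
      then show "x \<in> {\<one>\<^bsub>?R\<^esub>}" using *(4) one by simp
    qed
    show "{\<one>\<^bsub>?R\<^esub>} \<subseteq> ?A \<inter> ?B" using subgroup.one_closed[OF sub_A] subgroup.one_closed[OF sub_B] by blast
  qed
  have prod: "?A <#>\<^bsub>?R\<^esub> ?B = carrier ?R"
  proof
    show "?A <#>\<^bsub>?R\<^esub> ?B \<subseteq> carrier ?R" using A_sub B_sub by (rule R.setmult_subset_G)
    show "carrier ?R \<subseteq> ?A <#>\<^bsub>?R\<^esub> ?B"
    proof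
      fix x assume "x \<in> carrier ?R"
      then obtain b c w where "b \<noteq> 0" "c \<noteq> 0" "w \<in> ?W" "x = proj_class (diag3 1 b c ** w)" unfolding carrier by blast
      moreover from this have "x = proj_class (diag3 1 b c) \<otimes>\<^bsub>?R\<^esub> proj_class w" by (simp add: mult inv invW)
      ultimately show "x \<in> ?A <#>\<^bsub>?R\<^esub> ?B" unfolding set_mult_def by blast
    qed
  qed
  have type_A: "squared (cyclic_of_order (CARD('a) - 1)) (?R\<lparr>carrier := ?A\<rparr>)"
  proof (rule iso_transferD[OF iso_transfer_squares(2) _ _ _ squared_unit_group])
    show "group ((unit_group :: 'a monoid) \<times>\<times> (unit_group :: 'a monoid))" by (rule DirProd_group[OF group_unit group_unit])
    show "group (?R\<lparr>carrier := ?A\<rparr>)" by (rule R.subgroup_imp_group[OF sub_A])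
    let ?f = "\<lambda>(b, c). proj_class (diag3 1 b c) :: ('a ^ 3 ^ 3) set"
    show "(unit_group :: 'a monoid) \<times>\<times> (unit_group :: 'a monoid) \<cong> ?R\<lparr>carrier := ?A\<rparr>"
    proof (rule is_isoI, unfold iso_iff, intro conjI)
      show "?f \<in> hom ((unit_group :: 'a monoid) \<times>\<times> (unit_group :: 'a monoid)) (?R\<lparr>carrier := ?A\<rparr>)"
        by (auto simp: hom_def mult inv m3_mult)
      show "?f ` carrier ((unit_group :: 'a monoid) \<times>\<times> (unit_group :: 'a monoid)) = carrier (?R\<lparr>carrier := ?A\<rparr>)"
        by (auto simp: image_iff)
      show "inj_on ?f (carrier ((unit_group :: 'a monoid) \<times>\<times> (unit_group :: 'a monoid)))"
        by (auto simp: inj_on_def proj_class_eq_iff m3_scale)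
    qed
  qed
  have inj_W: "inj_on proj_class ?W"
  proof (rule inj_onI)
    fix v w :: "'a ^ 3 ^ 3" assume "v \<in> ?W" "w \<in> ?W" "proj_class v = proj_class w"
    then show "v = w" using inj_class[of 1 1 v 1 1 w] by (simp add: m3_scalar[symmetric])
  qed
  have "card ?W = 6" by (simp add: permutation_matrices_def)
  then have card_B: "card ?B = 6" using inj_W by (simp add: card_image)
  have type_B: "symmetric_group 3 (?R\<lparr>carrier := ?B\<rparr>)"
  proof (rule symmetric_group_3I[where a = "proj_class (m3 0 1 0 0 0 1 1 0 0)" and b = "proj_class (m3 1 0 0 0 0 1 0 1 0)"])
    show "group (?R\<lparr>carrier := ?B\<rparr>)" by (rule R.subgroup_imp_group[OF sub_B])
    show "proj_class (m3 0 1 0 0 0 1 1 0 0) \<noteq> \<one>\<^bsub>?R\<lparr>carrier := ?B\<rparr>\<^esub>"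
      by (simp add: one proj_class_eq_iff m3_scale)
  qed (simp_all add: card_B one mult m3_mult m3_invertible, simp_all add: permutation_matrices_def)
  show "semidirect (squared (cyclic_of_order (CARD('a) - 1))) (symmetric_group 3) ?R"
    unfolding semidirect_def using normal sub_B meet prod type_A type_B by blast
  have img: "carrier ?R = (\<lambda>((b, c), w). proj_class (diag3 1 b c ** w)) ` (((UNIV - {0}) \<times> (UNIV - {0})) \<times> ?W)"
    unfolding carrier
  proof (intro equalityI subsetI)
    fix C assume "C \<in> {proj_class (diag3 1 b c ** w) | b c w. b \<noteq> 0 \<and> c \<noteq> 0 \<and> w \<in> ?W}"
    then obtain b c w where "b \<noteq> 0" "c \<noteq> 0" "w \<in> ?W" "C = proj_class (diag3 1 b c ** w)" by blast
    then show "C \<in> (\<lambda>((b, c), w). proj_class (diag3 1 b c ** w)) ` (((UNIV - {0}) \<times> (UNIV - {0})) \<times> ?W)"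
      by (intro image_eqI[where x = "((b, c), w)"]) simp_all
  qed auto
  have inj: "inj_on (\<lambda>((b, c), w). proj_class (diag3 1 b c ** w)) (((UNIV - {0}) \<times> (UNIV - {0})) \<times> ?W)"
    using inj_class by (auto simp: inj_on_def)
  have "card (carrier ?R) = (CARD('a) - 1) * (CARD('a) - 1) * 6"
    using card_eq_card_param[OF img inj] \<open>card ?W = 6\<close> by (simp add: card_cartesian_product)
  then have card: "real (card (carrier ?R)) = (real CARD('a) - 1) * (real CARD('a) - 1) * 6"
    by (simp add: real_card_minus_1)
  show "1/6 * real CARD('a)^3 * (real CARD('a)^2 + real CARD('a) + 1) * (real CARD('a) + 1) * real (card (carrier ?R)) = order_PGL3 CARD('a)"
    unfolding card order_PGL3_def by (simp add: power2_eq_square power3_eq_cube algebra_simps)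
qed (simp_all add: iso_transfer_semidirect iso_transfer_squares iso_transfer_basic proj_plane_stabiliser_def)

section \<open>The types \<open>\<Sigma>\<^sub>1\<^sub>2\<close>, \<open>\<Sigma>\<^sub>1\<^sub>3\<close> and \<open>\<Sigma>\<^sub>1\<^sub>4\<close>\<close>

text \<open>
  The determinant \<open>\<alpha>(k\<gamma>\<^sup>2 - \<beta>\<^sup>2) - \<gamma>(\<beta> + \<delta>\<gamma>)\<^sup>2\<close> is a cubic with a node at the point of rank one if
  \<open>k \<noteq> 0\<close> and \<open>k \<noteq> \<delta>\<^sup>2\<close>; the tangents at the node are given by \<open>\<beta>\<^sup>2 = k\<gamma>\<^sup>2\<close>. The types correspond
  to the parameters \<open>(1, 0)\<close>, \<open>(1/\<epsilon>, 0)\<close> and \<open>(c, 1)\<close>.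
\<close>

definition nodal_plane :: "'a::field \<Rightarrow> 'a \<Rightarrow> ('a ^ 3 ^ 3) set" where
  "nodal_plane k \<delta> = {m3 \<alpha> (\<beta> + \<delta> * \<gamma>) 0 (\<beta> + \<delta> * \<gamma>) (k * \<gamma>) \<beta> 0 \<beta> \<gamma> | \<alpha> \<beta> \<gamma>. True}"

lemma nodal_plane_mem:
  "m3 a b c d e f g h i \<in> nodal_plane k \<delta> \<longleftrightarrow>
     d = b \<and> c = 0 \<and> g = 0 \<and> h = f \<and> b = f + \<delta> * i \<and> e = k * i"
  by (auto simp: nodal_plane_def)

lemma Sigma12_eq: "Sigma12 = nodal_plane 1 0"
  unfolding Sigma12_def mat3_m3 nodal_plane_def by simp

lemma Sigma13_eq:
  assumes "\<epsilon> \<noteq> 0"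
  shows "Sigma13 \<epsilon> = nodal_plane (1 / \<epsilon>) 0"
proof
  show "Sigma13 \<epsilon> \<subseteq> nodal_plane (1 / \<epsilon>) 0"
    using assms unfolding Sigma13_def mat3_m3 by (auto simp: nodal_plane_mem)
  show "nodal_plane (1 / \<epsilon>) 0 \<subseteq> Sigma13 \<epsilon>"
  proof
    fix M assume "M \<in> nodal_plane (1 / \<epsilon>) 0"
    then obtain \<alpha> \<beta> \<gamma> where "M = m3 \<alpha> \<beta> 0 \<beta> (\<gamma> / \<epsilon>) \<beta> 0 \<beta> \<gamma>" by (auto simp: nodal_plane_def)
    then have "M = m3 \<alpha> \<beta> 0 \<beta> (\<gamma> / \<epsilon>) \<beta> 0 \<beta> (\<epsilon> * (\<gamma> / \<epsilon>))" using assms by simp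
    then show "M \<in> Sigma13 \<epsilon>" unfolding Sigma13_def mat3_m3 by blast
  qed
qed

lemma Sigma14_eq: "Sigma14 c = nodal_plane c 1"
proof
  show "Sigma14 c \<subseteq> nodal_plane c 1" unfolding Sigma14_def mat3_m3 by (auto simp: nodal_plane_mem)
  show "nodal_plane c 1 \<subseteq> Sigma14 c"
  proof
    fix M assume "M \<in> nodal_plane c 1"
    then obtain \<alpha> \<beta> \<gamma> where "M = m3 \<alpha> (\<beta> + \<gamma>) 0 (\<beta> + \<gamma>) (c * \<gamma>) \<beta> 0 \<beta> \<gamma>" by (auto simp: nodal_plane_def)
    then have "M = m3 \<alpha> (\<beta> + \<gamma>) 0 (\<beta> + \<gamma>) (c * \<gamma>) (\<beta> + \<gamma> - \<gamma>) 0 (\<beta> + \<gamma> - \<gamma>) \<gamma>" by simp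
    then show "M \<in> Sigma14 c" unfolding Sigma14_def mat3_m3 by blast
  qed
qed

lemma rank_one_nodal_plane: "rank_one_plane (nodal_plane k \<delta>)"
  unfolding nodal_plane_def
  by (rule rank_one_planeI3[where a=1 and b=0 and c=0 and x=1 and y=0 and z=0, OF refl])
     (simp_all add: m3_add m3_scale m3_eq_0_iff m3_transpose algebra_simps)

text \<open>
  The image of the point of rank one is again a point of rank one of the plane. There is no
  other one as long as \<open>k \<noteq> 0\<close> and \<open>k \<noteq> \<delta>\<^sup>2\<close>.
\<close>

lemma nodal_plane_first_column:
  fixes k \<delta> :: "'a::field"
  assumes k: "k \<noteq> 0" "k \<noteq> \<delta>\<^sup>2"
    and mem: "m3 a b c d e f g h i ** m3 1 0 0 0 0 0 0 0 0 ** transpose (m3 a b c d e f g h i) \<in> nodal_plane k \<delta>"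
  shows "d = 0" "g = 0"
proof -
  have 1: "a * g = 0" "d * d = k * (g * g)" "a * d = d * g + \<delta> * (g * g)"
    using mem by (auto simp: m3_mult m3_transpose nodal_plane_mem)
  show g: "g = 0"
  proof (rule ccontr)
    assume "g \<noteq> 0"
    then have "(d + \<delta> * g) * g = 0" using 1 by (simp add: algebra_simps)
    then have "d = - (\<delta> * g)" using \<open>g \<noteq> 0\<close> by (simp add: add_eq_0_iff2)
    then have "(k - \<delta>\<^sup>2) * (g * g) = k * (g * g) - d * d" by (simp add: power2_eq_square algebra_simps)
    then have "(k - \<delta>\<^sup>2) * (g * g) = 0" using 1(2) by simp
    then show False using \<open>g \<noteq> 0\<close> k(2) by simp
  qed
  then show "d = 0" using 1(2) by simp
qed

text \<open>
  If \<open>k \<noteq> 0\<close> and \<open>k \<noteq> \<delta>\<^sup>2\<close>, then every matrix in the stabiliser of the plane has first column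
  proportional to the first unit vector. The matrices in it with first entry one therefore
  form a group, and each class modulo scalars contains exactly one of them.
\<close>

definition nodal_group :: "'a::field \<Rightarrow> 'a \<Rightarrow> ('a ^ 3 ^ 3) set" where
  "nodal_group k \<delta> = {A. invertible A \<and> A$1$1 = 1 \<and> A$2$1 = 0 \<and> A$3$1 = 0 \<and>
     (\<forall>M\<in>nodal_plane k \<delta>. A ** M ** transpose A \<in> nodal_plane k \<delta>)}"

lemma nodal_group_closed:
  "nodal_group k \<delta> \<noteq> {}" "A \<in> nodal_group k \<delta> \<Longrightarrow> invertible A"
  "A \<in> nodal_group k \<delta> \<Longrightarrow> B \<in> nodal_group k \<delta> \<Longrightarrow> A ** B \<in> nodal_group k \<delta>"
proof -
  have "mat 1 \<in> nodal_group k \<delta>" by (simp add: nodal_group_def transpose_mat) (simp add: mat_def)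
  then show "nodal_group k \<delta> \<noteq> {}" by blast
  show "A ** B \<in> nodal_group k \<delta>" if A: "A \<in> nodal_group k \<delta>" and B: "B \<in> nodal_group k \<delta>" for A B
  proof -
    have "A ** B ** M ** transpose (A ** B) \<in> nodal_plane k \<delta>" if "M \<in> nodal_plane k \<delta>" for M
    proof -
      have "A ** (B ** M ** transpose B) ** transpose A \<in> nodal_plane k \<delta>"
        using A B that by (simp add: nodal_group_def)
      then show ?thesis by (simp add: matrix_transpose_mul matrix_mul_assoc)
    qed
    then show ?thesis using A B by (simp add: nodal_group_def invertible_mult matrix3_mult_nth)
  qed
qed (simp add: nodal_group_def)

lemma group_nodal_group: "group (subgroup_GL (nodal_group k \<delta> :: ('a::{field,finite} ^ 3 ^ 3) set))"
  by (intro group_subgroup_GL nodal_group_closed)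

lemma stabiliser_and_number_nodal_plane:
  fixes k \<delta> :: "'a::{field,finite}"
  assumes odd: "odd CARD('a)" and k: "k \<noteq> 0" "k \<noteq> \<delta>\<^sup>2"
    and T: "T (subgroup_GL (nodal_group k \<delta>))" and tr: "iso_transfer T T'"
    and m: "m * real (card (nodal_group k \<delta>)) = order_PGL3 CARD('a)"
  shows "stabiliser_and_number (nodal_plane k \<delta>) T' m"
proof (rule stabiliser_and_number_complement[OF odd rank_one_nodal_plane nodal_group_closed(1), of k \<delta>])
  show "invertible A" if "A \<in> nodal_group k \<delta>" for A using that by (rule nodal_group_closed(2))
  show "A ** B \<in> nodal_group k \<delta>" if "A \<in> nodal_group k \<delta>" "B \<in> nodal_group k \<delta>" for A B
    using that by (rule nodal_group_closed(3))
  show "A ** M ** transpose A \<in> nodal_plane k \<delta>" if "A \<in> nodal_group k \<delta>" "M \<in> nodal_plane k \<delta>" for A M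
    using that by (simp add: nodal_group_def)
  show "\<exists>c. \<exists>h\<in>nodal_group k \<delta>. c \<noteq> 0 \<and> A = mat c ** h"
    if inv: "invertible A" and pres: "\<And>M. M \<in> nodal_plane k \<delta> \<Longrightarrow> A ** M ** transpose A \<in> nodal_plane k \<delta>" for A
  proof -
    obtain a b c d e f g h i where A: "A = m3 a b c d e f g h i" by (rule m3_cases)
    have dg: "d = 0" "g = 0"
      using nodal_plane_first_column[OF k, of a b c d e f g h i] pres[of "m3 1 0 0 0 0 0 0 0 0"]
      by (simp_all add: A nodal_plane_mem)
    have a: "a \<noteq> 0" using inv dg by (auto simp: A m3_invertible)
    have ai: "invertible (mat (1 / a) :: 'a ^ 3 ^ 3)" using a by (simp add: m3_scalar m3_invertible)
    have "mat (1 / a) ** A ** M ** transpose (mat (1 / a) ** A) \<in> nodal_plane k \<delta>" if M: "M \<in> nodal_plane k \<delta>" for M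
    proof -
      obtain a' b' c' d' e' f' g' h' i' where N: "A ** M ** transpose A = m3 a' b' c' d' e' f' g' h' i'" by (rule m3_cases)
      have "mat (1 / a) ** A ** M ** transpose (mat (1 / a) ** A)
          = mat (1 / a) ** (A ** M ** transpose A) ** transpose (mat (1 / a))"
        by (simp add: matrix_transpose_mul matrix_mul_assoc)
      also have "\<dots> = mat (1 / a) ** (mat (1 / a) ** (A ** M ** transpose A))"
        unfolding transpose_mat scalar_matrix_commute ..
      finally show ?thesis using pres[OF M] unfolding N
        by (auto simp: m3_scale nodal_plane_mem add_divide_distrib algebra_simps)
    qed
    then have "mat (1 / a) ** A \<in> nodal_group k \<delta>"
      using inv ai a dg by (simp add: nodal_group_def invertible_mult matrix3_scale_nth) (simp add: A)
    moreover have "A = mat a ** (mat (1 / a) ** A)" using a by (simp add: A m3_scale)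
    ultimately show ?thesis using a by blast
  qed
  show "c = 1" if "A \<in> nodal_group k \<delta>" "mat c ** A \<in> nodal_group k \<delta>" for A c
    using that by (simp add: nodal_group_def matrix3_scale_nth)
qed (rule T tr m)+

text \<open>
  The conditions that the images of the generators \<open>\<beta> = 1\<close> and \<open>\<gamma> = 1\<close> of the plane satisfy its
  defining equations, for a matrix with first row \<open>(1, u, v)\<close> and lower right block
  \<open>(p, s; r, t)\<close>. Each group of three stands for the entry \<open>(1, 3)\<close>, the relation between the
  entries \<open>(2, 2)\<close> and \<open>(3, 3)\<close>, and that between \<open>(1, 2)\<close>, \<open>(2, 3)\<close> and \<open>(3, 3)\<close>.
\<close>

definition nodal_equations :: "'a::field \<Rightarrow> 'a \<Rightarrow> 'a \<Rightarrow> 'a \<Rightarrow> 'a \<Rightarrow> 'a \<Rightarrow> 'a \<Rightarrow> 'a \<Rightarrow> bool" where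
  "nodal_equations k \<delta> u v p s r t \<longleftrightarrow> p * t - r * s \<noteq> 0 \<and>
     r + u * t + v * r = 0 \<and> p * s = k * (r * t) \<and> p + u * s + v * p = p * t + r * s + 2 * \<delta> * (r * t) \<and>
     \<delta> * r + k * u * r + v * t = 0 \<and> k * (p * p) + s * s = k * (k * (r * r) + t * t) \<and>
     \<delta> * p + k * u * p + v * s = k * (p * r) + s * t + \<delta> * (k * (r * r) + t * t)"

lemma nodal_group_mem:
  fixes k \<delta> :: "'a::field"
  assumes 2: "(2 :: 'a) \<noteq> 0"
  shows "m3 1 u v 0 p s 0 r t \<in> nodal_group k \<delta> \<longleftrightarrow> nodal_equations k \<delta> u v p s r t"
proof
  let ?A = "m3 1 u v 0 p s 0 r t"
  assume A: "?A \<in> nodal_group k \<delta>"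
  have "?A ** m3 0 1 0 1 0 1 0 1 0 ** transpose ?A \<in> nodal_plane k \<delta>"
    using A by (simp add: nodal_group_def nodal_plane_mem)
  then have 1: "r + u * t + v * r = 0" "2 * (p * s) = 2 * (k * (r * t))"
      "p + u * s + v * p = p * t + r * s + 2 * \<delta> * (r * t)"
    by (simp_all add: m3_mult m3_transpose nodal_plane_mem algebra_simps)
  have "?A ** m3 0 \<delta> 0 \<delta> k 0 0 0 1 ** transpose ?A \<in> nodal_plane k \<delta>"
    using A by (simp add: nodal_group_def nodal_plane_mem)
  then have 3: "\<delta> * r + k * u * r + v * t = 0" "k * (p * p) + s * s = k * (k * (r * r) + t * t)"
     "\<delta> * p + k * u * p + v * s = k * (p * r) + s * t + \<delta> * (k * (r * r) + t * t)"
    by (simp_all add: m3_mult m3_transpose nodal_plane_mem algebra_simps)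
  have 4: "p * t - r * s \<noteq> 0" using A by (auto simp: nodal_group_def m3_invertible algebra_simps)
  show "nodal_equations k \<delta> u v p s r t"
    unfolding nodal_equations_def using 1 2 3 4 by simp
next
  let ?A = "m3 1 u v 0 p s 0 r t"
  assume *: "nodal_equations k \<delta> u v p s r t"
  have "?A ** M ** transpose ?A \<in> nodal_plane k \<delta>" if "M \<in> nodal_plane k \<delta>" for M
  proof -
    obtain \<alpha> \<beta> \<gamma> where M: "M = m3 \<alpha> (\<beta> + \<delta> * \<gamma>) 0 (\<beta> + \<delta> * \<gamma>) (k * \<gamma>) \<beta> 0 \<beta> \<gamma>"
      using \<open>M \<in> nodal_plane k \<delta>\<close> unfolding nodal_plane_def by blast
    have e13: "\<beta> * (r + u * t + v * r) + \<gamma> * (\<delta> * r + k * u * r + v * t) = 0"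
      using * by (simp add: nodal_equations_def)
    have e22: "\<beta> * (2 * (p * s)) + \<gamma> * (k * (p * p) + s * s) = k * (\<beta> * (2 * (r * t)) + \<gamma> * (k * (r * r) + t * t))"
      using * by (simp add: nodal_equations_def algebra_simps)
    have e12: "\<beta> * (p + u * s + v * p) + \<gamma> * (\<delta> * p + k * u * p + v * s) =
        \<beta> * (p * t + r * s + 2 * \<delta> * (r * t)) + \<gamma> * (k * (p * r) + s * t + \<delta> * (k * (r * r) + t * t))"
      using * by (simp add: nodal_equations_def)
    show ?thesis using e13 e22 e12
      by (simp add: M m3_mult m3_transpose nodal_plane_mem algebra_simps)
  qed
  then show "?A \<in> nodal_group k \<delta>"
    using * by (auto simp: nodal_group_def m3_invertible nodal_equations_def algebra_simps)
qed

text \<open>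
  By congruence, the lower right block preserves the space of matrices \<open>(k\<gamma>, \<beta>; \<beta>, \<gamma>)\<close>, hence
  its transpose preserves the form \<open>y\<^sub>1\<^sup>2 - ky\<^sub>2\<^sup>2\<close> up to a factor. So it is multiplication by
  \<open>p + r\<surd>k\<close>, with \<open>s = kr\<close> and \<open>t = p\<close>, or this composed with a conjugation; the former is
  called a rotation and the latter a reflection.
\<close>

lemma nodal_equations_signs:
  fixes k \<delta> :: "'a::field"
  assumes k: "k \<noteq> 0" and eqs: "nodal_equations k \<delta> u v p s r t"
  shows "t = p \<and> s = k * r \<or> t = - p \<and> s = - (k * r)"
proof -
  have D: "p * t - r * s \<noteq> 0" and ps: "p * s = k * (r * t)"
    and sq: "k * (p * p) + s * s = k * (k * (r * r) + t * t)" using eqs by (simp_all add: nodal_equations_def)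
  have "k * ((p * p - t * t) * (p * p - k * (r * r)))
      = p * p * (k * (p * p) + s * s) - p * p * (k * (k * (r * r) + t * t)) - (p * s) * (p * s) + k * (r * t) * (k * (r * t))"
    by (simp add: algebra_simps)
  also have "\<dots> = 0" unfolding sq ps by simp
  finally have "p * p = t * t \<or> p * p = k * (r * r)" using k by simp
  moreover have "p * p \<noteq> k * (r * r)"
  proof
    assume *: "p * p = k * (r * r)"
    have "p * (p * t - r * s) = t * (p * p - k * (r * r)) - r * (p * s - k * (r * t))" by (simp add: algebra_simps)
    then have "p * (p * t - r * s) = 0" using * ps by simp
    then have "p = 0" using D by simp
    then have "r = 0" using * k by simp
    then show False using D \<open>p = 0\<close> by simp
  qed
  ultimately have t: "t = p \<or> t = - p" by (metis square_eq_iff)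
  show ?thesis
  proof (cases "p = 0")
    case True
    then have "s * s = (k * r) * (k * r)" using sq t by (auto simp: algebra_simps)
    then have "s = k * r \<or> s = - (k * r)" by (metis square_eq_iff)
    then show ?thesis using True t by auto
  next
    case False
    from t show ?thesis
    proof
      assume t: "t = p"
      then have "p * (s - k * r) = 0" using ps by (simp add: algebra_simps)
      then show ?thesis using False t by simp
    next
      assume t: "t = - p"
      then have "p * (s + k * r) = 0" using ps by (simp add: algebra_simps)
      then show ?thesis using False t by (simp add: add_eq_0_iff2)
    qed
  qed
qed

text \<open>
  The solutions of \<open>(p + r\<surd>k)\<^sup>3 = 1\<close> of norm one. Inverting the element changes the sign of
  \<open>r\<close>, so that \<open>z\<^sup>2 = z\<^sup>-\<^sup>1\<close> reads \<open>p\<^sup>2 + kr\<^sup>2 = p\<close> and \<open>2pr = -r\<close>. In characteristic three,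
  \<open>2p = -1\<close> means \<open>p = 1\<close>.
\<close>

definition rotation_params :: "'a::field \<Rightarrow> ('a \<times> 'a) set" where
  "rotation_params k = {(p, r). p = 1 \<and> r = 0 \<or> 2 * p = - 1 \<and> 4 * k * (r * r) = - 3 \<and> r \<noteq> 0}"

lemma rotation_paramsI:
  fixes k p r :: "'a::field"
  assumes 2: "(2 :: 'a) \<noteq> 0" and D: "p * p - k * (r * r) \<noteq> 0"
    and p: "p * p + k * (r * r) = p" and r: "2 * (p * r) = - r"
  shows "(p, r) \<in> rotation_params k"
proof (cases "r = 0")
  case True
  then have "p * (p - 1) = 0" "p \<noteq> 0" using p D by (auto simp: algebra_simps)
  then show ?thesis using True by (simp add: rotation_params_def)
next
  case False
  have "r * (2 * p + 1) = 0" using r by (simp add: algebra_simps)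
  then have 2: "2 * p = - 1" using False by (simp add: add_eq_0_iff2)
  have "4 * k * (r * r) = 4 * (p * p + k * (r * r)) - (2 * p) * (2 * p)" by (simp add: algebra_simps)
  also have "\<dots> = 2 * (2 * p) - (2 * p) * (2 * p)" unfolding p by simp
  finally show ?thesis using 2 False by (simp add: rotation_params_def)
qed

lemma rotation_paramsD:
  fixes k p r :: "'a::field"
  assumes 2: "(2 :: 'a) \<noteq> 0" and pr: "(p, r) \<in> rotation_params k"
  shows "p * p + k * (r * r) = p" "2 * (p * r) = - r" "p * p - k * (r * r) = 1" "p \<noteq> 0"
proof -
  have "(2 :: 'a) * 2 \<noteq> 0" using 2 by (metis mult_eq_0_iff)
  then have 4: "(4 :: 'a) \<noteq> 0" by simp
  have *: "p = 1 \<and> r = 0 \<or> 2 * p = - 1 \<and> 4 * k * (r * r) = - 3" using pr by (auto simp: rotation_params_def)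
  have "4 * (p * p + k * (r * r)) = 4 * p"
    using *
  proof
    assume "2 * p = - 1 \<and> 4 * k * (r * r) = - 3"
    then have p: "2 * p = - 1" and r: "4 * k * (r * r) = - 3" by blast+
    have "4 * (p * p + k * (r * r)) = (2 * p) * (2 * p) + 4 * k * (r * r)" by (simp add: algebra_simps)
    also have "\<dots> = 2 * (2 * p)" unfolding p r by simp
    finally show ?thesis by simp
  qed simp
  then show "p * p + k * (r * r) = p" using 4 by (metis mult_left_cancel)
  have "4 * (p * p - k * (r * r)) = 4 * 1"
    using *
  proof
    assume "2 * p = - 1 \<and> 4 * k * (r * r) = - 3"
    then have p: "2 * p = - 1" and r: "4 * k * (r * r) = - 3" by blast+
    have "4 * (p * p - k * (r * r)) = (2 * p) * (2 * p) - 4 * k * (r * r)" by (simp add: algebra_simps)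
    also have "\<dots> = 4 * 1" unfolding p r by simp
    finally show ?thesis .
  qed simp
  then show "p * p - k * (r * r) = 1" using 4 by (metis mult_left_cancel)
  have "(2 * p) * r = - r"
    using *
  proof
    assume "2 * p = - 1 \<and> 4 * k * (r * r) = - 3"
    then have "2 * p = - 1" by blast
    then show ?thesis by (simp only: mult_minus1)
  qed simp
  then show "2 * (p * r) = - r" by (simp only: mult.assoc)
  show "p \<noteq> 0" using * by auto
qed

text \<open>
  The entries \<open>u\<close> and \<open>v\<close> of the first row are determined by the linear equations among
  \<open>nodal_equations\<close>, whose determinant \<open>p\<^sup>2 - kr\<^sup>2\<close> equals one.
\<close>

definition rotation :: "'a::field \<Rightarrow> 'a \<Rightarrow> 'a \<Rightarrow> 'a \<Rightarrow> 'a ^ 3 ^ 3" where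
  "rotation k \<delta> p r = m3 1 (\<delta> * (r * r) - p * r) (k * (r * r) - \<delta> * (p * r)) 0 p (k * r) 0 r p"

definition reflection :: "'a::field \<Rightarrow> 'a \<Rightarrow> 'a \<Rightarrow> 'a ^ 3 ^ 3" where
  "reflection k p r = m3 1 (p * r) (k * (r * r)) 0 (- p) (k * r) 0 (- r) p"

text \<open>
  Eliminating \<open>u\<close> and \<open>v\<close> leaves, for \<open>X = p\<^sup>2 + kr\<^sup>2\<close> and \<open>Y = 2pr\<close>, the equations
  \<open>X + \<delta>Y = p - \<delta>r\<close> and \<open>\<delta>X + kY = \<delta>p - kr\<close>. Since \<open>k \<noteq> \<delta>\<^sup>2\<close>, they are equivalent to \<open>X = p\<close> and
  \<open>Y = -r\<close>.
\<close>

lemma nodal_equations_rotation: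
  fixes k \<delta> :: "'a::field"
  assumes 2: "(2 :: 'a) \<noteq> 0" and k: "k \<noteq> \<delta>\<^sup>2"
  shows "nodal_equations k \<delta> u v p (k * r) r p \<longleftrightarrow> (p, r) \<in> rotation_params k \<and>
    u = \<delta> * (r * r) - p * r \<and> v = k * (r * r) - \<delta> * (p * r)"
proof
  assume *: "nodal_equations k \<delta> u v p (k * r) r p"
  then have D: "p * p - k * (r * r) \<noteq> 0"
    and i: "r + u * p + v * r = 0" and iv: "\<delta> * r + k * u * r + v * p = 0"
    and iii: "p + u * (k * r) + v * p = p * p + r * (k * r) + 2 * \<delta> * (r * p)"
    and vi: "\<delta> * p + k * u * p + v * (k * r) = k * (p * r) + k * r * p + \<delta> * (k * (r * r) + p * p)"
    by (auto simp: nodal_equations_def algebra_simps)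
  have a: "p - \<delta> * r = p * p + k * (r * r) + \<delta> * (2 * (p * r))"
  proof -
    have "p - \<delta> * r = (p + u * (k * r) + v * p) - (\<delta> * r + k * u * r + v * p)" by (simp add: algebra_simps)
    then show ?thesis unfolding iii iv by (simp add: algebra_simps)
  qed
  have b: "\<delta> * p - k * r = k * (2 * (p * r)) + \<delta> * (p * p + k * (r * r))"
  proof -
    have "\<delta> * p - k * r = (\<delta> * p + k * u * p + v * (k * r)) - k * (r + u * p + v * r)" by (simp add: algebra_simps)
    then show ?thesis unfolding vi i by (simp add: algebra_simps)
  qed
  have "(k - \<delta>\<^sup>2) * (2 * (p * r) + r) = 0"
  proof -
    have "(k - \<delta>\<^sup>2) * (2 * (p * r) + r) = (k * (2 * (p * r)) + \<delta> * (p * p + k * (r * r)) - (\<delta> * p - k * r))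
        - \<delta> * (p * p + k * (r * r) + \<delta> * (2 * (p * r)) - (p - \<delta> * r))"
      by (simp add: power2_eq_square algebra_simps)
    then show ?thesis unfolding a b by simp
  qed
  then have y: "2 * (p * r) = - r" using k by (simp add: add_eq_0_iff2)
  have x: "p * p + k * (r * r) = p" using a y by (simp add: algebra_simps)
  have pr: "(p, r) \<in> rotation_params k" by (rule rotation_paramsI[OF 2 D x y])
  have N: "p * p - k * (r * r) = 1" by (rule rotation_paramsD(3)[OF 2 pr])
  have "(p * p - k * (r * r)) * u
      = \<delta> * (r * r) - p * r + (p * (r + u * p + v * r) - r * (\<delta> * r + k * u * r + v * p))"
    by (simp add: algebra_simps)
  then have u: "u = \<delta> * (r * r) - p * r" unfolding N i iv by simp
  have "(p * p - k * (r * r)) * v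
      = k * (r * r) - \<delta> * (p * r) + (p * (\<delta> * r + k * u * r + v * p) - k * r * (r + u * p + v * r))"
    by (simp add: algebra_simps)
  then have v: "v = k * (r * r) - \<delta> * (p * r)" unfolding N i iv by simp
  show "(p, r) \<in> rotation_params k \<and> u = \<delta> * (r * r) - p * r \<and> v = k * (r * r) - \<delta> * (p * r)"
    using pr u v by blast
next
  assume *: "(p, r) \<in> rotation_params k \<and> u = \<delta> * (r * r) - p * r \<and> v = k * (r * r) - \<delta> * (p * r)"
  then have u: "u = \<delta> * (r * r) - p * r" and v: "v = k * (r * r) - \<delta> * (p * r)"
    and pr: "p * p + k * (r * r) = p" "2 * (p * r) = - r" "p * p - k * (r * r) = 1"
    using rotation_paramsD[OF 2] by blast+
  have "p * p - r * (k * r) \<noteq> 0" using pr(3) by (simp add: algebra_simps)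
  moreover have "r + u * p + v * r = 0"
  proof -
    have "r + u * p + v * r = r - r * (p * p - k * (r * r))" unfolding u v by (simp add: algebra_simps)
    then show ?thesis unfolding pr by simp
  qed
  moreover have "p * (k * r) = k * (r * p)" by simp
  moreover have "p + u * (k * r) + v * p = p * p + r * (k * r) + 2 * \<delta> * (r * p)"
  proof -
    have "p + u * (k * r) + v * p = p - \<delta> * r * (p * p - k * (r * r))" unfolding u v by (simp add: algebra_simps)
    also have "\<dots> = (p * p + k * (r * r)) + \<delta> * (2 * (p * r))" unfolding pr by simp
    finally show ?thesis by (simp add: algebra_simps)
  qed
  moreover have "\<delta> * r + k * u * r + v * p = 0"
  proof -
    have "\<delta> * r + k * u * r + v * p = \<delta> * r - \<delta> * r * (p * p - k * (r * r))" unfolding u v by (simp add: algebra_simps)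
    then show ?thesis unfolding pr by simp
  qed
  moreover have "k * (p * p) + k * r * (k * r) = k * (k * (r * r) + p * p)" by (simp add: algebra_simps)
  moreover have "\<delta> * p + k * u * p + v * (k * r) = k * (p * r) + k * r * p + \<delta> * (k * (r * r) + p * p)"
  proof -
    have "\<delta> * p + k * u * p + v * (k * r) = \<delta> * p - k * r * (p * p - k * (r * r))" unfolding u v by (simp add: algebra_simps)
    also have "\<dots> = k * (2 * (p * r)) + \<delta> * (p * p + k * (r * r))" unfolding pr by simp
    finally show ?thesis by (simp add: algebra_simps)
  qed
  ultimately show "nodal_equations k \<delta> u v p (k * r) r p" unfolding nodal_equations_def by blast
qed

text \<open>
  The same elimination for reflections. The coefficients on the two sides now have different
  signs, so the outcome depends on \<open>\<delta>\<close>.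
\<close>

lemma nodal_equations_reflectionD:
  fixes k \<delta> :: "'a::field"
  assumes "nodal_equations k \<delta> u v p (- (k * r)) r (- p)"
  shows "p * p - k * (r * r) \<noteq> 0"
    "p + \<delta> * r = - (p * p + k * (r * r) + \<delta> * (2 * (p * r)))"
    "\<delta> * p + k * r = k * (2 * (p * r)) + \<delta> * (p * p + k * (r * r))"
    "(p * p - k * (r * r)) * u = p * r + \<delta> * (r * r)"
    "(p * p - k * (r * r)) * v = \<delta> * (p * r) + k * (r * r)"
proof -
  have i: "r + u * (- p) + v * r = 0" and iv: "\<delta> * r + k * u * r + v * (- p) = 0"
    and iii: "p + u * (- (k * r)) + v * p = p * (- p) + r * (- (k * r)) + 2 * \<delta> * (r * (- p))"
    and vi: "\<delta> * p + k * u * p + v * (- (k * r)) = k * (p * r) + (- (k * r)) * (- p) + \<delta> * (k * (r * r) + (- p) * (- p))"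
    using assms unfolding nodal_equations_def by blast+
  show "p * p - k * (r * r) \<noteq> 0" using assms by (auto simp: nodal_equations_def algebra_simps)
  show "p + \<delta> * r = - (p * p + k * (r * r) + \<delta> * (2 * (p * r)))"
  proof -
    have "p + \<delta> * r = (p + u * (- (k * r)) + v * p) + (\<delta> * r + k * u * r + v * (- p))" by (simp add: algebra_simps)
    then show ?thesis unfolding iii iv by (simp add: algebra_simps)
  qed
  show "\<delta> * p + k * r = k * (2 * (p * r)) + \<delta> * (p * p + k * (r * r))"
  proof -
    have "\<delta> * p + k * r = (\<delta> * p + k * u * p + v * (- (k * r))) + k * (r + u * (- p) + v * r)" by (simp add: algebra_simps)
    then show ?thesis unfolding vi i by (simp add: algebra_simps)
  qed
  show "(p * p - k * (r * r)) * u = p * r + \<delta> * (r * r)"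
  proof -
    have "(p * p - k * (r * r)) * u
        = p * r + \<delta> * (r * r) - (p * (r + u * (- p) + v * r) + r * (\<delta> * r + k * u * r + v * (- p)))"
      by (simp add: algebra_simps)
    then show ?thesis unfolding i iv by simp
  qed
  show "(p * p - k * (r * r)) * v = \<delta> * (p * r) + k * (r * r)"
  proof -
    have "(p * p - k * (r * r)) * v
        = \<delta> * (p * r) + k * (r * r) - (k * r * (r + u * (- p) + v * r) + p * (\<delta> * r + k * u * r + v * (- p)))"
      by (simp add: algebra_simps)
    then show ?thesis unfolding i iv by simp
  qed
qed

lemma nodal_group_cases:
  assumes A: "A \<in> nodal_group k \<delta>"
  obtains u v p s r t where "A = m3 1 u v 0 p s 0 r t"
  using A by (cases A rule: m3_cases) (auto simp: nodal_group_def)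

text \<open>
  For \<open>\<delta> = 0\<close> the substitution \<open>(p, r) \<mapsto> (-p, -r)\<close> turns the equations of reflections into
  those of rotations: the diagonal matrix with entries \<open>1, -1, 1\<close> preserves the plane, and the
  reflections are its products with the rotations.
\<close>

lemma nodal_group_0:
  fixes k :: "'a::field"
  assumes 2: "(2 :: 'a) \<noteq> 0" and k: "k \<noteq> 0"
  shows "nodal_group k 0 = (\<lambda>(p, r). rotation k 0 p r) ` rotation_params k \<union> (\<lambda>(p, r). reflection k p r) ` rotation_params k"
proof (intro equalityI subsetI)
  fix A assume A: "A \<in> nodal_group k 0"
  obtain u v p s r t where uv: "A = m3 1 u v 0 p s 0 r t" using A by (rule nodal_group_cases)
  have eqs: "nodal_equations k 0 u v p s r t" using A unfolding uv nodal_group_mem[OF 2] .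
  from nodal_equations_signs[OF k this]
  show "A \<in> (\<lambda>(p, r). rotation k 0 p r) ` rotation_params k \<union> (\<lambda>(p, r). reflection k p r) ` rotation_params k"
  proof
    assume *: "t = p \<and> s = k * r"
    then have "nodal_equations k 0 u v p (k * r) r p" using eqs by simp
    then have "(p, r) \<in> rotation_params k" "A = rotation k 0 p r"
      using nodal_equations_rotation[OF 2, of k 0 u v p r] k * by (simp_all add: uv rotation_def)
    then show ?thesis by auto
  next
    assume *: "t = - p \<and> s = - (k * r)"
    then have "nodal_equations k 0 u v p (- (k * r)) r (- p)" using eqs by simp
    note refl = nodal_equations_reflectionD[OF this, simplified]
    have p: "(- p) * (- p) + k * ((- r) * (- r)) = - p"
    proof -
      have "(- p) * (- p) + k * ((- r) * (- r)) = - (- (p * p) - k * (r * r))" by simp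
      then show ?thesis by (simp only: refl(2)[symmetric])
    qed
    have "k * (2 * (p * r) - r) = 0" using refl(3) by (simp add: algebra_simps)
    then have r: "2 * ((- p) * (- r)) = - (- r)" using k by simp
    have "(- p, - r) \<in> rotation_params k" by (rule rotation_paramsI[OF 2 _ p r]) (use refl(1) in simp)
    moreover have "p * p - k * (r * r) = 1" using rotation_paramsD(3)[OF 2 calculation] by simp
    then have "u = p * r" "v = k * (r * r)" using refl(4,5) by simp_all
    then have "A = reflection k (- p) (- r)" using * by (simp add: uv reflection_def)
    ultimately show ?thesis by auto
  qed
next
  fix A assume "A \<in> (\<lambda>(p, r). rotation k 0 p r) ` rotation_params k \<union> (\<lambda>(p, r). reflection k p r) ` rotation_params k"
  then show "A \<in> nodal_group k 0"
  proof
    assume "A \<in> (\<lambda>(p, r). rotation k 0 p r) ` rotation_params k"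
    then obtain p r where pr: "(p, r) \<in> rotation_params k" "A = rotation k 0 p r" by auto
    then show ?thesis using k unfolding pr(2) rotation_def
      by (simp add: nodal_group_mem[OF 2] nodal_equations_rotation[OF 2])
  next
    assume "A \<in> (\<lambda>(p, r). reflection k p r) ` rotation_params k"
    then obtain p r where pr: "(p, r) \<in> rotation_params k" "A = reflection k p r" by auto
    note pr' = rotation_paramsD(1-3)[OF 2 pr(1)]
    have "- p * p - - r * (k * r) \<noteq> 0"
    proof
      assume "- p * p - - r * (k * r) = 0"
      then have "p * p - k * (r * r) = 0" by (simp add: algebra_simps)
      then show False using pr'(3) by simp
    qed
    moreover have "- r + p * r * p + k * (r * r) * - r = 0"
    proof -
      have "- r + p * r * p + k * (r * r) * - r = r * (p * p - k * (r * r)) - r" by (simp add: algebra_simps)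
      then show ?thesis unfolding pr' by simp
    qed
    moreover have "- p * (k * r) = k * (- r * p)" by simp
    moreover have "- p + p * r * (k * r) + k * (r * r) * - p = - p * p + - r * (k * r) + 2 * 0 * (- r * p)"
    proof -
      have "- p * p + - r * (k * r) + 2 * 0 * (- r * p) = - (p * p + k * (r * r))" by (simp add: algebra_simps)
      then show ?thesis unfolding pr' by (simp add: algebra_simps)
    qed
    moreover have "0 * - r + k * (p * r) * - r + k * (r * r) * p = 0" by simp
    moreover have "k * (- p * - p) + k * r * (k * r) = k * (k * (- r * - r) + p * p)" by (simp add: algebra_simps)
    moreover have "0 * - p + k * (p * r) * - p + k * (r * r) * (k * r) = k * (- p * - r) + k * r * p + 0 * (k * (- r * - r) + p * p)"
    proof -
      have "0 * - p + k * (p * r) * - p + k * (r * r) * (k * r) = - (k * r * (p * p - k * (r * r)))" by (simp add: algebra_simps)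
      also have "\<dots> = k * (2 * (p * r))" unfolding pr' by simp
      finally show ?thesis by (simp add: algebra_simps)
    qed
    ultimately have "nodal_equations k 0 (p * r) (k * (r * r)) (- p) (k * r) (- r) p"
      unfolding nodal_equations_def by blast
    then show ?thesis unfolding pr(2) reflection_def by (simp add: nodal_group_mem[OF 2])
  qed
qed

text \<open>
  For \<open>\<delta> = 1\<close> and \<open>k = c\<close> a reflection would satisfy the hypotheses of
  \<open>Sigma14_parameter_excludes_reflection\<close>.
\<close>

lemma nodal_group_1:
  assumes 2: "(2 :: 'a::{field,finite}) \<noteq> 0" and c: "Sigma14_parameter (c :: 'a)"
  shows "nodal_group c 1 = (\<lambda>(p, r). rotation c 1 p r) ` rotation_params c"
proof (intro equalityI subsetI)
  have c01: "c \<noteq> 0" "c \<noteq> 1" using c by (simp_all add: Sigma14_parameter_def)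
  fix A assume A: "A \<in> nodal_group c 1"
  obtain u v p s r t where uv: "A = m3 1 u v 0 p s 0 r t" using A by (rule nodal_group_cases)
  have eqs: "nodal_equations c 1 u v p s r t" using A unfolding uv nodal_group_mem[OF 2] .
  from nodal_equations_signs[OF c01(1) this]
  show "A \<in> (\<lambda>(p, r). rotation c 1 p r) ` rotation_params c"
  proof
    assume *: "t = p \<and> s = c * r"
    then have "nodal_equations c 1 u v p (c * r) r p" using eqs by simp
    then have "(p, r) \<in> rotation_params c" "A = rotation c 1 p r"
      using nodal_equations_rotation[OF 2, of c 1 u v p r] c01 * by (simp_all add: uv rotation_def)
    then show ?thesis by auto
  next
    assume *: "t = - p \<and> s = - (c * r)"
    then have "nodal_equations c 1 u v p (- (c * r)) r (- p)" using eqs by simp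
    note refl = nodal_equations_reflectionD[OF this, simplified]
    let ?X = "p * p + c * (r * r)" and ?Y = "2 * (p * r)"
    have e: "?X + ?Y = - (p + r)" "?X + c * ?Y = p + c * r"
      unfolding refl(2,3) by (simp_all add: algebra_simps)
    \<comment> \<open>The combination of squares c (X + Y)^2 - (X + c Y)^2 equals (c - 1) N^2 on one side and
        (c - 1) N on the other, where N is the norm.\<close>
    have "(c - 1) * ((p * p - c * (r * r)) * (p * p - c * (r * r) - 1))
        = (c * ((?X + ?Y) * (?X + ?Y)) - (?X + c * ?Y) * (?X + c * ?Y)) - (c * ((p + r) * (p + r)) - (p + c * r) * (p + c * r))"
      by (simp add: algebra_simps)
    also have "\<dots> = 0" unfolding e by (simp add: algebra_simps)
    finally have "(c - 1) * ((p * p - c * (r * r)) * (p * p - c * (r * r) - 1)) = 0" .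
    then have N: "p * p - c * (r * r) = 1" using c01 refl(1) by (metis mult_eq_0_iff right_minus_eq)
    have False
    proof (rule Sigma14_parameter_excludes_reflection[OF c])
      show "(- p)\<^sup>2 - c * (- r)\<^sup>2 = 1" using N by (simp add: power2_eq_square)
      show "- p + - r = ((- p)\<^sup>2 + c * (- r)\<^sup>2) + 2 * (- p) * (- r)" using e(1) by (simp add: power2_eq_square mult.assoc)
      show "- (- p) - c * (- r) = c * (2 * (- p) * (- r)) + ((- p)\<^sup>2 + c * (- r)\<^sup>2)" by (simp add: e(2)[symmetric] power2_eq_square mult.assoc add.commute)
    qed
    then show ?thesis ..
  qed
next
  have c01: "c \<noteq> 0" "c \<noteq> 1" using c by (simp_all add: Sigma14_parameter_def)
  fix A assume "A \<in> (\<lambda>(p, r). rotation c 1 p r) ` rotation_params c"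
  then obtain p r where pr: "(p, r) \<in> rotation_params c" "A = rotation c 1 p r" by auto
  then show "A \<in> nodal_group c 1" using c01 unfolding pr(2) rotation_def
    by (simp add: nodal_group_mem[OF 2] nodal_equations_rotation[OF 2])
qed

text \<open>
  The square of a nontrivial rotation is its inverse. The coordinates of the products differ
  from the expected ones by multiples of the three expressions \<open>x\<close>, \<open>y\<close>, \<open>n\<close>, which vanish for
  the parameters of rotations.
\<close>

lemma rotation_mult:
  fixes k \<delta> :: "'a::field"
  assumes 2: "(2 :: 'a) \<noteq> 0" and pr: "(p, r) \<in> rotation_params k"
  shows "rotation k \<delta> p r ** rotation k \<delta> p r = rotation k \<delta> p (- r)"
    "rotation k \<delta> p (- r) ** rotation k \<delta> p r = mat 1"
proof -
  have x: "p * p + k * (r * r) - p = 0" and y: "p * r + p * r + r = 0" and n: "p * p - k * (r * r) - 1 = 0"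
    using rotation_paramsD(1-3)[OF 2 pr] by simp_all
  have y2: "2 * (k * (p * r)) = - (k * r)" "2 * (p * r) = - r"
    using rotation_paramsD(2)[OF 2 pr] by (simp_all add: mult.left_commute[of 2 k])
  let ?x = "p * p + k * (r * r) - p" and ?y = "p * r + p * r + r" and ?n = "p * p - k * (r * r) - 1"
  have "p * p + k * r * r - p = ?x" "r * p + p * r - (- r) = ?y" "r * (k * r) + p * p - p = ?x"
    "p * (k * r) + k * r * p - k * - r = k * ?y"
    "1 * (\<delta> * (r * r) - p * r) + (\<delta> * (r * r) - p * r) * p + (k * (r * r) - \<delta> * (p * r)) * r - (\<delta> * (- r * - r) - p * - r)
      = - ?y - r * ?n"
    "1 * (k * (r * r) - \<delta> * (p * r)) + (\<delta> * (r * r) - p * r) * (k * r) + (k * (r * r) - \<delta> * (p * r)) * p - (k * (- r * - r) - \<delta> * (p * - r))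
      = - (\<delta> * ?y) - \<delta> * r * ?n"
    by (simp_all add: algebra_simps)
  then show "rotation k \<delta> p r ** rotation k \<delta> p r = rotation k \<delta> p (- r)"
    unfolding x y n by (simp add: rotation_def m3_mult) (use y2 in blast)
  have "p * p + k * - r * r - 1 = ?n" "- r * (k * r) + p * p - 1 = ?n"
    "1 * (\<delta> * (r * r) - p * r) + (\<delta> * (- r * - r) - p * - r) * p + (k * (- r * - r) - \<delta> * (p * - r)) * r = \<delta> * r * ?y + r * ?x"
    "1 * (k * (r * r) - \<delta> * (p * r)) + (\<delta> * (- r * - r) - p * - r) * (k * r) + (k * (- r * - r) - \<delta> * (p * - r)) * p = k * r * ?y + \<delta> * r * ?x"
    by (simp_all add: algebra_simps)
  then show "rotation k \<delta> p (- r) ** rotation k \<delta> p r = mat 1"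
    unfolding x y n by (simp add: rotation_def m3_mult m3_scalar)
qed

lemma rotation_params_trivial:
  fixes k :: "'a::field"
  assumes "\<not> (\<exists>r. 4 * k * (r * r) = - 3 \<and> r \<noteq> 0)"
  shows "rotation_params k = {(1, 0)}"
  using assms by (auto simp: rotation_params_def)

lemma rotation_params_nontrivial:
  fixes k r0 :: "'a::field"
  assumes 2: "(2 :: 'a) \<noteq> 0" and k: "k \<noteq> 0" and r0: "4 * k * (r0 * r0) = - 3" "r0 \<noteq> 0"
  shows "rotation_params k = {(1, 0), (- 1 / 2, r0), (- 1 / 2, - r0)}"
proof -
  have "(2 :: 'a) * 2 \<noteq> 0" using 2 by (metis mult_eq_0_iff)
  then have 4: "(4 :: 'a) * k \<noteq> 0" using k by simp
  have "4 * k * (r * r) = - 3 \<longleftrightarrow> r = r0 \<or> r = - r0" for r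
    unfolding r0(1)[symmetric] using 4 by (metis mult_cancel_left square_eq_iff)
  moreover have "2 * p = - 1 \<longleftrightarrow> p = - 1 / 2" for p :: 'a unfolding eq_divide_eq using 2 by (simp add: mult.commute)
  ultimately show ?thesis using r0(2) by (auto simp: rotation_params_def)
qed

lemma stabiliser_and_number_nodal_plane_trivial_rotations:
  fixes k :: "'a::{field,finite}"
  assumes odd: "odd CARD('a)" and k: "k \<noteq> 0" and r: "\<not> (\<exists>r. 4 * k * (r * r) = - 3 \<and> r \<noteq> 0)"
  shows "stabiliser_and_number (nodal_plane k 0) (cyclic_of_order 2)
    (1/2 * real CARD('a)^3 * (real CARD('a)^3 - 1) * (real CARD('a)^2 - 1))"
proof (rule stabiliser_and_number_nodal_plane[OF odd k])
  have 2: "(2 :: 'a) \<noteq> 0" using odd by (rule two_neq_0_if_odd_card)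
  have H: "nodal_group k 0 = {mat 1, m3 1 0 0 0 (- 1) 0 0 0 1}"
    unfolding nodal_group_0[OF 2 k] rotation_params_trivial[OF r]
    by (auto simp: rotation_def reflection_def m3_scalar)
  have ne: "m3 1 0 0 0 (- 1) 0 0 0 1 \<noteq> (mat 1 :: 'a ^ 3 ^ 3)"
    using one_neq_minus_one[OF 2] by (simp add: m3_scalar)
  show "cyclic_of_order 2 (subgroup_GL (nodal_group k 0))"
    by (rule cyclic_of_order_2I[OF group_nodal_group]) (use H ne in simp_all)
  show "1/2 * real CARD('a)^3 * (real CARD('a)^3 - 1) * (real CARD('a)^2 - 1) * real (card (nodal_group k 0)) = order_PGL3 CARD('a)"
    using H ne by (simp add: order_PGL3_def)
qed (use k in \<open>simp_all add: iso_transfer_basic\<close>)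

lemma stabiliser_and_number_nodal_plane_three_rotations:
  fixes k :: "'a::{field,finite}"
  assumes odd: "odd CARD('a)" and k: "k \<noteq> 0" and r0: "4 * k * (r0 * r0) = - 3" "r0 \<noteq> 0"
  shows "stabiliser_and_number (nodal_plane k 0) (symmetric_group 3)
    (1/6 * real CARD('a)^3 * (real CARD('a)^3 - 1) * (real CARD('a)^2 - 1))"
proof (rule stabiliser_and_number_nodal_plane[OF odd k])
  have 2: "(2 :: 'a) \<noteq> 0" using odd by (rule two_neq_0_if_odd_card)
  let ?R = "rotation_params k" and ?a = "rotation k 0 (- 1 / 2) r0" and ?b = "reflection k 1 0"
  note R = rotation_params_nontrivial[OF 2 k r0]
  have r0': "r0 \<noteq> - r0" "- r0 \<noteq> r0"
    using 2 r0(2) by (metis add.inverse_inverse add_eq_0_iff mult_2 mult_eq_0_iff)+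
  have card_R: "card ?R = 3" unfolding R using r0(2) r0' by simp
  have fin: "finite ?R" by (rule finite)
  have inj: "inj_on (\<lambda>(p, r). rotation k 0 p r) ?R" "inj_on (\<lambda>(p, r). reflection k p r) ?R"
    by (auto simp: inj_on_def rotation_def reflection_def)
  have disj: "(\<lambda>(p, r). rotation k 0 p r) ` ?R \<inter> (\<lambda>(p, r). reflection k p r) ` ?R = {}"
  proof -
    have "rotation k 0 p r \<noteq> reflection k p' r'" if "(p, r) \<in> ?R" for p r p' r'
    proof
      assume "rotation k 0 p r = reflection k p' r'"
      then have "p = - p'" "p = p'" unfolding rotation_def reflection_def m3_eq_iff by blast+
      then have "p = - p" by simp
      then have "2 * p = 0" by (metis add_eq_0_iff mult_2)
      then show False using 2 rotation_paramsD(4)[OF 2 that] by simp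
    qed
    then show ?thesis by auto
  qed
  have card: "card (nodal_group k 0) = 6"
    unfolding nodal_group_0[OF 2 k] using fin disj inj card_R by (simp add: card_Un_disjoint card_image)
  have ar: "(- 1 / 2, r0) \<in> ?R" unfolding R by simp
  note a_mult = rotation_mult[OF 2 ar, of 0]
  have one: "?a \<noteq> mat 1" using r0(2) by (simp add: rotation_def m3_scalar)
  show "symmetric_group 3 (subgroup_GL (nodal_group k 0))"
  proof (rule symmetric_group_3I[OF group_nodal_group, where a = ?a and b = ?b])
    show "?a \<in> carrier (subgroup_GL (nodal_group k 0))" "?b \<in> carrier (subgroup_GL (nodal_group k 0))"
      unfolding nodal_group_0[OF 2 k] R by simp_all
    show "?b \<otimes>\<^bsub>subgroup_GL (nodal_group k 0)\<^esub> ?a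
        = ?a \<otimes>\<^bsub>subgroup_GL (nodal_group k 0)\<^esub> ?a \<otimes>\<^bsub>subgroup_GL (nodal_group k 0)\<^esub> ?b"
      using a_mult by simp (simp add: rotation_def reflection_def m3_mult)
    show "?b \<otimes>\<^bsub>subgroup_GL (nodal_group k 0)\<^esub> ?b = \<one>\<^bsub>subgroup_GL (nodal_group k 0)\<^esub>"
      by (simp add: reflection_def m3_mult m3_scalar)
  qed (use a_mult one card in simp_all)
  show "1/6 * real CARD('a)^3 * (real CARD('a)^3 - 1) * (real CARD('a)^2 - 1) * real (card (nodal_group k 0)) = order_PGL3 CARD('a)"
    using card by (simp add: order_PGL3_def)
qed (use k in \<open>simp_all add: iso_transfer_basic\<close>)

lemma stabiliser_and_number_Sigma14:
  fixes c :: "'a::{field,finite}"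
  assumes odd: "odd CARD('a)" and 3: "(3 :: 'a) \<noteq> 0" and c: "Sigma14_parameter c"
  shows "stabiliser_and_number (Sigma14 c) (cyclic_of_order 3)
    (1/3 * real CARD('a)^3 * (real CARD('a)^3 - 1) * (real CARD('a)^2 - 1))"
  unfolding Sigma14_eq
proof (rule stabiliser_and_number_nodal_plane[OF odd])
  have 2: "(2 :: 'a) \<noteq> 0" using odd by (rule two_neq_0_if_odd_card)
  show c0: "c \<noteq> 0" and "c \<noteq> 1\<^sup>2" using c by (simp_all add: Sigma14_parameter_def)
  obtain w where w: "- 3 * c = w\<^sup>2" using c by (auto simp: Sigma14_parameter_def)
  define r0 where "r0 = w / (2 * c)"
  have w': "w = 2 * c * r0" using 2 c0 by (simp add: r0_def)
  have "c * (4 * c * (r0 * r0)) = c * (- 3)" using w unfolding w' by (simp add: power2_eq_square algebra_simps)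
  then have r0: "4 * c * (r0 * r0) = - 3" using c0 by (simp only: mult_cancel_left) simp
  then have r00: "r0 \<noteq> 0" using 3 by auto
  note R = rotation_params_nontrivial[OF 2 c0 r0 r00]
  let ?a = "rotation c 1 (- 1 / 2) r0"
  have ar: "(- 1 / 2, r0) \<in> rotation_params c" unfolding R by simp
  note a_mult = rotation_mult[OF 2 ar, of 1]
  have H: "nodal_group c 1 = {mat 1, ?a, ?a ** ?a}"
    unfolding nodal_group_1[OF 2 c] R a_mult(1) by (simp add: m3_scalar) (simp add: rotation_def)
  have r0': "r0 \<noteq> - r0"
    using 2 r00 by (metis add_eq_0_iff mult_2 mult_eq_0_iff)
  have card: "card (nodal_group c 1) = 3"
    unfolding H a_mult(1) using r0' r00 c0 by (simp add: rotation_def m3_scalar)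
  show "cyclic_of_order 3 (subgroup_GL (nodal_group c 1))"
    by (rule cyclic_of_order_3I[OF group_nodal_group, where a = ?a]) (use H card in simp_all)
  show "1/3 * real CARD('a)^3 * (real CARD('a)^3 - 1) * (real CARD('a)^2 - 1) * real (card (nodal_group c 1)) = order_PGL3 CARD('a)"
    using card by (simp add: order_PGL3_def)
qed (rule iso_transfer_basic)

text \<open>
  The correspondence is \<open>w = 2kr\<close>, which turns \<open>4kr\<^sup>2 = -3\<close> into \<open>w\<^sup>2 = -3k\<close>.
\<close>

lemma rotations_exist_iff:
  fixes k :: "'a::{field,finite}"
  assumes 2: "(2 :: 'a) \<noteq> 0" and k: "k \<noteq> 0"
  shows "(\<exists>r. 4 * k * (r * r) = - 3 \<and> r \<noteq> 0) \<longleftrightarrow> (3 :: 'a) \<noteq> 0 \<and> (\<exists>w. - 3 * k = w\<^sup>2)"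
proof
  have "(2 :: 'a) * 2 \<noteq> 0" using 2 by (metis mult_eq_0_iff)
  then have 4: "(4 :: 'a) \<noteq> 0" by simp
  assume "\<exists>r. 4 * k * (r * r) = - 3 \<and> r \<noteq> 0"
  then obtain r where r: "4 * k * (r * r) = - 3" "r \<noteq> 0" by blast
  have "(3 :: 'a) \<noteq> 0"
  proof
    assume "(3 :: 'a) = 0"
    then have "4 * k * (r * r) = 0" using r(1) by simp
    then show False using 4 k r(2) by simp
  qed
  moreover have "- 3 * k = (2 * k * r)\<^sup>2" unfolding r(1)[symmetric] by (simp add: power2_eq_square algebra_simps)
  ultimately show "(3 :: 'a) \<noteq> 0 \<and> (\<exists>w. - 3 * k = w\<^sup>2)" by blast
next
  assume "(3 :: 'a) \<noteq> 0 \<and> (\<exists>w. - 3 * k = w\<^sup>2)"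
  then obtain w where 3: "(3 :: 'a) \<noteq> 0" and w: "- 3 * k = w\<^sup>2" by blast
  define r where "r = w / (2 * k)"
  have w': "w = 2 * k * r" using 2 k by (simp add: r_def)
  have "k * (4 * k * (r * r)) = k * (- 3)" using w unfolding w' by (simp add: power2_eq_square algebra_simps)
  then have r: "4 * k * (r * r) = - 3" using k by (simp only: mult_cancel_left) simp
  then have "r \<noteq> 0" using 3 by auto
  then show "\<exists>r. 4 * k * (r * r) = - 3 \<and> r \<noteq> 0" using r by blast
qed

lemma Sigma12_rotations:
  assumes odd: "odd CARD('a::{field,finite})"
  shows "(\<exists>r :: 'a. 4 * 1 * (r * r) = - 3 \<and> r \<noteq> 0) \<longleftrightarrow> CARD('a) mod 3 = 1"
proof -
  have 2: "(2 :: 'a) \<noteq> 0" using odd by (rule two_neq_0_if_odd_card)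
  have iff: "(\<exists>r :: 'a. 4 * 1 * (r * r) = - 3 \<and> r \<noteq> 0) \<longleftrightarrow> (3 :: 'a) \<noteq> 0 \<and> (\<exists>w :: 'a. - 3 = w\<^sup>2)"
    using rotations_exist_iff[OF 2, of 1] by simp
  show ?thesis
  proof (cases "(3 :: 'a) = 0")
    case True
    then show ?thesis unfolding iff using three_eq_0_iff[where 'a = 'a] by simp
  next
    case False
    then show ?thesis unfolding iff using minus3_square_iff[where 'a = 'a, OF odd] by simp
  qed
qed

text \<open>
  Dividing by the non-square \<open>\<epsilon>\<close> exchanges squares and non-squares, so the condition is the
  opposite of that for \<open>\<Sigma>\<^sub>1\<^sub>2\<close> unless the characteristic is three, where \<open>-3 = 0\<close> and neither
  type has nontrivial rotations.
\<close>

lemma Sigma13_rotations: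
  fixes \<epsilon> :: "'a::{field,finite}"
  assumes odd: "odd CARD('a)" and \<epsilon>: "\<not> (\<exists>x. \<epsilon> = x\<^sup>2)"
  shows "(\<exists>r :: 'a. 4 * (1 / \<epsilon>) * (r * r) = - 3 \<and> r \<noteq> 0) \<longleftrightarrow> CARD('a) mod 3 = 2"
proof -
  have 2: "(2 :: 'a) \<noteq> 0" using odd by (rule two_neq_0_if_odd_card)
  have \<epsilon>0: "\<epsilon> \<noteq> 0" using \<epsilon> by (metis zero_power2)
  have iff: "(\<exists>r :: 'a. 4 * (1 / \<epsilon>) * (r * r) = - 3 \<and> r \<noteq> 0) \<longleftrightarrow> (3 :: 'a) \<noteq> 0 \<and> (\<exists>w :: 'a. - 3 * (1 / \<epsilon>) = w\<^sup>2)"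
    using rotations_exist_iff[OF 2, of "1 / \<epsilon>"] \<epsilon>0 by simp
  show ?thesis
  proof (cases "(3 :: 'a) = 0")
    case True
    then show ?thesis unfolding iff using three_eq_0_iff[where 'a = 'a] by simp
  next
    case False
    have sq: "(\<exists>w :: 'a. - 3 * (1 / \<epsilon>) = w\<^sup>2) \<longleftrightarrow> \<not> (\<exists>w :: 'a. - 3 = w\<^sup>2)"
    proof
      assume "\<exists>w :: 'a. - 3 * (1 / \<epsilon>) = w\<^sup>2"
      then obtain w :: 'a where w: "- 3 * (1 / \<epsilon>) = w\<^sup>2" by blast
      then have w3: "- 3 = \<epsilon> * w\<^sup>2" using \<epsilon>0 by (simp add: field_simps)
      show "\<not> (\<exists>w :: 'a. - 3 = w\<^sup>2)"
      proof
        assume "\<exists>v :: 'a. - 3 = v\<^sup>2"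
        then obtain v :: 'a where v: "- 3 = v\<^sup>2" by blast
        have "w \<noteq> 0" using w3 False by auto
        then have "\<epsilon> = (\<epsilon> * w\<^sup>2) / w\<^sup>2" by simp
        then have "\<epsilon> = (v / w)\<^sup>2" unfolding w3[symmetric] v by (simp add: power_divide)
        then show False using \<epsilon> by blast
      qed
    next
      assume n: "\<not> (\<exists>w :: 'a. - 3 = w\<^sup>2)"
      obtain x where x: "(- 3) * \<epsilon> = x\<^sup>2" using nonsquare_mult_nonsquare[OF n \<epsilon>] by blast
      have "- 3 * (1 / \<epsilon>) = (x / \<epsilon>)\<^sup>2" using x \<epsilon>0 by (simp add: power_divide power2_eq_square field_simps)
      then show "\<exists>w :: 'a. - 3 * (1 / \<epsilon>) = w\<^sup>2" by blast
    qed
    have "CARD('a) mod 3 \<noteq> 0" using False three_eq_0_iff[where 'a = 'a] by simp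
    then have "CARD('a) mod 3 = 2 \<longleftrightarrow> \<not> CARD('a) mod 3 = 1" by linarith
    then show ?thesis unfolding iff sq using False minus3_square_iff[where 'a = 'a, OF odd False] by simp
  qed
qed

lemma stabiliser_and_number_Sigma12:
  assumes odd: "odd CARD('a::{field,finite})"
  shows "CARD('a) mod 3 = 1 \<Longrightarrow> stabiliser_and_number (Sigma12 :: ('a ^ 3 ^ 3) set) (symmetric_group 3)
      (1/6 * real CARD('a)^3 * (real CARD('a)^3 - 1) * (real CARD('a)^2 - 1))"
    and "CARD('a) mod 3 \<noteq> 1 \<Longrightarrow> stabiliser_and_number (Sigma12 :: ('a ^ 3 ^ 3) set) (cyclic_of_order 2)
      (1/2 * real CARD('a)^3 * (real CARD('a)^3 - 1) * (real CARD('a)^2 - 1))"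
  using stabiliser_and_number_nodal_plane_three_rotations[OF odd one_neq_zero] stabiliser_and_number_nodal_plane_trivial_rotations[OF odd one_neq_zero] Sigma12_rotations[OF odd]
  unfolding Sigma12_eq by blast+

lemma stabiliser_and_number_Sigma13:
  fixes \<epsilon> :: "'a::{field,finite}"
  assumes odd: "odd CARD('a)" and \<epsilon>: "\<not> (\<exists>x. \<epsilon> = x\<^sup>2)"
  shows "CARD('a) mod 3 = 2 \<Longrightarrow> stabiliser_and_number (Sigma13 \<epsilon>) (symmetric_group 3)
      (1/6 * real CARD('a)^3 * (real CARD('a)^3 - 1) * (real CARD('a)^2 - 1))"
    and "CARD('a) mod 3 \<noteq> 2 \<Longrightarrow> stabiliser_and_number (Sigma13 \<epsilon>) (cyclic_of_order 2)
      (1/2 * real CARD('a)^3 * (real CARD('a)^3 - 1) * (real CARD('a)^2 - 1))"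
proof -
  have \<epsilon>0: "\<epsilon> \<noteq> 0" using \<epsilon> by (metis zero_power2)
  then have k: "1 / \<epsilon> \<noteq> 0" by simp
  show "CARD('a) mod 3 = 2 \<Longrightarrow> stabiliser_and_number (Sigma13 \<epsilon>) (symmetric_group 3)
      (1/6 * real CARD('a)^3 * (real CARD('a)^3 - 1) * (real CARD('a)^2 - 1))"
    "CARD('a) mod 3 \<noteq> 2 \<Longrightarrow> stabiliser_and_number (Sigma13 \<epsilon>) (cyclic_of_order 2)
      (1/2 * real CARD('a)^3 * (real CARD('a)^3 - 1) * (real CARD('a)^2 - 1))"
    using stabiliser_and_number_nodal_plane_three_rotations[OF odd k] stabiliser_and_number_nodal_plane_trivial_rotations[OF odd k] Sigma13_rotations[OF odd \<epsilon>]
    unfolding Sigma13_eq[OF \<epsilon>0] by blast+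
qed

section \<open>Stabilisers and orbit sizes of all types\<close>

theorem theorem1p3:
  fixes \<epsilon> :: "'a::{field,finite}" and q :: nat
  assumes "q = CARD('a)" and "odd q" and "\<not> (\<exists>x. \<epsilon> = x\<^sup>2)"
  shows
   "(stabiliser_and_number (Sigma1 :: ('a ^ 3 ^ 3) set)
       (semidirect (squared (elementary_abelian q)) (general_linear_2 TYPE('a)))
       (real q^2 + real q + 1)) \<and>
    (stabiliser_and_number (Sigma2 :: ('a ^ 3 ^ 3) set)
       (semidirect (squared (cyclic_of_order (q - 1))) (symmetric_group 3))
       (1/6 * real q^3 * (real q^2 + real q + 1) * (real q + 1))) \<and>
    (stabiliser_and_number (Sigma3 :: ('a ^ 3 ^ 3) set)
       (semidirect (elementary_abelian q) (squared (cyclic_of_order (q - 1))))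
       (real q^2 * (real q^2 + real q + 1) * (real q + 1))) \<and>
    (stabiliser_and_number (Sigma4 :: ('a ^ 3 ^ 3) set)
       (semidirect (semidirect (elementary_abelian q) (cyclic_of_order (q - 1))) (cyclic_of_order 2))
       (1/2 * real q^2 * (real q^3 - 1) * (real q + 1))) \<and>
    (stabiliser_and_number (Sigma5 :: ('a ^ 3 ^ 3) set)
       (semidirect (cyclic_of_order (q - 1)) (cyclic_of_order 2))
       (1/2 * real q^3 * (real q^3 - 1) * (real q + 1))) \<and>
    (stabiliser_and_number (Sigma6 \<epsilon>)
       (GO_minus_2 TYPE('a))
       (1/2 * real q^3 * (real q^3 - 1))) \<and>
    (stabiliser_and_number (Sigma7 :: ('a ^ 3 ^ 3) set)
       (semidirect (squared (elementary_abelian q)) (general_linear_2 TYPE('a)))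
       (real q^2 + real q + 1)) \<and>
    (stabiliser_and_number (Sigma8 :: ('a ^ 3 ^ 3) set)
       (semidirect (elementary_abelian q) (squared (cyclic_of_order (q - 1))))
       (real q^2 * (real q^2 + real q + 1) * (real q + 1))) \<and>
    (stabiliser_and_number (Sigma9 :: ('a ^ 3 ^ 3) set)
       (semidirect (semidirect (elementary_abelian q) (cyclic_of_order (q - 1))) (cyclic_of_order 2))
       (1/2 * real q^2 * (real q^3 - 1) * (real q + 1))) \<and>
    (stabiliser_and_number (Sigma10 \<epsilon>)
       (semidirect (semidirect (elementary_abelian q) (cyclic_of_order (q - 1))) (cyclic_of_order 2))
       (1/2 * real q^2 * (real q^3 - 1) * (real q + 1))) \<and>
    (q mod 3 \<noteq> 0 \<longrightarrow> stabiliser_and_number (Sigma11 :: ('a ^ 3 ^ 3) set)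
       (cyclic_of_order (q - 1))
       (real q^3 * (real q^3 - 1) * (real q + 1))) \<and>
    (q mod 3 = 0 \<longrightarrow> stabiliser_and_number (Sigma11 :: ('a ^ 3 ^ 3) set)
       (elementary_abelian q)
       (real q^2 * (real q^3 - 1) * (real q^2 - 1))) \<and>
    (q mod 3 = 1 \<longrightarrow> stabiliser_and_number (Sigma12 :: ('a ^ 3 ^ 3) set)
       (symmetric_group 3)
       (1/6 * real q^3 * (real q^3 - 1) * (real q^2 - 1))) \<and>
    (q mod 3 \<noteq> 1 \<longrightarrow> stabiliser_and_number (Sigma12 :: ('a ^ 3 ^ 3) set)
       (cyclic_of_order 2)
       (1/2 * real q^3 * (real q^3 - 1) * (real q^2 - 1))) \<and>
    (q mod 3 = 2 \<longrightarrow> stabiliser_and_number (Sigma13 \<epsilon>)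
       (symmetric_group 3)
       (1/6 * real q^3 * (real q^3 - 1) * (real q^2 - 1))) \<and>
    (q mod 3 \<noteq> 2 \<longrightarrow> stabiliser_and_number (Sigma13 \<epsilon>)
       (cyclic_of_order 2)
       (1/2 * real q^3 * (real q^3 - 1) * (real q^2 - 1))) \<and>
    (q mod 3 \<noteq> 0 \<longrightarrow>
       (\<exists>c :: 'a. Sigma14_parameter c) \<and>
       (\<forall>c :: 'a. Sigma14_parameter c \<longrightarrow> stabiliser_and_number (Sigma14 c)
          (cyclic_of_order 3)
          (1/3 * real q^3 * (real q^3 - 1) * (real q^2 - 1)))) \<and>
    (q mod 3 = 0 \<longrightarrow> stabiliser_and_number (Sigma14' :: ('a ^ 3 ^ 3) set)
       (semidirect (elementary_abelian q) (cyclic_of_order (q - 1)))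
       (real q^2 * (real q^3 - 1) * (real q + 1))) \<and>
    (stabiliser_and_number (Sigma15 :: ('a ^ 3 ^ 3) set)
       (semidirect (E_1_plus_2 q) (cyclic_of_order (q - 1)))
       ((real q^3 - 1) * (real q + 1)))"
proof -
  have odd: "odd CARD('a)" using assms(1,2) by simp
  have three: "(3 :: 'a) = 0 \<longleftrightarrow> CARD('a) mod 3 = 0" by (rule three_eq_0_iff)
  have \<epsilon>0: "\<epsilon> \<noteq> 0" using assms(3) by (metis zero_power2)
  show ?thesis
    unfolding assms(1) Sigma9_eq Sigma10_eq
  proof (intro conjI impI allI)
    show "\<exists>c :: 'a. Sigma14_parameter c" if "CARD('a) mod 3 \<noteq> 0"
      by (rule Sigma14_parameter_exists) (use odd that three in simp_all)
  qed (rule stabiliser_and_number_Sigma1[OF odd] stabiliser_and_number_Sigma2[OF odd] stabiliser_and_number_Sigma3[OF odd] stabiliser_and_number_Sigma4[OF odd]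
      stabiliser_and_number_Sigma5[OF odd] stabiliser_and_number_Sigma6[OF odd assms(3)] stabiliser_and_number_Sigma7[OF odd] stabiliser_and_number_Sigma8[OF odd]
      stabiliser_and_number_tangent_conic_plane[OF odd one_neq_zero] stabiliser_and_number_tangent_conic_plane[OF odd \<epsilon>0]
      stabiliser_and_number_Sigma11_if_3_neq_0[OF odd, unfolded three] stabiliser_and_number_Sigma11_if_3_eq_0[OF odd, unfolded three]
      stabiliser_and_number_Sigma12[OF odd] stabiliser_and_number_Sigma13[OF odd assms(3)] stabiliser_and_number_Sigma14[OF odd, unfolded three]
      stabiliser_and_number_Sigma14'[OF odd, unfolded three] stabiliser_and_number_Sigma15[OF odd]; assumption)+
qed

end
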